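(* Given an SLP of size $n$ representing a string $S$ of length $N$, the LZ78 factorization of $S$ can be computed in $O(N_\alpha + m\log N)$ time and $O(N_\alpha + m)$ space, where $m$ is the number of factors in the LZ78 factorization of $S$, $N_\alpha = O(\min\{N-\alpha,\ n\sqrt{N}\})$, and $\alpha = \sum_{i \in I} (\mathit{vOcc}(X_i) - 1)\cdot(|t_i| - (c_N - 1)) \geq 0$.
   Context: A straight line program (SLP) of size $n$ is a sequence of assignments $X_1 \to expr_1, \ldots, X_n \to expr_n$, where each $X_i$ is a distinct nonterminal and each $expr_i$ is either a single character $a \in \Sigma$ or $X_{\ell(i)}X_{r(i)}$ with $\ell(i), r(i) < i$; $\mathit{val}(X_i)$ is the string derived from $X_i$, $|X_i| = |\mathit{val}(X_i)|$, and the SLP represents $S = \mathit{val}(X_n)$. The derivation tree is the labeled ordered binary tree rooted at a node labeled $X_n$ in which a node labeled $X_i$ with $X_i \to X_{\ell(i)}X_{r(i)}$ has left child labeled $X_{\ell(i)}$ and right child labeled $X_{r(i)}$, and a node labeled $X_i$ with $X_i \to a$ has a single leaf child labeled $a$; $\mathit{vOcc}(X_i)$ is the number of nodes of the derivation tree labeled $X_i$. Let $c_N = \sqrt{2N+1/4}-1/2$ and $I = \{ i \mid |X_i| \ge c_N\}$. For a string $T$ and integer $q\ge 0$, $\mathit{pre}(T,q) = T[1:\min\{q,|T|\}]$ and $\mathit{suf}(T,q) = T[\max\{1,|T|-q+1\}:|T|]$. For $i \in I$ with $X_i \to X_{\ell(i)}X_{r(i)}$, $t_i = \mathit{suf}(\mathit{val}(X_{\ell(i)}),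 c_N - 1)\,\mathit{pre}(\mathit{val}(X_{r(i)}), c_N - 1)$. The alphabet $\Sigma$ is finite, and the last character of $S$ is a special character \$ occurring nowhere else in $S$. The LZ78 factorization of $S$ is the factorization $S = f_1 \cdots f_m$ where each $f_i \in \Sigma^+$ is the longest prefix of $f_i\cdots f_m$ with $f_i \in \{f_j c \mid 1 \le j < i, c \in \Sigma\}\cup\Sigma$; it is output as the sequence of pairs $(j, c)$ where $f_i = f_j c$ (with $j=0$, $f_0=\varepsilon$ if $f_i$ is a single character). The model of computation is the word RAM with word size at least $\log N$; space is measured in words.
   Formalization: Every nonterminal is assumed to occur in the derivation tree (otherwise α can be negative and n is unbounded in N), and the word size is at least log N plus a constant depending only on the alphabet, so that the input's indices and addresses fit in a word. *)

theory Defs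
  imports Complex_Main "HOL-Library.Sublist"
begin

section \<open>Straight line programs\<close>

text \<open>
  Nonterminals are numbered from 0, so index \<open>i\<close> is the nonterminal $X_{i+1}$ and the
  start symbol of \<open>G\<close> is \<open>length G - 1\<close>.
\<close>

datatype 'a rule = Terminal 'a | Pair nat nat

type_synonym 'a slp = "'a rule list"

definition is_slp :: "'a slp \<Rightarrow> bool" where
  "is_slp G \<longleftrightarrow> G \<noteq> [] \<and> (\<forall>i<length G. \<forall>l r. G ! i = Pair l r \<longrightarrow> l < i \<and> r < i)"

text \<open>
  The tests \<open>l < i \<and> r < i\<close> below always succeed when \<open>is_slp G\<close>; they only make the
  recursion total.
\<close>

fun val :: "'a slp \<Rightarrow> nat \<Rightarrow> 'a list" where
  "val G i = (case G ! i of
      Terminal a \<Rightarrow> [a]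
    | Pair l r \<Rightarrow> if l < i \<and> r < i then val G l @ val G r else [])"

declare val.simps [simp del]

definition slp_string :: "'a slp \<Rightarrow> 'a list" where
  "slp_string G = val G (length G - 1)"

datatype 'a dtree = Leaf 'a | Unary nat "'a dtree" | Binary nat "'a dtree" "'a dtree"

fun deriv_tree_at :: "'a slp \<Rightarrow> nat \<Rightarrow> 'a dtree" where
  "deriv_tree_at G i = (case G ! i of
      Terminal a \<Rightarrow> Unary i (Leaf a)
    | Pair l r \<Rightarrow>
        if l < i \<and> r < i then Binary i (deriv_tree_at G l) (deriv_tree_at G r) else undefined)"

declare deriv_tree_at.simps [simp del]

definition deriv_tree :: "'a slp \<Rightarrow> 'a dtree" where
  "deriv_tree G = deriv_tree_at G (length G - 1)"

fun nodes_labelled :: "nat \<Rightarrow> 'a dtree \<Rightarrow> nat" where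
  "nodes_labelled i (Leaf a) = 0"
| "nodes_labelled i (Unary j t) = of_bool (i = j) + nodes_labelled i t"
| "nodes_labelled i (Binary j t u) = of_bool (i = j) + nodes_labelled i t + nodes_labelled i u"

definition vOcc :: "'a slp \<Rightarrow> nat \<Rightarrow> nat" where
  "vOcc G i = nodes_labelled i (deriv_tree G)"

text \<open>
  Without this condition \<open>\<alpha>\<close> below may be negative, and the number of rules is not
  bounded in terms of the length of the string.
\<close>

definition all_nonterminals_used :: "'a slp \<Rightarrow> bool" where
  "all_nonterminals_used G \<longleftrightarrow> (\<forall>i<length G. vOcc G i \<ge> 1)"

definition pre :: "'a list \<Rightarrow> nat \<Rightarrow> 'a list" where
  "pre T q = take (min q (length T)) T"

definition suf :: "'a list \<Rightarrow> nat \<Rightarrow> 'a list" where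
  "suf T q = drop (length T - q) T"

definition c_bound :: "nat \<Rightarrow> real" where
  "c_bound N = sqrt (2 * real N + 1/4) - 1/2"

definition long_nonterminals :: "'a slp \<Rightarrow> nat set" where
  "long_nonterminals G =
     {i. i < length G \<and> real (length (val G i)) \<ge> c_bound (length (slp_string G))}"

text \<open>
  The number \<open>c_bound N - 1\<close> need not be an integer. The positions of a string that satisfy the
  inequalities defining a prefix or suffix of this length are those for its integer part.

  For \<open>X_i \<rightarrow> a\<close> the string \<open>t_i\<close> is not defined. Such an \<open>i\<close> is long only if the whole string
  has length 1; if moreover all nonterminals are used, its factor \<open>vOcc G i - 1\<close> in \<open>\<alpha>\<close> is 0.
\<close>

definition t_string :: "'a slp \<Rightarrow> nat \<Rightarrow> 'a list" where
  "t_string G i =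
     (let q = nat \<lfloor>c_bound (length (slp_string G)) - 1\<rfloor> in
      case G ! i of
        Terminal a \<Rightarrow> []
      | Pair l r \<Rightarrow> suf (val G l) q @ pre (val G r) q)"

definition alpha :: "'a slp \<Rightarrow> real" where
  "alpha G = (\<Sum>i\<in>long_nonterminals G.
     (real (vOcc G i) - 1) *
     (real (length (t_string G i)) - (c_bound (length (slp_string G)) - 1)))"

definition sentinel_terminated :: "'a \<Rightarrow> 'a list \<Rightarrow> bool" where
  "sentinel_terminated d S \<longleftrightarrow> S \<noteq> [] \<and> last S = d \<and> d \<notin> set (butlast S)"


section \<open>The LZ78 factorization\<close>

definition lz78_candidates :: "'a list list \<Rightarrow> 'a list set" where
  "lz78_candidates fs = {f @ [c] | f c. f \<in> set fs} \<union> {[c] | c. True}"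

definition lz78_factorization :: "'a list \<Rightarrow> 'a list list \<Rightarrow> bool" where
  "lz78_factorization S fs \<longleftrightarrow>
     concat fs = S \<and>
     (\<forall>i<length fs.
        fs ! i \<in> lz78_candidates (take i fs) \<and>
        (\<forall>g \<in> lz78_candidates (take i fs).
           prefix g (concat (drop i fs)) \<longrightarrow> length g \<le> length (fs ! i)))"

lemma lz78_factorization_unique:
  assumes "lz78_factorization S fs" "lz78_factorization S gs"
  shows "fs = gs"
proof -
  have aux: "length fs \<le> length gs \<and> take (length fs) gs = fs"
    if F: "lz78_factorization S fs" and G: "lz78_factorization S gs" for fs gs :: "'a list list"
  proof -
    have "i \<le> length fs \<Longrightarrow> i \<le> length gs \<and> take i fs = take i gs" for i
    proof (induction i)
      case (Suc i)
      then have i: "i < length fs" and le: "i \<le> length gs" and eq: "take i fs = take i gs" by auto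
      have "concat (take i fs) @ concat (drop i fs) = concat (take i gs) @ concat (drop i gs)"
        using F G unfolding lz78_factorization_def by (metis append_take_drop_id concat_append)
      then have rest: "concat (drop i fs) = concat (drop i gs)" using eq by simp
      have f: "fs ! i \<in> lz78_candidates (take i fs)" using F i by (simp add: lz78_factorization_def)
      have pf: "prefix (fs ! i) (concat (drop i fs))"
        using i by (metis Cons_nth_drop_Suc concat.simps(2) prefixI)
      have ne: "fs ! i \<noteq> []" using f by (auto simp: lz78_candidates_def)
      have i': "i < length gs"
      proof (rule ccontr)
        assume "\<not> i < length gs"
        then have "concat (drop i gs) = []" by simp
        then show False using rest pf ne by (metis prefix_Nil)
      qed
      have g: "gs ! i \<in> lz78_candidates (take i gs)" using G i' by (simp add: lz78_factorization_def)
      have pg: "prefix (gs ! i) (concat (drop i gs))"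
        using i' by (metis Cons_nth_drop_Suc concat.simps(2) prefixI)
      have "length (fs ! i) \<le> length (gs ! i)"
        using G i' f pf rest eq unfolding lz78_factorization_def by metis
      moreover have "length (gs ! i) \<le> length (fs ! i)"
        using F i g pg rest eq unfolding lz78_factorization_def by metis
      ultimately have "fs ! i = gs ! i"
        using pf pg rest by (metis le_antisym prefix_length_prefix prefix_order.antisym order_refl)
      then show ?case using i i' eq by (simp add: take_Suc_conv_app_nth)
    qed simp
    from this[of "length fs"] show ?thesis by simp
  qed
  show ?thesis using aux[OF assms] aux[OF assms(2,1)] by simp
qed

text \<open>Factors are numbered from 1 in the output, with the empty string as factor 0.\<close>

definition lz78_output :: "'a list list \<Rightarrow> (nat \<times> 'a) list \<Rightarrow> bool" where
  "lz78_output fs ps \<longleftrightarrow>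
     length ps = length fs \<and>
     (\<forall>i<length fs. case ps ! i of (j, c) \<Rightarrow>
        j \<le> i \<and> ([] # fs) ! Suc i = ([] # fs) ! j @ [c])"


section \<open>The word RAM\<close>

text \<open>
  Words of \<open>w\<close> bits are the natural numbers below \<open>2 ^ w\<close>. The word size is not part of a program:
  the same program is run for every input and every word size. A program can name only
  finitely many registers; all other storage is in the memory, addressed by words.
\<close>

datatype binop = Add | Sub | Mul | Div | Mod | And | Or | Xor | ShiftL | ShiftR | Less | Equal

datatype instr =
    Const nat nat
  | Copy nat nat
  | Op binop nat nat nat
  | Load nat nat
  | Store nat nat
  | Jump nat
  | JumpIfZero nat nat
  | Halt

type_synonym program = "instr list"

datatype config = Config (pc: nat) (reg: "nat \<Rightarrow> nat") (mem: "nat \<Rightarrow> nat")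

fun binop_val :: "nat \<Rightarrow> binop \<Rightarrow> nat \<Rightarrow> nat \<Rightarrow> nat" where
  "binop_val w Add x y = (x + y) mod 2 ^ w"
| "binop_val w Sub x y = nat ((int x - int y) mod 2 ^ w)"
| "binop_val w Mul x y = (x * y) mod 2 ^ w"
| "binop_val w Div x y = x div y"
| "binop_val w Mod x y = x mod y"
| "binop_val w And x y = Bit_Operations.and x y"
| "binop_val w Or x y = Bit_Operations.or x y"
| "binop_val w Xor x y = Bit_Operations.xor x y"
| "binop_val w ShiftL x y = push_bit y x mod 2 ^ w"
| "binop_val w ShiftR x y = drop_bit y x"
| "binop_val w Less x y = of_bool (x < y)"
| "binop_val w Equal x y = of_bool (x = y)"

fun exec :: "nat \<Rightarrow> instr \<Rightarrow> config \<Rightarrow> config" where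
  "exec w (Const r k) (Config p R M) = Config (Suc p) (R(r := k mod 2 ^ w)) M"
| "exec w (Copy r s) (Config p R M) = Config (Suc p) (R(r := R s)) M"
| "exec w (Op f r s u) (Config p R M) = Config (Suc p) (R(r := binop_val w f (R s) (R u))) M"
| "exec w (Load r s) (Config p R M) = Config (Suc p) (R(r := M (R s))) M"
| "exec w (Store r s) (Config p R M) = Config (Suc p) R (M(R r := R s))"
| "exec w (Jump l) (Config p R M) = Config l R M"
| "exec w (JumpIfZero r l) (Config p R M) = Config (if R r = 0 then l else Suc p) R M"
| "exec w Halt (Config p R M) = Config p R M"

definition halted :: "program \<Rightarrow> config \<Rightarrow> bool" where
  "halted P s \<longleftrightarrow> pc s \<ge> length P \<or> P ! pc s = Halt"

definition step :: "nat \<Rightarrow> program \<Rightarrow> config \<Rightarrow> config" where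
  "step w P s = (if halted P s then s else exec w (P ! pc s) s)"

definition addresses_accessed :: "program \<Rightarrow> config \<Rightarrow> nat set" where
  "addresses_accessed P s =
     (if halted P s then {}
      else case P ! pc s of
          Load r a \<Rightarrow> {reg s a}
        | Store a r \<Rightarrow> {reg s a}
        | _ \<Rightarrow> {})"

definition halts :: "nat \<Rightarrow> program \<Rightarrow> config \<Rightarrow> bool" where
  "halts w P s \<longleftrightarrow> (\<exists>t. halted P ((step w P ^^ t) s))"

definition run_time :: "nat \<Rightarrow> program \<Rightarrow> config \<Rightarrow> nat" where
  "run_time w P s = (LEAST t. halted P ((step w P ^^ t) s))"

definition run_result :: "nat \<Rightarrow> program \<Rightarrow> config \<Rightarrow> config" where
  "run_result w P s = (step w P ^^ run_time w P s) s"

text \<open>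
  Space is the length of the shortest initial segment of the memory that contains every accessed
  cell, so a program cannot save space by scattering its data over a large address range.
\<close>

definition run_space :: "nat \<Rightarrow> program \<Rightarrow> config \<Rightarrow> nat" where
  "run_space w P s =
     (LEAST b. \<forall>t < run_time w P s. addresses_accessed P ((step w P ^^ t) s) \<subseteq> {..<b})"


section \<open>Input and output conventions\<close>

definition initial_config :: "nat list \<Rightarrow> config" where
  "initial_config xs = Config 0 (\<lambda>_. 0) (\<lambda>a. if a < length xs then xs ! a else 0)"

fun encode_rule :: "('a \<Rightarrow> nat) \<Rightarrow> 'a rule \<Rightarrow> nat list" where
  "encode_rule code (Terminal a) = [0, code a, 0]"
| "encode_rule code (Pair l r) = [1, l, r]"

definition encode_slp :: "('a \<Rightarrow> nat) \<Rightarrow> 'a slp \<Rightarrow> nat list" where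
  "encode_slp code G = length G # concat (map (encode_rule code) G)"

definition encode_output :: "('a \<Rightarrow> nat) \<Rightarrow> (nat \<times> 'a) list \<Rightarrow> nat list" where
  "encode_output code ps = length ps # concat (map (\<lambda>(j, c). [j, code c]) ps)"

text \<open>On termination register 0 holds the address of the output block.\<close>

definition result_is :: "config \<Rightarrow> nat list \<Rightarrow> bool" where
  "result_is s xs \<longleftrightarrow> (\<forall>k<length xs. mem s (reg s 0 + k) = xs ! k)"

definition computes_lz78 ::
    "('a \<Rightarrow> nat) \<Rightarrow> nat \<Rightarrow> program \<Rightarrow> 'a slp \<Rightarrow> 'a list list \<Rightarrow> bool" where
  "computes_lz78 code w P G fs \<longleftrightarrow>
     halts w P (initial_config (encode_slp code G)) \<and>
     (\<exists>ps. lz78_output fs ps \<and>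
        result_is (run_result w P (initial_config (encode_slp code G))) (encode_output code ps))"

end

theory Submission
  imports Defs
begin

text \<open>
  Let \<open>h\<close> be the integer part of \<open>c_bound N\<close>, which bounds the length of a factor. A traversal of the
  derivation tree that abbreviates repeated nonterminals of length at least \<open>3 h\<close> to their first and
  last \<open>3 h\<close> characters writes a text \<open>T\<close> of length \<open>O(N - \<alpha>)\<close> and \<open>O(n \<surd>N)\<close> in which all windows
  of the string occur. The string is covered by \<open>O(N / h) = O(m)\<close> pieces of \<open>T\<close>, each continuing
  correctly for \<open>h\<close> more characters, so every factor is read inside one piece. The factors found so
  far are intervals of the suffix array of \<open>T\<close>, which the difference cover algorithm computes in
  linear time; the longest one that is a prefix of the rest of the string is the deepest interval that
  contains the rank of the current position, and a segment tree finds it in \<open>O(log N)\<close> time.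

  The program is written in a small structured language with a weakest precondition calculus that
  counts steps and tracks word and memory bounds, and is then compiled to the word RAM.
\<close>


section \<open>A structured language with arrays\<close>

text \<open>Nonempty proper prefixes of a factor are earlier factors. So a factor of length L comes
  with factors of lengths 1, ..., L, whose sum L (L + 1) / 2 is at most N; \<open>c_bound N\<close>
  is the root of x (x + 1) = 2 N. For the same reason, of two factors that are prefixes of one
  string the later one is longer: deepest means newest, and the segment tree may simply overwrite
  old marks.

  A position of the string has no address in the text. As factors are produced from left to right,
  the pieces can be consumed like a list instead of searching the grammar for each factor. Since 2 N
  <= m (m + 1) gives h <= m, the O(N / h) pieces, with h about sqrt (2 N), are O(m).

  The term N - \<alpha> counts windows. For h > 1, each of the N - h + 1 windows of length h in the
  string straddles the middle of exactly one node of the derivation tree. The summand of \<alpha>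
  for i is at most the number of those at all but one occurrence of the i-th nonterminal, so the
  rest still pays for writing every long nonterminal once.\<close>

datatype aexp = Lit nat | Var nat | Bin binop aexp aexp | Idx nat aexp

abbreviation add_e (infixl "\<oplus>" 65) where "a \<oplus> b \<equiv> Bin Add a b"
abbreviation sub_e (infixl "\<ominus>" 65) where "a \<ominus> b \<equiv> Bin Sub a b"
abbreviation mul_e (infixl "\<otimes>" 70) where "a \<otimes> b \<equiv> Bin Mul a b"
abbreviation div_e (infixl "\<oslash>" 70) where "a \<oslash> b \<equiv> Bin Div a b"
abbreviation mod_e (infixl "\<odot>" 70) where "a \<odot> b \<equiv> Bin Mod a b"
abbreviation less_e (infix "\<lhd>" 50) where "a \<lhd> b \<equiv> Bin Less a b"
abbreviation eq_e (infix "\<doteq>" 50) where "a \<doteq> b \<equiv> Bin Equal a b"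

datatype com = Skip
 | Assign nat aexp (infix "::=" 62)
 | Write nat aexp aexp
 | Alloc nat aexp
 | AllocRest nat
 | Seq com com (infixr ";;" 60)
 | Cond aexp com com
 | Loop aexp com

record state =
 vr :: "nat => nat"
 ar :: "nat => nat => nat"
 sz :: "nat => nat"
 brk :: nat
 tm :: nat

abbreviation tick :: "state => state" where "tick s \<equiv> s(|tm := Suc (tm s)|)"

fun bop :: "binop => nat => nat => nat" where
 "bop Add x y = x + y"
| "bop Sub x y = x - y"
| "bop Mul x y = x * y"
| "bop Div x y = x div y"
| "bop Mod x y = x mod y"
| "bop Less x y = of_bool (x < y)"
| "bop Equal x y = of_bool (x = y)"
| "bop _ x y = 0"

fun ev :: "aexp => state => nat" where
 "ev (Lit k) s = k"
| "ev (Var x) s = vr s x"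
| "ev (Bin f a b) s = bop f (ev a s) (ev b s)"
| "ev (Idx a e) s = ar s a (ev e s)"

fun wv :: "com => nat set" where
 "wv (x ::= e) = {x}"
| "wv (c ;; d) = wv c \<union> wv d"
| "wv (Cond b c d) = wv c \<union> wv d"
| "wv (Loop b c) = wv c"
| "wv _ = {}"

fun wa :: "com => nat set" where
 "wa (Write a i e) = {a}"
| "wa (Alloc a e) = {a}"
| "wa (AllocRest a) = {a}"
| "wa (c ;; d) = wa c \<union> wa d"
| "wa (Cond b c d) = wa c \<union> wa d"
| "wa (Loop b c) = wa c"
| "wa _ = {}"

fun al :: "com => nat set" where
 "al (Alloc a e) = {a}"
| "al (AllocRest a) = {a}"
| "al (c ;; d) = al c \<union> al d"
| "al (Cond b c d) = al c \<union> al d"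
| "al (Loop b c) = al c"
| "al _ = {}"

text \<open>Everything outside the syntactic write sets persists, so a loop invariant has to mention
  only what the loop changes. The clock is included as a monotone quantity.\<close>

definition frame :: "com => state => state => bool" where
 "frame c s s' \<longleftrightarrow> (\<forall>x. x \<notin> wv c --> vr s' x = vr s x) & (\<forall>a. a \<notin> wa c --> ar s' a = ar s a) &
   (\<forall>a. a \<notin> al c --> sz s' a = sz s a) & (al c = {} --> brk s' = brk s) & tm s <= tm s'"

text \<open>
 The parameter \<open>B\<close> bounds all intermediate values and \<open>A\<close> is the number of memory cells.
 The array allocated by \<open>AllocRest\<close> extends to the end of the memory; since the memory bound is
 not known to the program, this is how an array of unknown final size is modelled.
\<close>

locale machine = fixes B A :: nat
begin

fun opok :: "binop => nat => nat => bool" where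
 "opok Add x y = (x + y < B)"
| "opok Sub x y = (y <= x & x < B)"
| "opok Mul x y = (x * y < B)"
| "opok Div x y = True"
| "opok Mod x y = True"
| "opok Less x y = True"
| "opok Equal x y = True"
| "opok _ x y = False"

fun ok :: "aexp => state => bool" where
 "ok (Lit k) s = (k < B)"
| "ok (Var x) s = True"
| "ok (Bin f a b) s = (ok a s & ok b s & opok f (ev a s) (ev b s))"
| "ok (Idx a e) s = (ok e s & ev e s < sz s a)"

text \<open>Evaluating an expression takes no time here: its instruction count is bounded by the
  length of the program and enters as a factor in \<open>run_cc\<close>. Fresh arrays are zero
  because memory beyond \<open>brk\<close> has never been written. The bounds on \<open>brk\<close>
  are strict so that the next free address, kept in a register, is still a word.\<close>

inductive bs :: "com => state => state => bool" where
 bsSkip: "bs Skip s s"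
| bsAssign: "ok e s ==> bs (x ::= e) s (tick s(|vr := (vr s)(x := ev e s)|))"
| bsWrite: "ok i s ==> ok e s ==> ev i s < sz s a ==>
  bs (Write a i e) s (tick s(|ar := (ar s)(a := (ar s a)(ev i s := ev e s))|))"
| bsAlloc: "ok e s ==> brk s + ev e s < A ==>
  bs (Alloc a e) s (tick s(|ar := (ar s)(a := (%_. 0)), sz := (sz s)(a := ev e s), brk := brk s + ev e s|))"
| bsAllocRest: "brk s < A ==>
  bs (AllocRest a) s (tick s(|ar := (ar s)(a := (%_. 0)), sz := (sz s)(a := A - brk s), brk := A|))"
| bsSeq: "bs c s s' ==> bs d s' s'' ==> bs (c ;; d) s s''"
| bsCondT: "ok b s ==> ev b s ~= 0 ==> bs c (tick s) s' ==> bs (Cond b c d) s s'"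
| bsCondF: "ok b s ==> ev b s = 0 ==> bs d (tick s) s' ==> bs (Cond b c d) s s'"
| bsLoopF: "ok b s ==> ev b s = 0 ==> bs (Loop b c) s (tick s)"
| bsLoopT: "ok b s ==> ev b s ~= 0 ==> bs c (tick s) s' ==> bs (Loop b c) s' s'' ==> bs (Loop b c) s s''"

inductive_cases bs_SkipE: "bs Skip s s'"
inductive_cases bs_AssignE: "bs (x ::= e) s s'"
inductive_cases bs_WriteE: "bs (Write a i e) s s'"
inductive_cases bs_AllocE: "bs (Alloc a e) s s'"
inductive_cases bs_AllocRestE: "bs (AllocRest a) s s'"
inductive_cases bs_SeqE: "bs (c ;; d) s s'"
inductive_cases bs_CondE: "bs (Cond b c d) s s'"

lemma bs_frame: "bs c s s' ==> frame c s s'"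
 by (induction rule: bs.induct) (auto simp: frame_def)

text \<open>Termination together with a postcondition; execution is deterministic, so the existence
  of one run speaks about all. The inversion rules make the equations below exact, which lets
  simplification execute straight-line code.\<close>

definition wp :: "com => (state => bool) => state => bool" where
 "wp c Q s \<longleftrightarrow> (\<exists>s'. bs c s s' & Q s')"

lemma wp_Skip [simp]: "wp Skip Q s = Q s"
 unfolding wp_def by (blast intro: bsSkip elim: bs_SkipE)

lemma wp_Assign [simp]:
 "wp (x ::= e) Q s = (ok e s & Q (tick s(|vr := (vr s)(x := ev e s)|)))"
 unfolding wp_def by (blast intro: bsAssign elim: bs_AssignE)

lemma wp_Write [simp]: "wp (Write a i e) Q s = (ok i s & ok e s & ev i s < sz s a &
  Q (tick s(|ar := (ar s)(a := (ar s a)(ev i s := ev e s))|)))"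
 unfolding wp_def by (blast intro: bsWrite elim: bs_WriteE)

lemma wp_Alloc [simp]: "wp (Alloc a e) Q s = (ok e s & brk s + ev e s < A &
  Q (tick s(|ar := (ar s)(a := (%_. 0)), sz := (sz s)(a := ev e s), brk := brk s + ev e s|)))"
 unfolding wp_def by (blast intro: bsAlloc elim: bs_AllocE)

lemma wp_AllocRest [simp]: "wp (AllocRest a) Q s = (brk s < A &
  Q (tick s(|ar := (ar s)(a := (%_. 0)), sz := (sz s)(a := A - brk s), brk := A|)))"
 unfolding wp_def by (blast intro: bsAllocRest elim: bs_AllocRestE)

lemma wp_Seq [simp]: "wp (c ;; d) Q s = wp c (wp d Q) s"
 unfolding wp_def by (blast intro: bsSeq elim: bs_SeqE)

lemma wp_Cond [simp]: "wp (Cond b c d) Q s =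
  (ok b s & (ev b s ~= 0 --> wp c Q (tick s)) & (ev b s = 0 --> wp d Q (tick s)))"
 unfolding wp_def by (cases "ev b s = 0") (auto intro: bsCondT bsCondF elim: bs_CondE)

lemma wp_conseq:
 assumes "wp c Q' s" and "\<And>s'. frame c s s' ==> Q' s' ==> Q s'"
 shows "wp c Q s"
 using assms bs_frame unfolding wp_def by blast

lemma frame_refl: "frame c s s"
 by (simp add: frame_def)

lemma frame_trans: "frame c s s' ==> frame c s' s'' ==> frame c s s''"
 by (auto simp: frame_def)

lemma frame_tick: "frame c (tick s) s' ==> frame c s s'"
 by (auto simp: frame_def)

text \<open>Every iteration consumes time, so a bound on the time that holds along an invariant implies termination.\<close>

lemma wp_Loop:
 assumes init: "I s"
  and step: "\<And>s'. I s' ==> frame c s s' ==>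
   ok b s' & tm s' <= T & (if ev b s' = 0 then Q (tick s') else wp c I (tick s'))"
 shows "wp (Loop b c) Q s"
proof -
 have "I s' ==> frame c s s' ==> wp (Loop b c) Q s'" for s'
 proof (induction "T - tm s'" arbitrary: s' rule: less_induct)
  case less
  note st = step[OF less.prems]
  show ?case
  proof (cases "ev b s' = 0")
   case True
   then show ?thesis using st bsLoopF[of b s' c] by (auto simp: wp_def)
  next
   case False
   then obtain s'' where s'': "bs c (tick s') s''" "I s''" using st by (auto simp: wp_def)
   have f: "frame c (tick s') s''" by (rule bs_frame[OF s''(1)])
   have f': "frame c s s''" using frame_trans[OF less.prems(2) frame_tick[OF f]] .
   have "tm s'' <= T" using step[OF s''(2) f'] by simp
   moreover have "tm s' < tm s''" using f by (simp add: frame_def)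
   ultimately have "T - tm s'' < T - tm s'" by linarith
   from less.hyps[OF this s''(2) f'] obtain u where "bs (Loop b c) s'' u" "Q u" by (auto simp: wp_def)
   then show ?thesis using bsLoopT[OF _ False s''(1)] st by (auto simp: wp_def)
  qed
 qed
 then show ?thesis using init frame_refl by blast
qed

end

section \<open>Compilation to the word RAM\<close>

text \<open>The registers 3 k, 3 (k + 1), ... serve as an evaluation stack. Its height is bounded by
  the depth of the expression, so a fixed program gets by with finitely many registers.\<close>

fun ce :: "aexp => nat => instr list" where
 "ce (Lit c) k = [Const (3 * k) c]"
| "ce (Var x) k = [Copy (3 * k) (3 * x + 1)]"
| "ce (Bin f a b) k = ce a k @ ce b (Suc k) @ [Op f (3 * k) (3 * k) (3 * Suc k)]"
| "ce (Idx a e) k = ce e k @ [Op Add (3 * k) (3 * k) (3 * a + 2), Load (3 * k) (3 * k)]"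

text \<open>
 Register \<open>3 k\<close> with \<open>k \<ge> 1\<close> is temporary, \<open>3 x + 1\<close> holds variable \<open>x\<close>, \<open>3 a + 2\<close> the base address
 of array \<open>a\<close>, and register 0 the first free address.
\<close>

fun cc :: "nat => com => instr list" where
 "cc p Skip = []"
| "cc p (x ::= e) = ce e 1 @ [Copy (3 * x + 1) 3]"
| "cc p (Write a i e) = ce i 1 @ [Op Add 3 3 (3 * a + 2)] @ ce e 2 @ [Store 3 6]"
| "cc p (Alloc a e) = ce e 1 @ [Copy (3 * a + 2) 0, Op Add 0 0 3]"
| "cc p (AllocRest a) = [Copy (3 * a + 2) 0]"
| "cc p (c ;; d) = (let cs = cc p c in cs @ cc (p + length cs) d)"
| "cc p (Cond b c d) =
  (let bs = ce b 1; cs = cc (p + length bs + 1) c; q = p + length bs + 1 + length cs + 1; ds = cc q d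
   in bs @ [JumpIfZero 3 q] @ cs @ [Jump (q + length ds)] @ ds)"
| "cc p (Loop b c) =
  (let bs = ce b 1; cs = cc (p + length bs + 1) c
   in bs @ [JumpIfZero 3 (p + length bs + 1 + length cs + 1)] @ cs @ [Jump p])"

fun code_at :: "program => nat => instr list => bool" where
 "code_at P p [] = True"
| "code_at P p (x # xs) = (p < length P & P ! p = x & code_at P (Suc p) xs)"

lemma code_at_append [simp]: "code_at P p (a @ b) \<longleftrightarrow> code_at P p a & code_at P (p + length a) b"
 by (induction a arbitrary: p) auto

lemma code_at_self: "code_at (l @ xs @ r) (length l) xs"
proof (induction xs arbitrary: l)
 case (Cons x xs)
 then show ?case using Cons[of "l @ [x]"] by simp
qed simp

text \<open>The step count is exact, so a run that ends in a halted configuration determines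
  \<open>run_time\<close> and does not merely bound it.\<close>

fun run :: "nat => program => nat => nat => config => config => bool" where
 "run w P A 0 s s' = (s = s')"
| "run w P A (Suc t) s s' =
  (\<not> halted P s & addresses_accessed P s \<subseteq> {..<A} & run w P A t (step w P s) s')"

lemma run_trans: "run w P A t s s' ==> run w P A u s' s'' ==> run w P A (t + u) s s''"
 by (induction t arbitrary: s) auto

lemma run_iterate: "run w P A t s s' ==> s' = (step w P ^^ t) s &
  (\<forall>j<t. \<not> halted P ((step w P ^^ j) s) & addresses_accessed P ((step w P ^^ j) s) \<subseteq> {..<A})"
proof (induction t arbitrary: s)
 case (Suc t)
 then have IH: "s' = (step w P ^^ t) (step w P s)"
  "\<forall>j<t. \<not> halted P ((step w P ^^ j) (step w P s)) &
    addresses_accessed P ((step w P ^^ j) (step w P s)) \<subseteq> {..<A}" by auto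
 have "\<not> halted P ((step w P ^^ j) s) & addresses_accessed P ((step w P ^^ j) s) \<subseteq> {..<A}"
  if "j < Suc t" for j
  using that IH(2) Suc.prems by (cases j) (auto simp: funpow_swap1 simp del: funpow.simps(2) simp add: funpow_Suc_right)
 then show ?case using IH(1) by (simp add: funpow_swap1)
qed simp

lemma run_halted:
 assumes "run w P A t s s'" "halted P s'"
 shows "halts w P s" "run_time w P s = t" "run_result w P s = s'" "run_space w P s <= A"
proof -
 note it = run_iterate[OF assms(1)]
 show "halts w P s" using it assms(2) by (auto simp: halts_def)
 show rt: "run_time w P s = t" unfolding run_time_def
  by (rule Least_equality) (use it assms(2) in \<open>auto simp: not_less[symmetric]\<close>)
 show "run_result w P s = s'" using it rt by (simp add: run_result_def)
 show "run_space w P s <= A" unfolding run_space_def by (rule Least_le) (use it rt in auto)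
qed

lemma run_step:
 assumes "p < length P" "P ! p = i" "i ~= Halt"
 shows "run w P A (Suc t) (Config p R M) s' \<longleftrightarrow>
  (case i of Load r a => R a < A | Store a r => R a < A | _ => True) &
  run w P A t (exec w i (Config p R M)) s'"
 using assms by (auto simp: halted_def step_def addresses_accessed_def split: instr.splits)

declare run.simps(2) [simp del]

locale simulation = machine +
 fixes w :: nat and P :: program
 assumes Bw: "B <= 2 ^ w" and Aw: "A <= 2 ^ w"
begin

text \<open>Arrays are disjoint blocks below \<open>brk\<close>, and everything above is still zero,
  which spares initialisation on allocation. Register 0 is constrained only while
  \<open>brk s < A\<close>: after \<open>AllocRest\<close> there is no next free address.\<close>

definition rel :: "state => (nat => nat) => (nat => nat) => bool" where
 "rel s R M \<longleftrightarrow> (\<forall>x. R (3 * x + 1) = vr s x) &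
   (\<forall>a i. i < sz s a --> M (R (3 * a + 2) + i) = ar s a i) &
   (\<forall>a. R (3 * a + 2) + sz s a <= brk s) &
   (\<forall>a b i j. a ~= b --> i < sz s a --> j < sz s b --> R (3 * a + 2) + i ~= R (3 * b + 2) + j) &
   (\<forall>x \<ge> brk s. M x = 0) & (brk s < A --> R 0 = brk s) & brk s <= A"

lemma rel_cong:
 assumes "rel s R M" "\<And>r. r mod 3 ~= 0 \<or> r < 3 ==> R' r = R r"
 shows "rel s R' M"
proof -
 have "R' (3 * x + 1) = R (3 * x + 1)" "R' (3 * x + 2) = R (3 * x + 2)" "R' 0 = R 0" for x
  by (rule assms(2); presburger)+
 then show ?thesis using assms(1) unfolding rel_def by simp
qed

lemma binop_val_ok: "opok f x y ==> binop_val w f x y = bop f x y"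
proof (cases f)
 case Sub
 assume "opok f x y"
 then have *: "y <= x" "x < 2 ^ w" using Sub Bw by auto
 then have 1: "int x - int y = int (x - y)" and 2: "(x - y) mod 2 ^ w = x - y" by auto
 have "(int x - int y) mod 2 ^ w = int ((x - y) mod 2 ^ w)" unfolding 1 by (simp add: zmod_int)
 then show ?thesis using Sub 2 by simp
qed (use Bw in auto)

lemma run_ce:
 "ok e s ==> rel s R M ==> code_at P p (ce e k) ==> 1 <= k ==>
  \<exists>R'. run w P A (length (ce e k)) (Config p R M) (Config (p + length (ce e k)) R' M) &
   R' (3 * k) = ev e s & (\<forall>r. r mod 3 ~= 0 \<or> r < 3 * k --> R' r = R r)"
proof (induction e arbitrary: p k R)
 case (Lit c)
 then show ?case using Bw
  by (intro exI[of _ "R(3 * k := c)"]) (auto simp: run_step)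
next
 case (Var x)
 then show ?case
  by (intro exI[of _ "R(3 * k := R (3 * x + 1))"]) (auto simp: run_step rel_def)
next
 case (Bin f a b)
 let ?la = "length (ce a k)" and ?lb = "length (ce b (Suc k))"
 obtain R1 where R1: "run w P A ?la (Config p R M) (Config (p + ?la) R1 M)" "R1 (3 * k) = ev a s"
  "\<And>r. r mod 3 ~= 0 \<or> r < 3 * k ==> R1 r = R r"
  using Bin.IH(1)[of R p k] Bin.prems by auto
 have "rel s R1 M" by (rule rel_cong[OF Bin.prems(2)]) (use R1(3) Bin.prems(4) in auto)
 then obtain R2 where R2: "run w P A ?lb (Config (p + ?la) R1 M) (Config (p + ?la + ?lb) R2 M)"
  "R2 (3 * Suc k) = ev b s" "\<And>r. r mod 3 ~= 0 \<or> r < 3 * Suc k ==> R2 r = R1 r"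
  using Bin.IH(2)[of R1 "p + ?la" "Suc k"] Bin.prems by auto
 have k: "R2 (3 * k) = ev a s" using R2(3)[of "3 * k"] R1(2) by simp
 define Rn where "Rn = R2(3 * k := bop f (ev a s) (ev b s))"
 have Rn: "Rn (3 * k) = bop f (ev a s) (ev b s)" "\<And>r. r mod 3 ~= 0 \<or> r < 3 * k ==> Rn r = R2 r"
  by (auto simp: Rn_def)
 have "run w P A 1 (Config (p + ?la + ?lb) R2 M) (Config (p + ?la + ?lb + 1) Rn M)" unfolding Rn_def
  using Bin.prems R2(2) k binop_val_ok[of f "ev a s" "ev b s"] by (auto simp: run_step)
 from run_trans[OF R1(1) run_trans[OF R2(1) this]] show ?case
  using R1(3) R2(3) Rn by (intro exI[of _ Rn]) (auto simp: ac_simps)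
next
 case (Idx a e)
 let ?l = "length (ce e k)"
 obtain R1 where R1: "run w P A ?l (Config p R M) (Config (p + ?l) R1 M)" "R1 (3 * k) = ev e s"
  "\<And>r. r mod 3 ~= 0 \<or> r < 3 * k ==> R1 r = R r"
  using Idx.IH[of R p k] Idx.prems by auto
 have a: "R1 (3 * a + 2) = R (3 * a + 2)" using R1(3)[of "3 * a + 2"] by presburger
 have lt: "ev e s < sz s a" using Idx.prems by simp
 have adr: "ev e s + R (3 * a + 2) < A"
  using Idx.prems(2) lt unfolding rel_def by (metis (no_types) add.commute add_less_mono1 order_less_le_trans)
 have mval: "M (ev e s + R (3 * a + 2)) = ar s a (ev e s)"
  using Idx.prems(2) lt unfolding rel_def by (metis add.commute)
 define Rn where "Rn = R1(3 * k := ar s a (ev e s))"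
 have Rn: "Rn (3 * k) = ar s a (ev e s)" "\<And>r. r mod 3 ~= 0 \<or> r < 3 * k ==> Rn r = R1 r"
  by (auto simp: Rn_def)
 have "run w P A 2 (Config (p + ?l) R1 M) (Config (p + ?l + 2) Rn M)"
  unfolding numeral_2_eq_2 Rn_def using Idx.prems R1(2) a adr mval Aw
  by (auto simp: run_step)
 from run_trans[OF R1(1) this] show ?case using R1(3) Rn by (intro exI[of _ Rn]) (auto simp: ac_simps)
qed

text \<open>Covers both kinds of allocation: an ordinary one stays strictly below A, while
  \<open>AllocRest\<close> reaches A and leaves register 0 alone.\<close>

lemma rel_alloc:
 assumes rel: "rel s R M" and le: "brk s + k <= A" and "\<And>x. R' (3 * x + 1) = R (3 * x + 1)"
  "\<And>b. R' (3 * b + 2) = (if b = a then brk s else R (3 * b + 2))" "brk s + k < A ==> R' 0 = brk s + k"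
 shows "rel (tick s(|ar := (ar s)(a := (%_. 0)), sz := (sz s)(a := k), brk := brk s + k|)) R' M"
proof -
 have adr: "R (3 * b + 2) + i < brk s" if "i < sz s b" for b i
  using rel that unfolding rel_def by (metis add_less_cancel_left order_less_le_trans)
 have 2: "M (R' (3 * b + 2) + i) = ((ar s)(a := (%_. 0))) b i" if "i < ((sz s)(a := k)) b" for b i
  using that rel assms(4)[of b] unfolding rel_def by (auto split: if_splits)
 have 3: "R' (3 * b + 2) + ((sz s)(a := k)) b <= brk s + k" for b
  using rel assms(4)[of b] unfolding rel_def by (auto intro: trans_le_add1)
 have 4: "R' (3 * b + 2) + i ~= R' (3 * c + 2) + j"
  if ne: "b ~= c" and i: "i < ((sz s)(a := k)) b" and j: "j < ((sz s)(a := k)) c" for b c i j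
 proof -
  consider "b = a" "c ~= a" | "c = a" "b ~= a" | "b ~= a" "c ~= a" using ne by blast
  then show ?thesis
  proof cases
   case 1 then show ?thesis using assms(4)[of b] assms(4)[of c] adr[of j c] j by simp
  next
   case 2 then show ?thesis using assms(4)[of b] assms(4)[of c] adr[of i b] i by simp
  next
   case 3 then show ?thesis using assms(4)[of b] assms(4)[of c] rel ne i j unfolding rel_def by simp
  qed
 qed
 show ?thesis using rel assms(2,3,5) 2 3 4 unfolding rel_def by simp
qed

text \<open>A construct that ticks executes, apart from its subcommands, at most as many
  instructions as its code is long; so one tick pays for K steps. The additive form composes along
  sequences and iterations without subtraction.\<close>

lemma run_cc:
 "bs c s s' ==> rel s R M ==> code_at P p (cc p c) ==> length (cc p c) <= K ==>
  \<exists>R' M' t. run w P A t (Config p R M) (Config (p + length (cc p c)) R' M') & rel s' R' M' &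
   t + K * tm s <= K * tm s'"
proof (induction arbitrary: p R M rule: bs.induct)
 case (bsSkip s)
 then show ?case by - (rule exI[of _ R], rule exI[of _ M], rule exI[of _ 0], auto)
next
 case (bsAssign e s x)
 obtain R1 where R1: "run w P A (length (ce e 1)) (Config p R M) (Config (p + length (ce e 1)) R1 M)"
  "R1 3 = ev e s" "\<And>r. r mod 3 ~= 0 \<or> r < 3 ==> R1 r = R r"
  using run_ce[OF bsAssign(1,2), of p 1] bsAssign by auto
 define Rn where "Rn = R1(3 * x + 1 := ev e s)"
 have "run w P A 1 (Config (p + length (ce e 1)) R1 M) (Config (p + length (ce e 1) + 1) Rn M)" unfolding Rn_def
  using bsAssign R1(2) by (auto simp: run_step)
 note r = run_trans[OF R1(1) this]
 have r1: "rel s R1 M" by (rule rel_cong[OF bsAssign(2)]) (use R1(3) in auto)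
 have "3 * xa + 2 ~= Suc (3 * x)" "Suc (3 * xa) = Suc (3 * x) \<longleftrightarrow> xa = x" for xa by presburger+
 then have "rel (tick s(|vr := (vr s)(x := ev e s)|)) Rn M"
  using r1 unfolding rel_def Rn_def by simp
 then show ?case using r bsAssign(4)
  by - (rule exI[of _ Rn], rule exI[of _ M], rule exI[of _ "length (ce e 1) + 1"], auto simp: ac_simps)
next
 case (bsWrite i s e a)
 let ?l = "length (ce i 1)" and ?m = "length (ce e 2)"
 obtain R1 where R1: "run w P A ?l (Config p R M) (Config (p + ?l) R1 M)"
  "R1 3 = ev i s" "\<And>r. r mod 3 ~= 0 \<or> r < 3 ==> R1 r = R r"
  using run_ce[OF bsWrite(1,4), of p 1] bsWrite by auto
 have a: "R1 (3 * a + 2) = R (3 * a + 2)" using R1(3)[of "3 * a + 2"] by presburger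
 have adr: "ev i s + R (3 * a + 2) < A"
  using bsWrite unfolding rel_def by (metis (no_types) add.commute add_less_mono1 order_less_le_trans)
 let ?R2 = "R1(3 := R (3 * a + 2) + ev i s)"
 have s2: "run w P A 1 (Config (p + ?l) R1 M) (Config (p + ?l + 1) ?R2 M)"
  using bsWrite R1(2) a adr Aw by (auto simp: run_step ac_simps)
 have r2: "rel s ?R2 M" by (rule rel_cong[OF bsWrite(4)]) (use R1(3) in auto)
 obtain R3 where R3: "run w P A ?m (Config (p + ?l + 1) ?R2 M) (Config (p + ?l + 1 + ?m) R3 M)"
  "R3 6 = ev e s" "\<And>r. r mod 3 ~= 0 \<or> r < 6 ==> R3 r = ?R2 r"
  using run_ce[OF bsWrite(2) r2, of "p + ?l + 1" 2] bsWrite by auto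
 have three: "R3 3 = R (3 * a + 2) + ev i s" using R3(3)[of 3] by simp
 define Mn where "Mn = M(R (3 * a + 2) + ev i s := ev e s)"
 have s4: "run w P A 1 (Config (p + ?l + 1 + ?m) R3 M) (Config (p + ?l + 1 + ?m + 1) R3 Mn)" unfolding Mn_def
  using bsWrite R3(2) three adr by (auto simp: run_step ac_simps)
 have r3: "rel s R3 M" by (rule rel_cong[OF r2]) (use R3(3) in auto)
 have a3: "R3 (3 * a + 2) = R (3 * a + 2)"
  using R3(3)[of "3 * a + 2"] a by (simp; presburger)
 have m: "Mn (R3 (3 * b + 2) + k) = ((ar s)(a := (ar s a)(ev i s := ev e s))) b k" if "k < sz s b" for b k
 proof (cases "b = a")
  case True
  have "M (R3 (3 * b + 2) + k) = ar s b k" using that r3 by (simp add: rel_def)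
  then show ?thesis using True a3 by (simp add: Mn_def)
 next
  case False
  then have "R3 (3 * b + 2) + k ~= R (3 * a + 2) + ev i s"
   using that r3 a3 bsWrite(3) unfolding rel_def by metis
  then show ?thesis using False that r3 by (auto simp: rel_def Mn_def)
 qed
 have lt: "R (3 * a + 2) + ev i s < brk s"
  using r3 bsWrite(3) a3 unfolding rel_def by (metis add_less_cancel_left order_less_le_trans)
 have z: "Mn x = 0" if "brk s <= x" for x
  using that lt r3 by (auto simp: rel_def Mn_def)
 have "rel (tick s(|ar := (ar s)(a := (ar s a)(ev i s := ev e s))|)) R3 Mn"
  using r3 m z unfolding rel_def by simp
 then show ?case using run_trans[OF R1(1) run_trans[OF s2 run_trans[OF R3(1) s4]]] bsWrite(6)
  by - (rule exI[of _ R3], rule exI[of _ Mn], rule exI[of _ "?l + (1 + (?m + 1))"], auto simp: ac_simps)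
next
 case (bsAlloc e s a)
 obtain R1 where R1: "run w P A (length (ce e 1)) (Config p R M) (Config (p + length (ce e 1)) R1 M)"
  "R1 3 = ev e s" "\<And>r. r mod 3 ~= 0 \<or> r < 3 ==> R1 r = R r"
  using run_ce[OF bsAlloc(1,3), of p 1] bsAlloc by auto
 have r1: "rel s R1 M" by (rule rel_cong[OF bsAlloc(3)]) (use R1(3) in auto)
 have R0: "R1 0 = brk s" using r1 bsAlloc(2) by (simp add: rel_def)
 define Rn where "Rn = R1(3 * a + 2 := brk s, 0 := brk s + ev e s)"
 have "run w P A 2 (Config (p + length (ce e 1)) R1 M) (Config (p + length (ce e 1) + 2) Rn M)"
  unfolding numeral_2_eq_2 Rn_def using bsAlloc R1(2) R0 Aw
  by (auto simp: run_step fun_upd_def)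
 note r = run_trans[OF R1(1) this]
 have ne: "3 * x + 2 = 3 * a + 2 \<longleftrightarrow> x = a" "3 * x + 1 ~= 3 * a + 2" for x by presburger+
 have "rel (tick s(|ar := (ar s)(a := (%_. 0)), sz := (sz s)(a := ev e s), brk := brk s + ev e s|)) Rn M"
  by (rule rel_alloc[OF r1]) (use bsAlloc(2) ne in \<open>auto simp: Rn_def\<close>)
 then show ?case using r bsAlloc(5)
  by - (rule exI[of _ Rn], rule exI[of _ M], rule exI[of _ "length (ce e 1) + 2"], auto simp: ac_simps)
next
 case (bsAllocRest s a)
 define Rn where "Rn = R(3 * a + 2 := brk s)"
 have R0: "R 0 = brk s" using bsAllocRest by (simp add: rel_def)
 have r: "run w P A 1 (Config p R M) (Config (p + 1) Rn M)" unfolding Rn_def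
  using bsAllocRest R0 by (auto simp: run_step)
 have ne: "3 * x + 2 = 3 * a + 2 \<longleftrightarrow> x = a" "3 * x + 1 ~= 3 * a + 2" for x by presburger+
 have "rel (tick s(|ar := (ar s)(a := (%_. 0)), sz := (sz s)(a := A - brk s), brk := brk s + (A - brk s)|)) Rn M"
  by (rule rel_alloc[OF bsAllocRest(2)]) (use bsAllocRest(1) ne in \<open>auto simp: Rn_def\<close>)
 then have "rel (tick s(|ar := (ar s)(a := (%_. 0)), sz := (sz s)(a := A - brk s), brk := A|)) Rn M"
  using bsAllocRest(1) by simp
 then show ?case using r bsAllocRest(4)
  by - (rule exI[of _ Rn], rule exI[of _ M], rule exI[of _ 1], auto)
next
 case (bsSeq c s s' d s'')
 let ?c = "cc p c"
 obtain R1 M1 t1 where 1: "run w P A t1 (Config p R M) (Config (p + length ?c) R1 M1)" "rel s' R1 M1"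
  "t1 + K * tm s <= K * tm s'"
  using bsSeq.IH(1)[of R M p] bsSeq.prems by (auto simp: Let_def)
 obtain R2 M2 t2 where 2: "run w P A t2 (Config (p + length ?c) R1 M1)
   (Config (p + length ?c + length (cc (p + length ?c) d)) R2 M2)" "rel s'' R2 M2"
  "t2 + K * tm s' <= K * tm s''"
  using bsSeq.IH(2)[of R1 M1 "p + length ?c"] 1 bsSeq.prems by (auto simp: Let_def)
 show ?case using run_trans[OF 1(1) 2(1)] 1 2
  by - (rule exI[of _ R2], rule exI[of _ M2], rule exI[of _ "t1 + t2"], auto simp: Let_def ac_simps)
next
 case (bsCondT b s c s' d)
 let ?b = "ce b 1" and ?c = "cc (p + length (ce b 1) + 1) c"
 let ?q = "p + length ?b + 1 + length ?c + 1"
 let ?d = "cc ?q d"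
 have code: "code_at P p ?b" "p + length ?b < length P" "P ! (p + length ?b) = JumpIfZero 3 ?q"
  "code_at P (p + length ?b + 1) ?c" "p + length ?b + 1 + length ?c < length P"
  "P ! (p + length ?b + 1 + length ?c) = Jump (?q + length ?d)"
  "length ?b + length ?c + length ?d + 2 <= K"
  using bsCondT.prems by (auto simp: Let_def)
 obtain R1 where R1: "run w P A (length ?b) (Config p R M) (Config (p + length ?b) R1 M)"
  "R1 3 = ev b s" "\<And>r. r mod 3 ~= 0 \<or> r < 3 ==> R1 r = R r"
  using run_ce[OF bsCondT(1,5) code(1)] by auto
 have r1: "rel (tick s) R1 M" using rel_cong[OF bsCondT.prems(1), of R1] R1(3) by (auto simp: rel_def)
 have s1: "run w P A 1 (Config (p + length ?b) R1 M) (Config (p + length ?b + 1) R1 M)"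
  using code R1(2) bsCondT(2) by (auto simp: run_step)
 obtain R2 M2 t2 where 2: "run w P A t2 (Config (p + length ?b + 1) R1 M)
   (Config (p + length ?b + 1 + length ?c) R2 M2)" "rel s' R2 M2" "t2 + K * tm (tick s) <= K * tm s'"
  using bsCondT.IH[OF r1 code(4)] code(7) by auto
 have s3: "run w P A 1 (Config (p + length ?b + 1 + length ?c) R2 M2) (Config (?q + length ?d) R2 M2)"
  using code by (auto simp: run_step)
 have len: "p + length (cc p (Cond b c d)) = ?q + length ?d" by (simp add: Let_def)
 have "length ?b + (1 + (t2 + 1)) + K * tm s <= K * tm s'" using 2(3) code(7) by simp
 then show ?case unfolding len using run_trans[OF R1(1) run_trans[OF s1 run_trans[OF 2(1) s3]]] 2(2) by blast
next
 case (bsCondF b s d s' c)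
 let ?b = "ce b 1" and ?c = "cc (p + length (ce b 1) + 1) c"
 let ?q = "p + length ?b + 1 + length ?c + 1"
 let ?d = "cc ?q d"
 have code: "code_at P p ?b" "p + length ?b < length P" "P ! (p + length ?b) = JumpIfZero 3 ?q"
  "code_at P ?q ?d" "length ?b + length ?c + length ?d + 2 <= K"
  using bsCondF.prems by (auto simp: Let_def)
 obtain R1 where R1: "run w P A (length ?b) (Config p R M) (Config (p + length ?b) R1 M)"
  "R1 3 = ev b s" "\<And>r. r mod 3 ~= 0 \<or> r < 3 ==> R1 r = R r"
  using run_ce[OF bsCondF(1,5) code(1)] by auto
 have r1: "rel (tick s) R1 M" using rel_cong[OF bsCondF.prems(1), of R1] R1(3) by (auto simp: rel_def)
 have s1: "run w P A 1 (Config (p + length ?b) R1 M) (Config ?q R1 M)"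
  using code R1(2) bsCondF(2) by (auto simp: run_step)
 obtain R2 M2 t2 where 2: "run w P A t2 (Config ?q R1 M)
   (Config (?q + length ?d) R2 M2)" "rel s' R2 M2" "t2 + K * tm (tick s) <= K * tm s'"
  using bsCondF.IH[OF r1 code(4)] code(5) by auto
 have len: "p + length (cc p (Cond b c d)) = ?q + length ?d" by (simp add: Let_def)
 have "length ?b + (1 + t2) + K * tm s <= K * tm s'" using 2(3) code(5) by simp
 then show ?case unfolding len using run_trans[OF R1(1) run_trans[OF s1 2(1)]] 2(2) by blast
next
 case (bsLoopF b s c)
 let ?b = "ce b 1" and ?c = "cc (p + length (ce b 1) + 1) c"
 let ?q = "p + length ?b + 1 + length ?c + 1"
 have code: "code_at P p ?b" "p + length ?b < length P" "P ! (p + length ?b) = JumpIfZero 3 ?q"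
  "length ?b + length ?c + 2 <= K"
  using bsLoopF.prems by (auto simp: Let_def)
 obtain R1 where R1: "run w P A (length ?b) (Config p R M) (Config (p + length ?b) R1 M)"
  "R1 3 = ev b s" "\<And>r. r mod 3 ~= 0 \<or> r < 3 ==> R1 r = R r"
  using run_ce[OF bsLoopF(1,3) code(1)] by auto
 have r1: "rel (tick s) R1 M" using rel_cong[OF bsLoopF.prems(1), of R1] R1(3) by (auto simp: rel_def)
 have s1: "run w P A 1 (Config (p + length ?b) R1 M) (Config ?q R1 M)"
  using code R1(2) bsLoopF(2) by (auto simp: run_step)
 have len: "p + length (cc p (Loop b c)) = ?q" by (simp add: Let_def)
 have "length ?b + 1 + K * tm s <= K * tm (tick s)" using code(4) by simp
 then show ?case unfolding len using run_trans[OF R1(1) s1] r1 by blast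
next
 case (bsLoopT b s c s' s'')
 let ?b = "ce b 1" and ?c = "cc (p + length (ce b 1) + 1) c"
 let ?q = "p + length ?b + 1 + length ?c + 1"
 have code: "code_at P p ?b" "p + length ?b < length P" "P ! (p + length ?b) = JumpIfZero 3 ?q"
  "code_at P (p + length ?b + 1) ?c" "p + length ?b + 1 + length ?c < length P"
  "P ! (p + length ?b + 1 + length ?c) = Jump p"
  "length ?b + length ?c + 2 <= K"
  using bsLoopT.prems by (auto simp: Let_def)
 obtain R1 where R1: "run w P A (length ?b) (Config p R M) (Config (p + length ?b) R1 M)"
  "R1 3 = ev b s" "\<And>r. r mod 3 ~= 0 \<or> r < 3 ==> R1 r = R r"
  using run_ce[OF bsLoopT(1) bsLoopT.prems(1) code(1)] by auto
 have r1: "rel (tick s) R1 M" using rel_cong[OF bsLoopT.prems(1), of R1] R1(3) by (auto simp: rel_def)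
 have s1: "run w P A 1 (Config (p + length ?b) R1 M) (Config (p + length ?b + 1) R1 M)"
  using code R1(2) bsLoopT(2) by (auto simp: run_step)
 obtain R2 M2 t2 where 2: "run w P A t2 (Config (p + length ?b + 1) R1 M)
   (Config (p + length ?b + 1 + length ?c) R2 M2)" "rel s' R2 M2" "t2 + K * tm (tick s) <= K * tm s'"
  using bsLoopT.IH(1)[OF r1 code(4)] code(7) by auto
 have s3: "run w P A 1 (Config (p + length ?b + 1 + length ?c) R2 M2) (Config p R2 M2)"
  using code by (auto simp: run_step)
 obtain R4 M4 t4 where 4: "run w P A t4 (Config p R2 M2) (Config (p + length (cc p (Loop b c))) R4 M4)"
  "rel s'' R4 M4" "t4 + K * tm s' <= K * tm s''"
  using bsLoopT.IH(2)[OF 2(2) bsLoopT.prems(2,3)] by blast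
 have "length ?b + (1 + (t2 + (1 + t4))) + K * tm s <= K * tm s''" using 2(3) 4(3) code(7) by simp
 then show ?case using run_trans[OF R1(1) run_trans[OF s1 run_trans[OF 2(1) run_trans[OF s3 4(1)]]]] 4(2) by blast
qed

end

definition initial_state :: "nat list => state" where
 "initial_state xs = (|vr = %_. 0, ar = %a i. if a = 0 & i < length xs then xs ! i else 0,
   sz = (%a. if a = 0 then length xs else 0), brk = length xs, tm = 0|)"

text \<open>The prologue computes the input length 3 n + 1 from the first word and leaves it in
  register 0 as the first free address; its six instructions explain the code address 6. The final
  addition forms the address of the output from the base of array a and the variable x.\<close>

definition compiled :: "com => nat => nat => program" where
 "compiled c a x = [Const 3 0, Load 3 3, Const 6 3, Op Mul 3 3 6, Const 6 1, Op Add 0 3 6] @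
   cc 6 c @ [Op Add 0 (3 * a + 2) (3 * x + 1), Halt]"

lemma compiled_correct:
 assumes bs: "machine.bs B A c (initial_state xs) s'"
  and BA: "B <= 2 ^ w" "A <= 2 ^ w" "length xs < A" "3 < B"
  and xs: "xs ~= []" "length xs = 3 * hd xs + 1"
  and res: "\<And>k. k < length ys ==> vr s' x + k < sz s' a & ar s' a (vr s' x + k) = ys ! k" "ys ~= []"
 shows "halts w (compiled c a x) (initial_config xs)"
  "result_is (run_result w (compiled c a x) (initial_config xs)) ys"
  "run_time w (compiled c a x) (initial_config xs) <= length (compiled c a x) * (tm s' + 1)"
  "run_space w (compiled c a x) (initial_config xs) <= A"
proof -
 let ?P = "compiled c a x" and ?M = "%a. if a < length xs then xs ! a else 0"
 interpret simulation B A w ?P by unfold_locales (use BA in auto)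
 let ?R = "(%_. 0)(3 := 3 * hd xs, 6 := 1, 0 := length xs)"
 have xs0: "xs ! 0 = hd xs" using xs(1) by (simp add: hd_conv_nth)
 have len: "3 * hd xs + 1 < 2 ^ w" "3 * hd xs < 2 ^ w" "length xs > 0" "1 < (2::nat) ^ w" "3 < (2::nat) ^ w"
  using BA xs by auto
 have code0: "code_at ?P 0 [Const 3 0, Load 3 3, Const 6 3, Op Mul 3 3 6, Const 6 1, Op Add 0 3 6]"
  unfolding compiled_def using code_at_self[of "[]"] by simp
 have r0: "run w ?P A (Suc (Suc (Suc (Suc (Suc (Suc 0)))))) (Config 0 (%_. 0) ?M) (Config 6 ?R ?M)"
  using code0 len BA(3) xs0 xs by (auto simp: run_step fun_eq_iff mult.commute)
 have rel0: "rel (initial_state xs) ?R ?M"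
  using BA(3) by (auto simp: rel_def initial_state_def; presburger)
 have six: "length [Const 3 0, Load 3 3, Const 6 3, Op Mul 3 3 6, Const 6 1, Op Add 0 3 6] = 6" by simp
 have code: "code_at ?P 6 (cc 6 c)"
  unfolding compiled_def by (subst (2) six[symmetric], rule code_at_self)
 have lP: "length ?P = length (cc 6 c) + 8" by (simp add: compiled_def)
 obtain R' M' t where 1: "run w ?P A t (Config 6 ?R ?M) (Config (6 + length (cc 6 c)) R' M')" "rel s' R' M'"
  "t + length ?P * tm (initial_state xs) <= length ?P * tm s'"
  using run_cc[OF bs rel0 code, of "length ?P"] lP by auto
 have P6: "?P ! (6 + length (cc 6 c)) = Op Add 0 (3 * a + 2) (3 * x + 1)" "?P ! (7 + length (cc 6 c)) = Halt"
  by (simp_all add: compiled_def nth_append)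
 have vx: "R' (3 * x + 1) = vr s' x" using 1(2) by (simp add: rel_def)
 have l0: "vr s' x < sz s' a" using res(1)[of 0] res(2) by simp
 have b: "R' (3 * a + 2) + sz s' a <= A" using 1(2) unfolding rel_def by (metis order.trans)
 let ?R' = "R'(0 := R' (3 * a + 2) + vr s' x)"
 have "run w ?P A 1 (Config (6 + length (cc 6 c)) R' M') (Config (7 + length (cc 6 c)) ?R' M')"
  using P6(1) lP vx l0 b Aw by (auto simp: run_step)
 note r = run_trans[OF r0 run_trans[OF 1(1) this]]
 have h: "halted ?P (Config (7 + length (cc 6 c)) ?R' M')" using P6 by (simp add: halted_def)
 have ic: "initial_config xs = Config 0 (%_. 0) ?M" by (simp add: initial_config_def)
 note fin = run_halted[OF r h, folded ic]
 show "halts w ?P (initial_config xs)" "run_space w ?P (initial_config xs) <= A" using fin by auto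
 show "run_time w ?P (initial_config xs) <= length ?P * (tm s' + 1)"
  using fin(2) 1(3) lP by (simp add: initial_state_def)
 have "M' (R' (3 * a + 2) + vr s' x + k) = ys ! k" if "k < length ys" for k
  using res(1)[OF that] 1(2) unfolding rel_def by (metis add.assoc)
 then show "result_is (run_result w ?P (initial_config xs)) ys"
  using fin(3) by (simp add: result_is_def)
qed

section \<open>Counting loops\<close>

abbreviation For :: "nat => nat => com => com" where
 "For i n c \<equiv> Loop (Var i \<lhd> Var n) (c ;; i ::= Var i \<oplus> Lit (Suc 0))"

lemma frame_simps:
 assumes "frame c s s'"
 shows "x \<notin> wv c ==> vr s' x = vr s x" "a \<notin> wa c ==> ar s' a = ar s a" "al c = {} ==> sz s' = sz s"
  "al c = {} ==> brk s' = brk s"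
 using assms by (auto simp: frame_def)

context machine
begin

text \<open>The invariant may not depend on the clock, so the ticks of test and increment, the 2 in
  \<open>D + 2\<close>, stay outside it. The body is asked to establish the invariant for the
  incremented counter, which hides the final assignment.\<close>

lemma wp_For:
 assumes ni: "n ~= i" "i \<notin> wv c" "n \<notin> wv c"
  and init: "I (vr s i) s" "vr s i <= vr s n" "vr s n < B"
  and tm: "\<And>k u t. I k u ==> I k (u(|tm := t|))"
  and step: "\<And>k s'. vr s i <= k ==> k < vr s n ==> vr s' i = k ==>
   frame (c ;; i ::= Var i \<oplus> Lit (Suc 0)) s s' ==> I k s' ==>
   wp c (%u. tm u <= tm s' + D & I (Suc k) (u(|vr := (vr u)(i := Suc k)|))) s'"
  and post: "\<And>s'. I (vr s n) s' ==> vr s' i = vr s n ==> frame (c ;; i ::= Var i \<oplus> Lit (Suc 0)) s s' ==>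
   tm s' <= tm s + (D + 2) * (vr s n - vr s i) + 1 ==> Q s'"
 shows "wp (For i n c) Q s"
proof (rule wp_Loop[where I = "%u. vr s i <= vr u i & vr u i <= vr s n & I (vr u i) u &
   tm u <= tm s + (D + 2) * (vr u i - vr s i)" and T = "tm s + (D + 2) * (vr s n - vr s i)"], goal_cases)
 case 1
 then show ?case using init by simp
next
 case (2 s')
 then have I: "vr s i <= vr s' i" "vr s' i <= vr s n" "I (vr s' i) s'"
  "tm s' <= tm s + (D + 2) * (vr s' i - vr s i)" and f: "frame (c ;; i ::= Var i \<oplus> Lit (Suc 0)) s s'" by auto
 have n: "vr s' n = vr s n" using f ni by (simp add: frame_def)
 have "tm s' <= tm s + (D + 2) * (vr s n - vr s i)"
  using I(2,4) by (meson add_left_mono diff_le_mono le_trans mult_le_mono2)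
 moreover have "Q (tick s')" if "\<not> vr s' i < vr s n"
 proof (rule post)
  show "I (vr s n) (tick s')" using that I by (intro tm) (simp add: order.antisym)
  show "vr (tick s') i = vr s n" using that I by simp
  show "frame (c ;; i ::= Var i \<oplus> Lit (Suc 0)) s (tick s')" using f by (auto simp: frame_def)
  show "tm (tick s') <= tm s + (D + 2) * (vr s n - vr s i) + 1" using calculation by simp
 qed
 moreover have "wp (c ;; i ::= Var i \<oplus> Lit (Suc 0)) (%u. vr s i <= vr u i & vr u i <= vr s n & I (vr u i) u &
   tm u <= tm s + (D + 2) * (vr u i - vr s i)) (tick s')" if lt: "vr s' i < vr s n"
 proof (simp, rule wp_conseq[OF step[OF I(1) lt]], goal_cases)
  case 1 show ?case by simp
 next
  case 2 show ?case using f by (auto simp: frame_def)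
 next
  case 3 show ?case by (rule tm) fact
 next
  case (4 u)
  then have u: "frame c (tick s') u" "tm u <= tm (tick s') + D" "I (Suc (vr s' i)) (u(|vr := (vr u)(i := Suc (vr s' i))|))"
   by auto
  have i: "vr u i = vr s' i" using u(1) ni by (simp add: frame_def)
  obtain d where d: "vr s' i = vr s i + d" using I(1) le_Suc_ex by blast
  have t: "Suc (tm u) <= tm s + (D + 2) * (Suc (vr s' i) - vr s i)" using u(2) I(4) unfolding d by simp
  have "tick u(|vr := (vr u)(i := Suc (vr s' i))|) = u(|vr := (vr u)(i := Suc (vr s' i)), tm := Suc (tm u)|)" by simp
  then have J: "I (Suc (vr s' i)) (tick u(|vr := (vr u)(i := Suc (vr s' i))|))"
   using tm[OF u(3), of "Suc (tm u)"] by metis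
  show ?case using lt init(3) I(1) t J by (auto simp: i)
 qed
 ultimately show ?case using n by auto
qed

end

section \<open>Positions in a stably sorted order, and counting sort\<close>

definition rpos :: "(nat => nat) => nat => nat => nat" where
 "rpos key c i = card {j. j < c & (key j < key i \<or> key j = key i & j < i)}"

lemma rpos_mono:
 assumes "i < c" "j < c"
 shows "rpos key c i < rpos key c j \<longleftrightarrow> key i < key j \<or> key i = key j & i < j"
proof -
 have lt: "rpos key c i < rpos key c j" if "i < c" "key i < key j \<or> key i = key j & i < j" for i j
  unfolding rpos_def by (rule psubset_card_mono) (use that in auto)
 show ?thesis using lt[of i j] lt[of j i] assms by (metis linorder_neqE_nat order_less_asym order_less_irrefl)
qed

lemma rpos_less: "i < c ==> rpos key c i < c"
proof -
 assume i: "i < c"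
 have "rpos key c i < card {..<c}" unfolding rpos_def by (rule psubset_card_mono) (use i in auto)
 then show ?thesis by simp
qed

lemma rpos_inj: "inj_on (rpos key c) {..<c}"
proof (rule inj_onI)
 fix i j assume "i \<in> {..<c}" "j \<in> {..<c}" "rpos key c i = rpos key c j"
 then show "i = j" using rpos_mono[of i c j key] rpos_mono[of j c i key] by (metis lessThan_iff linorder_neqE_nat nless_le)
qed

lemma rpos_bij: "bij_betw (rpos key c) {..<c} {..<c}"
proof -
 have "rpos key c ` {..<c} \<subseteq> {..<c}" using rpos_less by auto
 then have "rpos key c ` {..<c} = {..<c}" using rpos_inj by (simp add: endo_inj_surj)
 then show ?thesis using rpos_inj by (simp add: bij_betw_def)
qed

text \<open>In this form the position is what the counting array delivers: the start of the bucket
  plus the number of its elements placed before.\<close>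

lemma rpos_split:
 "rpos key c i = card {j. j < c & key j < key i} + card {j. j < c & j < i & key j = key i}"
 unfolding rpos_def by (subst card_Un_disjoint[symmetric]) (auto intro: arg_cong[where f = card])

abbreviation (input) "aTX \<equiv> 2::nat"
abbreviation (input) "aCNT \<equiv> 20::nat"
abbreviation (input) "vOff \<equiv> 40::nat"
abbreviation (input) "vLen \<equiv> 41::nat"
abbreviation (input) "vK \<equiv> 42::nat"
abbreviation (input) "vCnt \<equiv> 43::nat"
abbreviation (input) "vI \<equiv> 44::nat"
abbreviation (input) "vX \<equiv> 46::nat"
abbreviation (input) "vY \<equiv> 47::nat"

text \<open>One pass distributes the positions listed in a by the character at distance d behind
  them. As it is stable, passes with decreasing d sort by blocks of characters.\<close>

definition radix :: "nat => nat => nat => com" where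
 "radix a b d =
  vI ::= Lit 0 ;; For vI vK (Write aCNT (Var vI) (Lit 0)) ;;
  vI ::= Lit 0 ;; For vI vCnt
   (vX ::= Idx aTX (Var vOff \<oplus> Idx a (Var vI) \<oplus> Lit d) ;; Write aCNT (Var vX) (Idx aCNT (Var vX) \<oplus> Lit 1)) ;;
  vI ::= Lit 0 ;; vY ::= Lit 0 ;; For vI vK
   (vX ::= Idx aCNT (Var vI) ;; Write aCNT (Var vI) (Var vY) ;; vY ::= Var vY \<oplus> Var vX) ;;
  vI ::= Lit 0 ;; For vI vCnt
   (vX ::= Idx aTX (Var vOff \<oplus> Idx a (Var vI) \<oplus> Lit d) ;; Write b (Idx aCNT (Var vX)) (Idx a (Var vI)) ;;
    Write aCNT (Var vX) (Idx aCNT (Var vX) \<oplus> Lit 1))"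

lemma card_key_Suc:
 "card {j. j < Suc k & key j = (x::nat)} = card {j. j < k & key j = x} + of_bool (key k = x)"
proof -
 have "{j. j < Suc k & key j = x} = (if key k = x then insert k {j. j < k & key j = x} else {j. j < k & key j = x})"
  by (auto simp: less_Suc_eq)
 then show ?thesis by simp
qed

lemma card_key_less_Suc:
 "card {j. j < c & key j < Suc (x::nat)} = card {j. j < (c::nat) & key j < x} + card {j. j < c & key j = x}"
 by (subst card_Un_disjoint[symmetric]) (auto intro: arg_cong[where f = card])

lemma card_key_le: "card {j. j < (c::nat) & Q j} <= c"
 using card_mono[of "{..<c}" "{j. j < c & Q j}"] by auto

context machine
begin

lemma wp_radix:
 fixes s :: state and a b d :: nat
 defines "key \<equiv> %i. ar s aTX (vr s vOff + ar s a i + d)" and "c \<equiv> vr s vCnt" and "K \<equiv> vr s vK"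
 assumes ab: "a ~= b" "a ~= aTX" "a ~= aCNT" "b ~= aTX" "b ~= aCNT"
  and bnd: "\<And>i. i < c ==> vr s vOff + ar s a i + d < sz s aTX & key i < K"
  and szs: "c <= sz s a" "c <= sz s b" "K <= sz s aCNT"
  and B: "sz s aTX + d < B" "c + 2 < B" "K + 2 < B"
  and Q: "\<And>s'. frame (radix a b d) s s' ==> (\<And>i. i < c ==> ar s' b (rpos key c i) = ar s a i) ==>
   tm s' <= tm s + 10 * (K + c) + 20 ==> Q s'"
 shows "wp (radix a b d) Q s"
proof -
 have "wp (radix a b d) (%s'. (\<forall>i<c. ar s' b (rpos key c i) = ar s a i) & tm s' <= tm s + 10 * (K + c) + 20) s"
  unfolding radix_def
  apply (simp only: wp_Seq wp_Assign)
  apply (intro conjI)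
  subgoal using B by simp
  apply (rule wp_For[where I = "%k u. \<forall>x<k. ar u aCNT x = 0" and D = 1])
  subgoal by simp subgoal by simp subgoal by simp subgoal by simp subgoal by simp
  subgoal using B by (simp add: K_def)
  subgoal by simp
  subgoal for k s' using szs B by (auto simp: frame_def less_Suc_eq K_def)
  subgoal for s1
  apply (simp only: wp_Seq wp_Assign)
  apply (intro conjI)
  subgoal using B by simp
  apply (rule wp_For[where I = "%k u. \<forall>x<K. ar u aCNT x = card {j. j < k & key j = x}" and D = 2])
  subgoal by simp subgoal by simp subgoal by simp
  subgoal by (simp add: frame_def K_def)
  subgoal by simp
  subgoal using B by (simp add: frame_def c_def)
  subgoal by simp
  subgoal for k s'
   using bnd[of k] szs B ab card_key_le[of k "%j. key j = key k"]
   by (auto simp: frame_def c_def K_def key_def card_key_Suc)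
  subgoal for s2
  apply (simp only: wp_Seq wp_Assign)
  apply (intro conjI)
  subgoal using B by simp
  subgoal using B by simp
  \<comment> \<open>The counting array is converted in place: below k it holds bucket starts, from k
    on still the counts.\<close>
  apply (rule wp_For[where I = "%k u. (\<forall>x<k. ar u aCNT x = card {j. j < c & key j < x}) &
     (\<forall>x<K. k <= x --> ar u aCNT x = card {j. j < c & key j = x}) & vr u vY = card {j. j < c & key j < k}" and D = 3])
  subgoal by simp subgoal by simp subgoal by simp
  subgoal by (simp add: frame_def c_def)
  subgoal by simp
  subgoal using B by (simp add: frame_def K_def)
  subgoal by simp
  subgoal for k s'
   using szs B ab card_key_le[of c "%j. key j < Suc k"] card_key_less_Suc[of c key k]
   by (auto simp: frame_def c_def K_def less_Suc_eq)
  subgoal for s3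
  apply (simp only: wp_Seq wp_Assign)
  apply (intro conjI)
  subgoal using B by simp
  apply (rule wp_For[where I = "%k u. (\<forall>x<K. ar u aCNT x = card {j. j < c & key j < x} + card {j. j < k & key j = x}) &
     (\<forall>i<k. ar u b (rpos key c i) = ar s a i)" and D = 3])
  subgoal by simp subgoal by simp subgoal by simp
  subgoal by (simp add: frame_def K_def)
  subgoal by simp
  subgoal using B by (simp add: frame_def c_def)
  subgoal by simp
  subgoal premises prems for k s'
  proof -
   have k: "k < c" using prems by (simp add: frame_def c_def)
   have pos: "rpos key c k = card {j. j < c & key j < key k} + card {j. j < k & key j = key k}"
    using k unfolding rpos_split by (auto intro!: arg_cong[where f = card])
   have ne: "rpos key c i ~= rpos key c k" if "i < k" for i
    using rpos_inj[of key c] that k by (auto simp: inj_on_def)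
   have f: "vr s' vOff = vr s vOff" "ar s' a = ar s a" "ar s' aTX = ar s aTX" "sz s' = sz s" "vr s' vI = k"
    using prems ab by (auto simp: frame_def)
   have cnt: "\<forall>x<K. ar s' aCNT x = card {j. j < c & key j < x} + card {j. j < k & key j = x}"
    and out: "\<forall>i<k. ar s' b (rpos key c i) = ar s a i" using prems by auto
   have key: "ar s aTX (vr s vOff + ar s a k + d) = key k" by (simp add: key_def)
   have cp: "ar s' aCNT (key k) = rpos key c k" using cnt bnd[OF k] pos by simp
   show ?thesis
    using f k bnd[OF k] szs B ab rpos_less[OF k, of key] ne cnt out
    by (simp add: key cp card_key_Suc pos[symmetric]) (auto simp: less_Suc_eq)
  qed
  subgoal for s4 by (auto simp: frame_def c_def K_def)
  done done done done
 then show ?thesis by (rule wp_conseq) (use Q in auto)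
qed

end

section \<open>Suffix order and the difference cover reduction\<close>

fun lless :: "nat list => nat list => bool" where
 "lless xs [] = False"
| "lless [] (y # ys) = True"
| "lless (x # xs) (y # ys) = (x < y \<or> x = y & lless xs ys)"

lemma lless_irrefl [simp]: "\<not> lless xs xs"
 by (induction xs) auto

lemma lless_trans: "lless xs ys ==> lless ys zs ==> lless xs zs"
proof (induction xs ys arbitrary: zs rule: lless.induct)
 case (2 y ys)
 then show ?case by (cases zs) auto
next
 case (3 x xs y ys)
 then show ?case by (cases zs) auto
qed simp

lemma lless_total: "xs ~= ys ==> lless xs ys \<or> lless ys xs"
proof (induction xs ys rule: lless.induct)
 case (1 xs)
 then show ?case by (cases xs) auto
qed auto

definition sl :: "nat list => nat => nat => bool" where
 "sl R x y = lless (drop x R) (drop y R)"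

text \<open>Reading beyond the end yields 0. With \<open>posl\<close> this padding is smaller than
  every character, so suffixes of different lengths can be compared without treating their ends
  separately.\<close>

definition zc :: "nat list => nat => nat" where
 "zc R x = (if x < length R then R ! x else 0)"

definition posl :: "nat list => bool" where
 "posl R \<longleftrightarrow> (\<forall>x<length R. 0 < R ! x)"

lemma zc_zero: "posl R ==> zc R x = 0 \<longleftrightarrow> length R <= x"
 by (auto simp: posl_def zc_def)

lemma sl_irrefl [simp]: "\<not> sl R x x"
 by (simp add: sl_def)

lemma sl_trans: "sl R x y ==> sl R y z ==> sl R x z"
 unfolding sl_def by (rule lless_trans)

lemma sl_asym: "sl R x y ==> \<not> sl R y x"
 using sl_trans[of R x y x] by auto

lemma sl_total: "x < length R ==> x ~= y ==> sl R x y \<or> sl R y x"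
proof -
 assume "x < length R" "x ~= y"
 then have "length (drop x R) ~= length (drop y R)" by auto
 then have "drop x R ~= drop y R" by metis
 then show ?thesis unfolding sl_def by (rule lless_total)
qed

lemma lless_Nil: "lless [] ys \<longleftrightarrow> ys ~= []"
 by (cases ys) auto

lemma sl_end: "length R <= x ==> sl R x y \<longleftrightarrow> y < length R" "length R <= y ==> \<not> sl R x y"
 by (auto simp: sl_def lless_Nil)

lemma sl_unfold:
 assumes "posl R"
 shows "sl R x y \<longleftrightarrow> zc R x < zc R y \<or> zc R x = zc R y & sl R (Suc x) (Suc y)"
proof -
 have d: "drop x R = R ! x # drop (Suc x) R" if "x < length R" for x using that by (simp add: Cons_nth_drop_Suc)
 consider "x < length R" "y < length R" | "x \<ge> length R" | "y \<ge> length R" "x < length R" by linarith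
 then show ?thesis
 proof cases
  case 1 then show ?thesis unfolding sl_def by (simp add: d zc_def)
 next
  case 2 then show ?thesis using assms sl_end(1)[of R x y] sl_end(1)[of R "Suc x" "Suc y"] by (auto simp: zc_def posl_def)
 next
  case 3 then show ?thesis using assms sl_end(2)[of R y] sl_end(2)[of R "Suc y"] by (auto simp: zc_def posl_def)
 qed
qed

section \<open>Triples, sample positions and the reduced string\<close>

definition t3l :: "nat list => nat => nat => bool" where
 "t3l R x y \<longleftrightarrow> zc R x < zc R y \<or> zc R x = zc R y & (zc R (x + 1) < zc R (y + 1) \<or>
   zc R (x + 1) = zc R (y + 1) & zc R (x + 2) < zc R (y + 2))"

definition t3e :: "nat list => nat => nat => bool" where
 "t3e R x y \<longleftrightarrow> zc R x = zc R y & zc R (x + 1) = zc R (y + 1) & zc R (x + 2) = zc R (y + 2)"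

lemma t3_total: "t3e R x y \<longleftrightarrow> \<not> t3l R x y & \<not> t3l R y x"
 by (auto simp: t3l_def t3e_def)

lemma sl_unfold3:
 assumes "posl R"
 shows "sl R x y \<longleftrightarrow> t3l R x y \<or> t3e R x y & sl R (x + 3) (y + 3)"
 using sl_unfold[OF assms, of x y] sl_unfold[OF assms, of "Suc x" "Suc y"]
  sl_unfold[OF assms, of "Suc (Suc x)" "Suc (Suc y)"]
 by (auto simp: t3l_def t3e_def eval_nat_numeral)

text \<open>\<open>n0 n\<close> counts the positions below n divisible by 3, and equally the sample
  positions congruent to 1, since these include n itself if n mod 3 = 1. The summand
  \<open>n div 3\<close> of \<open>n02\<close> counts the positions congruent to 2.\<close>

definition n0 :: "nat => nat" where "n0 n = (n + 2) div 3"
definition n02 :: "nat => nat" where "n02 n = n0 n + n div 3"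

text \<open>
 Position \<open>n\<close> belongs to the sample if \<open>n mod 3 = 1\<close>; then the last triple of the positions
 congruent to 1 always contains the end of the string, which separates the two halves of the
 reduced string.
\<close>

definition sample :: "nat => nat set" where
 "sample n = {x. x mod 3 ~= 0 & (x < n \<or> x = n & n mod 3 = 1)}"

text \<open>The triples at positions congruent to 1 come first, then those congruent to 2; three
  steps in the string become one step in the reduced string.\<close>

definition idx :: "nat => nat => nat" where
 "idx n x = (if x mod 3 = 1 then x div 3 else n0 n + x div 3)"

definition unidx :: "nat => nat => nat" where
 "unidx n k = (if k < n0 n then 3 * k + 1 else 3 * (k - n0 n) + 2)"

lemma mod3_cases:
 obtains a where "n = 3 * a" "n0 n = a" "n div 3 = a" "n mod 3 = 0"
 | a where "n = 3 * a + 1" "n0 n = a + 1" "n div 3 = a" "n mod 3 = 1"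
 | a where "n = 3 * a + 2" "n0 n = a + 1" "n div 3 = a" "n mod 3 = 2"
proof -
 have e: "n = 3 * (n div 3) + n mod 3" by simp
 consider "n mod 3 = 0" | "n mod 3 = 1" | "n mod 3 = 2" by linarith
 then show ?thesis
 proof cases
  case 1
  then have "n0 n = n div 3" unfolding n0_def by presburger
  then show ?thesis using that(1)[of "n div 3"] 1 e by simp
 next
  case 2
  then have "n0 n = n div 3 + 1" unfolding n0_def by presburger
  then show ?thesis using that(2)[of "n div 3"] 2 e by simp
 next
  case 3
  then have "n0 n = n div 3 + 1" unfolding n0_def by presburger
  then show ?thesis using that(3)[of "n div 3"] 3 e by simp
 qed
qed

lemma mod3_simps: "Suc (3 * m) mod 3 = 1" "Suc (Suc (3 * m)) mod 3 = 2" "Suc (Suc (3 * m)) div 3 = m"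
 by presburger+

lemma idx_less: "x \<in> sample n ==> idx n x < n02 n"
 unfolding sample_def idx_def n02_def by (cases n rule: mod3_cases; cases x rule: mod3_cases) auto

lemma unidx_sample: "k < n02 n ==> unidx n k \<in> sample n"
 unfolding sample_def unidx_def n02_def
 by (cases n rule: mod3_cases; auto simp: mod_Suc split: if_splits)

lemma idx_unidx: "k < n02 n ==> idx n (unidx n k) = k"
 unfolding idx_def unidx_def by (cases "k < n0 n") (auto simp: mod3_simps)

lemma unidx_idx: "x \<in> sample n ==> unidx n (idx n x) = x"
 unfolding sample_def unidx_def idx_def by (cases n rule: mod3_cases; cases x rule: mod3_cases) auto

lemma unidx_bij: "bij_betw (unidx n) {..<n02 n} (sample n)"
 by (rule bij_betw_byWitness[where f' = "idx n"]) (auto simp: idx_less unidx_sample idx_unidx unidx_idx)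

lemma idx_inj: "x \<in> sample n ==> y \<in> sample n ==> idx n x = idx n y \<longleftrightarrow> x = y"
 by (metis unidx_idx)

text \<open>The sample can be left only by arriving at the end n with n mod 3 = 2, and then the
  reduced string ends as well.\<close>

lemma idx_add3:
 assumes "x mod 3 ~= 0" "x + 3 <= n"
 shows "(x + 3 \<in> sample n & idx n (x + 3) = Suc (idx n x)) \<or> (x + 3 = n & Suc (idx n x) = n02 n)"
 using assms unfolding sample_def idx_def n02_def by (cases n rule: mod3_cases; cases x rule: mod3_cases; auto; presburger)

definition reduced :: "nat list => nat list => bool" where
 "reduced R R' \<longleftrightarrow> length R' = n02 (length R) & posl R' &
   (\<forall>x\<in>sample (length R). \<forall>y\<in>sample (length R).
    R' ! idx (length R) x < R' ! idx (length R) y \<longleftrightarrow> t3l R x y)"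

text \<open>Both comparisons proceed triple by triple, and a character of the reduced string orders
  like a triple. If the comparison runs from the first half of the reduced string into the second,
  the triple just passed contains padding, and equal triples with padding belong to the same
  position.\<close>

lemma reduced_sl:
 assumes pos: "posl R" and red: "reduced R R'"
 shows "x \<in> sample (length R) ==> y \<in> sample (length R) ==>
  sl R' (idx (length R) x) (idx (length R) y) \<longleftrightarrow> sl R x y"
proof (induction "2 * length R + 2 - x - y" arbitrary: x y rule: less_induct)
 case less
 let ?n = "length R" and ?i = "idx (length R)"
 have pos': "posl R'" and len: "length R' = n02 ?n" using red by (auto simp: reduced_def)
 have il: "?i x < length R'" "?i y < length R'" using less.prems idx_less len by auto
 have nx: "x mod 3 ~= 0" "y mod 3 ~= 0" "x <= ?n" "y <= ?n" using less.prems by (auto simp: sample_def)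
 have lt: "zc R' (?i x) < zc R' (?i y) \<longleftrightarrow> t3l R x y" "zc R' (?i y) < zc R' (?i x) \<longleftrightarrow> t3l R y x"
  using il red less.prems by (auto simp: zc_def reduced_def)
 then have eq: "zc R' (?i x) = zc R' (?i y) \<longleftrightarrow> t3e R x y" using t3_total by (metis less_irrefl linorder_neqE_nat)
 have "sl R' (Suc (?i x)) (Suc (?i y)) \<longleftrightarrow> sl R (x + 3) (y + 3)" if e: "t3e R x y"
 proof (cases "x + 2 < ?n")
  case True
  then have "y + 2 < ?n" using e zc_zero[OF pos, of "x + 2"] zc_zero[OF pos, of "y + 2"] by (auto simp: t3e_def)
  then have le: "x + 3 <= ?n" "y + 3 <= ?n" using True by auto
  consider "x + 3 \<in> sample ?n" "?i (x + 3) = Suc (?i x)" "y + 3 \<in> sample ?n" "?i (y + 3) = Suc (?i y)"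
   | "x + 3 = ?n" "Suc (?i x) = n02 ?n" | "y + 3 = ?n" "Suc (?i y) = n02 ?n"
   using idx_add3[OF nx(1) le(1)] idx_add3[OF nx(2) le(2)] by blast
  then show ?thesis
  proof cases
   case 1
   have "2 * ?n + 2 - (x + 3) - (y + 3) < 2 * ?n + 2 - x - y" using nx by linarith
   from less.hyps[OF this 1(1,3)] show ?thesis using 1 by simp
  next
   case 2
   have "y + 3 < ?n \<longleftrightarrow> Suc (?i y) < n02 ?n"
   proof (cases "y + 3 = ?n")
    case True
    then have "y = x" using 2 by simp
    then show ?thesis using 2 by simp
   next
    case False
    then have "y + 3 \<in> sample ?n" "?i (y + 3) = Suc (?i y)" using idx_add3[OF nx(2) le(2)] by auto
    then show ?thesis using idx_less[of "y + 3" ?n] False le by simp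
   qed
   then show ?thesis using 2 len sl_end(1)[of R' "Suc (?i x)"] sl_end(1)[of R "x + 3"] by simp
  next
   case 3
   then show ?thesis using len sl_end(2)[of R' "Suc (?i y)"] sl_end(2)[of R "y + 3"] by simp
  qed
 next
  case False
  have "y + 2 \<ge> ?n" using False e zc_zero[OF pos, of "x + 2"] zc_zero[OF pos, of "y + 2"] by (auto simp: t3e_def)
  moreover have "?n <= x \<longleftrightarrow> ?n <= y" "?n <= x + 1 \<longleftrightarrow> ?n <= y + 1"
   using e zc_zero[OF pos, of x] zc_zero[OF pos, of y] zc_zero[OF pos, of "x + 1"] zc_zero[OF pos, of "y + 1"]
   by (auto simp: t3e_def)
  ultimately have "x = y" using False nx by linarith
  then show ?thesis by simp
 qed
 then show ?case using sl_unfold[OF pos', of "?i x" "?i y"] sl_unfold3[OF pos, of x y] lt eq by blast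
qed

section \<open>Suffix arrays, stable passes and comparison by sample ranks\<close>

definition isSA :: "nat list => (nat => nat) => bool" where
 "isSA R f \<longleftrightarrow> bij_betw f {..<length R} {..<length R} &
   (\<forall>i j. i < j --> j < length R --> sl R (f i) (f j))"

text \<open>\<open>P\<close> stands for the order already present in the input, which a stable pass
  by \<open>K\<close> keeps among equal keys. Iterated from the last character to the first, this is
  radix sort.\<close>

lemma stable_sorted:
 assumes xs: "\<And>i j. i < j ==> j < c ==> P (xs i) (xs j)"
  and ys: "\<And>i. i < c ==> ys (rpos (%i. K (xs i)) c i) = xs i"
  and ij: "i < j" "j < c"
 shows "K (ys i) < K (ys j) \<or> K (ys i) = K (ys j) & P (ys i) (ys j)"
proof -
 let ?p = "rpos (%i. K (xs i)) c"
 have "i \<in> ?p ` {..<c}" "j \<in> ?p ` {..<c}" using rpos_bij[of "%i. K (xs i)" c] ij by (auto simp: bij_betw_def)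
 then obtain a b where ab: "a < c" "b < c" "i = ?p a" "j = ?p b" by auto
 have "K (xs a) < K (xs b) \<or> K (xs a) = K (xs b) & a < b" using rpos_mono[OF ab(1,2), of "%i. K (xs i)"] ij ab by simp
 then show ?thesis using xs[of a b] ys ab by auto
qed

lemma stable_bij:
 assumes xs: "bij_betw xs {..<c} S" and ys: "\<And>i. i < c ==> ys (rpos k c i) = xs i"
 shows "bij_betw ys {..<c} S"
proof -
 have "bij_betw (ys \<circ> rpos k c) {..<c} S" using xs by (rule bij_betw_cong[THEN iffD1, rotated]) (simp add: ys)
 then show ?thesis using rpos_bij[of k c] by (metis bij_betw_comp_iff)
qed

text \<open>Suffixes at positions not divisible by 3 are compared by their ranks in the sorted sample.\<close>

definition rank_ok :: "nat list => (nat => nat) => bool" where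
 "rank_ok R k \<longleftrightarrow> (\<forall>x\<in>sample (length R). \<forall>y\<in>sample (length R). k x < k y \<longleftrightarrow> sl R x y) &
   (\<forall>x\<in>sample (length R). 0 < k x) & (\<forall>x \<ge> length R. x \<notin> sample (length R) --> x < length R + 3 --> k x = 0)"

text \<open>Merging looks ahead by one or two positions and may leave the string; rank 0 makes such
  positions smallest. One position has to be inside: of two positions beyond the end, one can be the
  sample position n with positive rank, although both suffixes are empty.\<close>

lemma rank_ok_less:
 assumes pos: "posl R" and k: "rank_ok R k" and x: "x mod 3 ~= 0" "x <= length R + 2" and y: "y mod 3 ~= 0" "y <= length R + 2"
  and one: "x < length R \<or> y < length R"
 shows "k x < k y \<longleftrightarrow> sl R x y"
proof -
 let ?n = "length R"
 have s: "x < ?n ==> x \<in> sample ?n" if "x mod 3 ~= 0" for x using that by (simp add: sample_def)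
 show ?thesis
 proof (cases "x \<in> sample ?n & y \<in> sample ?n")
  case True
  then show ?thesis using k by (simp add: rank_ok_def)
 next
  case False
  consider "x \<notin> sample ?n" "y < ?n" "?n <= x" "y \<in> sample ?n" | "y \<notin> sample ?n" "?n <= y"
   using False one s x y by (metis not_le)
  then show ?thesis
  proof cases
   case 1
   then have "k x = 0" "0 < k y" using k x by (auto simp: rank_ok_def)
   then show ?thesis using 1 sl_end(1)[of R x y] by simp
  next
   case 2
   then have "k y = 0" using k y by (auto simp: rank_ok_def)
   then show ?thesis using 2 sl_end(2)[of R y x] by simp
  qed
 qed
qed

text \<open>One character further, positions congruent to 1 and 0 become congruent to 2 and 1, which
  both have ranks.\<close>

lemma merge_less1:
 assumes "posl R" "rank_ok R k" "x mod 3 = 1" "y mod 3 = 0" "x < length R" "y < length R"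
 shows "sl R x y \<longleftrightarrow> (if zc R x = zc R y then k (x + 1) < k (y + 1) else zc R x < zc R y)"
proof -
 have "k (x + 1) < k (y + 1) \<longleftrightarrow> sl R (x + 1) (y + 1)"
  by (rule rank_ok_less[OF assms(1,2)]) (use assms in presburger)+
 then show ?thesis using sl_unfold[OF assms(1), of x y] by auto
qed

text \<open>Positions congruent to 2 and 0 become congruent to 0 and 1 after one character, so a
  second character is needed to reach 1 and 2.\<close>

lemma merge_less2:
 assumes "posl R" "rank_ok R k" "x mod 3 = 2" "y mod 3 = 0" "x < length R" "y < length R"
 shows "sl R x y \<longleftrightarrow> (if zc R x = zc R y then if zc R (x + 1) = zc R (y + 1) then k (x + 2) < k (y + 2)
  else zc R (x + 1) < zc R (y + 1) else zc R x < zc R y)"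
proof -
 have "k (x + 2) < k (y + 2) \<longleftrightarrow> sl R (x + 2) (y + 2)" if "zc R (x + 1) = zc R (y + 1)"
 proof (cases "x + 2 < length R \<or> y + 2 < length R")
  case True
  have "(x + 2) mod 3 ~= 0" "(y + 2) mod 3 ~= 0" using assms(3,4) by presburger+
  then show ?thesis using assms(5,6) True by (intro rank_ok_less[OF assms(1,2)]) auto
 next
  case False
  have "x + 1 < length R \<longleftrightarrow> y + 1 < length R"
   using that zc_zero[OF assms(1), of "x + 1"] zc_zero[OF assms(1), of "y + 1"] by linarith
  then have "x = y" using False assms by linarith
  then show ?thesis by simp
 qed
 then show ?thesis using sl_unfold[OF assms(1), of x y] sl_unfold[OF assms(1), of "x + 1" "y + 1"] by auto
qed

section \<open>Sorting the triples of the sample\<close>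

abbreviation (input) "aA1 \<equiv> 16::nat"
abbreviation (input) "aA2 \<equiv> 17::nat"
abbreviation (input) "aA3 \<equiv> 18::nat"
abbreviation (input) "aA4 \<equiv> 19::nat"
abbreviation (input) "aRK \<equiv> 21::nat"
abbreviation (input) "aLO \<equiv> 22::nat"
abbreviation (input) "aLN \<equiv> 23::nat"
abbreviation (input) "vN0 \<equiv> 48::nat"
abbreviation (input) "vN02 \<equiv> 49::nat"
abbreviation (input) "vNm \<equiv> 50::nat"
abbreviation (input) "vLev \<equiv> 51::nat"
abbreviation (input) "vP \<equiv> 52::nat"
abbreviation (input) "vQ \<equiv> 53::nat"
abbreviation (input) "vT \<equiv> 54::nat"
abbreviation (input) "vGo \<equiv> 55::nat"
abbreviation (input) "vM \<equiv> 56::nat"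

lemma radix_mods [simp]: "wv (radix a b d) = {vI, vX, vY}" "wa (radix a b d) = {aCNT, b}" "al (radix a b d) = {}"
 by (auto simp: radix_def)

text \<open>The three cells behind the string are zero, as padding for triples that begin near its
  end. All levels of the recursion lie one behind the other in \<open>aTX\<close>, the current one
  at \<open>vOff\<close>.\<close>

definition holds :: "state => nat => nat list => bool" where
 "holds u off R \<longleftrightarrow> (\<forall>k < length R + 3. ar u aTX (off + k) = zc R k)"

text \<open>The last character of the triples is sorted first. The alphabet size
  \<open>M + n + 1\<close> serves every level: original characters are at most M, names at most the
  length of their level.\<close>

definition sort3 :: com where
 "sort3 =
  vN0 ::= (Var vLen \<oplus> Lit 2) \<oslash> Lit 3 ;; vN02 ::= Var vN0 \<oplus> Var vLen \<oslash> Lit 3 ;;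
  vK ::= Var vM \<oplus> Var vLen \<oplus> Lit 1 ;; vCnt ::= Var vN02 ;;
  vI ::= Lit 0 ;; For vI vN02
   (Cond (Var vI \<lhd> Var vN0) (Write aA1 (Var vI) (Lit 3 \<otimes> Var vI \<oplus> Lit 1))
     (Write aA1 (Var vI) (Lit 3 \<otimes> (Var vI \<ominus> Var vN0) \<oplus> Lit 2))) ;;
  radix aA1 aA2 2 ;; radix aA2 aA1 (Suc 0) ;; radix aA1 aA2 0"

lemma n0_le: "0 < n ==> n0 n <= n" and n02_le: "n02 n <= n + 1" and n02_pos: "0 < n ==> 0 < n0 n"
 and n0_le_n02: "n0 n <= n02 n"
 by (cases n rule: mod3_cases; simp add: n02_def)+

text \<open>The true factor is close to 2/3; 8/9 leaves room for rounding at small lengths. The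
  geometric series with this ratio sums to 9, the factor in the time bounds of the loops over the
  levels.\<close>

lemma n02_shrink: "2 <= n02 n ==> 3 <= n & 9 * n02 n <= 8 * n"
 by (cases n rule: mod3_cases) (auto simp: n02_def)

lemma sample_le: "x \<in> sample n ==> x <= n"
 by (auto simp: sample_def)

lemma zc_bound: "(\<And>x. x < length R ==> R ! x < K) ==> 0 < K ==> zc R x < K"
 by (auto simp: zc_def)

context machine
begin

lemma wp_sort3:
 fixes s :: state and R :: "nat list"
 defines "n \<equiv> length R" and "M \<equiv> vr s vM" and "off \<equiv> vr s vOff"
 assumes h: "holds s off R" and len: "vr s vLen = n" "0 < n"
  and ch: "\<And>x. x < n ==> R ! x <= M + n"
  and szs: "n + 3 <= sz s aA1" "n + 3 <= sz s aA2" "M + n + 1 <= sz s aCNT" "off + n + 3 <= sz s aTX"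
  and B: "sz s aTX + 10 < B" "M + 3 * n + 10 < B"
  and Q: "\<And>s'. frame sort3 s s' ==> bij_betw (ar s' aA2) {..<n02 n} (sample n) ==>
    (\<And>i j. i < j ==> j < n02 n ==> \<not> t3l R (ar s' aA2 j) (ar s' aA2 i)) ==>
    vr s' vN0 = n0 n ==> vr s' vN02 = n02 n ==>
    tm s' <= tm s + 160 * (M + n + 1) ==> Q s'"
 shows "wp sort3 Q s"
proof -
 define F where "F u \<longleftrightarrow> vr u vOff = off & ar u aTX = ar s aTX & vr u vCnt = n02 n & vr u vK = M + n + 1 &
  vr u vN0 = n0 n & vr u vN02 = n02 n & sz u = sz s" for u :: state
 have hz: "ar s aTX (off + x + d) = zc R (x + d)" if "x \<in> sample n" "d <= 2" for x d
  using h that sample_le[OF that(1)] unfolding holds_def n_def by (simp add: add.assoc)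
 have key: "off + x + d < sz s aTX & ar s aTX (off + x + d) < M + n + 1" if "x \<in> sample n" "d <= 2" for x d
  using hz[OF that] zc_bound[of R "M + n + 1" "x + d"] ch sample_le[OF that(1)] that(2) szs(4) unfolding n_def
  by (auto simp: less_Suc_eq_le)
 have K2: "n02 n + 2 < B" "M + n + 1 + 2 < B" using B n02_le[of n] by auto
 \<comment> \<open>One statement for all three passes: \<open>P\<close> is the order established by
   the preceding ones, at first the trivial one.\<close>
 have rad: "wp (radix a b d) (%u. F u & bij_betw (ar u b) {..<n02 n} (sample n) &
   (\<forall>i j. i < j --> j < n02 n --> zc R (ar u b i + d) < zc R (ar u b j + d) \<or>
     zc R (ar u b i + d) = zc R (ar u b j + d) & P (ar u b i) (ar u b j)) &
   tm u <= tm u0 + 20 * (M + n + 1) + 20) u0"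
  if F: "F u0" and bij: "bij_betw (ar u0 a) {..<n02 n} (sample n)"
   and P: "\<forall>i j. i < j --> j < n02 n --> P (ar u0 a i) (ar u0 a j)"
   and ab: "a \<in> {aA1, aA2}" "b \<in> {aA1, aA2}" "a ~= b" "d <= 2" for u0 a b d P
 proof (rule wp_radix)
  have ina: "ar u0 a i \<in> sample n" if "i < n02 n" for i using bij that by (auto simp: bij_betw_def)
  show "a ~= b" "a ~= aTX" "a ~= aCNT" "b ~= aTX" "b ~= aCNT" using ab by auto
  show "vr u0 vOff + ar u0 a i + d < sz u0 aTX & ar u0 aTX (vr u0 vOff + ar u0 a i + d) < vr u0 vK" if "i < vr u0 vCnt" for i
   using F that key[OF ina ab(4)] by (auto simp: F_def)
  show "vr u0 vCnt <= sz u0 a" "vr u0 vCnt <= sz u0 b" "vr u0 vK <= sz u0 aCNT"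
   using F ab szs n02_le[of n] by (auto simp: F_def)
  show "sz u0 aTX + d < B" "vr u0 vCnt + 2 < B" "vr u0 vK + 2 < B" using F B K2 ab by (auto simp: F_def)
 next
  fix u
  assume f: "frame (radix a b d) u0 u"
   and out: "\<And>i. i < vr u0 vCnt ==> ar u b (rpos (%i. ar u0 aTX (vr u0 vOff + ar u0 a i + d)) (vr u0 vCnt) i) = ar u0 a i"
   and t: "tm u <= tm u0 + 10 * (vr u0 vK + vr u0 vCnt) + 20"
  have Fu: "F u" using F ab by (auto simp: F_def frame_simps[OF f])
  have out': "ar u b (rpos (%i. ar s aTX (off + ar u0 a i + d)) (n02 n) i) = ar u0 a i" if "i < n02 n" for i
   using out[of i] that F by (simp add: F_def)
  have bj: "bij_betw (ar u b) {..<n02 n} (sample n)" by (rule stable_bij[OF bij out'])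
  have inb: "ar u b i \<in> sample n" if "i < n02 n" for i using bj that by (auto simp: bij_betw_def)
  have "zc R (ar u b i + d) < zc R (ar u b j + d) \<or>
     zc R (ar u b i + d) = zc R (ar u b j + d) & P (ar u b i) (ar u b j)" if "i < j" "j < n02 n" for i j
   using stable_sorted[of "n02 n" P "ar u0 a" "ar u b" "%x. ar s aTX (off + x + d)", OF _ out' that] P
    hz[OF inb ab(4), of i] hz[OF inb ab(4), of j] that by auto
  then show "F u & bij_betw (ar u b) {..<n02 n} (sample n) &
   (\<forall>i j. i < j --> j < n02 n --> zc R (ar u b i + d) < zc R (ar u b j + d) \<or>
     zc R (ar u b i + d) = zc R (ar u b j + d) & P (ar u b i) (ar u b j)) &
   tm u <= tm u0 + 20 * (M + n + 1) + 20" using Fu bj t F n02_le[of n] by (auto simp: F_def)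
 qed
 have "wp sort3 (%s'. bij_betw (ar s' aA2) {..<n02 n} (sample n) &
    (\<forall>i j. i < j --> j < n02 n --> \<not> t3l R (ar s' aA2 j) (ar s' aA2 i)) &
    vr s' vN0 = n0 n & vr s' vN02 = n02 n & tm s' <= tm s + 80 * (M + n + 1) + 80) s"
  unfolding sort3_def
  using B len n02_le[of n]
  apply (simp add: n02_def[of n, symmetric] n0_def[of n, unfolded add_2_eq_Suc', symmetric] M_def[symmetric])
  apply (rule wp_For[where I = "%k u. \<forall>i<k. ar u aA1 i = unidx n i" and D = 2])
  subgoal by simp subgoal by simp subgoal by simp subgoal by simp subgoal by simp
  subgoal using K2 by simp
  subgoal by simp
  subgoal premises p for k s'
  proof -
   have k: "k < n02 n" using p by simp
   have "vr s' vN0 = n0 n" "vr s' vI = k" "sz s' = sz s"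
    using p by (simp_all add: frame_simps[OF p(9)])
   moreover have "3 * (k - n0 n) <= 3 * n" using k n02_le[of n] by simp
   ultimately show ?thesis using p(10) k n02_le[of n] szs B
    by (cases "k < n0 n") (simp_all add: unidx_def less_Suc_eq)
  qed
  subgoal premises p for u1
  proof -
   have F1: "F u1" using len by (simp add: frame_simps[OF p(8)] F_def off_def)
   have A1: "ar u1 aA1 i = unidx n i" if "i < n02 n" for i using p(6) that by simp
   have bij1: "bij_betw (ar u1 aA1) {..<n02 n} (sample n)"
    using unidx_bij[of n] A1 by (metis (mono_tags, lifting) bij_betw_cong lessThan_iff)
   have t1: "tm u1 <= tm s + 4 * n + 16" using p(9) n02_le[of n] by simp
   show ?thesis
   proof (simp only: wp_Seq, rule wp_conseq[OF rad[OF F1 bij1, where P = "%_ _. True"]], goal_cases)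
    case (6 u2)
    show ?case
    proof (simp only: wp_Seq, rule wp_conseq[OF rad[of u2 aA2, where P = "%x y. zc R (x + 2) <= zc R (y + 2)"]], goal_cases)
     case (8 u3)
     show ?case
     proof (rule wp_conseq[OF rad[of u3 aA1, where P = "%x y. zc R (x + 1) < zc R (y + 1) \<or>
        zc R (x + 1) = zc R (y + 1) & zc R (x + 2) <= zc R (y + 2)"]], goal_cases)
      case (8 u4)
      have "\<not> t3l R (ar u4 aA2 j) (ar u4 aA2 i)" if ij: "i < j" "j < n02 n" for i j
      proof -
       have "zc R (ar u4 aA2 i + 0) < zc R (ar u4 aA2 j + 0) \<or> zc R (ar u4 aA2 i + 0) = zc R (ar u4 aA2 j + 0) &
        (zc R (ar u4 aA2 i + 1) < zc R (ar u4 aA2 j + 1) \<or>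
         zc R (ar u4 aA2 i + 1) = zc R (ar u4 aA2 j + 1) & zc R (ar u4 aA2 i + 2) <= zc R (ar u4 aA2 j + 2))"
        using 8(2) ij by blast
       then show ?thesis unfolding t3l_def by auto
      qed
      moreover have "tm u4 <= tm s + 80 * (M + n + 1) + 80" using t1 6(2) 8(2) \<open>F u3 & _\<close> by simp
      ultimately show ?case using 8(2) by (simp add: F_def)
     qed (use 8 in auto)
    qed (use 6 in \<open>auto simp: order.order_iff_strict\<close>)
   qed auto
  qed
  done
 then show ?thesis by (rule wp_conseq) (use Q n_def in \<open>auto\<close>)
qed

end

section \<open>Names of triples\<close>

primrec nmf :: "nat list => (nat => nat) => nat => nat" where
 "nmf R f 0 = 1"
| "nmf R f (Suc i) = nmf R f i + (if t3e R (f (Suc i)) (f i) then 0 else 1)"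

lemma nmf_bounds: "1 <= nmf R f i" "nmf R f i <= Suc i"
 by (induction i) auto

lemma nmf_mono: "i <= j ==> nmf R f i <= nmf R f j"
 by (rule lift_Suc_mono_le) auto

lemma nmf_diff: "i <= j ==> nmf R f j <= nmf R f i + (j - i)"
proof (induction j)
 case (Suc j)
 then show ?case by (cases "i = Suc j") auto
qed simp

text \<open>In a sorted list equal triples are adjacent, so counting the changes ranks the distinct
  triples.\<close>

lemma nmf_less:
 assumes srt: "\<And>i j. i < j ==> j < c ==> \<not> t3l R (f j) (f i)" and ij: "i < c" "j < c"
 shows "nmf R f i < nmf R f j \<longleftrightarrow> t3l R (f i) (f j)"
proof -
 have e: "nmf R f i = nmf R f j \<longleftrightarrow> t3e R (f i) (f j)" if "i <= j" "j < c" for i j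
  using that
 proof (induction j)
  case 0
  then show ?case by (simp add: t3e_def)
 next
  case (Suc j)
  show ?case
  proof (cases "i = Suc j")
   case True
   then show ?thesis by (simp add: t3e_def)
  next
   case False
   then have ij: "i <= j" using Suc by simp
   have IH: "nmf R f i = nmf R f j \<longleftrightarrow> t3e R (f i) (f j)" using Suc ij by simp
   have m: "nmf R f i <= nmf R f j" using nmf_mono[OF ij] .
   have "t3e R (f i) (f (Suc j)) ==> t3e R (f i) (f j)"
   proof (cases "i = j")
    case True
    then show ?thesis by (simp add: t3e_def)
   next
    case False
    assume "t3e R (f i) (f (Suc j))"
    moreover have "\<not> t3l R (f j) (f i)" "\<not> t3l R (f (Suc j)) (f j)" using srt Suc ij False by auto
    ultimately show ?thesis by (auto simp: t3e_def t3l_def)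
   qed
   moreover have "t3e R (f i) (f j) ==> t3e R (f (Suc j)) (f j) \<longleftrightarrow> t3e R (f i) (f (Suc j))"
    by (auto simp: t3e_def)
   ultimately show ?thesis using IH m by auto
  qed
 qed
 show ?thesis
 proof (cases "i <= j")
  case True
  then show ?thesis using e[OF True ij(2)] nmf_mono[OF True, of R f] srt[of i j] ij t3_total[of R "f i" "f j"]
   by (cases "i = j") (auto simp: t3_total)
 next
  case False
  then have "\<not> t3l R (f i) (f j)" using srt[of j i] ij by auto
  then show ?thesis using nmf_mono[of j i R f] False by simp
 qed
qed

text \<open>The third claim is the test that ends the recursion: names grow by at most one per step,
  so if the last one equals the number of triples, it has grown every time and all triples
  differ.\<close>

lemma nmf_reduced:
 assumes bij: "bij_betw f {..<n02 (length R)} (sample (length R))"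
  and srt: "\<And>i j. i < j ==> j < n02 (length R) ==> \<not> t3l R (f j) (f i)"
  and len: "length R' = n02 (length R)" and R': "\<And>i. i < n02 (length R) ==> R' ! idx (length R) (f i) = nmf R f i"
 shows "reduced R R'" and "\<And>j. j < n02 (length R) ==> R' ! j <= nmf R f (n02 (length R) - 1)"
  and "nmf R f (n02 (length R) - 1) = n02 (length R) ==> i < n02 (length R) ==> nmf R f i = Suc i"
proof -
 let ?n = "length R"
 have ex: "\<exists>i<n02 ?n. f i = x" if "x \<in> sample ?n" for x
  using bij that unfolding bij_betw_def by (metis imageE lessThan_iff)
 have exj: "\<exists>i<n02 ?n. j = idx ?n (f i)" if "j < n02 ?n" for j
  using ex[OF unidx_sample[OF that]] idx_unidx[OF that] by metis
 show "reduced R R'" unfolding reduced_def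
 proof (intro conjI ballI)
  show "posl R'" unfolding posl_def len using exj R' nmf_bounds(1) by (metis less_eq_Suc_le One_nat_def)
  fix x y assume "x \<in> sample ?n" "y \<in> sample ?n"
  then obtain i j where "i < n02 ?n" "j < n02 ?n" "f i = x" "f j = y" using ex by metis
  then show "R' ! idx ?n x < R' ! idx ?n y \<longleftrightarrow> t3l R x y" using nmf_less[of "n02 ?n" R f i j, OF srt] R'[of i] R'[of j] by auto
 qed (rule len)
 show "R' ! j <= nmf R f (n02 ?n - 1)" if j: "j < n02 ?n" for j
 proof -
  obtain i where "i < n02 ?n" "j = idx ?n (f i)" using exj[OF j] by blast
  then show ?thesis using R'[of i] nmf_mono[of i "n02 ?n - 1" R f] by simp
 qed
 show "nmf R f i = Suc i" if "nmf R f (n02 ?n - 1) = n02 ?n" "i < n02 ?n"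
 proof -
  have "i <= n02 ?n - 1" using that by linarith
  then show ?thesis using nmf_diff[of i "n02 ?n - 1" R f] that nmf_bounds(2)[of R f i] by linarith
 qed
qed

text \<open>Base of the recursion: if the characters are 1, 2, ... in some order, the first
  character decides every comparison, and the inverse of this permutation lists the suffixes in
  order.\<close>

lemma isSA_unique:
 assumes "\<And>i. i < length R' ==> g (R' ! i - 1) = i" "\<And>i. i < length R' ==> \<exists>j < length R'. R' ! j = Suc i" "posl R'"
 shows "isSA R' g"
proof -
 let ?n = "length R'"
 have g: "g i < ?n & R' ! g i = Suc i" if i: "i < ?n" for i
 proof -
  obtain j where j: "j < ?n" "R' ! j = Suc i" using assms(2)[OF i] by blast
  then have "g i = j" using assms(1)[OF j(1)] by simp
  then show ?thesis using j by simp
 qed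
 have "inj_on g {..<?n}" by (rule inj_onI) (metis g lessThan_iff nat.inject)
 moreover have "g ` {..<?n} \<subseteq> {..<?n}" using g by auto
 ultimately have "bij_betw g {..<?n} {..<?n}" by (simp add: bij_betw_def endo_inj_surj)
 moreover have "sl R' (g i) (g j)" if "i < j" "j < ?n" for i j
  using that g[of i] g[of j] sl_unfold[OF assms(3), of "g i" "g j"] by (simp add: zc_def)
 ultimately show ?thesis by (simp add: isSA_def)
qed

section \<open>Naming, ranking, gathering and merging on one level\<close>

abbreviation "TXr x d \<equiv> Idx aTX (Var vOff \<oplus> Var x \<oplus> Lit d)"

definition name_write :: com where
 "name_write = Cond (Var vX \<odot> Lit 3 \<doteq> Lit 1) (Write aTX (Var vP \<oplus> Var vX \<oslash> Lit 3) (Var vNm))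
   (Write aTX (Var vP \<oplus> Var vN0 \<oplus> Var vX \<oslash> Lit 3) (Var vNm))"

definition naming_body :: com where
 "naming_body =
  vX ::= Idx aA2 (Var vI) ;;
  Cond (Var vI \<doteq> Lit 0) (vNm ::= Lit 1)
   (vY ::= Idx aA2 (Var vI \<ominus> Lit 1) ;;
    Cond (TXr vX 0 \<doteq> TXr vY 0) (Cond (TXr vX 1 \<doteq> TXr vY 1) (Cond (TXr vX 2 \<doteq> TXr vY 2) Skip
     (vNm ::= Var vNm \<oplus> Lit 1)) (vNm ::= Var vNm \<oplus> Lit 1)) (vNm ::= Var vNm \<oplus> Lit 1)) ;;
  name_write"

lemma naming_mods [simp]: "wv naming_body = {vX, vY, vNm}" "wa naming_body = {aTX}" "al naming_body = {}"
 by (auto simp: naming_body_def name_write_def)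

text \<open>Ranks are shifted by one because 0 is reserved for positions beyond the end.\<close>

definition rank_body :: com where
 "rank_body =
  vX ::= Idx aA3 (Var vI) ;;
  Cond (Var vX \<lhd> Var vN0) (vX ::= Lit 3 \<otimes> Var vX \<oplus> Lit 1) (vX ::= Lit 3 \<otimes> (Var vX \<ominus> Var vN0) \<oplus> Lit 2) ;;
  Write aA1 (Var vI) (Var vX) ;; Write aRK (Var vX) (Var vI \<oplus> Lit 1)"

lemma rank_mods [simp]: "wv rank_body = {vX}" "wa rank_body = {aA1, aRK}" "al rank_body = {}"
 by (auto simp: rank_body_def)

text \<open>A suffix at a position divisible by 3 is one character followed by a sample suffix.
  Taking the predecessors of the sorted positions congruent to 1 orders these suffixes by their
  tails; one stable pass by the first character then completes their order.\<close>

definition gather_body :: com where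
 "gather_body = Cond (Idx aA1 (Var vI) \<odot> Lit 3 \<doteq> Lit 1)
   (Write aA2 (Var vCnt) (Idx aA1 (Var vI) \<ominus> Lit 1) ;; vCnt ::= Var vCnt \<oplus> Lit 1) Skip"

lemma gather_mods [simp]: "wv gather_body = {vCnt}" "wa gather_body = {aA2}" "al gather_body = {}"
 by (auto simp: gather_body_def)

definition compare_com :: com where
 "compare_com =
  vX ::= Idx aA1 (Var vP) ;; vY ::= Idx aA3 (Var vQ) ;;
  Cond (TXr vX 0 \<doteq> TXr vY 0)
   (Cond (Var vX \<odot> Lit 3 \<doteq> Lit 1)
    (vT ::= (Idx aRK (Var vX \<oplus> Lit 1) \<lhd> Idx aRK (Var vY \<oplus> Lit 1)))
    (Cond (TXr vX 1 \<doteq> TXr vY 1)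
     (vT ::= (Idx aRK (Var vX \<oplus> Lit 2) \<lhd> Idx aRK (Var vY \<oplus> Lit 2)))
     (vT ::= (TXr vX 1 \<lhd> TXr vY 1))))
   (vT ::= (TXr vX 0 \<lhd> TXr vY 0))"

lemma compare_mods [simp]: "wv compare_com = {vX, vY, vT}" "wa compare_com = {}" "al compare_com = {}"
 by (auto simp: compare_com_def)

definition merge_body :: com where
 "merge_body =
  Cond (Var vP \<doteq> Var vN02) (vT ::= Lit 0)
   (Cond (Var vQ \<doteq> Var vN0) (vT ::= Lit 1) compare_com) ;;
  Cond (Var vT) (Write aA4 (Var vI) (Idx aA1 (Var vP)) ;; vP ::= Var vP \<oplus> Lit 1)
   (Write aA4 (Var vI) (Idx aA3 (Var vQ)) ;; vQ ::= Var vQ \<oplus> Lit 1)"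

lemma merge_mods [simp]: "wv merge_body = {vX, vY, vT, vP, vQ}" "wa merge_body = {aA4}" "al merge_body = {}"
 by (auto simp: merge_body_def)

context machine
begin

lemma wp_naming:
 fixes s :: state and R :: "nat list"
 defines "n \<equiv> length R" and "f \<equiv> ar s aA2" and "off \<equiv> vr s vOff"
 assumes h: "holds s off R"
  and vs: "vr s vI = 0" "vr s vNm = 0" "vr s vP = off + n + 3" "vr s vN0 = n0 n" "vr s vN02 = n02 n"
  and n: "0 < n" and bij: "bij_betw f {..<n02 n} (sample n)"
  and zero: "\<And>x. off + n + 3 <= x ==> ar s aTX x = 0"
  and szs: "n + 3 <= sz s aA2" "off + n + 3 + n02 n + 3 <= sz s aTX" and B: "sz s aTX + 10 < B" "3 * n + 10 < B"
 shows "wp (For vI vN02 naming_body) (%u. vr u vNm = nmf R f (n02 n - 1) &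
   (\<forall>i<n02 n. ar u aTX (off + n + 3 + idx n (f i)) = nmf R f i) &
   (\<forall>x<off + n + 3. ar u aTX x = ar s aTX x) & (\<forall>x\<ge>off + n + 3 + n02 n. ar u aTX x = 0) &
   tm u <= tm s + 11 * n02 n + 1) s"
proof (rule wp_For[where I = "%k u. vr u vNm = (if k = 0 then 0 else nmf R f (k - 1)) &
   (\<forall>i<k. ar u aTX (off + n + 3 + idx n (f i)) = nmf R f i) &
   (\<forall>x<off + n + 3. ar u aTX x = ar s aTX x) & (\<forall>x\<ge>off + n + 3 + n02 n. ar u aTX x = 0)" and D = 9], goal_cases)
 case (8 k u)
 have k: "k < n02 n" using 8(2) vs by simp
 have smp: "f i \<in> sample n" if "i < n02 n" for i using bij that by (auto simp: bij_betw_def)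
 have u: "vr u vOff = off" "vr u vP = off + n + 3" "vr u vN0 = n0 n" "ar u aA2 = f" "sz u = sz s" "vr u vI = k"
  using vs 8(3) by (simp_all add: frame_simps[OF 8(4)] f_def off_def)
 have I: "vr u vNm = (if k = 0 then 0 else nmf R f (k - 1))" "\<forall>i<k. ar u aTX (off + n + 3 + idx n (f i)) = nmf R f i"
  "\<forall>x<off + n + 3. ar u aTX x = ar s aTX x" "\<forall>x\<ge>off + n + 3 + n02 n. ar u aTX x = 0" using 8(5) by auto
 have tx: "ar u aTX (off + x + d) = zc R (x + d)" if "x \<in> sample n" "d <= 2" for x d
  using I(3) h that sample_le[OF that(1)] unfolding holds_def n_def by (simp add: add.assoc)
 have lt: "off + x + d < sz s aTX" "off + x + d < B" if "x \<in> sample n" "d <= 2" for x d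
  using that sample_le[OF that(1)] szs B by auto
 note fk = smp[OF k]
 note tk = tx[OF fk, of 0] tx[OF fk, of 1] tx[OF fk, of 2] lt[OF fk, of 0] lt[OF fk, of 1] lt[OF fk, of 2]
 have il: "idx n (f k) < n02 n" using idx_less[OF fk] .
 have idk: "f k mod 3 = 1 ==> f k div 3 = idx n (f k)" "f k mod 3 ~= 1 ==> n0 n + f k div 3 = idx n (f k)"
  by (simp_all add: idx_def)
 have nbound: "nmf R f (k - 1) + 1 < B" using nmf_bounds(2)[of R f "k - 1"] k n02_le[of n] B by simp
 have ine: "idx n (f i) ~= idx n (f k)" if "i < k" for i
  using bij that k idx_inj[OF smp[of i] fk] by (auto simp: bij_betw_def inj_on_def)
 have fin: "tm v <= tm u + 7 ==> vr v vNm = nmf R f k ==> vr v vX = f k ==> vr v vP = off + n + 3 ==>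
   vr v vN0 = n0 n ==> ar v = ar u ==> sz v = sz s ==> vr v vI = k ==>
   wp name_write (%v. tm v <= tm u + 9 &
   vr v vNm = nmf R f k & (\<forall>i<Suc k. ar v aTX (off + n + 3 + idx n (f i)) = nmf R f i) &
   (\<forall>x<off + n + 3. ar v aTX x = ar s aTX x) & (\<forall>x\<ge>off + n + 3 + n02 n. ar v aTX x = 0)) v" for v
  unfolding name_write_def
  using I(2-4) ine szs B il idk by (cases "f k mod 3 = 1") (auto simp: less_Suc_eq add.assoc)
 show ?case
 proof (cases k)
  case 0
  show ?thesis unfolding naming_body_def
   apply (simp only: wp_Seq)
   using B szs k n02_le[of n] u 0 apply simp
   apply (rule wp_conseq[OF fin]) using 0 apply (simp_all add: u) done
 next
  case (Suc k')
  have k': "k' < n02 n" using k Suc by simp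
  note fk' = smp[OF k']
  note tk' = tx[OF fk', of 0] tx[OF fk', of 1] tx[OF fk', of 2] lt[OF fk', of 0] lt[OF fk', of 1] lt[OF fk', of 2]
  show ?thesis
  proof -
   have e: "t3e R (f k) (f k') \<longleftrightarrow> zc R (f k) = zc R (f k') & zc R (Suc (f k)) = zc R (Suc (f k')) &
     zc R (Suc (Suc (f k))) = zc R (Suc (Suc (f k')))" by (simp add: t3e_def)
   have nm: "vr u vNm = nmf R f k'" using I(1) Suc by simp
   have b: "k < sz s aA2" "k' < sz s aA2" "Suc (nmf R f k') < B" "k < B" "Suc 0 < B" "2 < B" "0 < B"
    using szs k n02_le[of n] B nbound Suc by auto
   show ?thesis
   proof (cases "t3e R (f k) (f k')")
    case True
    have z: "zc R (f k) = zc R (f k')" "zc R (Suc (f k)) = zc R (Suc (f k'))"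
     "zc R (Suc (Suc (f k))) = zc R (Suc (Suc (f k')))" using True e by auto
    show ?thesis unfolding naming_body_def
     apply (simp only: wp_Seq)
     using Suc tk tk' b nm u True z apply simp
     apply (rule wp_conseq[OF fin]) apply (simp_all add: u)
     done
   next
    case False
    consider (a) "zc R (f k) ~= zc R (f k')" | (b) "zc R (f k) = zc R (f k')" "zc R (Suc (f k)) ~= zc R (Suc (f k'))"
     | (c) "zc R (f k) = zc R (f k')" "zc R (Suc (f k)) = zc R (Suc (f k'))"
      "zc R (Suc (Suc (f k))) ~= zc R (Suc (Suc (f k')))" using False e by blast
    then show ?thesis
    proof cases
     case a
     show ?thesis unfolding naming_body_def
      apply (simp only: wp_Seq)
      using Suc tk tk' b nm u False a apply simp
      apply (rule wp_conseq[OF fin]) apply (simp_all add: u)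
      done
    next
     case b': b
     show ?thesis unfolding naming_body_def
      apply (simp only: wp_Seq)
      using Suc tk tk' b nm u False b' apply simp
      apply (rule wp_conseq[OF fin]) apply (simp_all add: u)
      done
    next
     case c
     show ?thesis unfolding naming_body_def
      apply (simp only: wp_Seq)
      using Suc tk tk' b nm u False c apply simp
      apply (rule wp_conseq[OF fin]) apply (simp_all add: u)
      done
    qed
   qed
  qed
 qed
next
 case (9 u)
 have "n02 n ~= 0" using n n02_pos[of n] n0_le_n02[of n] by simp
 then show ?case using 9 vs by simp
qed (use vs B n02_le[of n] zero in auto)

lemma wp_ranks:
 fixes s :: state and n :: nat
 defines "g \<equiv> ar s aA3"
 assumes vs: "vr s vI = 0" "vr s vN0 = n0 n" "vr s vN02 = n02 n"
  and bij: "bij_betw g {..<n02 n} {..<n02 n}" and z: "\<And>x. n <= x ==> x < n + 3 ==> ar s aRK x = 0"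
  and szs: "n + 3 <= sz s aA1" "n + 3 <= sz s aA3" "n + 3 <= sz s aRK" and B: "3 * n + 10 < B"
 shows "wp (For vI vN02 rank_body) (%u. (\<forall>i<n02 n. ar u aA1 i = unidx n (g i) & ar u aRK (unidx n (g i)) = Suc i) &
   (\<forall>x. n <= x --> x < n + 3 --> x \<notin> sample n --> ar u aRK x = 0) & tm u <= tm s + 10 * n02 n + 1) s"
proof (rule wp_For[where I = "%k u. (\<forall>i<k. ar u aA1 i = unidx n (g i) & ar u aRK (unidx n (g i)) = Suc i) &
   (\<forall>x. n <= x --> x < n + 3 --> x \<notin> sample n --> ar u aRK x = 0)" and D = 6], goal_cases)
 case (8 k u)
 have k: "k < n02 n" using 8(2) vs by simp
 have gl: "g i < n02 n" if "i < n02 n" for i using bij that by (auto simp: bij_betw_def)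
 have u: "vr u vN0 = n0 n" "ar u aA3 = g" "sz u = sz s" "vr u vI = k"
  using vs 8(3) by (simp_all add: frame_simps[OF 8(4)] g_def)
 have I: "\<forall>i<k. ar u aA1 i = unidx n (g i) & ar u aRK (unidx n (g i)) = Suc i"
   "\<forall>x. n <= x --> x < n + 3 --> x \<notin> sample n --> ar u aRK x = 0" using 8(5) by auto
 have sm: "unidx n (g k) \<in> sample n" using unidx_sample gl k by blast
 have le: "unidx n (g k) <= n" using sample_le[OF sm] .
 have ne: "unidx n (g i) ~= unidx n (g k)" if "i < k" for i
 proof
  assume "unidx n (g i) = unidx n (g k)"
  then have "g i = g k" using that k gl idx_unidx by (metis less_trans)
  then have "i = k" using bij that k unfolding bij_betw_def inj_on_def by auto
  then show False using that by simp
 qed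
 have ud: "g k < n0 n ==> Suc (3 * g k) = unidx n (g k)" "\<not> g k < n0 n ==> Suc (Suc (3 * (g k - n0 n))) = unidx n (g k)"
  by (auto simp: unidx_def)
 have bb: "3 * g k < B & g k < B" "3 * (g k - n0 n) < B" if True
  using ud le B gl[OF k] n02_le[of n] by (cases "g k < n0 n"; linarith)+
 have I': "\<And>i. i < k ==> ar u aA1 i = unidx n (g i)" "\<And>i. i < k ==> ar u aRK (unidx n (g i)) = Suc i"
  using I(1) by auto
 have J: "(\<forall>i<Suc k. ((ar u aA1)(k := unidx n (g k))) i = unidx n (g i) & ((ar u aRK)(unidx n (g k) := Suc k)) (unidx n (g i)) = Suc i) &
   (\<forall>x. n <= x --> x < n + 3 --> x \<notin> sample n --> ((ar u aRK)(unidx n (g k) := Suc k)) x = 0)"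
  using I' ne sm I(2) by (auto simp: less_Suc_eq)
 have szs': "k < sz s aA1" "k < sz s aA3" "unidx n (g k) < sz s aRK" "Suc k < B" "3 < B" "unidx n (g k) < B"
  using szs k n02_le[of n] le B by auto
 have "wp rank_body (%v. tm v <= tm u + 6 & ar v aA1 = (ar u aA1)(k := unidx n (g k)) &
   ar v aRK = (ar u aRK)(unidx n (g k) := Suc k)) u"
 proof (cases "g k < n0 n")
  case True
  then show ?thesis unfolding rank_body_def using u szs' ud(1)[OF True] bb by simp
 next
  case False
  then show ?thesis unfolding rank_body_def using u szs' ud(2)[OF False] bb by simp
 qed
 then show ?case
 proof (rule wp_conseq)
  fix v assume "tm v <= tm u + 6 & ar v aA1 = (ar u aA1)(k := unidx n (g k)) &
   ar v aRK = (ar u aRK)(unidx n (g k) := Suc k)"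
  then show "tm v <= tm u + 6 & (\<forall>i<Suc k. ar (v(|vr := (vr v)(vI := Suc k)|)) aA1 i = unidx n (g i) &
    ar (v(|vr := (vr v)(vI := Suc k)|)) aRK (unidx n (g i)) = Suc i) &
   (\<forall>x. n <= x --> x < n + 3 --> x \<notin> sample n --> ar (v(|vr := (vr v)(vI := Suc k)|)) aRK x = 0)"
   using J by (simp del: fun_upd_apply)
 qed
qed (use vs B n02_le[of n] z in auto)

lemma wp_gather:
 fixes s :: state and R :: "nat list"
 defines "n \<equiv> length R" and "f \<equiv> ar s aA1"
 assumes vs: "vr s vI = 0" "vr s vCnt = 0" "vr s vN02 = n02 n"
  and bij: "bij_betw f {..<n02 n} (sample n)" and srt: "\<And>i j. i < j ==> j < n02 n ==> sl R (f i) (f j)"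
  and szs: "n + 3 <= sz s aA1" "n + 3 <= sz s aA2" and B: "3 * n + 10 < B"
 shows "wp (For vI vN02 gather_body) (%u. vr u vCnt = n0 n & bij_betw (ar u aA2) {..<n0 n} {x. x < n & x mod 3 = 0} &
   (\<forall>a b. a < b --> b < n0 n --> sl R (Suc (ar u aA2 a)) (Suc (ar u aA2 b))) & tm u <= tm s + 10 * n02 n + 1) s"
proof (rule wp_For[where I = "%k u. vr u vCnt <= k &
   ar u aA2 ` {..<vr u vCnt} = (%x. x - 1) ` {f i | i. i < k & f i mod 3 = 1} &
   (\<forall>a b. a < b --> b < vr u vCnt --> sl R (Suc (ar u aA2 a)) (Suc (ar u aA2 b)))" and D = 4], goal_cases)
 case (8 k u)
 have k: "k < n02 n" using 8(2) vs by simp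
 have u: "ar u aA1 = f" "sz u = sz s" "vr u vI = k" using vs 8(3) by (simp_all add: frame_simps[OF 8(4)] f_def)
 let ?c = "vr u vCnt"
 have I: "?c <= k" "ar u aA2 ` {..<?c} = (%x. x - 1) ` {f i | i. i < k & f i mod 3 = 1}"
   "\<forall>a b. a < b --> b < ?c --> sl R (Suc (ar u aA2 a)) (Suc (ar u aA2 b))" using 8(5) by auto
 have fle: "f k <= n" using bij k sample_le by (auto simp: bij_betw_def)
 have S: "{f i | i. i < Suc k & f i mod 3 = 1} = (if f k mod 3 = 1 then insert (f k) {f i | i. i < k & f i mod 3 = 1} else {f i | i. i < k & f i mod 3 = 1})"
  by (auto simp: less_Suc_eq)
 show ?case
 proof (cases "f k mod 3 = 1")
  case True
  have new: "sl R (Suc (ar u aA2 a)) (f k)" if "a < ?c" for a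
  proof -
   have "ar u aA2 a \<in> (%x. x - 1) ` {f i | i. i < k & f i mod 3 = 1}" using I(2) that by blast
   then obtain i where i: "i < k" "f i mod 3 = 1" "ar u aA2 a = f i - 1" by blast
   then have "Suc (ar u aA2 a) = f i" by (cases "f i") auto
   then show ?thesis using srt[of i k] i k by simp
  qed
  have pos: "Suc (f k - Suc 0) = f k" using True by (cases "f k") auto
  have img: "((ar u aA2)(?c := f k - Suc 0)) ` {..<Suc ?c} = insert (f k - Suc 0) (ar u aA2 ` {..<?c})"
   by (auto simp: lessThan_Suc)
  have "0 < f k" using pos by linarith
  then have "wp gather_body (%v. tm v <= tm u + 4 & vr v vCnt = Suc ?c & ar v aA2 = (ar u aA2)(?c := f k - Suc 0)) u"
   unfolding gather_body_def using I(1) k szs B u True fle n02_le[of n] by simp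
  then show ?thesis
  proof (rule wp_conseq)
   fix v assume v: "tm v <= tm u + 4 & vr v vCnt = Suc ?c & ar v aA2 = (ar u aA2)(?c := f k - Suc 0)"
   have "sl R (Suc (ar v aA2 a)) (Suc (ar v aA2 b))" if "a < b" "b < Suc ?c" for a b
    using v that new I(3) pos by (cases "b = ?c") auto
   moreover have "ar v aA2 ` {..<vr v vCnt} = (%x. x - 1) ` {f i | i. i < Suc k & f i mod 3 = 1}"
   proof -
    have a: "ar v aA2 = (ar u aA2)(?c := f k - Suc 0)" and b: "vr v vCnt = Suc ?c" using v by auto
    show ?thesis unfolding a b img I(2) S using True by simp
   qed
   ultimately show "tm v <= tm u + 4 & vr (v(|vr := (vr v)(vI := Suc k)|)) vCnt <= Suc k &
    ar (v(|vr := (vr v)(vI := Suc k)|)) aA2 ` {..<vr (v(|vr := (vr v)(vI := Suc k)|)) vCnt} =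
     (%x. x - 1) ` {f i | i. i < Suc k & f i mod 3 = 1} &
    (\<forall>a b. a < b --> b < vr (v(|vr := (vr v)(vI := Suc k)|)) vCnt -->
     sl R (Suc (ar (v(|vr := (vr v)(vI := Suc k)|)) aA2 a)) (Suc (ar (v(|vr := (vr v)(vI := Suc k)|)) aA2 b)))"
    using v I(1) by simp
  qed
 next
  case False
  then show ?thesis unfolding gather_body_def using I k szs B u fle n02_le[of n] by (simp add: S[unfolded One_nat_def])
 qed
next
 case (9 u)
 let ?c = "vr u vCnt"
 have I: "?c <= n02 n" "ar u aA2 ` {..<?c} = (%x. x - 1) ` {f i | i. i < n02 n & f i mod 3 = 1}"
   "\<forall>a b. a < b --> b < ?c --> sl R (Suc (ar u aA2 a)) (Suc (ar u aA2 b))" using 9(1) vs by auto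
 have inj: "inj_on (ar u aA2) {..<?c}"
 proof (rule linorder_inj_onI')
  fix a b assume "a \<in> {..<?c}" "b \<in> {..<?c}" "a < b"
  then have "sl R (Suc (ar u aA2 a)) (Suc (ar u aA2 b))" using I(3) by auto
  then show "ar u aA2 a ~= ar u aA2 b" by auto
 qed
 have set: "ar u aA2 ` {..<?c} = {x. x < n & x mod 3 = 0}"
 proof -
  have "{f i | i. i < n02 n & f i mod 3 = 1} = {y \<in> sample n. y mod 3 = 1}" using bij by (auto simp: bij_betw_def)
  moreover have "(%x. x - 1) ` {y \<in> sample n. y mod 3 = 1} = {x. x < n & x mod 3 = 0}"
  proof (rule set_eqI, rule iffI)
   fix x assume "x \<in> (%x. x - 1) ` {y \<in> sample n. y mod 3 = 1}"
   then obtain y where y: "y \<in> sample n" "y mod 3 = 1" "x = y - 1" by blast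
   then show "x \<in> {x. x < n & x mod 3 = 0}" unfolding sample_def mem_Collect_eq by presburger
  next
   fix x assume "x \<in> {x. x < n & x mod 3 = 0}"
   then have "x < n" "x mod 3 = 0" by auto
   then have "Suc x \<in> sample n" "Suc x mod 3 = 1" unfolding sample_def mem_Collect_eq by presburger+
   then show "x \<in> (%x. x - 1) ` {y \<in> sample n. y mod 3 = 1}" by (intro image_eqI[of _ _ "Suc x"]) auto
  qed
  ultimately show ?thesis using I(2) by simp
 qed
 have bb: "bij_betw (%k. 3 * k) {..<n0 n} {x. x < n & x mod 3 = 0}"
  by (rule bij_betw_byWitness[where f' = "%x. x div 3"]; cases n rule: mod3_cases; auto)
 have "?c = n0 n" using card_image[OF inj] set bij_betw_same_card[OF bb] by simp
 then show ?case using inj set I 9(4) vs by (auto simp: bij_betw_def)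
qed (use vs B n02_le[of n] in auto)

lemma wp_compare:
 fixes s :: state and R :: "nat list"
 defines "x \<equiv> ar s aA1 (vr s vP)" and "y \<equiv> ar s aA3 (vr s vQ)" and "off \<equiv> vr s vOff"
 assumes h: "holds s off R" and pos: "posl R" and rk: "rank_ok R (ar s aRK)"
  and xy: "x < length R" "x mod 3 ~= 0" "y < length R" "y mod 3 = 0" "vr s vP < sz s aA1" "vr s vQ < sz s aA3"
  and szs: "off + length R + 3 <= sz s aTX" "length R + 3 <= sz s aRK" and B: "sz s aTX + 10 < B" "3 * length R + 10 < B"
 shows "wp compare_com (%u. vr u vT = of_bool (sl R x y) & tm u <= tm s + 6) s"
proof -
 have tx: "ar s aTX (off + z + d) = zc R (z + d)" if "z < length R" "d <= 2" for z d
  using h that unfolding holds_def by (simp add: add.assoc)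
 note t = tx[OF xy(1), of 0] tx[OF xy(1), of 1] tx[OF xy(3), of 0] tx[OF xy(3), of 1]
 show ?thesis
 proof (cases "x mod 3 = 1")
  case True
  show ?thesis unfolding compare_com_def using merge_less1[OF pos rk True xy(4,1,3)] t szs B xy True
   by (simp add: x_def[symmetric] y_def[symmetric] off_def[symmetric])
 next
  case False
  then have 2: "x mod 3 = 2" using xy(2) by presburger
  show ?thesis unfolding compare_com_def using merge_less2[OF pos rk 2 xy(4,1,3)] t szs B xy 2
   by (simp add: x_def[symmetric] y_def[symmetric] off_def[symmetric])
 qed
qed

end

text \<open>\<open>n0 n - Suc n div 3\<close> is the number of sample entries that the merge skips.
  If n mod 3 = 1, the sample contains the empty suffix n, which comes first in the order but has no
  place in the suffix array.\<close>

lemma n0_eqs: "n0 n - Suc n div 3 <= n02 n" "n02 n + n0 n = n + (n0 n - Suc n div 3)" "Suc n div 3 <= n0 n"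
 "n0 n - Suc n div 3 = of_bool (n mod 3 = 1)" if "0 < n"
 using that by (cases n rule: mod3_cases; simp add: n02_def; presburger)+

lemma isSA_cong: "(\<And>i. i < length R ==> f i = g i) ==> isSA R f \<longleftrightarrow> isSA R g"
 unfolding isSA_def using bij_betw_cong[of "{..<length R}" f g "{..<length R}"] by auto

definition copy_body :: com where "copy_body = Write aA3 (Var vI) (Idx aA4 (Var vI))"

lemma copy_mods [simp]: "wv copy_body = {}" "wa copy_body = {aA3}" "al copy_body = {}"
 by (auto simp: copy_body_def)

text \<open>The ranks of the three positions behind the string are reset, since the array may still
  hold ranks of a deeper level. The start value of \<open>vP\<close> skips the empty suffix if it is
  in the sample.\<close>

definition upstep :: com where
 "upstep =
  vN0 ::= (Var vLen \<oplus> Lit 2) \<oslash> Lit 3 ;; vN02 ::= Var vN0 \<oplus> Var vLen \<oslash> Lit 3 ;; vCnt ::= Lit 0 ;;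
  Write aRK (Var vLen) (Lit 0) ;; Write aRK (Var vLen \<oplus> Lit 1) (Lit 0) ;; Write aRK (Var vLen \<oplus> Lit 2) (Lit 0) ;;
  vI ::= Lit 0 ;; For vI vN02 rank_body ;;
  vI ::= Lit 0 ;; For vI vN02 gather_body ;;
  vK ::= Var vM \<oplus> Var vLen \<oplus> Lit 1 ;; radix aA2 aA3 0 ;;
  vP ::= Var vN0 \<ominus> (Var vLen \<oplus> Lit 1) \<oslash> Lit 3 ;; vQ ::= Lit 0 ;; vI ::= Lit 0 ;; For vI vLen merge_body ;;
  vI ::= Lit 0 ;; For vI vLen copy_body"

lemma upstep_mods [simp]: "wv upstep = {vN0, vN02, vCnt, vI, vX, vY, vT, vK, vP, vQ}"
 "wa upstep = {aRK, aA1, aA2, aA3, aA4, aCNT}" "al upstep = {}"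
 by (auto simp: upstep_def)

definition downstep :: com where
 "downstep = sort3 ;; vNm ::= Lit 0 ;; vP ::= Var vOff \<oplus> Var vLen \<oplus> Lit 3 ;; vI ::= Lit 0 ;; For vI vN02 naming_body"

lemma sort3_mods [simp]: "wv sort3 = {vN0, vN02, vK, vCnt, vI, vX, vY}" "wa sort3 = {aA1, aA2, aCNT}" "al sort3 = {}"
 by (auto simp: sort3_def)

lemma downstep_mods [simp]: "wv downstep = {vN0, vN02, vK, vCnt, vI, vX, vY, vNm, vP}"
 "wa downstep = {aA1, aA2, aCNT, aTX}" "al downstep = {}"
 by (auto simp: downstep_def)

context machine
begin

lemma wp_merge:
 fixes s :: state and R :: "nat list"
 defines "n \<equiv> length R" and "f \<equiv> ar s aA1" and "g \<equiv> ar s aA3" and "off \<equiv> vr s vOff"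
 assumes h: "holds s off R" and pos: "posl R" and rk: "rank_ok R (ar s aRK)"
  and vs: "vr s vI = 0" "vr s vQ = 0" "vr s vP = n0 n - Suc n div 3" "vr s vN0 = n0 n" "vr s vN02 = n02 n" "vr s vLen = n"
  and f: "\<And>j. n0 n - Suc n div 3 <= j ==> j < n02 n ==> f j < n & f j mod 3 ~= 0"
   "\<And>i j. i < j ==> j < n02 n ==> sl R (f i) (f j)"
  and g: "\<And>j. j < n0 n ==> g j < n & g j mod 3 = 0" "\<And>i j. i < j ==> j < n0 n ==> sl R (g i) (g j)"
  and szs: "off + n + 3 <= sz s aTX" "n + 3 <= sz s aRK" "n + 3 <= sz s aA1" "n + 3 <= sz s aA3" "n + 3 <= sz s aA4"
  and B: "sz s aTX + 10 < B" "3 * n + 10 < B" and n: "0 < n"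
 shows "wp (For vI vLen merge_body) (%u. isSA R (ar u aA4) & tm u <= tm s + 17 * n + 1) s"
proof (rule wp_For[where I = "%k u. n0 n - Suc n div 3 <= vr u vP & vr u vP <= n02 n & vr u vQ <= n0 n &
   vr u vP + vr u vQ = n0 n - Suc n div 3 + k & (\<forall>a<k. ar u aA4 a < n) &
   (\<forall>a b. a < b --> b < k --> sl R (ar u aA4 a) (ar u aA4 b)) &
   (\<forall>a j. a < k --> vr u vP <= j --> j < n02 n --> sl R (ar u aA4 a) (f j)) &
   (\<forall>a j. a < k --> vr u vQ <= j --> j < n0 n --> sl R (ar u aA4 a) (g j))" and D = 15], goal_cases)
 case (8 k u)
 let ?p = "vr u vP" and ?q = "vr u vQ"
 have k: "k < n" using 8(2) vs by simp
 have u: "ar u aA1 = f" "ar u aA3 = g" "sz u = sz s" "vr u vI = k" "vr u vN0 = n0 n" "vr u vN02 = n02 n" "vr u vOff = off"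
  "ar u aTX = ar s aTX" "ar u aRK = ar s aRK"
  using vs 8(3) by (simp_all add: frame_simps[OF 8(4)] f_def g_def off_def)
 have I: "n0 n - Suc n div 3 <= ?p" "?p <= n02 n" "?q <= n0 n" "?p + ?q = n0 n - Suc n div 3 + k" "\<forall>a<k. ar u aA4 a < n"
   "\<forall>a b. a < b --> b < k --> sl R (ar u aA4 a) (ar u aA4 b)"
   "\<forall>a j. a < k --> ?p <= j --> j < n02 n --> sl R (ar u aA4 a) (f j)"
   "\<forall>a j. a < k --> ?q <= j --> j < n0 n --> sl R (ar u aA4 a) (g j)" using 8(5) by auto
 have notboth: "?p = n02 n ==> ?q < n0 n" using I(2-4) n0_eqs(2)[OF n] k by linarith
 have bnds: "?p < n + 3" "?q < n + 3" using I n02_le[of n] n0_le[OF n] by auto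
 have bb: "k < sz s aA4" "?p < sz s aA1" "?q < sz s aA3" "Suc ?p < B" "Suc ?q < B" "Suc 0 < B" using szs k bnds B by auto
 have "wp merge_body (%v. tm v <= tm u + 15 &
   ((vr v vP = Suc ?p & vr v vQ = ?q & ar v aA4 = (ar u aA4)(k := f ?p) & ?p < n02 n & (?q = n0 n \<or> sl R (f ?p) (g ?q))) \<or>
    (vr v vP = ?p & vr v vQ = Suc ?q & ar v aA4 = (ar u aA4)(k := g ?q) & ?q < n0 n & (?p = n02 n \<or> sl R (g ?q) (f ?p))))) u"
 proof (cases "?p = n02 n \<or> ?q = n0 n")
  case True
  then show ?thesis unfolding merge_body_def using u bb notboth I(2,3) by (cases "?p = n02 n") auto
 next
  case False
  then have pq: "?p < n02 n" "?q < n0 n" using I by auto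
  have fp: "f ?p < n" "f ?p mod 3 ~= 0" "g ?q < n" "g ?q mod 3 = 0" using f(1)[of ?p] g(1)[of ?q] I(1) pq by auto
  have ne: "f ?p ~= g ?q" using fp(2,4) by metis
  have tot: "\<not> sl R (f ?p) (g ?q) ==> sl R (g ?q) (f ?p)" using sl_total[of "f ?p" R "g ?q"] fp(1) ne unfolding n_def by blast
  show ?thesis unfolding merge_body_def
   using False bb u apply simp
   apply (rule wp_conseq[OF wp_compare[where R = R]])
   using h pos rk fp szs B apply (simp_all add: holds_def n_def[symmetric])
   subgoal premises p for v
    using p(1-12) u(3) bb pq p tot
    by (auto simp: frame_simps[OF \<open>frame compare_com _ v\<close>] of_bool_def split: if_splits)
   done
 qed
 then show ?case
 proof (rule wp_conseq)
  fix v assume "tm v <= tm u + 15 &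
   ((vr v vP = Suc ?p & vr v vQ = ?q & ar v aA4 = (ar u aA4)(k := f ?p) & ?p < n02 n & (?q = n0 n \<or> sl R (f ?p) (g ?q))) \<or>
    (vr v vP = ?p & vr v vQ = Suc ?q & ar v aA4 = (ar u aA4)(k := g ?q) & ?q < n0 n & (?p = n02 n \<or> sl R (g ?q) (f ?p))))"
  then consider (a) "tm v <= tm u + 15" "vr v vP = Suc ?p" "vr v vQ = ?q" "ar v aA4 = (ar u aA4)(k := f ?p)" "?p < n02 n" "?q = n0 n \<or> sl R (f ?p) (g ?q)"
   | (b) "tm v <= tm u + 15" "vr v vP = ?p" "vr v vQ = Suc ?q" "ar v aA4 = (ar u aA4)(k := g ?q)" "?q < n0 n" "?p = n02 n \<or> sl R (g ?q) (f ?p)"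
   by blast
  then show "tm v <= tm u + 15 & n0 n - Suc n div 3 <= vr (v(|vr := (vr v)(vI := Suc k)|)) vP &
   vr (v(|vr := (vr v)(vI := Suc k)|)) vP <= n02 n & vr (v(|vr := (vr v)(vI := Suc k)|)) vQ <= n0 n &
   vr (v(|vr := (vr v)(vI := Suc k)|)) vP + vr (v(|vr := (vr v)(vI := Suc k)|)) vQ = n0 n - Suc n div 3 + Suc k &
   (\<forall>a<Suc k. ar (v(|vr := (vr v)(vI := Suc k)|)) aA4 a < n) &
   (\<forall>a b. a < b --> b < Suc k --> sl R (ar (v(|vr := (vr v)(vI := Suc k)|)) aA4 a) (ar (v(|vr := (vr v)(vI := Suc k)|)) aA4 b)) &
   (\<forall>a j. a < Suc k --> vr (v(|vr := (vr v)(vI := Suc k)|)) vP <= j --> j < n02 n --> sl R (ar (v(|vr := (vr v)(vI := Suc k)|)) aA4 a) (f j)) &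
   (\<forall>a j. a < Suc k --> vr (v(|vr := (vr v)(vI := Suc k)|)) vQ <= j --> j < n0 n --> sl R (ar (v(|vr := (vr v)(vI := Suc k)|)) aA4 a) (g j))"
  proof cases
   case a
   have gs: "sl R (f ?p) (g j)" if "?q <= j" "j < n0 n" for j
    using a(6) that g(2)[of ?q j] sl_trans[of R "f ?p" "g ?q" "g j"] by (cases "?q = j") auto
   have x: "f ?p < n" using f(1)[of ?p] I(1) a(5) by simp
   show ?thesis using a I x gs f(2) by (auto simp: less_Suc_eq)
  next
   case b
   have fs: "sl R (g ?q) (f j)" if "?p <= j" "j < n02 n" for j
    using b(6) that f(2)[of ?p j] sl_trans[of R "g ?q" "f ?p" "f j"] by (cases "?p = j") auto
   have x: "g ?q < n" using g(1)[of ?q] b(5) by simp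
   show ?thesis using b I x fs g(2) by (auto simp: less_Suc_eq)
  qed
 qed
next
 case (9 u)
 have I: "\<forall>a<n. ar u aA4 a < n" "\<forall>a b. a < b --> b < n --> sl R (ar u aA4 a) (ar u aA4 b)" using 9(1) vs by auto
 have inj: "inj_on (ar u aA4) {..<n}"
 proof (rule linorder_inj_onI')
  fix a b assume "a \<in> {..<n}" "b \<in> {..<n}" "a < b"
  then have "sl R (ar u aA4 a) (ar u aA4 b)" using I(2) by auto
  then show "ar u aA4 a ~= ar u aA4 b" by auto
 qed
 moreover have "ar u aA4 ` {..<n} \<subseteq> {..<n}" using I by auto
 ultimately have "bij_betw (ar u aA4) {..<n} {..<n}" by (simp add: bij_betw_def endo_inj_surj)
 then show ?case using I 9(4) vs by (simp add: isSA_def n_def)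
qed (use vs B n0_eqs[OF n] in auto)

lemma wp_upstep:
 fixes s :: state and R R' :: "nat list"
 defines "n \<equiv> length R" and "M \<equiv> vr s vM" and "off \<equiv> vr s vOff"
 assumes h: "holds s off R" and pos: "posl R" and red: "reduced R R'" and sa: "isSA R' (ar s aA3)"
  and len: "vr s vLen = n" "0 < n" and ch: "\<And>x. x < n ==> R ! x <= M + n"
  and szs: "n + 3 <= sz s aA1" "n + 3 <= sz s aA2" "n + 3 <= sz s aA3" "n + 3 <= sz s aA4" "n + 3 <= sz s aRK"
   "M + n + 1 <= sz s aCNT" "off + n + 3 <= sz s aTX"
  and B: "sz s aTX + 10 < B" "M + 3 * n + 10 < B"
 shows "wp upstep (%u. isSA R (ar u aA3) & tm u <= tm s + 200 * (M + n + 1)) s"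
proof -
 define F where "F u \<longleftrightarrow> vr u vOff = off & vr u vLen = n & vr u vM = M & vr u vN0 = n0 n & vr u vN02 = n02 n &
  ar u aTX = ar s aTX & sz u = sz s" for u :: state
 define F1 where "F1 u \<longleftrightarrow> F u & bij_betw (ar u aA1) {..<n02 n} (sample n) &
  (\<forall>i j. i < j --> j < n02 n --> sl R (ar u aA1 i) (ar u aA1 j)) & rank_ok R (ar u aRK)" for u :: state
 have n02le: "n02 n <= n + 1" "n0 n <= n" using n02_le n0_le len by auto
 have hF: "holds u off R" if "F u" for u using h that by (simp add: holds_def F_def)
 \<comment> \<open>The command is treated from its end: the facts \<open>E\<close>,
   \<open>D\<close>, \<open>C\<close> and \<open>Bb\<close> each cover one more phase together with
   everything after it.\<close>
 have E: "wp (For vI vLen copy_body) (%u. isSA R (ar u aA3) & tm u <= tm u0 + 3 * n + 1) u0"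
  if "F u0" "isSA R (ar u0 aA4)" "vr u0 vI = 0" for u0
 proof (rule wp_For[where I = "%k u. \<forall>i<k. ar u aA3 i = ar u0 aA4 i" and D = 1], goal_cases)
  case (8 k u)
  have u: "vr u vI = k" "ar u aA4 = ar u0 aA4" "sz u = sz s" "k < sz s aA3" "k < sz s aA4"
   using szs 8(2,3) that(1) by (simp_all add: frame_simps[OF 8(4)] F_def)
  have "\<forall>i<Suc k. ((ar u aA3)(k := ar u0 aA4 k)) i = ar u0 aA4 i" using 8(5) by (auto simp: less_Suc_eq)
  then show ?case unfolding copy_body_def using u by simp
 next
  case (9 u)
  then have "\<forall>i<n. ar u aA3 i = ar u0 aA4 i" using that by (simp add: F_def)
  moreover have "isSA R (ar u0 aA4)" by fact
  ultimately have "isSA R (ar u aA3)" using isSA_cong[of R "ar u aA3" "ar u0 aA4"] by (simp add: n_def)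
  then show ?case using 9(4) that by (simp add: F_def)
 qed (use that B in \<open>auto simp: F_def\<close>)
 have D: "wp (vP ::= Var vN0 \<ominus> (Var vLen \<oplus> Lit 1) \<oslash> Lit 3 ;; vQ ::= Lit 0 ;; vI ::= Lit 0 ;; For vI vLen merge_body ;;
   vI ::= Lit 0 ;; For vI vLen copy_body) (%u. isSA R (ar u aA3) & tm u <= tm u0 + 20 * n + 10) u0"
  if F1: "F1 u0" and g: "bij_betw (ar u0 aA3) {..<n0 n} {x. x < n & x mod 3 = 0}"
   "\<And>i j. i < j ==> j < n0 n ==> sl R (ar u0 aA3 i) (ar u0 aA3 j)" for u0
 proof -
  have F: "F u0" using F1 by (simp add: F1_def)
  let ?f = "ar u0 aA1" and ?p = "n0 n - Suc n div 3"
  have fbij: "bij_betw ?f {..<n02 n} (sample n)" and fs: "\<And>i j. i < j ==> j < n02 n ==> sl R (?f i) (?f j)"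
   and rk: "rank_ok R (ar u0 aRK)" using F1 by (auto simp: F1_def)
  have f: "?f j < n & ?f j mod 3 ~= 0" if j: "?p <= j" "j < n02 n" for j
  proof -
   have sj: "?f j \<in> sample n" using fbij j by (auto simp: bij_betw_def)
   have "?f j ~= n"
   proof
    assume fj: "?f j = n"
    then have "n mod 3 = 1" using sj by (auto simp: sample_def)
    then have "0 < j" using j n0_eqs(4)[OF len(2)] by simp
    then have "sl R (?f 0) n" using fs[of 0 j] j fj by simp
    then show False using sl_end(2)[of R n "?f 0"] by (simp add: n_def)
   qed
   then show ?thesis using sj by (auto simp: sample_def)
  qed
  have gm: "ar u0 aA3 j < n & ar u0 aA3 j mod 3 = 0" if "j < n0 n" for j using g(1) that by (auto simp: bij_betw_def)
  have bb: "Suc n < B" "n0 n < B" "3 < B" using B n02le by auto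
  define u1 where "u1 = u0(|tm := Suc (Suc (Suc (tm u0))), vr := (vr u0)(vP := ?p, vQ := 0, vI := 0)|)"
  have M: "wp (For vI vLen merge_body) (%u. isSA R (ar u aA4) & tm u <= tm u1 + 17 * n + 1) u1"
   unfolding n_def
   by (rule wp_merge) (use F hF[OF F] pos rk f fs g gm szs B len in \<open>simp_all add: u1_def F_def n_def[symmetric] holds_def\<close>)
  have "wp (For vI vLen merge_body) (wp (vI ::= Lit 0 ;; For vI vLen copy_body)
    (%u. isSA R (ar u aA3) & tm u <= tm u0 + 20 * n + 10)) u1"
  proof (rule wp_conseq[OF M], goal_cases)
   case (1 u2)
   have F2: "F (u2(|tm := Suc (tm u2), vr := (vr u2)(vI := 0)|))"
    using F by (simp add: F_def frame_simps[OF 1(1)] u1_def)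
   show ?case using bb apply simp
    apply (rule wp_conseq[OF E[OF F2]])
    using 1(2) by (simp_all add: u1_def)
  qed
  then show ?thesis using F bb n0_eqs(3)[OF len(2)] by (simp add: F_def u1_def)
 qed
 have C: "wp (vK ::= Var vM \<oplus> Var vLen \<oplus> Lit 1 ;; radix aA2 aA3 0 ;; vP ::= Var vN0 \<ominus> (Var vLen \<oplus> Lit 1) \<oslash> Lit 3 ;;
   vQ ::= Lit 0 ;; vI ::= Lit 0 ;; For vI vLen merge_body ;;
   vI ::= Lit 0 ;; For vI vLen copy_body) (%u. isSA R (ar u aA3) & tm u <= tm u0 + 60 * (M + n + 1)) u0"
  if F1: "F1 u0" and c: "vr u0 vCnt = n0 n" and bij: "bij_betw (ar u0 aA2) {..<n0 n} {x. x < n & x mod 3 = 0}"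
   and srt: "\<And>a b. a < b ==> b < n0 n ==> sl R (Suc (ar u0 aA2 a)) (Suc (ar u0 aA2 b))" for u0
 proof -
  have F: "F u0" using F1 by (simp add: F1_def)
  have inm: "ar u0 aA2 i < n" if "i < n0 n" for i using bij that by (auto simp: bij_betw_def)
  have hz: "ar s aTX (off + x) = zc R x" if "x < n" for x using h that by (simp add: holds_def n_def)
  define u1 where "u1 = u0(|tm := Suc (tm u0), vr := (vr u0)(vK := Suc (M + n))|)"
  have "wp (radix aA2 aA3 0) (wp (vP ::= Var vN0 \<ominus> (Var vLen \<oplus> Lit 1) \<oslash> Lit 3 ;; vQ ::= Lit 0 ;; vI ::= Lit 0 ;; For vI vLen merge_body ;;
   vI ::= Lit 0 ;; For vI vLen copy_body) (%u. isSA R (ar u aA3) & tm u <= tm u0 + 60 * (M + n + 1))) u1"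
  proof (rule wp_radix, goal_cases)
   case (6 i)
   have i: "i < n0 n" using 6 c by (simp add: u1_def)
   then have "ar s aTX (off + ar u0 aA2 i) < Suc (M + n)"
    using hz[OF inm[OF i]] zc_bound[of R "Suc (M + n)" "ar u0 aA2 i"] ch unfolding n_def by (simp add: less_Suc_eq_le)
   then show ?case using F inm[OF i] szs by (simp add: u1_def F_def)
  next
   case (13 u)
   have out: "ar u aA3 (rpos (%i. ar s aTX (off + ar u0 aA2 i)) (n0 n) i) = ar u0 aA2 i" if "i < n0 n" for i
    using 13(2)[of i] that c F by (simp add: u1_def F_def)
   have bij3: "bij_betw (ar u aA3) {..<n0 n} {x. x < n & x mod 3 = 0}" by (rule stable_bij[OF bij out])
   have in3: "ar u aA3 i < n" if "i < n0 n" for i using bij3 that by (auto simp: bij_betw_def)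
   have s3: "sl R (ar u aA3 i) (ar u aA3 j)" if "i < j" "j < n0 n" for i j
   proof -
    have "ar s aTX (off + ar u aA3 i) < ar s aTX (off + ar u aA3 j) \<or>
     ar s aTX (off + ar u aA3 i) = ar s aTX (off + ar u aA3 j) & sl R (Suc (ar u aA3 i)) (Suc (ar u aA3 j))"
     by (rule stable_sorted[of "n0 n" "%x y. sl R (Suc x) (Suc y)" "ar u0 aA2" "ar u aA3" "%x. ar s aTX (off + x)", OF srt out that])
    then show ?thesis using sl_unfold[OF pos, of "ar u aA3 i" "ar u aA3 j"] hz in3[of i] in3[of j] that by auto
   qed
   have "F1 u" using F1 by (simp add: F1_def F_def frame_simps[OF 13(1)] u1_def)
   show ?case
    by (rule wp_conseq[OF D[OF \<open>F1 u\<close> bij3 s3]]) (use 13(3) c n02le in \<open>auto simp: u1_def\<close>)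
  qed (use F c szs B n02le in \<open>auto simp: u1_def F_def\<close>)
  then show ?thesis using F B by (simp add: F_def u1_def)
 qed
 have Bb: "wp (vI ::= Lit 0 ;; For vI vN02 gather_body ;; vK ::= Var vM \<oplus> Var vLen \<oplus> Lit 1 ;; radix aA2 aA3 0 ;;
   vP ::= Var vN0 \<ominus> (Var vLen \<oplus> Lit 1) \<oslash> Lit 3 ;;
   vQ ::= Lit 0 ;; vI ::= Lit 0 ;; For vI vLen merge_body ;;
   vI ::= Lit 0 ;; For vI vLen copy_body) (%u. isSA R (ar u aA3) & tm u <= tm u0 + 60 * (M + n + 1) + 10 * n + 12) u0"
  if F1: "F1 u0" and c: "vr u0 vCnt = 0" for u0
 proof -
  have F: "F u0" using F1 by (simp add: F1_def)
  define u1 where "u1 = u0(|tm := Suc (tm u0), vr := (vr u0)(vI := 0)|)"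
  have G: "wp (For vI vN02 gather_body) (%u. vr u vCnt = n0 n & bij_betw (ar u aA2) {..<n0 n} {x. x < n & x mod 3 = 0} &
   (\<forall>a b. a < b --> b < n0 n --> sl R (Suc (ar u aA2 a)) (Suc (ar u aA2 b))) & tm u <= tm u1 + 10 * n02 n + 1) u1"
   unfolding n_def
   by (rule wp_gather) (use F F1 c szs B in \<open>auto simp: u1_def F_def F1_def n_def[symmetric]\<close>)
  have "wp (For vI vN02 gather_body) (wp (vK ::= Var vM \<oplus> Var vLen \<oplus> Lit 1 ;; radix aA2 aA3 0 ;;
   vP ::= Var vN0 \<ominus> (Var vLen \<oplus> Lit 1) \<oslash> Lit 3 ;;
   vQ ::= Lit 0 ;; vI ::= Lit 0 ;; For vI vLen merge_body ;;
   vI ::= Lit 0 ;; For vI vLen copy_body) (%u. isSA R (ar u aA3) & tm u <= tm u0 + 60 * (M + n + 1) + 10 * n + 12)) u1"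
  proof (rule wp_conseq[OF G], goal_cases)
   case (1 u)
   have "F1 u" using F1 by (simp add: F1_def F_def frame_simps[OF 1(1)] u1_def)
   from C[OF this] show ?case by (rule wp_conseq) (use 1(2) n02le in \<open>auto simp: u1_def\<close>)
  qed
  then show ?thesis using B by (simp add: u1_def)
 qed
 define u1 where "u1 = s(|tm := tm s + 7, vr := (vr s)(vN0 := n0 n, vN02 := n02 n, vCnt := 0, vI := 0),
   ar := (ar s)(aRK := (ar s aRK)(n := 0, Suc n := 0, Suc (Suc n) := 0))|)"
 have len': "length R' = n02 n" using red by (simp add: reduced_def n_def)
 let ?g = "ar s aA3"
 have gb: "bij_betw ?g {..<n02 n} {..<n02 n}" using sa len' by (simp add: isSA_def)
 have z: "ar u1 aRK x = 0" if "n <= x" "x < n + 3" for x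
 proof -
  have "x = n \<or> x = Suc n \<or> x = Suc (Suc n)" using that by linarith
  then show ?thesis by (auto simp: u1_def)
 qed
 have A: "wp (For vI vN02 rank_body) (%u. (\<forall>i<n02 n. ar u aA1 i = unidx n (?g i) & ar u aRK (unidx n (?g i)) = Suc i) &
   (\<forall>x. n <= x --> x < n + 3 --> x \<notin> sample n --> ar u aRK x = 0) & tm u <= tm u1 + 10 * n02 n + 1) u1"
  using wp_ranks[of u1 n, OF _ _ _ _ z] gb szs B by (simp add: u1_def)
 have "wp (For vI vN02 rank_body) (wp (vI ::= Lit 0 ;; For vI vN02 gather_body ;; vK ::= Var vM \<oplus> Var vLen \<oplus> Lit 1 ;; radix aA2 aA3 0 ;;
   vP ::= Var vN0 \<ominus> (Var vLen \<oplus> Lit 1) \<oslash> Lit 3 ;;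
   vQ ::= Lit 0 ;; vI ::= Lit 0 ;; For vI vLen merge_body ;;
   vI ::= Lit 0 ;; For vI vLen copy_body) (%u. isSA R (ar u aA3) & tm u <= tm s + 200 * (M + n + 1))) u1"
 proof (rule wp_conseq[OF A], goal_cases)
  case (1 u)
  have F: "F u" using len by (simp add: F_def frame_simps[OF 1(1)] u1_def M_def off_def)
  have a1: "ar u aA1 i = unidx n (?g i)" "ar u aRK (ar u aA1 i) = Suc i" if "i < n02 n" for i using 1(2) that by auto
  have bij1: "bij_betw (ar u aA1) {..<n02 n} (sample n)"
  proof -
   have "bij_betw (unidx n \<circ> ?g) {..<n02 n} (sample n)" using bij_betw_trans[OF gb unidx_bij] .
   moreover have "(unidx n \<circ> ?g) i = ar u aA1 i" if "i \<in> {..<n02 n}" for i using a1(1)[of i] that by simp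
   ultimately show ?thesis using bij_betw_cong[of "{..<n02 n}" "unidx n \<circ> ?g" "ar u aA1" "sample n"] by blast
  qed
  have gl: "?g i < n02 n" if "i < n02 n" for i using gb that by (auto simp: bij_betw_def)
  have s1: "sl R (ar u aA1 i) (ar u aA1 j)" if "i < j" "j < n02 n" for i j
  proof -
   have "sl R' (?g i) (?g j)" using sa that len' by (simp add: isSA_def)
   then show ?thesis using reduced_sl[OF pos red, of "unidx n (?g i)" "unidx n (?g j)"]
    unidx_sample[OF gl, of i] unidx_sample[OF gl, of j] idx_unidx[OF gl, of i] idx_unidx[OF gl, of j] a1(1)[of i] a1(1)[of j] that
    by (simp add: n_def)
  qed
  have rk: "rank_ok R (ar u aRK)" unfolding rank_ok_def n_def[symmetric]
  proof (intro conjI ballI allI impI)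
   have ex: "\<exists>i<n02 n. ar u aA1 i = x" if "x \<in> sample n" for x
    using bij1 that unfolding bij_betw_def by (metis imageE lessThan_iff)
   fix x y assume "x \<in> sample n" "y \<in> sample n"
   then obtain i j where ij: "i < n02 n" "j < n02 n" "ar u aA1 i = x" "ar u aA1 j = y" using ex by metis
   then show "ar u aRK x < ar u aRK y \<longleftrightarrow> sl R x y"
    using a1(2)[of i] a1(2)[of j] s1[of i j] s1[of j i] sl_asym[of R x y] by (metis Suc_less_eq linorder_neqE_nat sl_irrefl)
  next
   fix x assume "x \<in> sample n"
   then obtain i where "i < n02 n" "ar u aA1 i = x" using bij1 unfolding bij_betw_def by (metis imageE lessThan_iff)
   then show "0 < ar u aRK x" using a1(2)[of i] by simp
  next
   fix x assume "n <= x" "x \<notin> sample n" "x < n + 3"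
   then show "ar u aRK x = 0" using 1(2) by blast
  qed
  have "F1 u" using F bij1 s1 rk by (simp add: F1_def)
  moreover have "vr u vCnt = 0" by (simp add: frame_simps[OF 1(1)] u1_def)
  ultimately show ?case by (rule wp_conseq[OF Bb]) (use 1(2) n02le in \<open>auto simp: u1_def\<close>)
 qed
 note rest = this
 have one: "Suc 0 < B" "3 < B" "n + 2 < B" "n02 n < B" "n < sz s aRK" "Suc n < sz s aRK" "Suc (Suc n) < sz s aRK"
  using B szs n02le by auto
 have eqs: "Suc (Suc n) div 3 = n0 n" "n0 n + n div 3 = n02 n" by (simp_all add: n0_def n02_def)
 show ?thesis unfolding upstep_def using one len
  apply (simp add: eqs)
  apply (rule back_subst[of "wp _ _", OF rest[simplified]])
  apply (simp add: u1_def)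
  done
qed

end

section \<open>The recursion over the levels of reduced strings\<close>

definition offs :: "nat list list => nat => nat" where
 "offs Ls k = sum_list (map (%R. length R + 3) (take k Ls))"

lemma offs_Suc: "k < length Ls ==> offs Ls (Suc k) = offs Ls k + length (Ls ! k) + 3"
 by (simp add: offs_def take_Suc_conv_app_nth)

lemma offs_append: "k <= length Ls ==> offs (Ls @ Ms) k = offs Ls k"
 by (simp add: offs_def)

lemma offs_mono: "i <= j ==> j <= length Ls ==> offs Ls i <= offs Ls j"
proof (induction j)
 case (Suc j)
 then show ?case by (cases "i = Suc j") (auto simp: offs_Suc)
qed simp

definition levels :: "nat => nat list list => bool" where
 "levels M Ls \<longleftrightarrow> Ls ~= [] & (\<forall>R\<in>set Ls. posl R & R ~= [] & (\<forall>x<length R. R ! x <= M + length R)) &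
   (\<forall>j. Suc j < length Ls --> reduced (Ls ! j) (Ls ! Suc j) & 9 * length (Ls ! Suc j) <= 8 * length (Ls ! j))"

lemma levels_snoc:
 assumes "levels M Ls" "reduced (last Ls) R" "9 * length R <= 8 * length (last Ls)" "posl R" "R ~= []"
  "\<And>x. x < length R ==> R ! x <= M + length R"
 shows "levels M (Ls @ [R])"
proof -
 have "reduced ((Ls @ [R]) ! j) ((Ls @ [R]) ! Suc j) & 9 * length ((Ls @ [R]) ! Suc j) <= 8 * length ((Ls @ [R]) ! j)"
  if "j < length Ls" for j
 proof (cases "Suc j = length Ls")
  case True
  then have "Ls ! j = last Ls" using assms(1) by (metis diff_Suc_1 last_conv_nth levels_def)
  then show ?thesis using assms True by (simp add: nth_append)
 next
  case False
  then show ?thesis using assms(1) that by (simp add: nth_append levels_def)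
 qed
 then show ?thesis using assms by (auto simp: levels_def)
qed

definition inv_body :: com where
 "inv_body = Write aA3 (Idx aTX (Var vP \<oplus> Var vI) \<ominus> Lit 1) (Var vI)"

lemma inv_mods [simp]: "wv inv_body = {}" "wa inv_body = {aA3}" "al inv_body = {}"
 by (auto simp: inv_body_def)

text \<open>There is a single recursive call per level, so two loops and a record of offsets and
  lengths in \<open>aLO\<close> and \<open>aLN\<close> replace the call stack. The descent ends when
  all names are distinct.\<close>

definition down_loop :: com where
 "down_loop = Loop (Var vGo) (downstep ;;
   Cond (Var vNm \<lhd> Var vN02)
    (Write aLO (Var vLev) (Var vOff) ;; Write aLN (Var vLev) (Var vLen) ;; vLev ::= Var vLev \<oplus> Lit 1 ;;
    vOff ::= Var vP ;; vLen ::= Var vN02)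
    (vGo ::= Lit 0))"

definition up_loop :: com where
 "up_loop = Loop (Var vGo) (upstep ;;
   Cond (Var vLev \<doteq> Lit 0) (vGo ::= Lit 0)
    (vLev ::= Var vLev \<ominus> Lit 1 ;; vOff ::= Idx aLO (Var vLev) ;; vLen ::= Idx aLN (Var vLev)))"

definition dc3 :: com where
 "dc3 = vOff ::= Lit 0 ;; vLev ::= Lit 0 ;; vGo ::= Lit 1 ;; down_loop ;;
   vI ::= Lit 0 ;; For vI vN02 inv_body ;; vGo ::= Lit 1 ;; up_loop"

lemma down_mods [simp]: "wv down_loop = {vN0, vN02, vK, vCnt, vI, vX, vY, vNm, vP, vLev, vOff, vLen, vGo}"
 "wa down_loop = {aA1, aA2, aCNT, aTX, aLO, aLN}" "al down_loop = {}"
 by (auto simp: down_loop_def)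

lemma up_mods [simp]: "wv up_loop = {vN0, vN02, vK, vCnt, vI, vX, vY, vT, vP, vQ, vLev, vOff, vLen, vGo}"
 "wa up_loop = {aRK, aA1, aA2, aA3, aA4, aCNT}" "al up_loop = {}"
 by (auto simp: up_loop_def)

lemma dc3_mods [simp]: "wv dc3 = {vN0, vN02, vK, vCnt, vI, vX, vY, vT, vNm, vP, vQ, vLev, vOff, vLen, vGo}"
 "wa dc3 = {aRK, aA1, aA2, aA3, aA4, aCNT, aTX, aLO, aLN}" "al dc3 = {}"
 by (auto simp: dc3_def)

context machine
begin

lemma wp_downstep:
 fixes s :: state and R :: "nat list"
 defines "n \<equiv> length R" and "M \<equiv> vr s vM" and "off \<equiv> vr s vOff"
 assumes h: "holds s off R" and pos: "posl R" and len: "vr s vLen = n" "0 < n"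
  and ch: "\<And>x. x < n ==> R ! x <= M + n"
  and zero: "\<And>x. off + n + 3 <= x ==> ar s aTX x = 0"
  and szs: "n + 3 <= sz s aA1" "n + 3 <= sz s aA2" "M + n + 1 <= sz s aCNT" "off + 2 * n + 10 <= sz s aTX"
  and B: "sz s aTX + 10 < B" "M + 3 * n + 10 < B"
 shows "wp downstep (%u. (\<exists>R'. reduced R R' & holds u (off + n + 3) R' & (\<forall>x<n02 n. R' ! x <= vr u vNm) &
   (vr u vNm = n02 n --> (\<forall>i<n02 n. \<exists>j<n02 n. R' ! j = Suc i))) & (\<forall>x<off + n + 3. ar u aTX x = ar s aTX x) &
   (\<forall>x\<ge>off + n + 3 + n02 n + 3. ar u aTX x = 0) & 1 <= vr u vNm & vr u vNm <= n02 n &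
   vr u vP = off + n + 3 & vr u vN02 = n02 n & tm u <= tm s + 200 * (M + n + 1)) s"
proof -
 have nn: "n02 n <= n + 1" "0 < n02 n" using n02_le n02_pos[OF len(2)] n0_le_n02[of n] by auto
 show ?thesis unfolding downstep_def wp_Seq
 proof (rule wp_sort3[where R = R], goal_cases)
  case (11 u)
  let ?f = "ar u aA2"
  have u: "vr u vOff = off" "vr u vLen = n" "vr u vN0 = n0 n" "vr u vN02 = n02 n" "ar u aTX = ar s aTX" "sz u = sz s"
   using len 11(4,5) by (simp_all add: frame_simps[OF 11(1)] off_def n_def)
  define u1 where "u1 = u(|tm := Suc (Suc (Suc (tm u))), vr := (vr u)(vNm := 0, vP := off + n + 3, vI := 0)|)"
  have N: "wp (For vI vN02 naming_body) (%v. vr v vNm = nmf R (ar u1 aA2) (n02 n - 1) &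
   (\<forall>i<n02 n. ar v aTX (vr u1 vOff + n + 3 + idx n (ar u1 aA2 i)) = nmf R (ar u1 aA2) i) &
   (\<forall>x<vr u1 vOff + n + 3. ar v aTX x = ar u1 aTX x) & (\<forall>x\<ge>vr u1 vOff + n + 3 + n02 n. ar v aTX x = 0) &
   tm v <= tm u1 + 11 * n02 n + 1) u1" unfolding n_def
   by (rule wp_naming)
    (use h u zero 11(2) szs B nn len in \<open>simp_all add: u1_def holds_def n_def[symmetric]\<close>)
  have "wp (For vI vN02 naming_body) (%u. (\<exists>R'. reduced R R' & holds u (off + n + 3) R' & (\<forall>x<n02 n. R' ! x <= vr u vNm) &
   (vr u vNm = n02 n --> (\<forall>i<n02 n. \<exists>j<n02 n. R' ! j = Suc i))) & (\<forall>x<off + n + 3. ar u aTX x = ar s aTX x) &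
   (\<forall>x\<ge>off + n + 3 + n02 n + 3. ar u aTX x = 0) & 1 <= vr u vNm & vr u vNm <= n02 n &
   vr u vP = off + n + 3 & vr u vN02 = n02 n & tm u <= tm s + 200 * (M + n + 1)) u1"
  proof (rule wp_conseq[OF N], goal_cases)
   case (1 v)
   have v: "vr v vNm = nmf R ?f (n02 n - 1)" "\<And>i. i < n02 n ==> ar v aTX (off + n + 3 + idx n (?f i)) = nmf R ?f i"
    "\<forall>x<off + n + 3. ar v aTX x = ar s aTX x" "\<forall>x\<ge>off + n + 3 + n02 n. ar v aTX x = 0"
    "tm v <= tm u + 11 * n02 n + 4" using 1(2) u by (auto simp: u1_def)
   define R' where "R' = map (%j. ar v aTX (off + n + 3 + j)) [0..<n02 n]"
   have l: "length R' = n02 n" by (simp add: R'_def)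
   have inb: "idx n (?f i) < n02 n" if "i < n02 n" for i using idx_less 11(2) that by (auto simp: bij_betw_def n_def)
   have R'n: "R' ! idx n (?f i) = nmf R ?f i" if "i < n02 n" for i using v(2)[OF that] inb[OF that] by (simp add: R'_def)
   have red: "reduced R R'" "\<And>j. j < n02 n ==> R' ! j <= nmf R ?f (n02 n - 1)"
    "\<And>i. nmf R ?f (n02 n - 1) = n02 n ==> i < n02 n ==> nmf R ?f i = Suc i"
    using nmf_reduced[of ?f R R'] 11(2,3) l R'n unfolding n_def by blast+
   have hold: "holds v (off + n + 3) R'" unfolding holds_def l
   proof (intro allI impI)
    fix k assume "k < n02 n + 3"
    then show "ar v aTX (off + n + 3 + k) = zc R' k" using v(4) l by (cases "k < n02 n") (auto simp: zc_def R'_def)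
   qed
   have uniq: "\<exists>j<n02 n. R' ! j = Suc i" if "nmf R ?f (n02 n - 1) = n02 n" "i < n02 n" for i
    using red(3)[OF that] R'n[OF that(2)] inb[OF that(2)] by metis
   have nm: "1 <= nmf R ?f (n02 n - 1)" "nmf R ?f (n02 n - 1) <= n02 n"
    using nmf_bounds[of R ?f "n02 n - 1"] nn by auto
   have t: "tm v <= tm s + 200 * (M + n + 1)" using v(5) 11(6) nn by (simp add: M_def n_def)
   have w: "vr v vP = off + n + 3" "vr v vN02 = n02 n" using u by (simp_all add: frame_simps[OF 1(1)] u1_def)
   have "\<exists>R'. reduced R R' & holds v (off + n + 3) R' & (\<forall>x<n02 n. R' ! x <= vr v vNm) &
    (vr v vNm = n02 n --> (\<forall>i<n02 n. \<exists>j<n02 n. R' ! j = Suc i))"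
    by (rule exI[of _ R']) (use red(1,2) hold uniq v(1) in auto)
   then show ?case using v(1,3,4) nm t w by auto
  qed
  then show ?case using u szs B by (simp add: u1_def)
 qed (use h len ch szs B in \<open>auto simp: n_def M_def off_def\<close>)
qed

text \<open>The last two conditions are potentials. A level of length n takes n + 3 cells, while the
  next is shorter by at least n / 9, which releases 36 n / 9 = 4 n; so 36 cells per character of the
  first level hold all levels. Likewise every new level costs at least one character, which bounds
  their number.\<close>

definition lev_state :: "nat list => nat => nat list list => state => bool" where
 "lev_state R M Ls u \<longleftrightarrow> levels M Ls & Ls ! 0 = R & (\<forall>j<length Ls. holds u (offs Ls j) (Ls ! j)) &
  (\<forall>j. Suc j < length Ls --> ar u aLO j = offs Ls j & ar u aLN j = length (Ls ! j)) &
  offs Ls (length Ls - 1) + 36 * length (last Ls) <= 36 * length R & length Ls - 1 + length (last Ls) <= length R"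

definition dc_sizes :: "nat => nat => state => bool" where
 "dc_sizes n M u \<longleftrightarrow> n + 3 <= sz u aA1 & n + 3 <= sz u aA2 & n + 3 <= sz u aA3 & n + 3 <= sz u aA4 & n + 3 <= sz u aRK &
   M + n + 1 <= sz u aCNT & 36 * n <= sz u aTX & n + 1 <= sz u aLO & n + 1 <= sz u aLN &
   sz u aTX + 10 < B & M + 3 * n + 10 < B"

lemma level_time: "0 < n ==> 200 * (M + n + 1) + 10 <= 250 * (M + 2) * (n::nat)"
proof -
 assume "0 < n"
 then have "M + n + 1 <= (M + 2) * n" "1 <= (M + 2) * n" by (cases n; simp)+
 then show ?thesis by (simp add: algebra_simps)
qed

lemma wp_down_loop:
 fixes s :: state and R :: "nat list"
 defines "n \<equiv> length R" and "M \<equiv> vr s vM"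
 assumes h: "holds s 0 R" and pos: "posl R" "0 < n" and vs: "vr s vLen = n" "vr s vOff = 0" "vr s vLev = 0" "vr s vGo = 1"
  and ch: "\<And>x. x < n ==> R ! x <= M + n" and zero: "\<And>x. n + 3 <= x ==> ar s aTX x = 0" and szs: "dc_sizes n M s"
 shows "wp down_loop (%u. \<exists>Ls R'. lev_state R M Ls u & vr u vLev = length Ls - 1 & vr u vOff = offs Ls (length Ls - 1) &
   vr u vLen = length (last Ls) & reduced (last Ls) R' & vr u vP + length R' + 3 <= sz u aTX & holds u (vr u vP) R' & vr u vN02 = length R' &
   length R' <= n + 1 & (\<forall>i<length R'. \<exists>j<length R'. R' ! j = Suc i) & (\<forall>i<length R'. R' ! i <= length R') &
   tm u <= tm s + 9 * (250 * (M + 2) * n) + 1) s"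
proof -
 let ?D = "250 * (M + 2)"
 \<comment> \<open>Geometric decay as a potential: of 9 \<open>?D\<close> per character, the current
   level uses up one \<open>?D\<close>, and the remaining 8 \<open>?D\<close> amount to 9
   \<open>?D\<close> per character of the next level.\<close>
 define I1 where "I1 u \<longleftrightarrow> (\<exists>Ls. lev_state R M Ls u & vr u vLev = length Ls - 1 & vr u vOff = offs Ls (length Ls - 1) &
   vr u vLen = length (last Ls) & (\<forall>x \<ge> vr u vOff + vr u vLen + 3. ar u aTX x = 0) &
   tm u + 9 * (?D * vr u vLen) <= tm s + 9 * (?D * n))" for u :: state
 define I0 where "I0 u \<longleftrightarrow> (\<exists>Ls R'. lev_state R M Ls u & vr u vLev = length Ls - 1 & vr u vOff = offs Ls (length Ls - 1) &
   vr u vLen = length (last Ls) & reduced (last Ls) R' & vr u vP + length R' + 3 <= sz u aTX & holds u (vr u vP) R' & vr u vN02 = length R' &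
   length R' <= n + 1 & (\<forall>i<length R'. \<exists>j<length R'. R' ! j = Suc i) & (\<forall>i<length R'. R' ! i <= length R') &
   tm u <= tm s + 9 * (?D * n))" for u :: state
 have I1s: "I1 s" unfolding I1_def
  by (rule exI[of _ "[R]"])
   (use h pos vs ch zero in \<open>auto simp: lev_state_def levels_def offs_def n_def\<close>)
 show ?thesis unfolding down_loop_def
 proof (rule wp_Loop[where I = "%u. (vr u vGo = 1 & I1 u) \<or> (vr u vGo = 0 & I0 u)" and T = "tm s + 9 * (?D * n)"], goal_cases)
  case 1
  then show ?case using I1s vs by simp
 next
  case (2 u)
  show ?case
  proof (cases "vr u vGo = 0")
   case True
   then have "I0 u" using 2 by auto
   then show ?thesis using True unfolding I0_def lev_state_def holds_def by simp blast
  next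
   case False
   then have go: "vr u vGo = 1" "I1 u" using 2 by auto
   then obtain Ls where Ls: "lev_state R M Ls u" "vr u vLev = length Ls - 1" "vr u vOff = offs Ls (length Ls - 1)"
    "vr u vLen = length (last Ls)" "\<forall>x \<ge> vr u vOff + vr u vLen + 3. ar u aTX x = 0"
    "tm u + 9 * (?D * vr u vLen) <= tm s + 9 * (?D * n)" unfolding I1_def by blast
   let ?R = "last Ls" and ?k = "length Ls - 1" and ?n = "length (last Ls)"
   have lv: "levels M Ls" and L0: "Ls ! 0 = R" and hl: "\<And>j. j < length Ls ==> holds u (offs Ls j) (Ls ! j)"
    and lo: "\<And>j. Suc j < length Ls ==> ar u aLO j = offs Ls j & ar u aLN j = length (Ls ! j)"
    and sp: "offs Ls ?k + 36 * ?n <= 36 * n" "?k + ?n <= n" using Ls(1) by (auto simp: lev_state_def n_def)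
   have ne: "Ls ~= []" using lv by (simp add: levels_def)
   have kl: "?k < length Ls" "Ls ! ?k = ?R" using ne by (auto simp: last_conv_nth)
   have Rin: "?R \<in> set Ls" using ne by simp
   have Rok: "posl ?R" "0 < ?n" "\<And>x. x < ?n ==> ?R ! x <= M + ?n" using lv Rin by (auto simp: levels_def)
   have sz: "sz u = sz s" "vr u vM = M" by (simp_all add: frame_simps[OF 2(2)] M_def)
   have room: "vr u vOff + 2 * ?n + 10 <= sz s aTX" using sp(1) Rok(2) szs Ls(3) unfolding dc_sizes_def by linarith
   let ?u = "tick u"
   have W: "wp downstep (%v. (\<exists>R'. reduced ?R R' & holds v (vr ?u vOff + ?n + 3) R' & (\<forall>x<n02 ?n. R' ! x <= vr v vNm) &
    (vr v vNm = n02 ?n --> (\<forall>i<n02 ?n. \<exists>j<n02 ?n. R' ! j = Suc i))) & (\<forall>x<vr ?u vOff + ?n + 3. ar v aTX x = ar ?u aTX x) &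
    (\<forall>x\<ge>vr ?u vOff + ?n + 3 + n02 ?n + 3. ar v aTX x = 0) & 1 <= vr v vNm & vr v vNm <= n02 ?n &
    vr v vP = vr ?u vOff + ?n + 3 & vr v vN02 = n02 ?n & tm v <= tm ?u + 200 * (vr ?u vM + ?n + 1)) ?u"
    by (rule wp_downstep)
     (use hl[OF kl(1)] kl Ls(3-5) Rok szs sp sz room in \<open>auto simp: dc_sizes_def holds_def\<close>)
   let ?tail = "Cond (Var vNm \<lhd> Var vN02)
    (Write aLO (Var vLev) (Var vOff) ;; Write aLN (Var vLev) (Var vLen) ;; vLev ::= Var vLev \<oplus> Lit 1 ;;
    vOff ::= Var vP ;; vLen ::= Var vN02) (vGo ::= Lit 0)"
   have "wp downstep (wp ?tail (%u. (vr u vGo = 1 & I1 u) \<or> (vr u vGo = 0 & I0 u))) ?u"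
   proof (rule wp_conseq[OF W], goal_cases)
    case (1 v)
    obtain R' where R': "reduced ?R R'" "holds v (offs Ls ?k + ?n + 3) R'" "\<forall>x<n02 ?n. R' ! x <= vr v vNm"
     "vr v vNm = n02 ?n --> (\<forall>i<n02 ?n. \<exists>j<n02 ?n. R' ! j = Suc i)" using 1(2) Ls(3) by auto
    have v: "\<forall>x<offs Ls ?k + ?n + 3. ar v aTX x = ar u aTX x" "\<forall>x\<ge>offs Ls ?k + ?n + 3 + n02 ?n + 3. ar v aTX x = 0"
     "1 <= vr v vNm" "vr v vNm <= n02 ?n" "vr v vP = offs Ls ?k + ?n + 3" "vr v vN02 = n02 ?n" "tm v <= tm u + 1 + 200 * (M + ?n + 1)"
     using 1(2) Ls(3) sz by auto
    have fv: "vr v vLev = ?k" "vr v vOff = offs Ls ?k" "vr v vLen = ?n" "vr v vGo = 1" "ar v aLO = ar u aLO" "ar v aLN = ar u aLN" "sz v = sz s"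
     using Ls go sz by (simp_all add: frame_simps[OF 1(1)])
    have len': "length R' = n02 ?n" using R'(1) by (simp add: reduced_def)
    have tb: "tm v + 9 <= tm u + ?D * ?n" using v(7) level_time[OF Rok(2), of M] by linarith
    have hv: "holds v (offs Ls j) (Ls ! j)" if "j < length Ls" for j
    proof -
     have "offs Ls (Suc j) <= offs Ls (Suc ?k)" using that ne by (intro offs_mono) auto
     then have "offs Ls j + length (Ls ! j) + 3 <= offs Ls ?k + ?n + 3" using that kl by (simp add: offs_Suc)
     then show ?thesis using hl[OF that] v(1) by (simp add: holds_def)
    qed
    show ?case
    proof (cases "vr v vNm < n02 ?n")
     case True
     then have s3: "3 <= ?n" "9 * n02 ?n <= 8 * ?n" using n02_shrink[of ?n] v(3) by auto
     let ?Ls = "Ls @ [R']"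
     have R'ne: "R' ~= []" using len' True by auto
     have chb: "R' ! x <= M + length R'" if "x < length R'" for x
      using R'(3) v(4) that len' by (metis le_trans le_add2)
     have posR': "posl R'" using R'(1) by (simp add: reduced_def)
     have lv': "levels M ?Ls" by (rule levels_snoc[OF lv R'(1) _ posR' R'ne chb]) (use s3 len' in auto)
     have off': "offs ?Ls (length Ls) = offs Ls ?k + ?n + 3"
      using offs_Suc[of ?k Ls] kl ne by (simp add: offs_append)
     let ?v = "v(|ar := (ar v)(aLO := (ar v aLO)(?k := offs Ls ?k), aLN := (ar v aLN)(?k := ?n)), tm := Suc (Suc (Suc (Suc (Suc (Suc (tm v)))))),
       vr := (vr v)(vLev := Suc ?k, vOff := offs Ls ?k + ?n + 3, vLen := n02 ?n)|)"
     have hv': "holds ?v (offs ?Ls j) (?Ls ! j)" if "j < length ?Ls" for j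
     proof (cases "j < length Ls")
      case True
      then show ?thesis using hv[OF True] by (simp add: holds_def nth_append offs_append)
     next
      case False
      then have "j = length Ls" using that by simp
      then show ?thesis using R'(2) off' by (simp add: holds_def)
     qed
     have lo': "ar ?v aLO j = offs ?Ls j & ar ?v aLN j = length (?Ls ! j)" if "Suc j < length ?Ls" for j
     proof (cases "j = ?k")
      case True
      then show ?thesis using kl by (simp add: offs_append nth_append)
     next
      case False
      then have "Suc j < length Ls" using that by simp
      then show ?thesis using lo[of j] False fv by (simp add: offs_append nth_append)
     qed
     have "lev_state R M ?Ls ?v" unfolding lev_state_def
      using lv' L0 hv' lo' sp s3 off' len' ne by (auto simp: nth_append n_def)
     moreover have "tm ?v + 9 * (?D * n02 ?n) <= tm s + 9 * (?D * n)"
     proof -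
      have "?D * (9 * n02 ?n) <= ?D * (8 * ?n)" using s3(2) by (rule mult_le_mono2)
      then have "9 * (?D * n02 ?n) <= 8 * (?D * ?n)" by (metis mult.left_commute)
      then have "tm v + 6 + 9 * (?D * n02 ?n) <= tm s + 9 * (?D * n)"
       using tb Ls(6)[unfolded Ls(4)] by linarith
      then show ?thesis by simp
     qed
     moreover have "\<forall>x\<ge>offs Ls ?k + ?n + 3 + n02 ?n + 3. ar ?v aTX x = 0" using v(2) by simp
     ultimately have "I1 ?v" unfolding I1_def
      by (intro exI[of _ ?Ls]) (use off' len' ne in auto)
     moreover have "?k < sz s aLO" "?k < sz s aLN" "Suc ?k < B" "Suc 0 < B" using sp Rok(2) szs by (auto simp: dc_sizes_def)
     ultimately show ?thesis using True fv v(5,6) ne by simp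
    next
     case False
     then have nm: "vr v vNm = n02 ?n" using v(4) by simp
     let ?v = "v(|tm := tm v + 2, vr := (vr v)(vGo := 0)|)"
     have "lev_state R M Ls ?v" using Ls(1) hv fv by (auto simp: lev_state_def holds_def)
     moreover have "offs Ls ?k + ?n + 3 + n02 ?n + 3 <= sz s aTX"
     proof -
      have "36 * n <= sz s aTX" using szs by (simp add: dc_sizes_def)
      then show ?thesis using sp(1) n02_le[of ?n] Rok(2) by linarith
     qed
     moreover have "n02 ?n <= n + 1" using n02_le[of ?n] sp by simp
     ultimately have "I0 ?v" unfolding I0_def
      apply (intro exI[of _ Ls] exI[of _ R'])
      using R' nm v fv len' tb Ls(4,6) by (auto simp: holds_def)
     then show ?thesis using nm v(6) szs by (simp add: dc_sizes_def)
    qed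
   qed
   moreover have "tm u <= tm s + 9 * (?D * n)" using Ls(6) by simp
   ultimately show ?thesis using go by simp
  qed
 qed
qed

lemma levels_le: "levels M Ls ==> j < length Ls ==> length (Ls ! j) <= length (Ls ! 0)"
proof (induction j)
 case (Suc j)
 then have "9 * length (Ls ! Suc j) <= 8 * length (Ls ! j)" by (simp add: levels_def)
 then show ?case using Suc by simp
qed simp

lemma wp_up_loop:
 fixes s :: state and Ls :: "nat list list"
 defines "n \<equiv> length (Ls ! 0)" and "M \<equiv> vr s vM"
 assumes ls: "lev_state (Ls ! 0) M Ls s" and vs: "vr s vLev = length Ls - 1" "vr s vOff = offs Ls (length Ls - 1)"
   "vr s vLen = length (last Ls)" "vr s vGo = 1" and red: "reduced (last Ls) R'" and sa: "isSA R' (ar s aA3)"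
  and szs: "dc_sizes n M s"
 shows "wp up_loop (%u. isSA (Ls ! 0) (ar u aA3) & tm u <= tm s + 9 * (250 * (M + 2) * n) + 1) s"
proof -
 let ?D = "250 * (M + 2)"
 have lv: "levels M Ls" and hl: "\<And>j. j < length Ls ==> holds s (offs Ls j) (Ls ! j)"
  and lo: "\<And>j. Suc j < length Ls ==> ar s aLO j = offs Ls j & ar s aLN j = length (Ls ! j)"
  and sp: "offs Ls (length Ls - 1) + 36 * length (last Ls) <= 36 * n" "length Ls - 1 + length (last Ls) <= n"
  using ls by (auto simp: lev_state_def n_def)
 have ne: "Ls ~= []" using lv by (simp add: levels_def)
 have lst: "last Ls = Ls ! (length Ls - 1)" using ne by (simp add: last_conv_nth)
 have Rok: "posl (Ls ! j)" "0 < length (Ls ! j)" "\<And>x. x < length (Ls ! j) ==> (Ls ! j) ! x <= M + length (Ls ! j)"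
  if "j < length Ls" for j using lv that by (auto simp: levels_def)
 have fit: "offs Ls j + length (Ls ! j) + 3 <= sz s aTX" if "j < length Ls" for j
 proof -
  have "offs Ls (Suc j) <= offs Ls (Suc (length Ls - 1))" using that ne by (intro offs_mono) auto
  moreover have "offs Ls (Suc (length Ls - 1)) = offs Ls (length Ls - 1) + length (last Ls) + 3"
   unfolding lst by (rule offs_Suc) (use ne in auto)
  ultimately have "offs Ls j + length (Ls ! j) + 3 <= offs Ls (length Ls - 1) + length (last Ls) + 3"
   using offs_Suc[OF that] by linarith
  moreover have "0 < length (last Ls)" using Rok(2)[of "length Ls - 1"] ne lst by simp
  moreover have "36 * n <= sz s aTX" using szs by (simp add: dc_sizes_def)
  ultimately show ?thesis using sp(1) by linarith
 qed
 \<comment> \<open>The mirror image of the descent: the deeper levels together have cost at most 8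
   \<open>?D\<close> per character of the current one.\<close>
 define I1 where "I1 u \<longleftrightarrow> (\<exists>k R'. k < length Ls & vr u vLev = k & vr u vOff = offs Ls k & vr u vLen = length (Ls ! k) &
  reduced (Ls ! k) R' & isSA R' (ar u aA3) & tm u <= tm s + 8 * (?D * length (Ls ! k)))" for u :: state
 define I0 where "I0 u \<longleftrightarrow> isSA (Ls ! 0) (ar u aA3) & tm u <= tm s + 9 * (?D * n)" for u :: state
 have tmb: "9 * (?D * length (Ls ! k)) <= 9 * (?D * n)" if "k < length Ls" for k
  using levels_le[OF lv that] unfolding n_def by (intro mult_le_mono2) auto
 show ?thesis unfolding up_loop_def
 proof (rule wp_Loop[where I = "%u. (vr u vGo = 1 & I1 u) \<or> (vr u vGo = 0 & I0 u)" and T = "tm s + 9 * (?D * n)"], goal_cases)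
  case 1
  have "I1 s" unfolding I1_def
   by (rule exI[of _ "length Ls - 1"], rule exI[of _ R']) (use vs red sa ne lst in auto)
  then show ?case using vs by simp
 next
  case (2 u)
  show ?case
  proof (cases "vr u vGo = 0")
   case True
   then have "I0 u" using 2 by auto
   then show ?thesis using True unfolding I0_def by simp
  next
   case False
   then have go: "vr u vGo = 1" "I1 u" using 2 by auto
   then obtain k R1 where k: "k < length Ls" "vr u vLev = k" "vr u vOff = offs Ls k" "vr u vLen = length (Ls ! k)"
    "reduced (Ls ! k) R1" "isSA R1 (ar u aA3)" "tm u <= tm s + 8 * (?D * length (Ls ! k))" unfolding I1_def by blast
   have fu: "sz u = sz s" "vr u vM = M" "ar u aTX = ar s aTX" "ar u aLO = ar s aLO" "ar u aLN = ar s aLN"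
    by (simp_all add: frame_simps[OF 2(2)] M_def)
   let ?u = "tick u" and ?n = "length (Ls ! k)"
   have nl: "?n <= n" using levels_le[OF lv k(1)] by (simp add: n_def)
   have W: "wp upstep (%v. isSA (Ls ! k) (ar v aA3) & tm v <= tm ?u + 200 * (vr ?u vM + ?n + 1)) ?u"
    by (rule wp_upstep[where R' = R1])
     (use hl[OF k(1)] k Rok[OF k(1)] szs nl fit[OF k(1)] fu in \<open>auto simp: dc_sizes_def holds_def\<close>)
   let ?tail = "Cond (Var vLev \<doteq> Lit 0) (vGo ::= Lit 0)
    (vLev ::= Var vLev \<ominus> Lit 1 ;; vOff ::= Idx aLO (Var vLev) ;; vLen ::= Idx aLN (Var vLev))"
   have "wp upstep (wp ?tail (%u. (vr u vGo = 1 & I1 u) \<or> (vr u vGo = 0 & I0 u))) ?u"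
   proof (rule wp_conseq[OF W], goal_cases)
    case (1 v)
    have v: "isSA (Ls ! k) (ar v aA3)" "tm v <= tm u + 1 + 200 * (M + ?n + 1)" using 1(2) fu by auto
    have tb: "tm v + 9 <= tm s + 9 * (?D * ?n)" using v(2) level_time[OF Rok(2)[OF k(1)], of M] k(7) by linarith
    have fv: "vr v vLev = k" "vr v vGo = 1" "sz v = sz s" "ar v aLO = ar s aLO" "ar v aLN = ar s aLN"
     using k fu go by (simp_all add: frame_simps[OF 1(1)])
    have bb: "Suc 0 < B" "k < B" "k < sz s aLO" "k < sz s aLN" using szs k(1) sp Rok(2)[of "length Ls - 1"] ne lst
     by (auto simp: dc_sizes_def)
    show ?case
    proof (cases k)
     case 0
     have "I0 (v(|tm := Suc (Suc (tm v)), vr := (vr v)(vGo := 0)|))"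
     proof -
      have "tm v + 9 <= tm s + 9 * (?D * n)" using le_trans[OF tb add_le_mono[OF le_refl tmb[OF k(1)]]] .
      then show ?thesis unfolding I0_def using v(1) 0 by simp
     qed
     then show ?thesis using 0 fv bb by simp
    next
     case (Suc j)
     have r: "reduced (Ls ! j) (Ls ! k)" "9 * ?n <= 8 * length (Ls ! j)" using lv k(1) Suc by (auto simp: levels_def)
     have "?D * (9 * ?n) <= ?D * (8 * length (Ls ! j))" using r(2) by (rule mult_le_mono2)
     then have "9 * (?D * ?n) <= 8 * (?D * length (Ls ! j))" by (metis mult.left_commute)
     then have t: "tm v + 9 <= tm s + 8 * (?D * length (Ls ! j))" using tb by linarith
     have "I1 (v(|tm := Suc (Suc (Suc (Suc (tm v)))), vr := (vr v)(vLev := j, vOff := offs Ls j, vLen := length (Ls ! j))|))"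
      unfolding I1_def by (rule exI[of _ j], rule exI[of _ "Ls ! k"]) (use r(1) v(1) t Suc k(1) in simp)
     then show ?thesis using Suc fv bb lo[of j] k(1) by simp
    qed
   qed
   moreover have "tm u <= tm s + 9 * (?D * n)" using k(7) tmb[OF k(1)] by linarith
   ultimately show ?thesis using go by simp
  qed
 qed
qed

lemma wp_dc3:
 fixes s :: state and R :: "nat list"
 defines "n \<equiv> length R" and "M \<equiv> vr s vM"
 assumes h: "holds s 0 R" and pos: "posl R" "0 < n" and vs: "vr s vLen = n"
  and ch: "\<And>x. x < n ==> R ! x <= M + n" and zero: "\<And>x. n + 3 <= x ==> ar s aTX x = 0" and szs: "dc_sizes n M s"
 shows "wp dc3 (%u. isSA R (ar u aA3) & holds u 0 R & tm u <= tm s + 5000 * (M + 2) * n) s"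
proof -
 let ?D = "250 * (M + 2) * n"
 have Dn: "500 * n <= ?D" "1 <= n" using pos(2) by auto
 define s1 where "s1 = s(|tm := Suc (Suc (Suc (tm s))), vr := (vr s)(vOff := 0, vLev := 0, vGo := 1)|)"
 have bb: "Suc 0 < B" "n + 1 < B" using szs by (auto simp: dc_sizes_def)
 have W: "wp down_loop (%u. \<exists>Ls R'. lev_state R (vr s1 vM) Ls u & vr u vLev = length Ls - 1 & vr u vOff = offs Ls (length Ls - 1) &
   vr u vLen = length (last Ls) & reduced (last Ls) R' & vr u vP + length R' + 3 <= sz u aTX & holds u (vr u vP) R' & vr u vN02 = length R' &
   length R' <= n + 1 & (\<forall>i<length R'. \<exists>j<length R'. R' ! j = Suc i) & (\<forall>i<length R'. R' ! i <= length R') &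
   tm u <= tm s1 + 9 * (250 * (vr s1 vM + 2) * n) + 1) s1"
  unfolding n_def by (rule wp_down_loop)
   (use h pos vs ch zero szs in \<open>auto simp: s1_def M_def n_def holds_def dc_sizes_def\<close>)
 have "wp down_loop (wp (vI ::= Lit 0 ;; For vI vN02 inv_body ;; vGo ::= Lit 1 ;; up_loop)
   (%u. isSA R (ar u aA3) & holds u 0 R & tm u <= tm s + 5000 * (M + 2) * n)) s1"
 proof (rule wp_conseq[OF W], goal_cases)
  case (1 u)
  then obtain Ls R' where L: "lev_state R M Ls u" "vr u vLev = length Ls - 1" "vr u vOff = offs Ls (length Ls - 1)"
   "vr u vLen = length (last Ls)" "reduced (last Ls) R'" "vr u vP + length R' + 3 <= sz u aTX" "holds u (vr u vP) R'"
   "vr u vN02 = length R'" "length R' <= n + 1" "\<forall>i<length R'. \<exists>j<length R'. R' ! j = Suc i" "\<forall>i<length R'. R' ! i <= length R'"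
   "tm u <= tm s + 9 * ?D + 4" by (auto simp: s1_def M_def)
  have fu: "sz u = sz s" "vr u vM = M" by (simp_all add: frame_simps[OF 1(1)] s1_def M_def)
  have posR: "posl R'" using L(5) by (simp add: reduced_def)
  let ?N = "length R'"
  \<comment> \<open>The names take every value from 1 to their number, hence none twice; so the
    inversion loop overwrites nothing.\<close>
  have img: "(%i. R' ! i) ` {..<?N} = {1..?N}"
  proof
   show "(%i. R' ! i) ` {..<?N} \<subseteq> {1..?N}" using posR L(11) by (auto simp: posl_def Suc_le_eq)
   show "{1..?N} \<subseteq> (%i. R' ! i) ` {..<?N}"
   proof
    fix x assume "x \<in> {1..?N}"
    then have "x - 1 < ?N" "Suc (x - 1) = x" by auto
    then obtain j where "j < ?N" "R' ! j = x" using L(10) by metis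
    then show "x \<in> (%i. R' ! i) ` {..<?N}" by auto
   qed
  qed
  have inj: "inj_on (%i. R' ! i) {..<?N}" by (rule eq_card_imp_inj_on) (simp_all add: img)
  have rng: "1 <= R' ! i" "R' ! i <= ?N" if "i < ?N" for i using img that by auto
  have hz: "ar u aTX (vr u vP + i) = R' ! i" if "i < ?N" for i using L(7) that by (simp add: holds_def zc_def)
  define u1 where "u1 = u(|tm := Suc (tm u), vr := (vr u)(vI := 0)|)"
  have V: "wp (For vI vN02 inv_body) (%v. (\<forall>i<?N. ar v aA3 (R' ! i - 1) = i) & tm v <= tm u1 + 3 * ?N + 1) u1"
  proof (rule wp_For[where I = "%k v. \<forall>i<k. ar v aA3 (R' ! i - 1) = i" and D = 1], goal_cases)
   case (8 k v)
   have k: "k < ?N" using 8(2) L(8) by (simp add: u1_def)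
   have v: "vr v vP = vr u vP" "ar v aTX = ar u aTX" "sz v = sz s" "vr v vI = k"
    using 8(3) fu by (simp_all add: frame_simps[OF 8(4)] u1_def)
   have "\<forall>i<Suc k. ((ar v aA3)(R' ! k - 1 := k)) (R' ! i - 1) = i"
   proof (intro allI impI)
    fix i assume i: "i < Suc k"
    show "((ar v aA3)(R' ! k - 1 := k)) (R' ! i - 1) = i"
    proof (cases "i = k")
     case False
     then have "R' ! i ~= R' ! k" using inj i k by (auto simp: inj_on_def)
     then have "R' ! i - 1 ~= R' ! k - 1" using rng(1)[of i] rng(1)[of k] i k by linarith
     then show ?thesis using 8(5) i False by simp
    qed simp
   qed
   moreover have "R' ! k - 1 < sz s aA3" "R' ! k < B" "vr u vP + k < sz s aTX" "vr u vP + k < B" "1 <= R' ! k"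
    using rng[OF k] L(6,9) szs k fu by (auto simp: dc_sizes_def)
   ultimately show ?case unfolding inv_body_def using v hz[OF k] bb by simp
  next
   case (9 v)
   then show ?case using L(8) by (simp add: u1_def)
  qed (use L bb in \<open>auto simp: u1_def\<close>)
  have "wp (For vI vN02 inv_body) (wp (vGo ::= Lit 1 ;; up_loop)
    (%u. isSA R (ar u aA3) & holds u 0 R & tm u <= tm s + 5000 * (M + 2) * n)) u1"
  proof (rule wp_conseq[OF V], goal_cases)
   case (1 v)
   have sa: "isSA R' (ar v aA3)" by (rule isSA_unique) (use 1(2) L(10) posR in auto)
   have L0: "Ls ! 0 = R" using L(1) by (simp add: lev_state_def)
   define v1 where "v1 = v(|tm := Suc (tm v), vr := (vr v)(vGo := Suc 0)|)"
   have fv: "lev_state R M Ls v1" "vr v1 vLev = length Ls - 1" "vr v1 vOff = offs Ls (length Ls - 1)"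
    "vr v1 vLen = length (last Ls)" "vr v1 vM = M" "sz v1 = sz s" "vr v1 vGo = 1"
    using L fu by (simp_all add: frame_simps[OF 1(1)] u1_def v1_def lev_state_def holds_def)
   have U: "wp up_loop (%u. isSA (Ls ! 0) (ar u aA3) & tm u <= tm v1 + 9 * (250 * (vr v1 vM + 2) * length (Ls ! 0)) + 1) v1"
    by (rule wp_up_loop[where R' = R'])
     (use fv L0 L(5) sa szs in \<open>auto simp: n_def dc_sizes_def v1_def\<close>)
   have "wp up_loop (%u. isSA R (ar u aA3) & holds u 0 R & tm u <= tm s + 5000 * (M + 2) * n) v1"
   proof (rule wp_conseq[OF U], goal_cases)
    case (1 x)
    have "holds v1 0 R" using fv(1) L0 by (auto simp: lev_state_def levels_def offs_def)
    then have "holds x 0 R" by (simp add: holds_def frame_simps[OF 1(1)])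
    moreover have "tm x <= tm v + 1 + 9 * ?D + 1" using 1(2) fv(5) L0 by (simp add: v1_def n_def)
    moreover have "tm v <= tm u + 3 * (n + 1) + 2" using \<open>_ & tm v <= _\<close> L(9) by (simp add: u1_def)
    moreover have "5000 * (M + 2) * n = 20 * ?D" by simp
    moreover have "tm x <= tm s + 20 * D" if "tm x <= tm v + 1 + 9 * D + 1" "tm v <= tm u + 3 * (n + 1) + 2"
     "tm u <= tm s + 9 * D + 4" "500 * n <= D" "1 <= n" for D
    proof -
     have a: "3 * n + 11 <= 2 * D" using that(4,5) by simp
     have b: "tm x <= tm s + 18 * D + 3 * n + 11" using that(1-3) by simp
     show ?thesis using a b by simp
    qed
    ultimately have "tm x <= tm s + 5000 * (M + 2) * n" using L(12) Dn by metis
    then show ?case using 1(2) L0 \<open>holds x 0 R\<close> by blast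
   qed
   then show ?case using bb by (simp add: v1_def)
  qed
  then show ?case using bb by (simp add: u1_def)
 qed
 then show ?thesis unfolding dc3_def using bb by (simp add: s1_def)
qed

end

section \<open>Greedy construction of the LZ78 factorization\<close>

text \<open>Unlike in \<open>lz78_factorization\<close>, maximality refers to the rest of S and not
  to the concatenation of the later factors, so it makes sense for an unfinished list.\<close>

definition lzp :: "'a list => 'a list list => bool" where
 "lzp S fs \<longleftrightarrow> concat fs = take (length (concat fs)) S & length (concat fs) <= length S &
   (\<forall>i<length fs. fs ! i \<in> lz78_candidates (take i fs) &
    (\<forall>g\<in>lz78_candidates (take i fs). prefix g (drop (length (concat (take i fs))) S) --> length g <= length (fs ! i)))"

lemma lzp_Nil: "lzp S []"
 by (simp add: lzp_def)

lemma lzp_complete: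
 assumes "lzp S fs" "length (concat fs) = length S"
 shows "lz78_factorization S fs"
proof -
 have c: "concat fs = S" using assms by (simp add: lzp_def)
 have "concat (drop i fs) = drop (length (concat (take i fs))) S" for i
  using c by (metis append_eq_conv_conj append_take_drop_id concat_append)
 then show ?thesis using assms(1) c by (simp add: lz78_factorization_def lzp_def)
qed

lemma lzp_step:
 assumes l: "lzp S fs" and F: "F \<in> set ([] # fs)" "prefix F (drop (length (concat fs)) S)"
  and mx: "\<And>f. f \<in> set fs ==> prefix f (drop (length (concat fs)) S) ==> length f <= length F"
  and lt: "length (concat fs) + length F < length S"
 shows "lzp S (fs @ [F @ [S ! (length (concat fs) + length F)]])"
proof -
 let ?p = "length (concat fs)" and ?c = "S ! (length (concat fs) + length F)"
 have Ft: "F = take (length F) (drop ?p S)" using F(2) by (metis append_eq_conv_conj prefix_def)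
 have "take (?p + length F + 1) S = take ?p S @ take (length F) (drop ?p S) @ [?c]"
  using lt by (simp add: take_Suc_conv_app_nth take_add)
 then have c: "concat (fs @ [F @ [?c]]) = take (length (concat (fs @ [F @ [?c]]))) S"
  using l Ft by (simp add: lzp_def)
 have cand: "F @ [?c] \<in> lz78_candidates fs" using F(1) by (auto simp: lz78_candidates_def)
 have "length g <= length (F @ [?c])" if "g \<in> lz78_candidates fs" "prefix g (drop ?p S)" for g
  using that mx by (auto simp: lz78_candidates_def dest: append_prefixD)
 then have "(fs @ [F @ [?c]]) ! i \<in> lz78_candidates (take i (fs @ [F @ [?c]])) &
   (\<forall>g\<in>lz78_candidates (take i (fs @ [F @ [?c]])). prefix g (drop (length (concat (take i (fs @ [F @ [?c]])))) S) -->
    length g <= length ((fs @ [F @ [?c]]) ! i))" if "i < length (fs @ [F @ [?c]])" for i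
  using that cand l by (cases "i = length fs") (auto simp: nth_append lzp_def)
 then show ?thesis using c lt unfolding lzp_def by auto
qed

lemma lzp_no_sentinel:
 assumes "lzp S fs" "sentinel_terminated d S" "length (concat fs) < length S" "f \<in> set fs"
 shows "d \<notin> set f"
proof -
 have "set f \<subseteq> set (concat fs)" using assms(4) by auto
 also have "concat fs = take (length (concat fs)) S" using assms(1) by (simp add: lzp_def)
 also have "set \<dots> \<subseteq> set (take (length S - 1) S)" by (rule set_take_subset_set_take) (use assms(3) in simp)
 also have "take (length S - 1) S = butlast S" by (simp add: butlast_conv_take)
 finally show ?thesis using assms(2) by (auto simp: sentinel_terminated_def)
qed

text \<open>A match that reached the end of S would contain the sentinel. Hence a character always
  remains to extend the longest match to a factor.\<close>

lemma sentinel_short: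
 assumes "sentinel_terminated d S" "d \<notin> set F" "prefix F (drop p S)" "p < length S"
 shows "p + length F < length S"
proof (rule ccontr)
 assume "\<not> p + length F < length S"
 then have "length F \<ge> length (drop p S)" by simp
 then have "F = drop p S" using assms(3) by (metis append_eq_conv_conj append_self_conv prefix_def drop_all take_all)
 then have "last S \<in> set F" using assms(4) by (metis drop_eq_Nil last_drop last_in_set not_le)
 then show False using assms by (auto simp: sentinel_terminated_def)
qed

text \<open>The greedy choice can always be continued. This gives existence, and with uniqueness it
  identifies whatever has been computed so far as an initial part of the factorization.\<close>

lemma lzp_extend:
 assumes "lzp S fs" "sentinel_terminated d S"
 shows "\<exists>gs. lz78_factorization S (fs @ gs)"
 using assms(1)
proof (induction "length S - length (concat fs)" arbitrary: fs rule: less_induct)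
 case less
 show ?case
 proof (cases "length (concat fs) = length S")
  case True
  then show ?thesis using lzp_complete[OF less.prems] by (intro exI[of _ "[]"]) simp
 next
  case False
  let ?p = "length (concat fs)"
  have p: "?p < length S" using False less.prems by (simp add: lzp_def)
  let ?C = "{f \<in> set ([] # fs). prefix f (drop ?p S)}"
  have "finite ?C" "?C ~= {}" by auto
  then obtain F where F: "F \<in> ?C" "\<And>f. f \<in> ?C ==> length f <= length F"
   using Max_in[of "length ` ?C"] Max_ge[of "length ` ?C"] by (smt (verit) finite_imageI image_iff image_is_empty)
  have "d \<notin> set F" using F(1) lzp_no_sentinel[OF less.prems assms(2) p] by auto
  then have lt: "?p + length F < length S" using sentinel_short[OF assms(2)] F(1) p by auto
  have st: "lzp S (fs @ [F @ [S ! (?p + length F)]])"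
   by (rule lzp_step[OF less.prems]) (use F lt in auto)
  have "length S - length (concat (fs @ [F @ [S ! (?p + length F)]])) < length S - ?p" using p by simp
  from less.hyps[OF this st] show ?thesis by auto
 qed
qed

section \<open>The trie of factors\<close>

definition nodes_ok :: "'a list list => bool" where
 "nodes_ok fs \<longleftrightarrow> distinct ([] # fs) &
   (\<forall>k<length fs. \<exists>j c. j <= k & ([] # fs) ! Suc k = ([] # fs) ! j @ [c])"

lemma nodes_prefix:
 assumes "nodes_ok fs"
 shows "a <= length fs ==> l <= length (([] # fs) ! a) ==> \<exists>b\<le>a. ([] # fs) ! b = take l (([] # fs) ! a)"
proof (induction a rule: less_induct)
 case (less a)
 show ?case
 proof (cases "l = length (([] # fs) ! a)")
  case True
  then show ?thesis by auto
 next
  case False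
  then obtain k where k: "a = Suc k" using less.prems by (cases a) auto
  then obtain j c where jc: "j <= k" "([] # fs) ! a = ([] # fs) ! j @ [c]"
   using assms less.prems unfolding nodes_ok_def by (metis Suc_le_eq)
  then have "l <= length (([] # fs) ! j)" using False less.prems by simp
  then obtain b where "b <= j" "([] # fs) ! b = take l (([] # fs) ! j)" using less.IH[of j] jc k less.prems by auto
  then show ?thesis using jc k \<open>l <= length (([] # fs) ! j)\<close> by (intro exI[of _ b]) auto
 qed
qed

text \<open>If node b were shorter than the earlier node a, it would be a prefix of a and thus equal
  to a node of index at most a, against distinctness. So the largest index among matching nodes
  belongs to the longest match.\<close>

lemma nodes_longest:
 assumes ok: "nodes_ok fs" and ab: "a <= b" "b <= length fs"
  and pre: "prefix (([] # fs) ! a) X" "prefix (([] # fs) ! b) X"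
 shows "length (([] # fs) ! a) <= length (([] # fs) ! b)"
proof (rule ccontr)
 assume n: "\<not> ?thesis"
 then have "prefix (([] # fs) ! b) (([] # fs) ! a)" using pre by (metis nat_le_linear prefix_length_prefix)
 then have "([] # fs) ! b = take (length (([] # fs) ! b)) (([] # fs) ! a)" by (metis append_eq_conv_conj prefix_def)
 then obtain b' where b': "b' <= a" "([] # fs) ! b' = ([] # fs) ! b"
  using nodes_prefix[OF ok, of a "length (([] # fs) ! b)"] n ab by auto
 have "distinct ([] # fs)" using ok by (simp add: nodes_ok_def)
 moreover have "b' < length ([] # fs)" "b < length ([] # fs)" using b' ab by auto
 ultimately have "b' = b" using b'(2) nth_eq_iff_index_eq by blast
 then have "a = b" using b' ab by simp
 then show False using n by simp
qed

text \<open>A node and its ancestors, one of each smaller positive length, are factors on disjoint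
  parts of the string.\<close>

lemma lzp_node_length:
 assumes "nodes_ok fs"
 shows "k <= length fs ==> length (([] # fs) ! k) * (length (([] # fs) ! k) + 1) <= 2 * length (concat (take k fs))"
proof (induction k rule: less_induct)
 case (less k)
 show ?case
 proof (cases k)
  case (Suc i)
  then obtain j c where jc: "j <= i" "([] # fs) ! k = ([] # fs) ! j @ [c]"
   using assms less.prems unfolding nodes_ok_def by (metis Suc_le_eq)
  let ?L = "length (([] # fs) ! j)"
  have IH: "?L * (?L + 1) <= 2 * length (concat (take j fs))" using less.IH[of j] less.prems jc Suc by simp
  have "take k fs = take i fs @ [fs ! i]" using Suc less.prems by (simp add: take_Suc_conv_app_nth)
  then have "length (concat (take k fs)) = length (concat (take i fs)) + (?L + 1)" using jc Suc by simp
  moreover have "length (concat (take j fs)) <= length (concat (take i fs))"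
  proof -
   have "take i fs = take j fs @ drop j (take i fs)" using jc by (metis append_take_drop_id min.absorb1 take_take)
   then show ?thesis by (metis concat_append le_add1 length_append)
  qed
  ultimately have "2 * length (concat (take k fs)) \<ge> ?L * (?L + 1) + 2 * (?L + 1)" using IH by simp
  moreover have "length (([] # fs) ! k) = ?L + 1" using jc by simp
  ultimately show ?thesis by (simp add: algebra_simps)
 qed simp
qed

text \<open>Suffixes that share a prefix of length l are ordered by the character after it. So at
  depth l characters increase along the interval of a node, which is what binary search for a child
  needs.\<close>

lemma sl_common:
 assumes "posl R"
 shows "sl R x y ==> (\<And>i. i < l ==> zc R (x + i) = zc R (y + i)) ==> zc R (x + l) <= zc R (y + l)"
proof (induction l arbitrary: x y)
 case 0
 then show ?case using sl_unfold[OF assms, of x y] by auto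
next
 case (Suc l)
 have "zc R x = zc R y" using Suc.prems(2)[of 0] by simp
 then have "sl R (Suc x) (Suc y)" using Suc.prems(1) sl_unfold[OF assms, of x y] by auto
 moreover have "zc R (Suc x + i) = zc R (Suc y + i)" if "i < l" for i using Suc.prems(2)[of "Suc i"] that by simp
 ultimately show ?case using Suc.IH[of "Suc x" "Suc y"] by simp
qed

text \<open>A positive character never equals the padding, so agreement with the padded reading
  already keeps the match inside the string.\<close>

lemma prefix_drop_zc:
 assumes "posl R" "\<And>i. i < length f ==> 0 < f ! i"
 shows "prefix f (drop x R) \<longleftrightarrow> (\<forall>i<length f. zc R (x + i) = f ! i)"
proof
 assume "prefix f (drop x R)"
 then obtain g where g: "drop x R = f @ g" by (auto simp: prefix_def)
 show "\<forall>i<length f. zc R (x + i) = f ! i"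
 proof (intro allI impI)
  fix i assume i: "i < length f"
  have "length R - x = length f + length g" using g by (metis length_append length_drop)
  then have "x + i < length R" using i by simp
  moreover have "drop x R ! i = f ! i" using g i by (simp add: nth_append)
  ultimately show "zc R (x + i) = f ! i" by (simp add: zc_def)
 qed
next
 assume *: "\<forall>i<length f. zc R (x + i) = f ! i"
 then have in': "x + i < length R" if "i < length f" for i using assms that zc_zero[OF assms(1), of "x + i"] by (metis not_le less_irrefl)
 have le: "length f <= length R - x"
 proof (rule ccontr)
  assume "\<not> ?thesis"
  then have "x + (length R - x) < length R" by (intro in') simp
  then show False by simp
 qed
 have "take (length f) (drop x R) = f"
  by (rule nth_equalityI) (use * in' le in \<open>auto simp: zc_def\<close>)
 then show "prefix f (drop x R)" by (metis take_is_prefix)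
qed

section \<open>Stabbing queries on a bottom-up segment tree\<close>

text \<open>Leaf r is node t + r, and its ancestors are the quotients by powers of two. Every mark
  on the path of r names an interval that contains r, and an interval k that contains r has a mark
  of at least k there; so the largest mark on the path is the newest interval containing r.\<close>

definition seg_ok :: "nat => nat => (nat => nat) => (nat => nat) => (nat => nat) => bool" where
 "seg_ok t m lo hi E \<longleftrightarrow>
   (\<forall>r<t. \<forall>i. 0 < (t + r) div 2 ^ i --> E ((t + r) div 2 ^ i) <= m &
    lo (E ((t + r) div 2 ^ i)) <= r & r < hi (E ((t + r) div 2 ^ i))) &
   (\<forall>r<t. \<forall>k\<le>m. 0 < k --> lo k <= r --> r < hi k --> (\<exists>i. 0 < (t + r) div 2 ^ i & k <= E ((t + r) div 2 ^ i)))"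

text \<open>The leaves t, ..., 2 t - 1 span less than a factor of two. So a node marked for the
  leaves at distance j below it is not an ancestor of a leaf at any other distance, even if t is no
  power of two.\<close>

lemma seg_mark:
 assumes "t + lo <= y * 2 ^ j" "(y + 1) * 2 ^ j <= t + hi" "hi <= t" "r < t" "(t + r) div 2 ^ i = y"
 shows "lo <= r & r < (hi::nat)"
proof -
 have b: "y * 2 ^ i <= t + r" "t + r < (y + 1) * 2 ^ i"
  using assms(5) div_times_less_eq_dividend[of "t + r" "2 ^ i"] dividend_less_div_times[of "2 ^ i" "t + r"] by auto
 consider "i < j" | "i = j" | "j < i" by linarith
 then show ?thesis
 proof cases
  case 1
  then have "(2::nat) ^ (i + 1) <= 2 ^ j" by (intro power_increasing) auto
  then have "(y + 1) * (2 ^ i * 2) <= (y + 1) * 2 ^ j" by (intro mult_le_mono2) simp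
  then have "2 * ((y + 1) * 2 ^ i) <= t + hi" using assms(2) by (simp add: mult.assoc mult.left_commute)
  then show ?thesis using b assms(3) by linarith
 next
  case 2
  show ?thesis using order_less_le_trans[OF b(2)[unfolded 2] assms(2)] order_trans[OF assms(1) b(1)[unfolded 2]] by simp
 next
  case 3
  then have "(2::nat) ^ (j + 1) <= 2 ^ i" by (intro power_increasing) auto
  then have "y * (2 ^ j * 2) <= y * 2 ^ i" by (intro mult_le_mono2) simp
  from order_trans[OF this b(1)] have "2 * (y * 2 ^ j) <= t + r" by (simp only: mult_ac)
  then show ?thesis using assms by linarith
 qed
qed

text \<open>The new index exceeds all others, so overwriting a mark preserves the second condition
  for the older intervals.\<close>

lemma seg_update:
 assumes ok: "seg_ok t m lo hi E" and m: "m' = Suc m" and lh: "lo' m' = l" "hi' m' = h'" "\<And>k. k <= m ==> lo' k = lo k & hi' k = hi k"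
  and E': "\<And>y. E' y = (if y \<in> Mk then m' else E y)"
  and mk: "\<And>y r i. y \<in> Mk ==> r < t ==> (t + r) div 2 ^ i = y ==> l <= r & r < h'" "0 \<notin> Mk"
  and cov: "\<And>r. r < t ==> l <= r ==> r < h' ==> \<exists>i. (t + r) div 2 ^ i \<in> Mk"
 shows "seg_ok t m' lo' hi' E'"
 unfolding seg_ok_def
proof (intro conjI allI impI)
 fix r i assume r: "r < t" "0 < (t + r) div 2 ^ i"
 let ?y = "(t + r) div 2 ^ i"
 have "E ?y <= m & lo (E ?y) <= r & r < hi (E ?y)" using ok r by (auto simp: seg_ok_def)
 then show "E' ?y <= m'" "lo' (E' ?y) <= r" "r < hi' (E' ?y)"
  using E'[of ?y] lh m mk(1)[of ?y r i] r by (auto split: if_splits)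
next
 fix r k assume r: "r < t" "k <= m'" "0 < k" "lo' k <= r" "r < hi' k"
 show "\<exists>i. 0 < (t + r) div 2 ^ i & k <= E' ((t + r) div 2 ^ i)"
 proof (cases "k = m'")
  case True
  then obtain i where i: "(t + r) div 2 ^ i \<in> Mk" using cov[of r] r lh by auto
  then have "(t + r) div 2 ^ i ~= 0" using mk(2) by metis
  then show ?thesis using i True E' by (intro exI[of _ i]) auto
 next
  case False
  then have k: "k <= m" using r m by simp
  then obtain i where "0 < (t + r) div 2 ^ i" "k <= E ((t + r) div 2 ^ i)" using ok r k lh(3)[OF k] unfolding seg_ok_def by metis
  then show ?thesis using E' k m by (intro exI[of _ i]) auto
 qed
qed

abbreviation (input) "aITM \<equiv> 15::nat"
abbreviation (input) "aSEG \<equiv> 24::nat"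
abbreviation (input) "aREC \<equiv> 25::nat"
abbreviation (input) "vTl \<equiv> 60::nat"
abbreviation (input) "vMc \<equiv> 61::nat"
abbreviation (input) "vIt \<equiv> 62::nat"
abbreviation (input) "vNI \<equiv> 63::nat"
abbreviation (input) "vD \<equiv> 64::nat"
abbreviation (input) "vO \<equiv> 66::nat"
abbreviation (input) "vXq \<equiv> 67::nat"
abbreviation (input) "vKq \<equiv> 68::nat"
abbreviation (input) "vL \<equiv> 69::nat"
abbreviation (input) "vCh \<equiv> 70::nat"
abbreviation (input) "vLo \<equiv> 71::nat"
abbreviation (input) "vHi \<equiv> 72::nat"
abbreviation (input) "vA \<equiv> 73::nat"
abbreviation (input) "vB \<equiv> 74::nat"
abbreviation (input) "vMid \<equiv> 75::nat"

definition query_loop :: com where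
 "query_loop = Loop (Lit 0 \<lhd> Var vXq)
  (Cond (Var vKq \<lhd> Idx aSEG (Var vXq)) (vKq ::= Idx aSEG (Var vXq)) Skip ;; vXq ::= Var vXq \<oslash> Lit 2)"

definition search_loop :: "aexp => com" where
 "search_loop e = Loop (Var vA \<lhd> Var vB)
  (vMid ::= (Var vA \<oplus> Var vB) \<oslash> Lit 2 ;;
   Cond (Idx aTX (Idx aA3 (Var vMid) \<oplus> Var vL) \<lhd> e) (vA ::= Var vMid \<oplus> Lit 1) (vB ::= Var vMid))"

definition update_loop :: com where
 "update_loop = Loop (Var vA \<lhd> Var vB)
  (Cond (Var vA \<odot> Lit 2 \<doteq> Lit 1) (Write aSEG (Var vA) (Var vMc) ;; vA ::= Var vA \<oplus> Lit 1) Skip ;;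
   Cond (Var vB \<odot> Lit 2 \<doteq> Lit 1) (vB ::= Var vB \<ominus> Lit 1 ;; Write aSEG (Var vB) (Var vMc)) Skip ;;
   vA ::= Var vA \<oslash> Lit 2 ;; vB ::= Var vB \<oslash> Lit 2)"

lemma loop_mods [simp]: "wv query_loop = {vKq, vXq}" "wa query_loop = {}" "al query_loop = {}"
 "wv (search_loop e) = {vMid, vA, vB}" "wa (search_loop e) = {}" "al (search_loop e) = {}"
 "wv update_loop = {vA, vB}" "wa update_loop = {aSEG}" "al update_loop = {}"
 by (auto simp: query_loop_def search_loop_def update_loop_def)

context machine
begin

lemma wp_query:
 fixes s :: state
 assumes vs: "vr s vXq = x0" "vr s vKq = 0" and x0: "x0 < sz s aSEG" "x0 < 2 ^ lg" and B: "2 < B"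
 shows "wp query_loop (%u. (\<forall>i. 0 < x0 div 2 ^ i --> ar s aSEG (x0 div 2 ^ i) <= vr u vKq) &
   (vr u vKq = 0 \<or> (\<exists>i. 0 < x0 div 2 ^ i & vr u vKq = ar s aSEG (x0 div 2 ^ i))) & tm u <= tm s + 4 * lg + 1) s"
 unfolding query_loop_def
proof (rule wp_Loop[where I = "%u. \<exists>j\<le>lg. vr u vXq = x0 div 2 ^ j & (\<forall>i<j. 0 < x0 div 2 ^ i --> ar s aSEG (x0 div 2 ^ i) <= vr u vKq) &
   (vr u vKq = 0 \<or> (\<exists>i. 0 < x0 div 2 ^ i & vr u vKq = ar s aSEG (x0 div 2 ^ i))) & tm u <= tm s + 4 * j" and T = "tm s + 4 * lg"], goal_cases)
 case 1
 show ?case by (rule exI[of _ 0]) (use vs in auto)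
next
 case (2 u)
 then obtain j where j: "j <= lg" "vr u vXq = x0 div 2 ^ j" "\<forall>i<j. 0 < x0 div 2 ^ i --> ar s aSEG (x0 div 2 ^ i) <= vr u vKq"
  "vr u vKq = 0 \<or> (\<exists>i. 0 < x0 div 2 ^ i & vr u vKq = ar s aSEG (x0 div 2 ^ i))" "tm u <= tm s + 4 * j" by blast
 have f: "ar u aSEG = ar s aSEG" "sz u = sz s" by (simp_all add: frame_simps[OF 2(2)])
 show ?case
 proof (cases "x0 div 2 ^ j = 0")
  case True
  have all: "ar s aSEG (x0 div 2 ^ i) <= vr u vKq" if "0 < x0 div 2 ^ i" for i
  proof (cases "i < j")
   case False
   then have "(2::nat) ^ j <= 2 ^ i" by (intro power_increasing) auto
   moreover have "x0 < 2 ^ j" using True by (simp add: div_eq_0_iff)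
   ultimately have "x0 < 2 ^ i" by linarith
   then have "x0 div 2 ^ i = 0" by (rule div_less)
   then show ?thesis using that by simp
  qed (use j that in blast)
  then show ?thesis using True j B by simp
 next
  case False
  then have "j ~= lg" using x0(2) by auto
  then have jl: "Suc j <= lg" using j(1) by simp
  let ?y = "x0 div 2 ^ j"
  have y: "?y < sz s aSEG" using x0(1) div_le_dividend[of x0 "2 ^ j"] by linarith
  have half: "?y div 2 = x0 div 2 ^ Suc j" by (simp only: power_Suc2 div_mult2_eq)
  let ?k = "max (vr u vKq) (ar s aSEG ?y)"
  have "wp (Cond (Var vKq \<lhd> Idx aSEG (Var vXq)) (vKq ::= Idx aSEG (Var vXq)) Skip ;; vXq ::= Var vXq \<oslash> Lit 2)
   (%v. vr v vXq = x0 div 2 ^ Suc j & vr v vKq = ?k & tm v <= tm u + 4) (tick u)"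
   using f j(2) y B half by simp
  then have "wp (Cond (Var vKq \<lhd> Idx aSEG (Var vXq)) (vKq ::= Idx aSEG (Var vXq)) Skip ;; vXq ::= Var vXq \<oslash> Lit 2)
   (%u. \<exists>j\<le>lg. vr u vXq = x0 div 2 ^ j & (\<forall>i<j. 0 < x0 div 2 ^ i --> ar s aSEG (x0 div 2 ^ i) <= vr u vKq) &
   (vr u vKq = 0 \<or> (\<exists>i. 0 < x0 div 2 ^ i & vr u vKq = ar s aSEG (x0 div 2 ^ i))) & tm u <= tm s + 4 * j) (tick u)"
  proof (rule wp_conseq, goal_cases)
   case (1 v)
   have le: "ar s aSEG (x0 div 2 ^ i) <= ?k" if "i < Suc j" "0 < x0 div 2 ^ i" for i
    using that j(3) by (cases "i = j") (auto simp: le_max_iff_disj less_Suc_eq)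
   have "?k = 0 \<or> (\<exists>i. 0 < x0 div 2 ^ i & ?k = ar s aSEG (x0 div 2 ^ i))"
    using j(4) False unfolding max_def by auto
   then show ?case using 1(2) jl le j(5) by (intro exI[of _ "Suc j"]) auto
  qed
  moreover have "tm u <= tm s + 4 * lg" using j by linarith
  ultimately show ?thesis using False j(2) B by simp
 qed
qed

lemma wp_search:
 fixes s :: state and P :: "nat => bool"
 assumes vs: "vr s vA = lo" "vr s vB = hi" "lo <= hi"
  and P: "\<And>r. lo <= r ==> r < hi ==> P r \<longleftrightarrow> ar s aTX (ar s aA3 r + vr s vL) < c"
   "\<And>r r'. lo <= r ==> r <= r' ==> r' < hi ==> P r' ==> P r"
  and e: "\<And>u. vr u vCh = vr s vCh ==> ev e u = c & ok e u"
  and ok: "\<And>r. lo <= r ==> r < hi ==> r < sz s aA3 & ar s aA3 r + vr s vL < sz s aTX & ar s aA3 r + vr s vL < B"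
  and B: "2 < B" "hi + hi < B" and lg: "hi - lo < 2 ^ lg"
 shows "wp (search_loop e) (%u. lo <= vr u vA & vr u vA <= hi & (\<forall>r. lo <= r --> r < vr u vA --> P r) &
   (\<forall>r. vr u vA <= r --> r < hi --> \<not> P r) & tm u <= tm s + 4 * lg + 1) s"
 unfolding search_loop_def
proof (rule wp_Loop[where I = "%u. \<exists>j. lo <= vr u vA & vr u vA <= vr u vB & vr u vB <= hi &
   (\<forall>r. lo <= r --> r < vr u vA --> P r) & (\<forall>r. vr u vB <= r --> r < hi --> \<not> P r) & vr u vB - vr u vA < 2 ^ j &
   tm u + 4 * j <= tm s + 4 * lg" and T = "tm s + 4 * lg"], goal_cases)
 case 1
 show ?case by (rule exI[of _ lg]) (use vs lg in auto)
next
 case (2 u)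
 let ?a = "vr u vA" and ?b = "vr u vB"
 obtain j where j: "lo <= ?a" "?a <= ?b" "?b <= hi" "\<forall>r. lo <= r --> r < ?a --> P r" "\<forall>r. ?b <= r --> r < hi --> \<not> P r"
  "?b - ?a < 2 ^ j" "tm u + 4 * j <= tm s + 4 * lg" using 2(1) by blast
 have f: "ar u aTX = ar s aTX" "ar u aA3 = ar s aA3" "sz u = sz s" "vr u vL = vr s vL" "vr u vCh = vr s vCh"
  by (simp_all add: frame_simps[OF 2(2)])
 show ?case
 proof (cases "?a < ?b")
  case False
  then show ?thesis using j by auto
 next
  case True
  then obtain j' where j': "j = Suc j'" using j(6) by (cases j) auto
  define m where "m = (?a + ?b) div 2"
  have m: "?a <= m" "m < ?b" "lo <= m" "m < hi" using True j by (auto simp: m_def)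
  have hp: "?b - Suc m < 2 ^ j'" "m - ?a < 2 ^ j'" using j(6) True unfolding j' m_def by auto
  have mb: "?a + ?b < B" "m < B" "Suc m < B" "0 < B" using B j m by auto
  note okm = ok[OF m(3,4)]
  have e': "ev e v = c" "ok e v" if "vr v vCh = vr s vCh" for v using e[OF that] by auto
  have "wp (vMid ::= (Var vA \<oplus> Var vB) \<oslash> Lit 2 ;;
    Cond (Idx aTX (Idx aA3 (Var vMid) \<oplus> Var vL) \<lhd> e) (vA ::= Var vMid \<oplus> Lit 1) (vB ::= Var vMid))
    (%v. tm v <= tm u + 4 & ((P m & vr v vA = Suc m & vr v vB = ?b) \<or> (\<not> P m & vr v vA = ?a & vr v vB = m))) (tick u)"
   using f mb okm B P(1)[OF m(3,4)] by (simp add: m_def[symmetric] e')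
  then have "wp (vMid ::= (Var vA \<oplus> Var vB) \<oslash> Lit 2 ;;
    Cond (Idx aTX (Idx aA3 (Var vMid) \<oplus> Var vL) \<lhd> e) (vA ::= Var vMid \<oplus> Lit 1) (vB ::= Var vMid))
    (%u. \<exists>j. lo <= vr u vA & vr u vA <= vr u vB & vr u vB <= hi &
   (\<forall>r. lo <= r --> r < vr u vA --> P r) & (\<forall>r. vr u vB <= r --> r < hi --> \<not> P r) & vr u vB - vr u vA < 2 ^ j &
   tm u + 4 * j <= tm s + 4 * lg) (tick u)"
  proof (rule wp_conseq, goal_cases)
   case (1 v)
   have t: "tm v + 4 * j' <= tm s + 4 * lg" using 1(2) j(7) j' by auto
   consider (a) "P m" "vr v vA = Suc m" "vr v vB = ?b" | (b) "\<not> P m" "vr v vA = ?a" "vr v vB = m" using 1(2) by blast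
   then show ?case
   proof cases
    case a
    have "P r" if "lo <= r" "r < Suc m" for r using P(2)[of r m] that a m by simp
    then show ?thesis using a j m hp t by (intro exI[of _ j']) auto
   next
    case b
    have "\<not> P r" if "m <= r" "r < hi" for r using P(2)[of m r] that b m by blast
    then show ?thesis using b j m hp t by (intro exI[of _ j']) auto
   qed
  qed
  then show ?thesis using True j by simp
 qed
qed

lemma wp_update:
 fixes s :: state
 assumes vs: "vr s vA = t + l" "vr s vB = t + h" "vr s vMc = m'" and lh: "l <= h" "h <= t" "0 < t"
  and szs: "2 * t <= sz s aSEG" and B: "2 * t + 3 < B" and lg: "2 * t < 2 ^ lg"
 shows "wp update_loop (%u. (\<exists>Mk. (\<forall>y. ar u aSEG y = (if y \<in> Mk then m' else ar s aSEG y)) & 0 \<notin> Mk &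
   (\<forall>y r i. y \<in> Mk --> r < t --> (t + r) div 2 ^ i = y --> l <= r & r < h) &
   (\<forall>r. l <= r --> r < h --> (\<exists>i. (t + r) div 2 ^ i \<in> Mk))) & tm u <= tm s + 9 * lg + 1) s"
 unfolding update_loop_def
\<comment> \<open>At height j the leaves still to be covered are those below the nodes from
  \<open>vA\<close> up to, but excluding, \<open>vB\<close>.\<close>
proof (rule wp_Loop[where I = "%u. \<exists>j Mk. (\<forall>y. ar u aSEG y = (if y \<in> Mk then m' else ar s aSEG y)) & 0 \<notin> Mk &
   (\<forall>y r i. y \<in> Mk --> r < t --> (t + r) div 2 ^ i = y --> l <= r & r < h) &
   (\<forall>r. l <= r --> r < h --> (\<exists>i. (t + r) div 2 ^ i \<in> Mk) \<or> (vr u vA <= (t + r) div 2 ^ j & (t + r) div 2 ^ j < vr u vB)) &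
   t + l <= vr u vA * 2 ^ j & vr u vB * 2 ^ j <= t + h & j <= lg & tm u <= tm s + 9 * j" and T = "tm s + 9 * lg"], goal_cases)
 case 1
 show ?case by (rule exI[of _ 0], rule exI[of _ "{}"]) (use vs lh in auto)
next
 case (2 u)
 let ?a = "vr u vA" and ?b = "vr u vB"
 obtain j Mk where j0: "(\<forall>y. ar u aSEG y = (if y \<in> Mk then m' else ar s aSEG y)) & 0 \<notin> Mk &
   (\<forall>y r i. y \<in> Mk --> r < t --> (t + r) div 2 ^ i = y --> l <= r & r < h) &
   (\<forall>r. l <= r --> r < h --> (\<exists>i. (t + r) div 2 ^ i \<in> Mk) \<or> (?a <= (t + r) div 2 ^ j & (t + r) div 2 ^ j < ?b)) &
   t + l <= ?a * 2 ^ j & ?b * 2 ^ j <= t + h & j <= lg & tm u <= tm s + 9 * j" using 2(1) by (elim exE) (rule that)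
 note j = j0[THEN conjunct1, rule_format] j0[THEN conjunct2, THEN conjunct1]
  j0[THEN conjunct2, THEN conjunct2, THEN conjunct1, rule_format]
  j0[THEN conjunct2, THEN conjunct2, THEN conjunct2, THEN conjunct1, rule_format]
  j0[THEN conjunct2, THEN conjunct2, THEN conjunct2, THEN conjunct2, THEN conjunct1]
  j0[THEN conjunct2, THEN conjunct2, THEN conjunct2, THEN conjunct2, THEN conjunct2, THEN conjunct1]
  j0[THEN conjunct2, THEN conjunct2, THEN conjunct2, THEN conjunct2, THEN conjunct2, THEN conjunct2, THEN conjunct1]
  j0[THEN conjunct2, THEN conjunct2, THEN conjunct2, THEN conjunct2, THEN conjunct2, THEN conjunct2, THEN conjunct2]
 have f: "sz u = sz s" "vr u vMc = m'" using vs by (simp_all add: frame_simps[OF 2(2)])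
 have tl: "tm u <= tm s + 9 * lg" using j(7,8) by linarith
 show ?case
 proof (cases "?a < ?b")
  case False
  have "\<exists>i. (t + r) div 2 ^ i \<in> Mk" if "l <= r" "r < h" for r using j(4)[OF that] False by auto
  then have "\<exists>Mk. (\<forall>y. ar u aSEG y = (if y \<in> Mk then m' else ar s aSEG y)) & 0 \<notin> Mk &
   (\<forall>y r i. y \<in> Mk --> r < t --> (t + r) div 2 ^ i = y --> l <= r & r < h) &
   (\<forall>r. l <= r --> r < h --> (\<exists>i. (t + r) div 2 ^ i \<in> Mk))"
   using j0 by (intro exI[of _ Mk]) blast
  then show ?thesis using False tl by simp
 next
  case True
  have a0: "0 < ?a" using j(5) lh by (cases ?a) auto
  have bl: "?b <= 2 * t"
  proof -
   have "?b * 1 <= ?b * 2 ^ j" by (intro mult_le_mono2) simp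
   then show ?thesis using j(6) lh by linarith
  qed
  have jl: "Suc j <= lg"
  proof (rule ccontr)
   assume "\<not> Suc j <= lg"
   then have jlg: "j = lg" using j(7) by simp
   have "1 * 2 ^ j <= ?b * 2 ^ j" using True by (intro mult_le_mono1) simp
   then have "2 ^ j <= t + h" using j(6) by linarith
   then show False using lg lh unfolding jlg by linarith
  qed
  \<comment> \<open>An odd left end is a right child whose sibling lies outside; an odd right end
    leaves a left child without its sibling. These are marked individually, after which both ends
    are even and can be halved.\<close>
  define a1 where "a1 = (if odd ?a then Suc ?a else ?a)"
  define b1 where "b1 = (if odd ?b then ?b - 1 else ?b)"
  define Mk' where "Mk' = Mk \<union> (if odd ?a then {?a} else {}) \<union> (if odd ?b then {?b - 1} else {})"
  have ab: "even a1" "even b1" "?a <= a1" "b1 <= ?b" "a1 <= b1" using True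
   by (simp_all add: a1_def b1_def) presburger+
  have mk: "l <= r & r < h" if "y \<in> {?a..<?b}" "r < t" "(t + r) div 2 ^ i = y" for y r i
  proof (rule seg_mark[of t l y j h r i])
   show "t + l <= y * 2 ^ j" using that j(5) by (meson atLeastLessThan_iff le_trans mult_le_mono1)
   have "(y + 1) * 2 ^ j <= ?b * 2 ^ j" using that by (intro mult_le_mono1) auto
   then show "(y + 1) * 2 ^ j <= t + h" using j(6) by linarith
  qed (use that lh in auto)
  have new: "\<And>y r i. y \<in> Mk' ==> r < t ==> (t + r) div 2 ^ i = y ==> l <= r & r < h"
  proof -
   fix y r i assume y: "y \<in> Mk'" "r < t" "(t + r) div 2 ^ i = y"
   then have "y \<in> Mk \<or> y \<in> {?a..<?b}" using True by (auto simp: Mk'_def split: if_splits)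
   then show "l <= r & r < h" using j(3) mk y by blast
  qed
  have nz: "0 \<notin> Mk'" using j(2) a0 True by (auto simp: Mk'_def)
  have cov: "(\<exists>i. (t + r) div 2 ^ i \<in> Mk') \<or> (a1 div 2 <= (t + r) div 2 ^ Suc j & (t + r) div 2 ^ Suc j < b1 div 2)" if rr: "l <= r" "r < h" for r
  proof -
   let ?y = "(t + r) div 2 ^ j"
   have half: "(t + r) div 2 ^ Suc j = ?y div 2" by (simp only: power_Suc2 div_mult2_eq)
   consider "\<exists>i. (t + r) div 2 ^ i \<in> Mk" | "?a <= ?y" "?y < ?b" using j(4)[OF rr] by blast
   then show ?thesis
   proof cases
    case 2
    show ?thesis
    proof (cases "a1 <= ?y & ?y < b1")
     case True
     then have "a1 div 2 <= ?y div 2 & ?y div 2 < b1 div 2" using ab by (auto elim!: evenE)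
     then show ?thesis unfolding half by blast
    next
     case False
     then have "?y \<in> Mk'" using 2 unfolding a1_def b1_def Mk'_def by (auto split: if_splits)
     then show ?thesis by blast
    qed
   qed (auto simp: Mk'_def)
  qed
  have pw: "t + l <= (a1 div 2) * 2 ^ Suc j" "(b1 div 2) * 2 ^ Suc j <= t + h"
  proof -
   have "(a1 div 2) * 2 ^ Suc j = a1 * 2 ^ j" "(b1 div 2) * 2 ^ Suc j = b1 * 2 ^ j" using ab by (auto elim!: evenE)
   moreover have "?a * 2 ^ j <= a1 * 2 ^ j" "b1 * 2 ^ j <= ?b * 2 ^ j" using ab by (auto intro!: mult_le_mono1)
   ultimately show "t + l <= (a1 div 2) * 2 ^ Suc j" "(b1 div 2) * 2 ^ Suc j <= t + h" using j(5,6) by linarith+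
  qed
  have szb: "?a < sz s aSEG" "?b - 1 < sz s aSEG" "Suc ?a < B" "?b < B" "2 < B" "Suc 0 < B" "0 < B" using True bl szs B lh by auto
  have e1: "odd ?a ==> ?a mod 2 = Suc 0" "odd ?b ==> ?b mod 2 = Suc 0" "even ?a ==> ?a mod 2 = 0" "even ?b ==> ?b mod 2 = 0"
   by presburger+
  let ?body = "Cond (Var vA \<odot> Lit 2 \<doteq> Lit 1) (Write aSEG (Var vA) (Var vMc) ;; vA ::= Var vA \<oplus> Lit 1) Skip ;;
   Cond (Var vB \<odot> Lit 2 \<doteq> Lit 1) (vB ::= Var vB \<ominus> Lit 1 ;; Write aSEG (Var vB) (Var vMc)) Skip ;;
   vA ::= Var vA \<oslash> Lit 2 ;; vB ::= Var vB \<oslash> Lit 2"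
  have "wp ?body (%v. tm v <= tm u + 9 & vr v vA = a1 div 2 & vr v vB = b1 div 2 &
    ar v aSEG = (%y. if y \<in> Mk' then m' else ar s aSEG y)) (tick u)"
   using f szb True e1
   by (cases "odd ?a"; cases "odd ?b") (auto simp: a1_def b1_def Mk'_def fun_eq_iff j(1))
  then have "wp ?body (%u. \<exists>j Mk. (\<forall>y. ar u aSEG y = (if y \<in> Mk then m' else ar s aSEG y)) & 0 \<notin> Mk &
   (\<forall>y r i. y \<in> Mk --> r < t --> (t + r) div 2 ^ i = y --> l <= r & r < h) &
   (\<forall>r. l <= r --> r < h --> (\<exists>i. (t + r) div 2 ^ i \<in> Mk) \<or> (vr u vA <= (t + r) div 2 ^ j & (t + r) div 2 ^ j < vr u vB)) &
   t + l <= vr u vA * 2 ^ j & vr u vB * 2 ^ j <= t + h & j <= lg & tm u <= tm s + 9 * j) (tick u)"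
  proof (rule wp_conseq, goal_cases)
   case (1 v)
   show ?case
    apply (rule exI[of _ "Suc j"], rule exI[of _ Mk'])
    using 1(2) nz jl pw j(8) cov new by (simp del: power_Suc)
  qed
  then show ?thesis using True tl by simp
 qed
qed

end

section \<open>Finding and inserting one factor\<close>

definition search_part :: com where
 "search_part =
  vL ::= Idx aREC (Lit 5 \<otimes> Var vKq \<oplus> Lit 2) ;; vCh ::= Idx aTX (Var vO \<oplus> Var vL) ;;
  vA ::= Idx aREC (Lit 5 \<otimes> Var vKq) ;; vHi ::= Idx aREC (Lit 5 \<otimes> Var vKq \<oplus> Lit 1) ;; vB ::= Var vHi ;;
  search_loop (Var vCh) ;; vLo ::= Var vA ;; vB ::= Var vHi ;; search_loop (Var vCh \<oplus> Lit 1) ;; vHi ::= Var vA"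

text \<open>A node takes five cells of \<open>aREC\<close>: the two ends of its interval, its depth,
  its parent and its last character.\<close>

definition store_part :: com where
 "store_part =
  vMc ::= Var vMc \<oplus> Lit 1 ;; vXq ::= Lit 5 \<otimes> Var vMc ;;
  Write aREC (Var vXq) (Var vLo) ;; Write aREC (Var vXq \<oplus> Lit 1) (Var vHi) ;;
  Write aREC (Var vXq \<oplus> Lit 2) (Var vL \<oplus> Lit 1) ;; Write aREC (Var vXq \<oplus> Lit 3) (Var vKq) ;;
  Write aREC (Var vXq \<oplus> Lit 4) (Var vCh) ;;
  vA ::= Var vTl \<oplus> Var vLo ;; vB ::= Var vTl \<oplus> Var vHi ;; update_loop"

definition factor_com :: com where
 "factor_com = vXq ::= Idx aRK (Var vO) \<oplus> Var vTl ;; vKq ::= Lit 0 ;; query_loop ;; search_part ;; store_part"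

lemma part_mods [simp]: "wv search_part = {vL, vCh, vA, vHi, vB, vMid, vLo}" "wa search_part = {}" "al search_part = {}"
 "wv store_part = {vMc, vXq, vA, vB}" "wa store_part = {aREC, aSEG}" "al store_part = {}"
 by (auto simp: search_part_def store_part_def)

lemma factor_mods [simp]: "wv factor_com = {vL, vCh, vA, vHi, vB, vMid, vLo, vMc, vXq, vKq}" "wa factor_com = {aREC, aSEG}" "al factor_com = {}"
 by (auto simp: factor_com_def)

context machine
begin

text \<open>The characters at depth l increase along the interval of a node of depth l, so the
  suffixes that continue with \<open>vCh\<close> form a subinterval. Its ends are the insertion
  points of \<open>vCh\<close> and \<open>vCh + 1\<close>.\<close>

lemma wp_search_part:
 fixes s :: state and T :: "nat list"
 defines "t \<equiv> length T" and "k \<equiv> vr s vKq" and "SA \<equiv> ar s aA3" and "ob \<equiv> vr s vO"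
 defines "lo \<equiv> ar s aREC (5 * k)" and "hi \<equiv> ar s aREC (5 * k + 1)" and "l \<equiv> ar s aREC (5 * k + 2)"
 assumes h: "holds s 0 T" and hi: "lo <= hi" "hi <= t"
  and mono: "\<And>x x'. lo <= x ==> x <= x' ==> x' < hi ==> zc T (SA x + l) <= zc T (SA x' + l)"
  and bnd: "\<And>x. lo <= x ==> x < hi ==> SA x + l <= t" "ob + l <= t" "zc T (ob + l) + 2 < B"
  and szs: "t <= sz s aA3" "t + 3 <= sz s aTX" "5 * k + 5 <= sz s aREC" and B: "5 * k + 10 < B" "2 * t + 10 < B" and lg: "t < 2 ^ lg"
 shows "wp search_part (%u. vr u vL = l & vr u vCh = zc T (ob + l) & vr u vLo <= vr u vHi & vr u vHi <= t &
   (\<forall>x. vr u vLo <= x & x < vr u vHi \<longleftrightarrow> lo <= x & x < hi & zc T (SA x + l) = zc T (ob + l)) &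
   tm u <= tm s + 8 * lg + 10) s"
proof -
 have tx: "ar s aTX x = zc T x" if "x <= t" for x using h that by (simp add: holds_def t_def)
 let ?c = "zc T (ob + l)"
 have lgs: "hi - lo < 2 ^ lg" using hi lg by linarith
 define s1 where "s1 = s(|tm := Suc (Suc (Suc (Suc (Suc (tm s))))), vr := (vr s)(vL := l, vCh := ?c, vA := lo, vHi := hi, vB := hi)|)"
 have W1: "wp (search_loop (Var vCh)) (%u. lo <= vr u vA & vr u vA <= hi & (\<forall>r. lo <= r --> r < vr u vA --> zc T (SA r + l) < ?c) &
   (\<forall>r. vr u vA <= r --> r < hi --> \<not> zc T (SA r + l) < ?c) & tm u <= tm s1 + 4 * lg + 1) s1"
 proof (rule wp_search[where c = ?c], goal_cases)
  case (4 r) then show ?case using tx[OF bnd(1)] by (simp add: s1_def SA_def)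
 next
  case (5 r r') then show ?case using mono[of r r'] by linarith
 next
  case (7 r) then show ?case using bnd(1)[of r] szs B hi by (simp add: s1_def SA_def)
 qed (use hi B lgs in \<open>auto simp: s1_def\<close>)
 have "wp (search_loop (Var vCh)) (wp (vLo ::= Var vA ;; vB ::= Var vHi ;; search_loop (Var vCh \<oplus> Lit 1) ;; vHi ::= Var vA)
   (%u. vr u vL = l & vr u vCh = zc T (ob + l) & vr u vLo <= vr u vHi & vr u vHi <= t &
   (\<forall>x. vr u vLo <= x & x < vr u vHi \<longleftrightarrow> lo <= x & x < hi & zc T (SA x + l) = ?c) &
   tm u <= tm s + 8 * lg + 10)) s1"
 proof (rule wp_conseq[OF W1], goal_cases)
  case (1 u)
  let ?a = "vr u vA"
  have u: "lo <= ?a" "?a <= hi" "\<And>r. lo <= r ==> r < ?a ==> zc T (SA r + l) < ?c" "\<And>r. ?a <= r ==> r < hi ==> \<not> zc T (SA r + l) < ?c"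
   "tm u <= tm s + 4 * lg + 6" using 1(2) by (auto simp: s1_def)
  have fu: "vr u vL = l" "vr u vCh = ?c" "vr u vHi = hi" "ar u = ar s" "sz u = sz s"
   by (simp_all add: frame_simps[OF 1(1)] s1_def fun_eq_iff)
  define u1 where "u1 = u(|tm := Suc (Suc (tm u)), vr := (vr u)(vLo := ?a, vB := hi)|)"
  have W2: "wp (search_loop (Var vCh \<oplus> Lit 1)) (%v. ?a <= vr v vA & vr v vA <= hi & (\<forall>r. ?a <= r --> r < vr v vA --> zc T (SA r + l) < Suc ?c) &
   (\<forall>r. vr v vA <= r --> r < hi --> \<not> zc T (SA r + l) < Suc ?c) & tm v <= tm u1 + 4 * lg + 1) u1"
  proof (rule wp_search[where c = "Suc ?c"], goal_cases)
   case (4 r) then show ?case using tx[OF bnd(1)] u(1) fu by (simp add: u1_def SA_def)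
  next
   case (5 r r') then show ?case using mono[of r r'] u(1) by linarith
  next
   case (6 v) then show ?case using bnd(3) B fu by (simp add: u1_def)
  next
   case (7 r) then show ?case using bnd(1)[of r] szs B hi u(1) fu by (simp add: u1_def SA_def)
  qed (use hi B lgs u fu in \<open>auto simp: u1_def\<close>)
  have "wp (search_loop (Var vCh \<oplus> Lit 1)) (wp (vHi ::= Var vA) (%u. vr u vL = l & vr u vCh = zc T (ob + l) & vr u vLo <= vr u vHi & vr u vHi <= t &
   (\<forall>x. vr u vLo <= x & x < vr u vHi \<longleftrightarrow> lo <= x & x < hi & zc T (SA x + l) = ?c) &
   tm u <= tm s + 8 * lg + 10)) u1"
  proof (rule wp_conseq[OF W2], goal_cases)
   case (1 v)
   let ?b = "vr v vA"
   have v: "?a <= ?b" "?b <= hi" "\<And>r. ?a <= r ==> r < ?b ==> zc T (SA r + l) < Suc ?c" "\<And>r. ?b <= r ==> r < hi ==> \<not> zc T (SA r + l) < Suc ?c"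
    "tm v <= tm u + 4 * lg + 3" using 1(2) by (auto simp: u1_def)
   have fv: "vr v vL = l" "vr v vCh = ?c" "vr v vLo = ?a" using fu by (simp_all add: frame_simps[OF 1(1)] u1_def)
   have iff: "?a <= x & x < ?b \<longleftrightarrow> lo <= x & x < hi & zc T (SA x + l) = ?c" for x
   proof
    assume x: "?a <= x & x < ?b"
    then show "lo <= x & x < hi & zc T (SA x + l) = ?c" using u(1) u(4)[of x] v(2) v(3)[of x] by auto
   next
    assume x: "lo <= x & x < hi & zc T (SA x + l) = ?c"
    have "?a <= x" by (rule ccontr) (use u(3)[of x] x in simp)
    moreover have "x < ?b" by (rule ccontr) (use v(4)[of x] x in simp)
    ultimately show "?a <= x & x < ?b" by simp
   qed
   show ?case using fv v iff hi u(5) by simp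
  qed
  then show ?case using fu by (simp add: u1_def)
 qed
 then show ?thesis unfolding search_part_def using szs B bnd tx[of "ob + l"]
  by (simp add: s1_def k_def[symmetric] lo_def[symmetric] hi_def[symmetric, simplified] l_def[symmetric, simplified] ob_def[symmetric])
qed

lemma wp_factor:
 fixes s :: state and T :: "nat list"
 defines "t \<equiv> length T" and "m \<equiv> vr s vMc" and "SA \<equiv> ar s aA3" and "ob \<equiv> vr s vO" and "REC \<equiv> ar s aREC"
 defines "r \<equiv> ar s aRK (vr s vO)"
 assumes h: "holds s 0 T" and t: "0 < t" "vr s vTl = t" and r: "r < t" "SA r = ob" "ob < t"
  and seg: "seg_ok t m (%k. REC (5 * k)) (%k. REC (5 * k + 1)) (ar s aSEG)"
  and root: "REC 0 = 0" "REC 1 = t"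
  and lh: "\<And>k. k <= m ==> REC (5 * k) <= REC (5 * k + 1) & REC (5 * k + 1) <= t"
  and mono: "\<And>k x x'. k <= m ==> REC (5 * k) <= x ==> x <= x' ==> x' < REC (5 * k + 1) ==>
    zc T (SA x + REC (5 * k + 2)) <= zc T (SA x' + REC (5 * k + 2))"
  and bnd: "\<And>k x. k <= m ==> REC (5 * k) <= x ==> x < REC (5 * k + 1) ==> SA x + REC (5 * k + 2) <= t"
  and ch: "\<And>x. zc T x + 2 < B"
  and szs: "t <= sz s aA3" "t <= sz s aRK" "t + 3 <= sz s aTX" "5 * m + 10 <= sz s aREC" "2 * t <= sz s aSEG"
  and B: "5 * m + 20 < B" "2 * t + 10 < B" and lg: "2 * t < 2 ^ lg"
 shows "wp factor_com (%u. \<exists>k lo' hi'. k <= m & REC (5 * k) <= r & r < REC (5 * k + 1) &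
   (\<forall>k'\<le>m. REC (5 * k') <= r --> r < REC (5 * k' + 1) --> k' <= k) & vr u vL = REC (5 * k + 2) & vr u vMc = Suc m &
   ar u aREC = REC(5 * Suc m := lo', 5 * Suc m + 1 := hi', 5 * Suc m + 2 := Suc (REC (5 * k + 2)), 5 * Suc m + 3 := k,
    5 * Suc m + 4 := zc T (ob + REC (5 * k + 2))) & lo' <= hi' & hi' <= t &
   (\<forall>x. lo' <= x & x < hi' \<longleftrightarrow> REC (5 * k) <= x & x < REC (5 * k + 1) & zc T (SA x + REC (5 * k + 2)) = zc T (ob + REC (5 * k + 2))) &
   seg_ok t (Suc m) (%k. ar u aREC (5 * k)) (%k. ar u aREC (5 * k + 1)) (ar u aSEG) & tm u <= tm s + 21 * lg + 40) s"
  (is "wp _ ?Q s")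
proof -
 define s1 where "s1 = s(|tm := Suc (Suc (tm s)), vr := (vr s)(vXq := t + r, vKq := 0)|)"
 have W1: "wp query_loop (%u. (\<forall>i. 0 < (t + r) div 2 ^ i --> ar s1 aSEG ((t + r) div 2 ^ i) <= vr u vKq) &
   (vr u vKq = 0 \<or> (\<exists>i. 0 < (t + r) div 2 ^ i & vr u vKq = ar s1 aSEG ((t + r) div 2 ^ i))) & tm u <= tm s1 + 4 * lg + 1) s1"
  by (rule wp_query) (use r szs B lg in \<open>auto simp: s1_def\<close>)
 have "wp query_loop (wp (search_part ;; store_part) ?Q) s1"
 proof (rule wp_conseq[OF W1], goal_cases)
  case (1 u)
  let ?k = "vr u vKq"
  have q1: "\<And>i. 0 < (t + r) div 2 ^ i ==> ar s aSEG ((t + r) div 2 ^ i) <= ?k"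
   and q2: "?k = 0 \<or> (\<exists>i. 0 < (t + r) div 2 ^ i & ?k = ar s aSEG ((t + r) div 2 ^ i))"
   and q3: "tm u <= tm s + 4 * lg + 3" using 1(2) by (auto simp: s1_def)
  have fu: "ar u = ar s" "sz u = sz s" "vr u vO = ob" "vr u vMc = m" "vr u vTl = t"
   using t by (simp_all add: frame_simps[OF 1(1)] s1_def fun_eq_iff ob_def m_def)
  have k: "?k <= m & REC (5 * ?k) <= r & r < REC (5 * ?k + 1)"
   using q2
  proof
   assume "?k = 0" then show ?thesis using root r by simp
  next
   assume "\<exists>i. 0 < (t + r) div 2 ^ i & ?k = ar s aSEG ((t + r) div 2 ^ i)"
   then show ?thesis using seg r(1) unfolding seg_ok_def by metis
  qed
  have kmax: "\<forall>k'\<le>m. REC (5 * k') <= r --> r < REC (5 * k' + 1) --> k' <= ?k"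
  proof (intro allI impI)
   fix k' assume k': "k' <= m" "REC (5 * k') <= r" "r < REC (5 * k' + 1)"
   show "k' <= ?k"
   proof (cases "k' = 0")
    case False
    then obtain i where "0 < (t + r) div 2 ^ i" "k' <= ar s aSEG ((t + r) div 2 ^ i)"
     using seg r(1) k' unfolding seg_ok_def by (metis neq0_conv)
    then show ?thesis using q1[of i] by linarith
   qed simp
  qed
  let ?l = "REC (5 * ?k + 2)"
  have bl: "ob + ?l <= t" using bnd[of ?k r] k r(2) by simp
  have slb: "Suc ?l < B" using bl B by linarith
  have W2: "wp search_part (%v. vr v vL = ar u aREC (5 * ?k + 2) & vr v vCh = zc T (vr u vO + ar u aREC (5 * ?k + 2)) &
    vr v vLo <= vr v vHi & vr v vHi <= length T &
    (\<forall>x. vr v vLo <= x & x < vr v vHi \<longleftrightarrow> ar u aREC (5 * ?k) <= x & x < ar u aREC (5 * ?k + 1) &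
     zc T (ar u aA3 x + ar u aREC (5 * ?k + 2)) = zc T (vr u vO + ar u aREC (5 * ?k + 2))) & tm v <= tm u + 8 * lg + 10) u"
  proof (rule wp_search_part, goal_cases)
   case 1 then show ?case using h fu by (simp add: holds_def)
  next
   case 2 then show ?case using lh[of ?k] k fu by (simp add: REC_def)
  next
   case 3 then show ?case using lh[of ?k] k fu by (simp add: REC_def t_def)
  next
   case (4 x x') then show ?case using mono[of ?k x x'] k fu by (simp add: REC_def SA_def)
  next
   case (5 x) then show ?case using bnd[of ?k x] k fu by (simp add: REC_def SA_def t_def)
  next
   case 6 then show ?case using bl fu by (simp add: REC_def t_def)
  next
   case 7 then show ?case using ch by simp
  qed (use k szs B lg fu in \<open>auto simp: t_def\<close>)
  show ?case unfolding wp_Seq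
  proof (rule wp_conseq[OF W2], goal_cases)
   case (1 v)
   let ?lo = "vr v vLo" and ?hi = "vr v vHi" and ?c = "zc T (ob + ?l)"
   have v: "vr v vL = ?l" "vr v vCh = ?c" "?lo <= ?hi" "?hi <= t" "tm v <= tm u + 8 * lg + 10"
    and viff: "\<And>x. ?lo <= x & x < ?hi \<longleftrightarrow> REC (5 * ?k) <= x & x < REC (5 * ?k + 1) & zc T (SA x + ?l) = ?c"
    using 1(2) fu by (auto simp: REC_def SA_def t_def)
   have fv: "vr v vMc = m" "vr v vTl = t" "vr v vKq = ?k" "ar v = ar s" "sz v = sz s"
    using fu by (simp_all add: frame_simps[OF 1(1)] fun_eq_iff)
   define REC' where "REC' = REC(5 * Suc m := ?lo, 5 * Suc m + 1 := ?hi, 5 * Suc m + 2 := Suc ?l, 5 * Suc m + 3 := ?k, 5 * Suc m + 4 := ?c)"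
   define v1 where "v1 = v(|ar := (ar s)(aREC := REC'),
     tm := Suc (Suc (Suc (Suc (Suc (Suc (Suc (Suc (Suc (tm v))))))))), vr := (vr v)(vMc := Suc m, vXq := 5 * Suc m, vA := t + ?lo, vB := t + ?hi)|)"
   have W3: "wp update_loop (%x. (\<exists>Mk. (\<forall>y. ar x aSEG y = (if y \<in> Mk then Suc m else ar v1 aSEG y)) & 0 \<notin> Mk &
     (\<forall>y r i. y \<in> Mk --> r < t --> (t + r) div 2 ^ i = y --> ?lo <= r & r < ?hi) &
     (\<forall>r. ?lo <= r --> r < ?hi --> (\<exists>i. (t + r) div 2 ^ i \<in> Mk))) & tm x <= tm v1 + 9 * lg + 1) v1"
    by (rule wp_update) (use v fv t szs B lg in \<open>auto simp: v1_def\<close>)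
   have "wp update_loop ?Q v1"
   proof (rule wp_conseq[OF W3], goal_cases)
    case (1 x)
    then obtain Mk where Mk: "\<And>y. ar x aSEG y = (if y \<in> Mk then Suc m else ar v1 aSEG y)" "0 \<notin> Mk"
     "\<And>y r i. y \<in> Mk ==> r < t ==> (t + r) div 2 ^ i = y ==> ?lo <= r & r < ?hi"
     "\<And>r. ?lo <= r ==> r < ?hi ==> \<exists>i. (t + r) div 2 ^ i \<in> Mk" "tm x <= tm v1 + 9 * lg + 1" by metis
    have rx: "ar x aREC = REC'" by (simp add: frame_simps[OF 1(1)] v1_def)
    have sx: "ar v1 aSEG = ar s aSEG" by (simp add: v1_def)
    have "seg_ok t (Suc m) (%k. REC' (5 * k)) (%k. REC' (5 * k + 1)) (ar x aSEG)"
    proof (rule seg_update[OF seg refl, where l = ?lo and h' = ?hi and Mk = Mk])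
     show "REC' (5 * Suc m) = ?lo" "REC' (5 * Suc m + 1) = ?hi" by (simp_all add: REC'_def)
     show "REC' (5 * k) = REC (5 * k) & REC' (5 * k + 1) = REC (5 * k + 1)" if "k <= m" for k
      using that unfolding REC'_def by (auto; presburger)
     show "ar x aSEG y = (if y \<in> Mk then Suc m else ar s aSEG y)" for y using Mk(1) sx by simp
    qed (use Mk in auto)
    moreover have "tm x <= tm s + 21 * lg + 40" using Mk(5) v(5) q3 by (simp add: v1_def)
    moreover have "vr x vL = ?l" "vr x vMc = Suc m" using v by (simp_all add: frame_simps[OF 1(1)] v1_def)
    ultimately show ?case using k kmax v(3,4) viff rx
     by - (rule exI[of _ ?k], rule exI[of _ ?lo], rule exI[of _ ?hi], simp add: REC'_def)
   qed
   moreover have "wp update_loop Qx v1 ==> wp store_part Qx v" for Qx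
    unfolding store_part_def using fv v k szs B slb
    apply simp
    apply (erule back_subst[of "wp update_loop Qx"])
    apply (simp add: v1_def REC'_def REC_def)
    done
   ultimately show ?case by blast
  qed
 qed
 moreover have "wp query_loop (wp (search_part ;; store_part) Qx) s1 ==> wp factor_com Qx s" for Qx
 proof -
  have rv: "ar s aRK (vr s vO) = r" "vr s vO < sz s aRK" "t + r < B" "r + t < B" using r szs B by (simp_all add: r_def ob_def)
  show "wp query_loop (wp (search_part ;; store_part) Qx) s1 ==> wp factor_com Qx s"
   unfolding factor_com_def wp_Seq using t rv B
   apply simp
   apply (erule back_subst[of "wp query_loop (wp search_part (wp store_part Qx))"])
   apply (simp add: s1_def add.commute)
   done
 qed
 ultimately show ?thesis by blast
qed

end

section \<open>Reading the string piece by piece\<close>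

definition start :: "(nat \<times> nat) list => nat => nat" where
 "start its j = sum_list (map snd (take j its))"

lemma start_Suc: "j < length its ==> start its (Suc j) = start its j + snd (its ! j)"
 by (simp add: start_def take_Suc_conv_app_nth)

lemma start_mono: "i <= j ==> start its i <= start its j"
proof (induction j)
 case (Suc j)
 have "start its j <= start its (Suc j)"
 proof (cases "j < length its")
  case True
  then show ?thesis by (simp add: start_Suc)
 next
  case False
  then show ?thesis by (simp add: start_def)
 qed
 then show ?case using Suc by (cases "i = Suc j") auto
qed simp

text \<open>Item \<open>(p, n)\<close> says that the next \<open>n\<close> characters of \<open>S\<close>, and \<open>h\<close> more, can be read at position \<open>p\<close> of \<open>T\<close>.\<close>

definition good_items :: "nat list => nat list => nat => (nat \<times> nat) list => bool" where
 "good_items T S h its \<longleftrightarrow> start its (length its) = length S &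
   (\<forall>j<length its. \<forall>y < snd (its ! j) + h. start its j + y < length S -->
    zc T (fst (its ! j) + y) = S ! (start its j + y))"

text \<open>\<open>vD\<close> is the offset into the current piece. A factor may end beyond its
  piece; the second branch then moves on piece by piece, so there are at most as many iterations as
  factors and pieces together.\<close>

definition main_loop :: com where
 "main_loop = Loop (Var vIt \<lhd> Var vNI)
  (Cond (Var vD \<lhd> Idx aITM (Lit 2 \<otimes> Var vIt \<oplus> Lit 1))
   (vO ::= Idx aITM (Lit 2 \<otimes> Var vIt) \<oplus> Var vD ;; factor_com ;; vD ::= Var vD \<oplus> Var vL \<oplus> Lit 1)
   (vD ::= Var vD \<ominus> Idx aITM (Lit 2 \<otimes> Var vIt \<oplus> Lit 1) ;; vIt ::= Var vIt \<oplus> Lit 1))"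

lemma main_mods [simp]: "wv main_loop = {vD, vIt, vO, vL, vCh, vA, vHi, vB, vMid, vLo, vMc, vXq, vKq}" "wa main_loop = {aREC, aSEG}" "al main_loop = {}"
 by (auto simp: main_loop_def)

text \<open>Within the lookahead T and S agree, but only up to the end of S. A node that fits into
  the rest of S is compared character by character; a longer one would have to match the sentinel,
  which it does not contain.\<close>

lemma prefix_agree:
 assumes T: "posl T" and S: "posl S" "sentinel_terminated d S" and p: "p < length S"
  and f: "\<And>i. i < length f ==> 0 < f ! i" "length f <= h" "d \<notin> set f"
  and ag: "\<And>x. x <= h ==> p + x < length S ==> zc T (q + x) = S ! (p + x)"
 shows "prefix f (drop q T) \<longleftrightarrow> prefix f (drop p S)"
proof (cases "p + length f <= length S")
 case True
 have "zc T (q + i) = zc S (p + i)" if "i < length f" for i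
  using ag[of i] that f(2) True by (simp add: zc_def)
 then show ?thesis using prefix_drop_zc[OF T, of f q] prefix_drop_zc[OF S(1), of f p] f(1) by auto
next
 case False
 have "\<not> prefix f (drop p S)" using False p prefix_length_le[of f "drop p S"] by auto
 moreover have "\<not> prefix f (drop q T)"
 proof
  assume "prefix f (drop q T)"
  let ?i = "length S - 1 - p"
  have i: "?i < length f" "?i <= h" "p + ?i = length S - 1" using False p f(2) by auto
  have "zc T (q + ?i) = f ! ?i" using \<open>prefix f (drop q T)\<close> prefix_drop_zc[OF T, of f q] f(1) i(1) by auto
  moreover have "zc T (q + ?i) = S ! (length S - 1)" using ag[of ?i] i p by simp
  moreover have "S ! (length S - 1) = d" using S(2) last_conv_nth[of S] by (auto simp: sentinel_terminated_def)
  ultimately have "f ! ?i = d" by simp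
  then show False using f(3) i(1) by (metis nth_mem)
 qed
 ultimately show ?thesis by simp
qed

definition node_inv :: "nat list => (nat => nat) => nat list list => (nat => nat) => bool" where
 "node_inv T SA fs REC \<longleftrightarrow> REC 0 = 0 & REC 1 = length T &
  (\<forall>k\<le>length fs. REC (5 * k) <= REC (5 * k + 1) & REC (5 * k + 1) <= length T & REC (5 * k + 2) = length (([] # fs) ! k) &
    (\<forall>x<length T. REC (5 * k) <= x & x < REC (5 * k + 1) \<longleftrightarrow> prefix (([] # fs) ! k) (drop (SA x) T))) &
  (\<forall>k<length fs. REC (5 * Suc k + 3) <= k & ([] # fs) ! Suc k = ([] # fs) ! REC (5 * Suc k + 3) @ [REC (5 * Suc k + 4)])"

lemma node_inv_step:
 assumes T: "posl T" and ni: "node_inv T SA fs REC" and k: "k <= length fs" and F: "F = ([] # fs) ! k" and c: "0 < c"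
  and posF: "\<And>i. i < length F ==> 0 < F ! i"
  and lh: "lo <= hi" "hi <= length T"
   "\<And>x. lo <= x & x < hi \<longleftrightarrow> REC (5 * k) <= x & x < REC (5 * k + 1) & zc T (SA x + length F) = c"
  and REC': "REC' = REC(5 * Suc (length fs) := lo, 5 * Suc (length fs) + 1 := hi, 5 * Suc (length fs) + 2 := Suc (length F),
    5 * Suc (length fs) + 3 := k, 5 * Suc (length fs) + 4 := c)"
 shows "node_inv T SA (fs @ [F @ [c]]) REC'"
proof -
 let ?m = "length fs" and ?fs = "fs @ [F @ [c]]"
 have old: "REC' i = REC i" if "i < 5 * Suc ?m" for i using that by (simp add: REC')
 have str: "([] # ?fs) ! j = ([] # fs) ! j" if "j <= ?m" for j using that by (cases j) (auto simp: nth_append)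
 have strn: "([] # ?fs) ! Suc ?m = F @ [c]" by simp
 have new: "REC' (5 * Suc ?m) = lo" "REC' (5 * Suc ?m + 1) = hi" "REC' (5 * Suc ?m + 2) = Suc (length F)"
  "REC' (5 * Suc ?m + 3) = k" "REC' (5 * Suc ?m + 4) = c" by (simp_all add: REC')
 have a: "REC' (5 * j) <= REC' (5 * j + 1) & REC' (5 * j + 1) <= length T & REC' (5 * j + 2) = length (([] # ?fs) ! j) &
    (\<forall>x<length T. REC' (5 * j) <= x & x < REC' (5 * j + 1) \<longleftrightarrow> prefix (([] # ?fs) ! j) (drop (SA x) T))" if "j <= length ?fs" for j
 proof (cases "j = Suc ?m")
  case True
  have "lo <= x & x < hi \<longleftrightarrow> prefix (F @ [c]) (drop (SA x) T)" if x: "x < length T" for x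
  proof -
   have 1: "REC (5 * k) <= x & x < REC (5 * k + 1) \<longleftrightarrow> prefix F (drop (SA x) T)"
    using ni k x unfolding node_inv_def F by blast
   have pc: "0 < (F @ [c]) ! i" if "i < length (F @ [c])" for i using that posF c by (auto simp: nth_append less_Suc_eq)
   have "prefix (F @ [c]) (drop (SA x) T) \<longleftrightarrow> (\<forall>i<length F. zc T (SA x + i) = F ! i) & zc T (SA x + length F) = c"
    using prefix_drop_zc[OF T, of "F @ [c]" "SA x", OF pc] by (auto simp: nth_append less_Suc_eq)
   also have "(\<forall>i<length F. zc T (SA x + i) = F ! i) \<longleftrightarrow> prefix F (drop (SA x) T)"
    using prefix_drop_zc[OF T, of F "SA x", OF posF] by simp
   finally show ?thesis using 1 lh(3)[of x] by blast
  qed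
  then show ?thesis unfolding True strn new using lh by simp
 next
  case False
  then have j: "j <= ?m" using that by simp
  have o: "REC' (5 * j) = REC (5 * j)" "REC' (5 * j + 1) = REC (5 * j + 1)" "REC' (5 * j + 2) = REC (5 * j + 2)"
   using j by (auto intro!: old)
  show ?thesis unfolding o str[OF j] using ni j unfolding node_inv_def by blast
 qed
 have b: "REC' (5 * Suc j + 3) <= j & ([] # ?fs) ! Suc j = ([] # ?fs) ! REC' (5 * Suc j + 3) @ [REC' (5 * Suc j + 4)]" if "j < length ?fs" for j
 proof (cases "j = ?m")
  case True
  show ?thesis unfolding True strn new using k str[OF k] F by simp
 next
  case False
  then have j: "j < ?m" using that by simp
  have o: "REC' (5 * Suc j + 3) = REC (5 * Suc j + 3)" "REC' (5 * Suc j + 4) = REC (5 * Suc j + 4)"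
   using j by (auto intro!: old)
  have i: "REC (5 * Suc j + 3) <= j" "([] # fs) ! Suc j = ([] # fs) ! REC (5 * Suc j + 3) @ [REC (5 * Suc j + 4)]"
   using ni j unfolding node_inv_def by blast+
  have "([] # ?fs) ! Suc j = ([] # fs) ! Suc j" "([] # ?fs) ! REC (5 * Suc j + 3) = ([] # fs) ! REC (5 * Suc j + 3)"
   using str[of "Suc j"] str[of "REC (5 * Suc j + 3)"] j i(1) by auto
  then show ?thesis unfolding o using i by simp
 qed
 have "REC' 0 = REC 0" "REC' 1 = REC 1" by (rule old; simp)+
 then show ?thesis unfolding node_inv_def using a b ni by (simp add: node_inv_def)
qed

context machine
begin

text \<open>The assumption \<open>hb\<close> makes the lookahead \<open>hh\<close> at least as long
  as every node, by \<open>lzp_node_length\<close>; so testing a node at the current address of T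
  gives the same answer as testing it at the current position of S.\<close>

lemma wp_main:
 fixes s :: state and T S :: "nat list" and its :: "(nat \<times> nat) list"
 defines "t \<equiv> length T" and "N \<equiv> length S" and "SA \<equiv> ar s aA3" and "ni \<equiv> length its"
 assumes h: "holds s 0 T" and T: "posl T" "0 < t" "vr s vTl = t" and sa: "isSA T SA" and rk: "\<And>i. i < t ==> ar s aRK (SA i) = i"
  and S: "posl S" "sentinel_terminated d S" and FS: "lz78_factorization S FS"
  and its: "good_items T S hh its" "\<And>j. j < ni ==> ar s aITM (2 * j) = fst (its ! j) & ar s aITM (2 * j + 1) = snd (its ! j)"
  and hb: "\<And>L. L * (L + 1) <= 2 * N ==> L <= hh"
  and vs: "vr s vIt = 0" "vr s vD = 0" "vr s vMc = 0" "vr s vNI = ni"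
  and rec0: "ar s aREC = (%_. 0)(1 := t)" and seg0: "ar s aSEG = (%_. 0)"
  and ch: "\<And>x. zc T x + 2 < B"
  and szs: "t <= sz s aA3" "t <= sz s aRK" "t + 3 <= sz s aTX" "5 * length FS + 10 <= sz s aREC" "2 * t <= sz s aSEG" "2 * ni <= sz s aITM"
  and B: "5 * length FS + 20 < B" "2 * t + 10 < B" "2 * ni + 10 < B" "N + 10 < B" and lg: "2 * t < 2 ^ lg"
 shows "wp main_loop (%u. vr u vMc = length FS & node_inv T SA FS (ar u aREC) & tm u <= tm s + (21 * lg + 50) * (length FS + ni) + 1) s"
proof -
 let ?D = "21 * lg + 50" and ?p = "%fs. length (concat fs)"
 define I where "I u \<longleftrightarrow> (\<exists>fs. lzp S fs & nodes_ok fs & node_inv T SA fs (ar u aREC) & vr u vMc = length fs & vr u vIt <= ni &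
   start its (vr u vIt) + vr u vD = ?p fs &
   seg_ok t (length fs) (%k. ar u aREC (5 * k)) (%k. ar u aREC (5 * k + 1)) (ar u aSEG) &
   tm u <= tm s + ?D * (length fs + vr u vIt))" for u :: state
 have ext: "\<exists>gs. FS = fs @ gs" if "lzp S fs" for fs
  using lzp_extend[OF that S(2)] lz78_factorization_unique[OF FS] by auto
 have SAb: "SA x < t" if "x < t" for x using sa that unfolding isSA_def t_def bij_betw_def by auto
 have RK: "ar s aRK q < t & SA (ar s aRK q) = q" if "q < t" for q
 proof -
  have "q \<in> SA ` {..<t}" using sa that unfolding isSA_def t_def bij_betw_def by simp
  then obtain i where "i < t" "SA i = q" by auto
  then show ?thesis using rk[of i] by simp
 qed
 show ?thesis unfolding main_loop_def
 proof (rule wp_Loop[where I = I and T = "tm s + ?D * (length FS + ni)"], goal_cases)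
  case 1
  have "seg_ok t 0 (%k. ar s aREC (5 * k)) (%k. ar s aREC (5 * k + 1)) (ar s aSEG)"
   using T by (simp add: seg_ok_def rec0 seg0)
  moreover have "node_inv T SA [] (ar s aREC)" by (simp add: node_inv_def rec0 t_def)
  ultimately show ?case unfolding I_def using vs
   by (intro exI[of _ "[]"]) (simp add: lzp_Nil nodes_ok_def start_def)
 next
  case (2 u)
  then obtain fs where fs: "lzp S fs" "nodes_ok fs" "node_inv T SA fs (ar u aREC)" "vr u vMc = length fs" "vr u vIt <= ni"
   "start its (vr u vIt) + vr u vD = ?p fs"
   "seg_ok t (length fs) (%k. ar u aREC (5 * k)) (%k. ar u aREC (5 * k + 1)) (ar u aSEG)"
   "tm u <= tm s + ?D * (length fs + vr u vIt)" unfolding I_def by blast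
  let ?j = "vr u vIt" and ?d = "vr u vD" and ?m = "length fs" and ?REC = "ar u aREC"
  have fu: "ar u aTX = ar s aTX" "ar u aA3 = SA" "ar u aRK = ar s aRK" "ar u aITM = ar s aITM" "vr u vTl = t" "vr u vNI = ni" "sz u = sz s"
   using T vs by (simp_all add: frame_simps[OF 2(2)] SA_def)
  obtain gs where gs: "FS = fs @ gs" using ext[OF fs(1)] by blast
  have mF: "?m <= length FS" using gs by simp
  have pN: "?p fs <= N" using fs(1) by (simp add: lzp_def N_def)
  have tl: "tm u <= tm s + ?D * (length FS + ni)"
  proof -
   have "?D * (?m + ?j) <= ?D * (length FS + ni)" using mF fs(5) by (intro mult_le_mono2) simp
   then show ?thesis using fs(8) by linarith
  qed
  have tot: "start its ni = N" using its(1) by (simp add: good_items_def ni_def N_def)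
  show ?case
  proof (cases "?j < ni")
   case False
   then have j: "?j = ni" using fs(5) by simp
   then have pe: "?p fs = N" using fs(6) tot pN by simp
   then have "FS = fs" using lzp_complete[OF fs(1)] lz78_factorization_unique[OF FS] by (simp add: N_def)
   then show ?thesis using j fu fs(3,4,8) tl by simp
  next
   case True
   have itm: "ar u aITM (2 * ?j) = fst (its ! ?j)" "ar u aITM (2 * ?j + 1) = snd (its ! ?j)" using its(2)[OF True] fu by auto
   have st: "start its (Suc ?j) = start its ?j + snd (its ! ?j)" using True by (simp add: start_Suc ni_def)
   have stN: "start its (Suc ?j) <= N" using start_mono[of "Suc ?j" ni its] True tot by simp
   have ib: "2 * ?j + 1 < sz s aITM" "2 * ?j + 1 < B" "2 * ?j < B" "2 * ?j < sz s aITM" "Suc (Suc 0) < B" "Suc ?j < B" using True szs B by auto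
   show ?thesis
   proof (cases "?d < snd (its ! ?j)")
    case False
    let ?v = "u(|tm := Suc (Suc (Suc (Suc (tm u)))), vr := (vr u)(vD := ?d - snd (its ! ?j), vIt := Suc ?j)|)"
    have "I ?v" unfolding I_def
     by (rule exI[of _ fs]) (use fs st False True in \<open>auto simp: algebra_simps\<close>)
    moreover have "?d < B" using fs(6) pN B by linarith
    ultimately show ?thesis using True fu itm False ib tl by simp
   next
    case dl: True
    let ?p0 = "?p fs" and ?q = "fst (its ! ?j) + ?d"
    have p: "?p0 < N" using fs(6) st stN dl by linarith
    have ag: "zc T (?q + x) = S ! (?p0 + x)" if "x <= hh" "?p0 + x < N" for x
    proof -
     have "?d + x < snd (its ! ?j) + hh" using that dl by linarith
     then have "zc T (fst (its ! ?j) + (?d + x)) = S ! (start its ?j + (?d + x))"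
      using its(1) True that fs(6) unfolding good_items_def ni_def N_def by (metis add.assoc)
     then show ?thesis using fs(6) by (simp add: add.assoc[symmetric])
    qed
    have posS: "0 < S ! i" if "i < N" for i using S(1) that by (simp add: posl_def N_def)
    have "zc T ?q = S ! ?p0" using ag[of 0] p by simp
    then have q: "?q < t" using posS[OF p] by (auto simp: zc_def t_def split: if_splits)
    have setS: "set (concat fs) \<subseteq> set S" using fs(1) unfolding lzp_def by (metis set_take_subset)
    have str: "([] # fs) ! k \<in> set ([] # fs)" if "k <= ?m" for k using that by (intro nth_mem) simp
    have strpos: "0 < ([] # fs) ! k ! i" if "k <= ?m" "i < length (([] # fs) ! k)" for k i
    proof -
     have "([] # fs) ! k ! i \<in> set (concat fs)" using str[OF that(1)] nth_mem[OF that(2)] by auto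
     then have "([] # fs) ! k ! i \<in> set S" using setS by blast
     then obtain x where "x < N" "S ! x = ([] # fs) ! k ! i" unfolding N_def by (metis in_set_conv_nth)
     then show ?thesis using posS[of x] by simp
    qed
    have nosent: "d \<notin> set (([] # fs) ! k)" if "k <= ?m" for k
     using str[OF that] lzp_no_sentinel[OF fs(1) S(2)] p by (auto simp: N_def)
    have strlen: "length (([] # fs) ! k) <= hh" if "k <= ?m" for k
    proof (rule hb)
     have "length (concat (take k fs)) <= ?p0"
      by (metis append_take_drop_id concat_append le_add1 length_append)
     then show "length (([] # fs) ! k) * (length (([] # fs) ! k) + 1) <= 2 * N"
      using lzp_node_length[OF fs(2) that] pN by linarith
    qed
    have agree: "prefix (([] # fs) ! k) (drop ?q T) \<longleftrightarrow> prefix (([] # fs) ! k) (drop ?p0 S)" if "k <= ?m" for k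
     by (rule prefix_agree[OF T(1) S, of _ _ hh]) (use p strpos strlen nosent ag that in \<open>auto simp: N_def\<close>)
    have nd: "?REC (5 * k) <= ?REC (5 * k + 1) & ?REC (5 * k + 1) <= t & ?REC (5 * k + 2) = length (([] # fs) ! k) &
      (\<forall>x<t. ?REC (5 * k) <= x & x < ?REC (5 * k + 1) \<longleftrightarrow> prefix (([] # fs) ! k) (drop (SA x) T))" if "k <= ?m" for k
     using fs(3) that unfolding node_inv_def t_def by blast
    have ndp: "(?REC (5 * k) <= x & x < ?REC (5 * k + 1)) = prefix (([] # fs) ! k) (drop (SA x) T)"
     if "k <= ?m" "x < t" for k x using nd[OF that(1)] that(2) by blast
    define u1 where "u1 = u(|tm := Suc (Suc (Suc (tm u))), vr := (vr u)(vO := ?q)|)"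
    let ?r = "ar s aRK ?q"
    have r: "?r < t" "SA ?r = ?q" using RK[OF q] by auto
    have e1: "vr u1 vMc = ?m" "ar u1 = ar u" "vr u1 vO = ?q" "sz u1 = sz s" "vr u1 vTl = t" "tm u1 = tm u + 3"
     using fs(4) fu by (simp_all add: u1_def)
    have W: "wp factor_com (%v. \<exists>k lo' hi'. k <= vr u1 vMc & ar u1 aREC (5 * k) <= ar u1 aRK (vr u1 vO) & ar u1 aRK (vr u1 vO) < ar u1 aREC (5 * k + 1) &
      (\<forall>k'\<le>vr u1 vMc. ar u1 aREC (5 * k') <= ar u1 aRK (vr u1 vO) --> ar u1 aRK (vr u1 vO) < ar u1 aREC (5 * k' + 1) --> k' <= k) &
      vr v vL = ar u1 aREC (5 * k + 2) & vr v vMc = Suc (vr u1 vMc) &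
      ar v aREC = (ar u1 aREC)(5 * Suc (vr u1 vMc) := lo', 5 * Suc (vr u1 vMc) + 1 := hi', 5 * Suc (vr u1 vMc) + 2 := Suc (ar u1 aREC (5 * k + 2)), 5 * Suc (vr u1 vMc) + 3 := k,
       5 * Suc (vr u1 vMc) + 4 := zc T (vr u1 vO + ar u1 aREC (5 * k + 2))) & lo' <= hi' & hi' <= length T &
      (\<forall>x. lo' <= x & x < hi' \<longleftrightarrow> ar u1 aREC (5 * k) <= x & x < ar u1 aREC (5 * k + 1) & zc T (ar u1 aA3 x + ar u1 aREC (5 * k + 2)) = zc T (vr u1 vO + ar u1 aREC (5 * k + 2))) &
      seg_ok (length T) (Suc (vr u1 vMc)) (%k. ar v aREC (5 * k)) (%k. ar v aREC (5 * k + 1)) (ar v aSEG) & tm v <= tm u1 + 21 * lg + 40) u1"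
    proof (rule wp_factor, goal_cases)
     case (11 k x x')
     then have k: "k <= ?m" "?REC (5 * k) <= x" "x <= x'" "x' < ?REC (5 * k + 1)" using e1 by auto
     have xt: "x' < t" "x < t" using nd[OF k(1)] k by auto
     have pr: "prefix (([] # fs) ! k) (drop (SA x) T)" "prefix (([] # fs) ! k) (drop (SA x') T)"
     proof -
      have "?REC (5 * k) <= x & x < ?REC (5 * k + 1)" "?REC (5 * k) <= x' & x' < ?REC (5 * k + 1)" using k by linarith+
      then show "prefix (([] # fs) ! k) (drop (SA x) T)" "prefix (([] # fs) ! k) (drop (SA x') T)"
       using ndp[OF k(1) xt(2)] ndp[OF k(1) xt(1)] by blast+
     qed
     have z: "\<forall>i<length (([] # fs) ! k). zc T (SA x + i) = zc T (SA x' + i)"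
      using pr prefix_drop_zc[OF T(1), of "([] # fs) ! k", OF strpos[OF k(1)]] by simp
     have "zc T (SA x + length (([] # fs) ! k)) <= zc T (SA x' + length (([] # fs) ! k))"
     proof (cases "x = x'")
      case False
      then have "sl T (SA x) (SA x')" using sa k xt by (auto simp: isSA_def t_def)
      then show ?thesis by (rule sl_common[OF T(1)]) (use z in auto)
     qed simp
     then show ?case using nd[OF k(1)] e1 fu by simp
    next
     case (12 k x)
     then have k: "k <= ?m" "?REC (5 * k) <= x" "x < ?REC (5 * k + 1)" using e1 by auto
     have xt: "x < t" using nd[OF k(1)] k by auto
     have "prefix (([] # fs) ! k) (drop (SA x) T)" using ndp[OF k(1) xt] k by blast
     then have "length (([] # fs) ! k) <= t - SA x" using prefix_length_le by (fastforce simp: t_def)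
     then show ?case using nd[OF k(1)] e1 fu SAb[OF xt] by (simp add: t_def)
    next
     case (10 k)
     then show ?case using nd[of k] e1 by (simp add: t_def)
    next
     case 8
     then show ?case using fs(3) e1 by (simp add: node_inv_def)
    next
     case 9
     then show ?case using fs(3) e1 by (simp add: node_inv_def)
    qed (use e1 fu h T(2) r q fs(7) ch szs B mF lg in \<open>auto simp: t_def holds_def\<close>)
    have "wp factor_com (wp (vD ::= Var vD \<oplus> Var vL \<oplus> Lit 1) I) u1"
    proof (rule wp_conseq[OF W], goal_cases)
     case (1 v)
     then obtain k lo' hi' where K: "k <= ?m" "?REC (5 * k) <= ?r" "?r < ?REC (5 * k + 1)"
       "\<forall>k'\<le>?m. ?REC (5 * k') <= ?r --> ?r < ?REC (5 * k' + 1) --> k' <= k"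
       "vr v vL = ?REC (5 * k + 2)" "vr v vMc = Suc ?m"
       "ar v aREC = ?REC(5 * Suc ?m := lo', 5 * Suc ?m + 1 := hi', 5 * Suc ?m + 2 := Suc (?REC (5 * k + 2)), 5 * Suc ?m + 3 := k,
       5 * Suc ?m + 4 := zc T (?q + ?REC (5 * k + 2)))" "lo' <= hi'" "hi' <= t"
       "\<forall>x. lo' <= x & x < hi' \<longleftrightarrow> ?REC (5 * k) <= x & x < ?REC (5 * k + 1) & zc T (SA x + ?REC (5 * k + 2)) = zc T (?q + ?REC (5 * k + 2))"
       "seg_ok t (Suc ?m) (%k. ar v aREC (5 * k)) (%k. ar v aREC (5 * k + 1)) (ar v aSEG)" "tm v <= tm u + 21 * lg + 43"
      unfolding e1 fu t_def by auto
     let ?F = "([] # fs) ! k"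
     have lenk: "?REC (5 * k + 2) = length ?F" using nd[OF K(1)] by blast
     have inr: "?REC (5 * k') <= ?r & ?r < ?REC (5 * k' + 1) \<longleftrightarrow> prefix (([] # fs) ! k') (drop ?p0 S)" if "k' <= ?m" for k'
      using nd[OF that] r agree[OF that] by auto
     have pF: "prefix ?F (drop ?p0 S)" using inr[OF K(1)] K(2,3) by blast
     have lt: "?p0 + length ?F < N" using sentinel_short[OF S(2) nosent[OF K(1)] pF] p by (simp add: N_def)
     have c: "zc T (?q + ?REC (5 * k + 2)) = S ! (?p0 + length ?F)" using ag[OF strlen[OF K(1)] lt] lenk by simp
     have c': "zc T (?q + length ?F) = S ! (?p0 + length ?F)" using c unfolding lenk .
     let ?c = "S ! (?p0 + length ?F)" and ?fs = "fs @ [?F @ [S ! (?p0 + length ?F)]]"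
     have mx: "length f <= length ?F" if "f \<in> set fs" "prefix f (drop ?p0 S)" for f
     proof -
      obtain i where i: "i < ?m" "f = fs ! i" using \<open>f \<in> set fs\<close> by (auto simp: in_set_conv_nth)
      then have "Suc i <= k" using inr[of "Suc i"] that K(4) by auto
      then show ?thesis using nodes_longest[OF fs(2), of "Suc i" k "drop ?p0 S"] K(1) i that pF by simp
     qed
     have lz: "lzp S ?fs" by (rule lzp_step[OF fs(1)]) (use str[OF K(1)] pF mx lt in \<open>auto simp: N_def\<close>)
     have no: "nodes_ok ?fs"
     proof -
      \<comment> \<open>Otherwise it would be a matching node longer than the longest one.\<close>
      have "?F @ [?c] \<notin> set fs"
      proof
       assume "?F @ [?c] \<in> set fs"
       moreover have "prefix (?F @ [?c]) (drop ?p0 S)"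
       proof -
        obtain z where z: "drop ?p0 S = ?F @ z" using pF by (auto simp: prefix_def)
        have "length ?F < length (drop ?p0 S)" using lt by (simp add: N_def)
        then obtain a y where ay: "z = a # y" using z by (cases z) auto
        have "drop ?p0 S ! length ?F = ?c" using lt by (simp add: N_def)
        then have "a = ?c" using z ay by simp
        then show ?thesis using z ay by simp
       qed
       ultimately show False using mx[of "?F @ [?c]"] by simp
      qed
      then have "distinct ([] # ?fs)" using fs(2) by (simp add: nodes_ok_def)
      moreover have "\<exists>j c. j <= i & ([] # ?fs) ! Suc i = ([] # ?fs) ! j @ [c]" if "i < length ?fs" for i
      proof (cases "i = ?m")
       case True
       have "([] # ?fs) ! k = ?F" using K(1) by (cases k) (auto simp: nth_append)
       then show ?thesis using True K(1) by - (rule exI[of _ k], rule exI[of _ ?c], auto)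
      next
       case False
       then have i: "i < ?m" using that by simp
       then obtain j c where jc: "j <= i" "([] # fs) ! Suc i = ([] # fs) ! j @ [c]" using fs(2) unfolding nodes_ok_def by blast
       have "([] # ?fs) ! j = ([] # fs) ! j" using jc i by (cases j) (auto simp: nth_append)
       then show ?thesis using jc i by - (rule exI[of _ j], rule exI[of _ c], auto simp: nth_append)
      qed
      ultimately show ?thesis by (simp add: nodes_ok_def)
     qed
     have niv: "node_inv T SA ?fs (ar v aREC)"
     proof (rule node_inv_step[OF T(1) fs(3) K(1) refl, where lo = lo' and hi = hi'])
      show "0 < ?c" using posS[OF lt] .
      show "ar v aREC = ?REC(5 * Suc ?m := lo', 5 * Suc ?m + 1 := hi', 5 * Suc ?m + 2 := Suc (length ?F), 5 * Suc ?m + 3 := k, 5 * Suc ?m + 4 := ?c)"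
       using K(7) unfolding lenk c' .
      show "lo' <= x & x < hi' \<longleftrightarrow> ?REC (5 * k) <= x & x < ?REC (5 * k + 1) & zc T (SA x + length ?F) = ?c" for x
       using K(10) unfolding lenk c' by blast
     qed (use K(8,9) strpos[OF K(1)] in \<open>auto simp: t_def\<close>)
     have fv: "vr v vIt = ?j" "vr v vD = ?d" by (simp_all add: frame_simps[OF 1(1)] u1_def)
     have len': "length (concat ?fs) = ?p0 + length ?F + 1" by simp
     have "I (v(|tm := Suc (tm v), vr := (vr v)(vD := Suc (?d + length ?F))|))" unfolding I_def
      by (rule exI[of _ ?fs]) (use lz no niv K(6,11,12) fs(5,6,8) fv in \<open>simp add: algebra_simps\<close>)
     moreover have "?d + length ?F + 1 < B" using fs(6) lt B by linarith
     ultimately show ?case using fv K(5) lenk B by simp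
    qed
    moreover have "wp factor_com Qx u1 ==> wp (vO ::= Idx aITM (Lit 2 \<otimes> Var vIt) \<oplus> Var vD) (wp factor_com Qx) (u(|tm := Suc (Suc (tm u))|))" for Qx
     using itm ib q B szs fu by (simp add: u1_def)
    ultimately have "wp (vO ::= Idx aITM (Lit 2 \<otimes> Var vIt) \<oplus> Var vD ;; factor_com ;; vD ::= Var vD \<oplus> Var vL \<oplus> Lit 1) I (u(|tm := Suc (Suc (tm u))|))"
     unfolding wp_Seq by blast
    then show ?thesis using True fu itm dl ib tl by (simp del: wp_Seq)
   qed
  qed
 qed
qed

end

section \<open>Initialisation and output of the factor search\<close>

definition invert_body :: com where "invert_body = Write aRK (Idx aA3 (Var vI)) (Var vI)"

text \<open>Node i + 1 has its parent in cell 5 (i + 1) + 3 and its character in the next one.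
  Stored characters are codes plus one, hence the subtraction. The output goes behind the nodes, two
  cells per factor, which makes seven cells per factor in all.\<close>

definition out_body :: com where
 "out_body = Write aREC (Var vXq \<oplus> Lit 2 \<otimes> Var vI \<oplus> Lit 1) (Idx aREC (Lit 5 \<otimes> Var vI \<oplus> Lit 8)) ;;
   Write aREC (Var vXq \<oplus> Lit 2 \<otimes> Var vI \<oplus> Lit 2) (Idx aREC (Lit 5 \<otimes> Var vI \<oplus> Lit 9) \<ominus> Lit 1)"

lemma out_mods [simp]: "wv invert_body = {}" "wa invert_body = {aRK}" "al invert_body = {}"
 "wv out_body = {}" "wa out_body = {aREC}" "al out_body = {}"
 by (auto simp: invert_body_def out_body_def)

text \<open>Node 0 is the empty string and its interval is the whole suffix array; its other cells
  are 0 from the allocation.\<close>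

definition lz_init :: com where
 "lz_init = vI ::= Lit 0 ;; For vI vTl invert_body ;; vMc ::= Lit 0 ;; vIt ::= Lit 0 ;; vD ::= Lit 0 ;;
   Write aREC (Lit 1) (Var vTl)"

definition lz_out :: com where
 "lz_out = vXq ::= Lit 5 \<otimes> (Var vMc \<oplus> Lit 1) ;; Write aREC (Var vXq) (Var vMc) ;; vI ::= Lit 0 ;; For vI vMc out_body"

definition lz_phase :: com where "lz_phase = lz_init ;; main_loop ;; lz_out"

lemma lz_mods [simp]: "wv lz_init = {vI, vMc, vIt, vD}" "wa lz_init = {aRK, aREC}" "al lz_init = {}"
 "wv lz_out = {vI, vXq}" "wa lz_out = {aREC}" "al lz_out = {}"
 by (auto simp: lz_init_def lz_out_def)

context machine
begin

lemma wp_lz_out: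
 fixes s :: state
 defines "m \<equiv> vr s vMc" and "REC \<equiv> ar s aREC"
 assumes szs: "7 * m + 10 <= sz s aREC" and B: "7 * m + 20 < B" and rb: "\<And>i. i < m ==> 0 < REC (5 * i + 9) & REC (5 * i + 9) < B"
 shows "wp lz_out (%u. vr u vXq = 5 * m + 5 & ar u aREC (5 * m + 5) = m &
   (\<forall>i<m. ar u aREC (5 * m + 5 + (2 * i + 1)) = REC (5 * i + 8) & ar u aREC (5 * m + 5 + (2 * i + 2)) = REC (5 * i + 9) - 1) &
   tm u <= tm s + 4 * m + 10) s"
proof -
 define s1 where "s1 = s(|ar := (ar s)(aREC := REC(5 * m + 5 := m)), tm := Suc (Suc (Suc (tm s))), vr := (vr s)(vXq := 5 * m + 5, vI := 0)|)"
 have "wp (For vI vMc out_body) (%u. vr u vXq = 5 * m + 5 & ar u aREC (5 * m + 5) = m &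
   (\<forall>i<m. ar u aREC (5 * m + 5 + (2 * i + 1)) = REC (5 * i + 8) & ar u aREC (5 * m + 5 + (2 * i + 2)) = REC (5 * i + 9) - 1) &
   tm u <= tm s + 4 * m + 10) s1"
 proof (rule wp_For[where D = 2 and I = "%k u. ar u aREC (5 * m + 5) = m & (\<forall>x<5 * m + 5. ar u aREC x = REC x) &
   (\<forall>i<k. ar u aREC (5 * m + 5 + (2 * i + 1)) = REC (5 * i + 8) & ar u aREC (5 * m + 5 + (2 * i + 2)) = REC (5 * i + 9) - 1)"], goal_cases)
  case (8 k u)
  have k: "k < m" using 8(2) by (simp add: s1_def m_def)
  have u: "vr u vI = k" "vr u vXq = 5 * m + 5" "sz u = sz s" using 8(3) by (simp_all add: frame_simps[OF 8(4)] s1_def)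
  have I: "ar u aREC (5 * m + 5) = m" "\<forall>x<5 * m + 5. ar u aREC x = REC x"
   "\<forall>i<k. ar u aREC (5 * m + 5 + (2 * i + 1)) = REC (5 * i + 8) & ar u aREC (5 * m + 5 + (2 * i + 2)) = REC (5 * i + 9) - 1" using 8(5) by auto
  have r: "ar u aREC (5 * k + 8) = REC (5 * k + 8)" "ar u aREC (5 * k + 9) = REC (5 * k + 9)" using I(2) k by auto
  let ?R = "(ar u aREC)(5 * m + 5 + (2 * k + 1) := REC (5 * k + 8), 5 * m + 5 + (2 * k + 2) := REC (5 * k + 9) - 1)"
  have "?R (5 * m + 5 + (2 * i + 1)) = REC (5 * i + 8) & ?R (5 * m + 5 + (2 * i + 2)) = REC (5 * i + 9) - 1" if "i < Suc k" for i
  proof (cases "i = k")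
   case False
   then have ik: "i < k" using that by simp
   have ne: "5 * m + 5 + (2 * i + 1) ~= 5 * m + 5 + (2 * k + 1)" "5 * m + 5 + (2 * i + 1) ~= 5 * m + 5 + (2 * k + 2)"
    "5 * m + 5 + (2 * i + 2) ~= 5 * m + 5 + (2 * k + 1)" "5 * m + 5 + (2 * i + 2) ~= 5 * m + 5 + (2 * k + 2)" using ik by presburger+
   show ?thesis using ne I(3)[rule_format, OF ik] by (simp only: fun_upd_other simp_thms)
  qed simp
  moreover have "?R (5 * m + 5) = m" "\<forall>x<5 * m + 5. ?R x = REC x" using I by auto
  moreover have "wp out_body (%v. tm v <= tm u + 2 & ar v aREC = ?R) u"
   unfolding out_body_def using u r rb[OF k] k szs B by (simp add: add.assoc)
  ultimately show ?case
   by (elim wp_conseq) (simp del: fun_upd_apply)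
 next
  case (9 u)
  have "vr u vXq = 5 * m + 5" by (simp add: frame_simps[OF 9(3)] s1_def)
  then show ?case using 9(1,4) by (simp add: s1_def m_def)
 qed (use B in \<open>auto simp: s1_def m_def\<close>)
 moreover have "wp (For vI vMc out_body) Qx s1 ==> wp lz_out Qx s" for Qx
  unfolding lz_out_def using szs B
  apply (simp add: m_def[symmetric])
  apply (erule back_subst[of "wp (For vI vMc out_body) Qx", simplified])
  apply (simp add: s1_def m_def REC_def add.commute)
  done
 ultimately show ?thesis by blast
qed

lemma wp_lz_init:
 fixes s :: state and T :: "nat list"
 defines "t \<equiv> length T" and "SA \<equiv> ar s aA3"
 assumes sa: "isSA T SA" and vs: "vr s vTl = t" and szs: "t <= sz s aA3" "t <= sz s aRK" "2 <= sz s aREC" and B: "t + 2 < B"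
  and r0: "ar s aREC = (%_. 0)"
 shows "wp lz_init (%u. (\<forall>i<t. ar u aRK (SA i) = i) & vr u vMc = 0 & vr u vIt = 0 & vr u vD = 0 &
   ar u aREC = (%_. 0)(1 := t) & tm u <= tm s + 3 * t + 10) s"
proof -
 have bij: "bij_betw SA {..<t} {..<t}" using sa by (simp add: isSA_def t_def)
 have SAb: "SA i < t" if "i < t" for i using bij that by (auto simp: bij_betw_def)
 define s1 where "s1 = s(|tm := Suc (tm s), vr := (vr s)(vI := 0)|)"
 have L: "wp (For vI vTl invert_body) (%u. (\<forall>i<t. ar u aRK (SA i) = i) & tm u <= tm s1 + 3 * t + 1) s1"
 proof (rule wp_For[where D = 1 and I = "%k u. \<forall>i<k. ar u aRK (SA i) = i"], goal_cases)
  case (8 k u)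
  have k: "k < t" using 8(2) vs by (simp add: s1_def)
  have u: "vr u vI = k" "ar u aA3 = SA" "sz u = sz s" using 8(3) by (simp_all add: frame_simps[OF 8(4)] s1_def SA_def)
  have "\<forall>i<Suc k. ((ar u aRK)(SA k := k)) (SA i) = i"
  proof (intro allI impI)
   fix i assume i: "i < Suc k"
   show "((ar u aRK)(SA k := k)) (SA i) = i"
   proof (cases "i = k")
    case False
    then have "SA i ~= SA k" using bij i k by (auto simp: bij_betw_def inj_on_def)
    then show ?thesis using 8(5) i False by simp
   qed simp
  qed
  moreover have "wp invert_body (%v. tm v <= tm u + 1 & ar v aRK = (ar u aRK)(SA k := k)) u"
   unfolding invert_body_def using u SAb[OF k] k szs by simp
  ultimately show ?case by (elim wp_conseq) (simp del: fun_upd_apply)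
 next
  case (9 u)
  then show ?case using vs by (simp add: s1_def)
 qed (use vs B in \<open>auto simp: s1_def\<close>)
 have "wp (For vI vTl invert_body) (wp (vMc ::= Lit 0 ;; vIt ::= Lit 0 ;; vD ::= Lit 0 ;; Write aREC (Lit 1) (Var vTl))
  (%u. (\<forall>i<t. ar u aRK (SA i) = i) & vr u vMc = 0 & vr u vIt = 0 & vr u vD = 0 &
   ar u aREC = (%_. 0)(1 := t) & tm u <= tm s + 3 * t + 10)) s1"
 proof (rule wp_conseq[OF L], goal_cases)
  case (1 u)
  have u: "sz u = sz s" "vr u vTl = t" "ar u aREC = (%_. 0)" using vs r0 by (simp_all add: frame_simps[OF 1(1)] s1_def)
  show ?case using u 1(2) B szs by (simp add: s1_def)
 qed
 then show ?thesis unfolding lz_init_def using B by (simp add: s1_def)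
qed

lemma wp_lz_phase:
 fixes s :: state and T S :: "nat list" and its :: "(nat \<times> nat) list"
 defines "t \<equiv> length T" and "N \<equiv> length S" and "ni \<equiv> length its"
 assumes h: "holds s 0 T" and T: "posl T" "0 < t" "vr s vTl = t" and sa: "isSA T (ar s aA3)"
  and S: "posl S" "sentinel_terminated d S" and FS: "lz78_factorization S FS"
  and its: "good_items T S hh its" "\<And>j. j < ni ==> ar s aITM (2 * j) = fst (its ! j) & ar s aITM (2 * j + 1) = snd (its ! j)"
  and hb: "\<And>L. L * (L + 1) <= 2 * N ==> L <= hh"
  and vs: "vr s vNI = ni" and rec0: "ar s aREC = (%_. 0)" and seg0: "ar s aSEG = (%_. 0)"
  and ch: "\<And>x. zc T x + 2 < B" "\<And>x. x \<in> set S ==> x < B"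
  and szs: "t <= sz s aA3" "t <= sz s aRK" "t + 3 <= sz s aTX" "7 * length FS + 10 <= sz s aREC" "2 * t <= sz s aSEG" "2 * ni <= sz s aITM"
  and B: "7 * length FS + 20 < B" "2 * t + 10 < B" "2 * ni + 10 < B" "N + 10 < B" and lg: "2 * t < 2 ^ lg"
 shows "wp lz_phase (%u. vr u vXq = 5 * length FS + 5 & ar u aREC (5 * length FS + 5) = length FS &
   (\<forall>k<length FS. ar u aREC (5 * length FS + 5 + (2 * k + 1)) <= k &
    ([] # FS) ! Suc k = ([] # FS) ! (ar u aREC (5 * length FS + 5 + (2 * k + 1))) @ [Suc (ar u aREC (5 * length FS + 5 + (2 * k + 2)))]) &
   tm u <= tm s + 3 * t + (21 * lg + 60) * (length FS + ni) + 30) s"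
proof -
 let ?m = "length FS"
 have posFS: "0 < c & c < B" if "k < ?m" "FS ! k = f @ [c]" for k f c
 proof -
  have "f @ [c] \<in> set FS" using that nth_mem[of k FS] by simp
  then have "c \<in> set (concat FS)" unfolding set_concat by (intro UN_I[of "f @ [c]"]) auto
  moreover have "concat FS = S" using FS by (simp add: lz78_factorization_def)
  ultimately have "c \<in> set S" by metis
  then show ?thesis using S(1) ch(2) by (auto simp: posl_def in_set_conv_nth)
 qed
 have "wp lz_init (wp (main_loop ;; lz_out) (%u. vr u vXq = 5 * ?m + 5 & ar u aREC (5 * ?m + 5) = ?m &
   (\<forall>k<?m. ar u aREC (5 * ?m + 5 + (2 * k + 1)) <= k &
    ([] # FS) ! Suc k = ([] # FS) ! (ar u aREC (5 * ?m + 5 + (2 * k + 1))) @ [Suc (ar u aREC (5 * ?m + 5 + (2 * k + 2)))]) &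
   tm u <= tm s + 3 * t + (21 * lg + 60) * (?m + ni) + 30)) s"
 proof (rule wp_conseq[OF wp_lz_init[where T = T]], goal_cases)
  case (8 u)
  have u: "\<forall>i<t. ar u aRK (ar s aA3 i) = i" "vr u vMc = 0" "vr u vIt = 0" "vr u vD = 0" "ar u aREC = (%_. 0)(1 := t)" "tm u <= tm s + 3 * t + 10"
   using 8(2) by (auto simp: t_def)
  have fu: "ar u aTX = ar s aTX" "ar u aA3 = ar s aA3" "ar u aITM = ar s aITM" "ar u aSEG = ar s aSEG" "vr u vTl = t" "vr u vNI = ni" "sz u = sz s"
   using T vs by (simp_all add: frame_simps[OF 8(1)])
  have W: "wp main_loop (%v. vr v vMc = length FS & node_inv T (ar u aA3) FS (ar v aREC) & tm v <= tm u + (21 * lg + 50) * (length FS + length its) + 1) u"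
   by (rule wp_main[where S = S and hh = hh and d = d])
    (use h T sa u fu S FS its hb seg0 ch szs B lg vs in \<open>auto simp: t_def N_def ni_def holds_def\<close>)
  show ?case unfolding wp_Seq
  proof (rule wp_conseq[OF W], goal_cases)
   case (1 v)
   have v: "vr v vMc = ?m" "node_inv T (ar u aA3) FS (ar v aREC)" "tm v <= tm u + (21 * lg + 50) * (?m + ni) + 1"
    using 1(2) by (auto simp: ni_def)
   have sv: "sz v = sz s" using fu by (simp add: frame_simps[OF 1(1)])
   let ?R = "ar v aREC"
   have nv: "?R (5 * k + 8) <= k & ([] # FS) ! Suc k = ([] # FS) ! ?R (5 * k + 8) @ [?R (5 * k + 9)]" if "k < ?m" for k
   proof -
    have "?R (5 * Suc k + 3) <= k & ([] # FS) ! Suc k = ([] # FS) ! ?R (5 * Suc k + 3) @ [?R (5 * Suc k + 4)]"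
     using v(2) that unfolding node_inv_def by blast
    moreover have "5 * Suc k + 3 = 5 * k + 8" "5 * Suc k + 4 = 5 * k + 9" by simp_all
    ultimately show ?thesis by metis
   qed
   have rb: "0 < ?R (5 * i + 9) & ?R (5 * i + 9) < B" if "i < ?m" for i
    using nv[OF that] posFS[OF that] by auto
   have L: "wp lz_out (%x. vr x vXq = 5 * vr v vMc + 5 & ar x aREC (5 * vr v vMc + 5) = vr v vMc &
     (\<forall>i<vr v vMc. ar x aREC (5 * vr v vMc + 5 + (2 * i + 1)) = ?R (5 * i + 8) & ar x aREC (5 * vr v vMc + 5 + (2 * i + 2)) = ?R (5 * i + 9) - 1) &
     tm x <= tm v + 4 * vr v vMc + 10) v"
    by (rule wp_lz_out) (use v sv szs B rb in auto)
   show ?case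
   proof (rule wp_conseq[OF L], goal_cases)
    case (1 x)
    have "(21 * lg + 60) * (?m + ni) = (21 * lg + 50) * (?m + ni) + 10 * (?m + ni)" by (simp add: algebra_simps)
    then have "tm x <= tm s + 3 * t + (21 * lg + 60) * (?m + ni) + 30" using 1(2) v(1,3) u(6) by simp
    moreover have "ar x aREC (5 * ?m + 5 + (2 * k + 1)) <= k &
      ([] # FS) ! Suc k = ([] # FS) ! (ar x aREC (5 * ?m + 5 + (2 * k + 1))) @ [Suc (ar x aREC (5 * ?m + 5 + (2 * k + 2)))]" if k: "k < ?m" for k
    proof -
     have e: "ar x aREC (5 * ?m + 5 + (2 * k + 1)) = ?R (5 * k + 8)" "ar x aREC (5 * ?m + 5 + (2 * k + 2)) = ?R (5 * k + 9) - 1"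
      using 1(2)[unfolded v(1)] k by blast+
     have "Suc (?R (5 * k + 9) - 1) = ?R (5 * k + 9)" using rb[OF k] by simp
     then show ?thesis unfolding e using nv[OF k] by metis
    qed
    ultimately show ?case using 1(2)[unfolded v(1)] by blast
   qed
  qed
 qed (use sa T szs B rec0 in \<open>auto simp: t_def\<close>)
 then show ?thesis unfolding lz_phase_def wp_Seq .
qed

end

section \<open>A short text containing all windows of the string\<close>

definition sub :: "'a list => nat => 'a list => bool" where
 "sub T p w \<longleftrightarrow> (\<exists>a b. T = a @ w @ b & length a = p)"

lemma sub_append: "sub T p w ==> sub (T @ Y) p w"
 by (fastforce simp: sub_def)

lemma sub_prefix: "sub T p (w @ v) ==> sub T p w"
 by (fastforce simp: sub_def)

lemma sub_take: "sub T p w ==> sub T p (take k w)"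
 using sub_prefix[of T p "take k w" "drop k w"] by simp

lemma sub_suffix: "sub T p (v @ w) ==> sub T (p + length v) w"
proof -
 assume "sub T p (v @ w)"
 then obtain a b where "T = (a @ v) @ w @ b" "length a = p" by (auto simp: sub_def)
 then show ?thesis unfolding sub_def by (intro exI[of _ "a @ v"] exI[of _ b]) auto
qed

lemma sub_drop: "sub T p w ==> k <= length w ==> sub T (p + k) (drop k w)"
 using sub_suffix[of T p "take k w" "drop k w"] by simp

lemma sub_iff: "sub T p w \<longleftrightarrow> p + length w <= length T & take (length w) (drop p T) = w"
proof
 assume "p + length w <= length T & take (length w) (drop p T) = w"
 then have "T = take p T @ w @ drop (length w) (drop p T)" "length (take p T) = p"
  by (metis append_take_drop_id) (use \<open>p + length w <= length T & _\<close> in auto)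
 then show "sub T p w" unfolding sub_def by blast
qed (auto simp: sub_def)

lemma sub_nth: "sub T p w ==> i < length w ==> p + i < length T & T ! (p + i) = w ! i"
 by (auto simp: sub_def nth_append)

lemma val_Terminal: "G ! i = Terminal a ==> val G i = [a]"
 by (simp add: val.simps)

lemma val_Pair: "G ! i = Pair l r ==> l < i ==> r < i ==> val G i = val G l @ val G r"
 by (simp add: val.simps)

section \<open>Reachable nonterminals and the abbreviating traversal\<close>

fun reach :: "'a slp => nat => nat set" where
 "reach G i = (case G ! i of Terminal a => {i}
   | Pair l r => if l < i & r < i then insert i (reach G l \<union> reach G r) else {i})"

declare reach.simps [simp del]

lemma reach_Pair: "G ! i = Pair l r ==> l < i ==> r < i ==> reach G i = insert i (reach G l \<union> reach G r)"
 by (simp add: reach.simps)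

lemma reach_self: "i \<in> reach G i"
 by (subst reach.simps) (auto split: rule.split)

lemma reach_nodes: "is_slp G ==> i < length G ==> nodes_labelled j (deriv_tree_at G i) \<ge> 1 ==> j \<in> reach G i"
proof (induction i rule: less_induct)
 case (less i)
 show ?case
 proof (cases "G ! i")
  case (Terminal a)
  then show ?thesis using less.prems by (cases "j = i") (auto simp: deriv_tree_at.simps reach.simps)
 next
  case (Pair l r)
  then have lr: "l < i" "r < i" using less.prems by (auto simp: is_slp_def)
  have "j = i \<or> nodes_labelled j (deriv_tree_at G l) \<ge> 1 \<or> nodes_labelled j (deriv_tree_at G r) \<ge> 1"
   using less.prems(3) lr Pair by (cases "j = i") (auto simp: deriv_tree_at.simps[of G i])
  then show ?thesis using less.IH[of l] less.IH[of r] less.prems lr reach_Pair[OF Pair lr] by auto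
 qed
qed

text \<open>\<open>pp\<close>, \<open>md\<close> and \<open>se\<close> are the positions in the text
  where the first occurrence of a long nonterminal starts, where the part of its left child ends,
  and where it ends itself. \<open>stp\<close> and \<open>tch\<close> exist for the analysis: they
  yield the bounds on the time and on the number of rules.\<close>

record dst =
 tx :: "nat list"
 pp :: "nat => nat"
 md :: "nat => nat"
 se :: "nat => nat"
 stp :: nat
 tch :: "nat set"

text \<open>
 The nonzero entries of \<open>se\<close> mark the long nonterminals whose first occurrence has been
 written out; of later occurrences only the first and last \<open>H\<close> characters are repeated.
\<close>

fun vis :: "'a slp => ('a => nat) => nat => nat => dst => dst" where
 "vis G cf H i d = (case G ! i of
   Terminal a => d(|tx := tx d @ [cf a], stp := Suc (stp d), tch := insert i (tch d)|)
  | Pair l r =>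
    if \<not> (l < i & r < i) then d
    else if length (val G i) < H then vis G cf H r (vis G cf H l (d(|stp := Suc (stp d), tch := insert i (tch d)|)))
    else if se d i ~= 0 then
     d(|tx := tx d @ take H (drop (pp d i) (tx d)) @ take H (drop (se d i - H) (tx d)), stp := Suc (stp d + 2 * H), tch := insert i (tch d)|)
    else
     let d1 = vis G cf H l (d(|pp := (pp d)(i := length (tx d)), stp := Suc (stp d), tch := insert i (tch d)|));
       d2 = vis G cf H r (d1(|md := (md d1)(i := length (tx d1)), stp := Suc (stp d1)|))
     in d2(|se := (se d2)(i := length (tx d2)), stp := Suc (stp d2)|))"

declare vis.simps [simp del]

text \<open>A piece of up to 2 h characters and h characters of lookahead must fit into the H
  characters kept at either end of a long nonterminal; hence the factor 3.\<close>

locale slp_text =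
 fixes G :: "'a slp" and cf :: "'a => nat" and h H :: nat
 assumes slp: "is_slp G" and H: "H = 3 * h" "0 < h"
begin

abbreviation "V i \<equiv> map cf (val G i)"
abbreviation "vl i \<equiv> length (val G i)"
abbreviation "big i \<equiv> H <= vl i"
abbreviation "lastH w \<equiv> drop (length w - H) w"

lemma children: "i < length G ==> G ! i = Pair l r ==> l < i & r < i & l < length G & r < length G"
 using slp unfolding is_slp_def by (metis less_trans)

lemma V_Pair: "i < length G ==> G ! i = Pair l r ==> V i = V l @ V r"
 using children[of i l r] val_Pair[of G i l r] by simp

lemma vl_Pair: "i < length G ==> G ! i = Pair l r ==> vl i = vl l + vl r"
 using children[of i l r] val_Pair[of G i l r] by simp

lemma vl_pos: "i < length G ==> 0 < vl i"
proof (induction i rule: less_induct)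
 case (less i)
 show ?case
 proof (cases "G ! i")
  case (Terminal a)
  then show ?thesis by (simp add: val_Terminal)
 next
  case (Pair l r)
  then show ?thesis using less.IH[of l] less.prems children[OF less.prems Pair] vl_Pair[OF less.prems Pair] by simp
 qed
qed

lemma big_Pair: "i < length G ==> big i ==> \<exists>l r. G ! i = Pair l r"
 using H by (cases "G ! i") (auto simp: val_Terminal)

text \<open>The windows from which the pieces of j are read: its two ends and the junction of its
  children, with H characters of a long child or all of a short one. The junction is addressed from
  \<open>md\<close> if both children are long and from the start or the end of j if one is; if
  neither is, j was written in full.\<close>

definition rng :: "nat => nat list => nat => nat => nat => bool" where
 "rng j T p m e \<longleftrightarrow> sub T p (take H (V j)) & H <= e & sub T (e - H) (lastH (V j)) &
  (\<forall>l r. G ! j = Pair l r -->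
   (big l --> big r --> H <= m & sub T (m - H) (lastH (V l) @ take H (V r))) &
   (\<not> big l --> big r --> sub T p (V l @ take H (V r))) &
   (big l --> \<not> big r --> H + vl r <= e & sub T (e - (H + vl r)) (lastH (V l) @ V r)) &
   (\<not> big l --> \<not> big r --> sub T p (V j)))"

lemma rng_append: "rng j T p m e ==> rng j (T @ Y) p m e"
 unfolding rng_def by (auto intro: sub_append)

text \<open>For a long nonterminal only the ends of the emitted text are relied on; between them an
  abbreviation leaves something arbitrary.\<close>

definition emits :: "nat => nat list => bool" where
 "emits i Y \<longleftrightarrow> (\<not> big i --> Y = V i) & (\<exists>Z. Y = take H (V i) @ Z) & (\<exists>Z. Y = Z @ lastH (V i))"

lemma emits_small: "\<not> big i ==> emits i (V i)"
 by (auto simp: emits_def)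

text \<open>The first H characters of i either lie in the left child or consist of all of it, then
  short and written in full, and a prefix of what starts the right child. The other end is
  symmetric.\<close>

lemma emits_Pair:
 assumes i: "i < length G" "G ! i = Pair l r" and Y: "emits l Y1" "emits r Y2"
 shows "emits i (Y1 @ Y2)"
proof -
 have Vi: "V i = V l @ V r" and li: "vl i = vl l + vl r" using V_Pair[OF i] vl_Pair[OF i] by auto
 have sm: "Y1 @ Y2 = V i" if "\<not> big i" using that Y li Vi by (auto simp: emits_def)
 obtain Z1 where Z1: "Y1 = take H (V l) @ Z1" using Y by (auto simp: emits_def)
 obtain Z2 where Z2: "Y2 = take H (V r) @ Z2" using Y by (auto simp: emits_def)
 obtain Z1' where Z1': "Y1 = Z1' @ lastH (V l)" using Y by (auto simp: emits_def)
 obtain Z2' where Z2': "Y2 = Z2' @ lastH (V r)" using Y by (auto simp: emits_def)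
 have "\<exists>Z. Y1 @ Y2 = take H (V i) @ Z"
 proof (cases "big l")
  case True
  then show ?thesis using Z1 Vi by auto
 next
  case False
  then have "Y1 = V l" using Y by (simp add: emits_def)
  moreover have "take H (V i) = V l @ take (H - vl l) (V r)" using False Vi by simp
  moreover have "take H (V r) = take (H - vl l) (V r) @ drop (H - vl l) (take H (V r))"
   by (metis append_take_drop_id diff_le_self min.absorb1 take_take)
  ultimately show ?thesis using Z2 by (intro exI[of _ "drop (H - vl l) (take H (V r)) @ Z2"]) (metis append.assoc)
 qed
 moreover have "\<exists>Z. Y1 @ Y2 = Z @ lastH (V i)"
 proof (cases "big r")
  case True
  then have "lastH (V i) = lastH (V r)" using Vi by simp
  then show ?thesis using Z2' by (metis append.assoc)
 next
  case False
  then have y: "Y2 = V r" using Y by (simp add: emits_def)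
  have "lastH (V i) = drop (vl i - H) (V l) @ V r" using False Vi li by simp
  moreover have "lastH (V l) = take (vl i - H - (vl l - H)) (lastH (V l)) @ drop (vl i - H) (V l)"
   using li by (metis append_take_drop_id drop_drop le_add_diff_inverse2 diff_le_mono le_add1 length_map)
  ultimately show ?thesis using Z1' y
   by (intro exI[of _ "Z1' @ take (vl i - H - (vl l - H)) (lastH (V l))"]) (metis append.assoc)
 qed
 ultimately show ?thesis using sm by (simp add: emits_def)
qed

lemma emits_rng:
 assumes i: "i < length G" "G ! i = Pair l r" "big i" and Y: "emits l Y1" "emits r Y2"
 shows "rng i (T @ Y1 @ Y2) (length T) (length (T @ Y1)) (length (T @ Y1 @ Y2))"
proof -
 have Vi: "V i = V l @ V r" and li: "vl i = vl l + vl r" using V_Pair[OF i(1,2)] vl_Pair[OF i(1,2)] by auto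
 obtain Z where Z: "Y1 @ Y2 = take H (V i) @ Z" using emits_Pair[OF i(1,2) Y] by (auto simp: emits_def)
 obtain Z' where Z': "Y1 @ Y2 = Z' @ lastH (V i)" using emits_Pair[OF i(1,2) Y] by (auto simp: emits_def)
 have lH: "length (lastH (V i)) = H" using i(3) by simp
 have a: "sub (T @ Y1 @ Y2) (length T) (take H (V i))" unfolding sub_def Z by blast
 have "length (Y1 @ Y2) = length Z' + H" using Z' lH by (metis length_append)
 then have b: "H <= length (T @ Y1 @ Y2)" "length (T @ Y1 @ Y2) - H = length (T @ Z')" by auto
 have c: "sub (T @ Y1 @ Y2) (length (T @ Y1 @ Y2) - H) (lastH (V i))"
  unfolding b(2) unfolding sub_def by (rule exI[of _ "T @ Z'"], rule exI[of _ "[]"]) (use Z' in simp)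
 obtain Z1' where Z1': "Y1 = Z1' @ lastH (V l)" using Y by (auto simp: emits_def)
 obtain Z2 where Z2: "Y2 = take H (V r) @ Z2" using Y by (auto simp: emits_def)
 have d: "H <= length (T @ Y1) & sub (T @ Y1 @ Y2) (length (T @ Y1) - H) (lastH (V l) @ take H (V r))" if "big l"
 proof -
  have "length Y1 = length Z1' + H" using Z1' that by simp
  then have "H <= length (T @ Y1)" "length (T @ Y1) - H = length (T @ Z1')" by auto
  moreover have "sub (T @ Y1 @ Y2) (length (T @ Z1')) (lastH (V l) @ take H (V r))"
   unfolding sub_def Z1' Z2 by (intro exI[of _ "T @ Z1'"] exI[of _ Z2]) simp
  ultimately show ?thesis by simp
 qed
 have e: "sub (T @ Y1 @ Y2) (length T) (V l @ take H (V r))" if "\<not> big l"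
 proof -
  have "Y1 = V l" using that Y by (simp add: emits_def)
  then show ?thesis unfolding sub_def Z2 by (intro exI[of _ T] exI[of _ Z2]) simp
 qed
 have f: "H + vl r <= length (T @ Y1 @ Y2) & sub (T @ Y1 @ Y2) (length (T @ Y1 @ Y2) - (H + vl r)) (lastH (V l) @ V r)" if "big l" "\<not> big r"
 proof -
  have y2: "Y2 = V r" using that Y by (simp add: emits_def)
  have "length Y1 = length Z1' + H" using Z1' that by simp
  then have "H + vl r <= length (T @ Y1 @ Y2)" "length (T @ Y1 @ Y2) - (H + vl r) = length (T @ Z1')" using y2 by auto
  moreover have "sub (T @ Y1 @ Y2) (length (T @ Z1')) (lastH (V l) @ V r)"
   unfolding sub_def Z1' y2 by (intro exI[of _ "T @ Z1'"] exI[of _ "[]"]) simp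
  ultimately show ?thesis by simp
 qed
 have g: "sub (T @ Y1 @ Y2) (length T) (V i)" if "\<not> big l" "\<not> big r"
 proof -
  have "Y1 = V l" "Y2 = V r" using that Y by (auto simp: emits_def)
  then show ?thesis unfolding sub_def Vi by (intro exI[of _ T] exI[of _ "[]"]) simp
 qed
 show ?thesis unfolding rng_def using a b c d e f g i(2) by auto
qed

text \<open>The excess of text caused by expanding j: each child may leave 2 H characters, or its
  length if it is short, while j itself is granted 2 H.\<close>

definition wt :: "nat => nat" where
 "wt j = (case G ! j of Terminal a => 0 | Pair l r =>
   if H <= vl j then (if H <= vl l then (if H <= vl r then 2 * H else vl r) else if H <= vl r then vl l else 0) else 0)"

definition fin_set :: "dst => nat set" where "fin_set d = {j. j < length G & se d j ~= 0}"

text \<open>A copied occurrence is not descended into, so everything below it must already have been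
  visited and its long descendants recorded.\<close>

definition dj :: "dst => nat => bool" where
 "dj d j \<longleftrightarrow> j < length G & big j & rng j (tx d) (pp d j) (md d j) (se d j) &
   reach G j \<subseteq> tch d & (\<forall>k\<in>reach G j. big k --> se d k ~= 0)"

definition dinv :: "dst => bool" where
 "dinv d \<longleftrightarrow> finite (tch d) & (\<forall>j. se d j ~= 0 --> dj d j)"

lemma dj_mono:
 assumes "dj d j" "tx d' = tx d @ Y" "pp d' j = pp d j" "md d' j = md d j" "se d' j = se d j" "tch d \<subseteq> tch d'"
  "\<And>k. se d k ~= 0 ==> se d' k ~= 0"
 shows "dj d' j"
 using assms rng_append unfolding dj_def by (metis subset_trans)

lemma dinv_ext:
 assumes "dinv d" "tx d' = tx d @ Y" "se d' = se d" "\<And>j. se d j ~= 0 ==> pp d' j = pp d j & md d' j = md d j" "tch d \<subseteq> tch d'"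
  "finite (tch d')"
 shows "dinv d'"
 unfolding dinv_def
proof (intro conjI allI impI)
 fix j assume j: "se d' j ~= 0"
 then have "dj d j" using assms(1,3) by (simp add: dinv_def)
 then show "dj d' j" by (rule dj_mono[where Y = Y]) (use assms j in auto)
qed (rule assms)

text \<open>A binary tree with k leaves has 2 k - 1 nodes, and a rule takes at most three steps
  besides the visits to its children; the offsets 3 and 1 let both counts add up over two children.
  Entries above i stay unchanged, so positions recorded for i survive the visits to its children.
  The last line charges the text to the weights of the nonterminals finished meanwhile.\<close>

definition vpost :: "nat => dst => dst => bool" where
 "vpost i d d' \<longleftrightarrow> dinv d' & (\<exists>Y. tx d' = tx d @ Y & emits i Y & 0 < length Y &
   stp d' + 3 <= stp d + 4 * length Y & card (tch d') + 1 <= card (tch d) + 2 * length Y) &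
  (\<forall>j. se d j ~= 0 --> se d' j = se d j & pp d' j = pp d j & md d' j = md d j) &
  (\<forall>j>i. se d' j = se d j & pp d' j = pp d j & md d' j = md d j) &
  tch d \<subseteq> tch d' & reach G i \<subseteq> tch d' & (\<forall>k\<in>reach G i. big k --> se d' k ~= 0) &
  length (tx d') + sum wt (fin_set d) <= length (tx d) + sum wt (fin_set d') + (if big i then 2 * H else vl i)"

lemma vpost_se: "vpost i d d' ==> k \<in> reach G i ==> big k ==> se d' k ~= 0"
 unfolding vpost_def by blast

lemma vis_vpost: "i < length G ==> dinv d ==> vpost i d (vis G cf H i d)"
proof (induction i arbitrary: d rule: less_induct)
 case (less i)
 show ?case
 proof (cases "G ! i")
  case (Terminal a)
  have nb: "\<not> big i" using Terminal H by (simp add: val_Terminal)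
  let ?d = "d(|tx := tx d @ [cf a], stp := Suc (stp d), tch := insert i (tch d)|)"
  have "dinv ?d" by (rule dinv_ext[OF less.prems(2), where Y = "[cf a]"]) (use less.prems(2) in \<open>auto simp: dinv_def\<close>)
  moreover have "emits i [cf a]" using emits_small[OF nb] Terminal by (simp add: val_Terminal)
  moreover have "card (insert i (tch d)) + 1 <= card (tch d) + 2"
   using less.prems(2) by (simp add: card_insert_if dinv_def)
  ultimately have "vpost i d ?d" unfolding vpost_def using Terminal nb
   by (auto simp: reach.simps fin_set_def val_Terminal)
  then show ?thesis using Terminal by (simp add: vis.simps)
 next
  case (Pair l r)
  note ch = children[OF less.prems(1) Pair]
  have lr: "l < i" "r < i" "l < length G" "r < length G" using ch by auto
  have Vi: "V i = V l @ V r" and li: "vl i = vl l + vl r" using V_Pair[OF less.prems(1) Pair] vl_Pair[OF less.prems(1) Pair] by auto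
  have re: "reach G i = insert i (reach G l \<union> reach G r)" using reach_Pair[OF Pair lr(1,2)] .
  have fin: "finite (tch d)" using less.prems(2) by (simp add: dinv_def)
  have ci: "card (insert i (tch d)) <= card (tch d) + 1" using fin by (simp add: card_insert_if)
  have finfs: "finite (fin_set x)" for x unfolding fin_set_def by simp
  show ?thesis
  proof (cases "big i")
   case False
   have nb: "\<not> big l" "\<not> big r" using False li by auto
   let ?d0 = "d(|stp := Suc (stp d), tch := insert i (tch d)|)"
   have i0: "dinv ?d0" by (rule dinv_ext[OF less.prems(2), where Y = "[]"]) (use fin in auto)
   define d1 where "d1 = vis G cf H l ?d0"
   have p1: "vpost l ?d0 d1" unfolding d1_def by (rule less.IH[OF lr(1,3) i0])
   then have i1: "dinv d1" by (simp add: vpost_def)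
   define d2 where "d2 = vis G cf H r d1"
   have p2: "vpost r d1 d2" unfolding d2_def by (rule less.IH[OF lr(2,4) i1])
   obtain Y1 where Y1: "tx d1 = tx d @ Y1" "emits l Y1" "0 < length Y1" "stp d1 + 3 <= Suc (stp d) + 4 * length Y1"
    "card (tch d1) + 1 <= card (insert i (tch d)) + 2 * length Y1" using p1 by (auto simp: vpost_def)
   obtain Y2 where Y2: "tx d2 = tx d1 @ Y2" "emits r Y2" "0 < length Y2" "stp d2 + 3 <= stp d1 + 4 * length Y2"
    "card (tch d2) + 1 <= card (tch d1) + 2 * length Y2" using p2 by (auto simp: vpost_def)
   have "\<exists>Y. tx d2 = tx d @ Y & emits i Y & 0 < length Y &
    stp d2 + 3 <= stp d + 4 * length Y & card (tch d2) + 1 <= card (tch d) + 2 * length Y"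
    by (rule exI[of _ "Y1 @ Y2"]) (use Y1 Y2 ci emits_Pair[OF less.prems(1) Pair Y1(2) Y2(2)] in auto)
   moreover have "\<forall>k\<in>reach G i. big k --> se d2 k ~= 0" using p1 p2 False unfolding re vpost_def by (metis Un_iff insert_iff)
   moreover have "length (tx d2) + sum wt (fin_set d) <= length (tx d) + sum wt (fin_set d2) + vl i"
   proof -
    have "fin_set ?d0 = fin_set d" by (simp add: fin_set_def)
    then show ?thesis using p1 p2 nb li by (simp add: vpost_def)
   qed
   moreover have "tch d \<subseteq> tch d2" "reach G i \<subseteq> tch d2" using p1 p2 unfolding re vpost_def by auto
   moreover have "\<forall>j. se d j ~= 0 --> se d2 j = se d j & pp d2 j = pp d j & md d2 j = md d j"
    using p1 p2 by (auto simp: vpost_def)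
   moreover have "\<forall>j>i. se d2 j = se d j & pp d2 j = pp d j & md d2 j = md d j" using p1 p2 lr by (auto simp: vpost_def)
   moreover have "dinv d2" using p2 by (simp add: vpost_def)
   ultimately have "vpost i d d2" unfolding vpost_def using False by simp
   then show ?thesis using Pair lr False by (subst vis.simps) (simp add: d1_def d2_def)
  next
   case bi: True
   show ?thesis
   proof (cases "se d i = 0")
    case False
    let ?Y = "take H (drop (pp d i) (tx d)) @ take H (drop (se d i - H) (tx d))"
    let ?d = "d(|tx := tx d @ ?Y, stp := Suc (stp d + 2 * H), tch := insert i (tch d)|)"
    have rg: "rng i (tx d) (pp d i) (md d i) (se d i)" "reach G i \<subseteq> tch d" "\<forall>k\<in>reach G i. big k --> se d k ~= 0"
     using less.prems(2) False unfolding dinv_def dj_def by blast+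
    have "sub (tx d) (pp d i) (take H (V i))" "sub (tx d) (se d i - H) (lastH (V i))" using rg(1) by (auto simp: rng_def)
    moreover have "length (take H (V i)) = H" "length (lastH (V i)) = H" using bi by auto
    ultimately have Y: "?Y = take H (V i) @ lastH (V i)" by (simp add: sub_iff)
    have "emits i ?Y" unfolding Y emits_def using bi by auto
    moreover have lenY: "length ?Y = 2 * H" unfolding Y using bi by simp
    moreover have "dinv ?d" by (rule dinv_ext[OF less.prems(2), where Y = ?Y]) (use fin in auto)
    moreover have "length (tx ?d) + sum wt (fin_set d) <= length (tx d) + sum wt (fin_set ?d) + 2 * H"
     using lenY by (simp add: fin_set_def)
    moreover have "\<exists>Y. tx ?d = tx d @ Y & emits i Y & 0 < length Y &
     stp ?d + 3 <= stp d + 4 * length Y & card (tch ?d) + 1 <= card (tch d) + 2 * length Y"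
     by (rule exI[of _ ?Y]) (use calculation ci H in auto)
    moreover have "tch d \<subseteq> tch ?d" "reach G i \<subseteq> tch ?d" using rg(2) by auto
    moreover have "\<forall>k\<in>reach G i. big k --> se ?d k ~= 0" using rg(3) by simp
    moreover have "\<forall>j. se d j ~= 0 --> se ?d j = se d j & pp ?d j = pp d j & md ?d j = md d j" by simp
    moreover have "\<forall>j>i. se ?d j = se d j & pp ?d j = pp d j & md ?d j = md d j" by simp
    ultimately have "vpost i d ?d" unfolding vpost_def if_P[OF bi] by blast
    then show ?thesis using Pair lr bi False by (subst vis.simps) simp
   next
    case True
    let ?d0 = "d(|pp := (pp d)(i := length (tx d)), stp := Suc (stp d), tch := insert i (tch d)|)"
    have i0: "dinv ?d0" by (rule dinv_ext[OF less.prems(2), where Y = "[]"]) (use fin True in auto)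
    define d1 where "d1 = vis G cf H l ?d0"
    have p1: "vpost l ?d0 d1" unfolding d1_def by (rule less.IH[OF lr(1,3) i0])
    then have i1: "dinv d1" by (simp add: vpost_def)
    have at1: "se d1 i = 0" "pp d1 i = length (tx d)" using p1 lr True by (auto simp: vpost_def)
    let ?d1 = "d1(|md := (md d1)(i := length (tx d1)), stp := Suc (stp d1)|)"
    have i1': "dinv ?d1" by (rule dinv_ext[OF i1, where Y = "[]"]) (use i1 at1 in \<open>auto simp: dinv_def\<close>)
    define d2 where "d2 = vis G cf H r ?d1"
    have p2: "vpost r ?d1 d2" unfolding d2_def by (rule less.IH[OF lr(2,4) i1'])
    have i2: "dinv d2" using p2 by (simp add: vpost_def)
    have at2: "se d2 i = 0" "pp d2 i = length (tx d)" "md d2 i = length (tx d1)" using p2 lr at1 by (auto simp: vpost_def)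
    let ?d2 = "d2(|se := (se d2)(i := length (tx d2)), stp := Suc (stp d2)|)"
    obtain Y1 where Y1: "tx d1 = tx d @ Y1" "emits l Y1" "0 < length Y1" "stp d1 + 3 <= Suc (stp d) + 4 * length Y1"
     "card (tch d1) + 1 <= card (insert i (tch d)) + 2 * length Y1" using p1 by (auto simp: vpost_def)
    obtain Y2 where Y2: "tx d2 = tx d1 @ Y2" "emits r Y2" "0 < length Y2" "stp d2 + 3 <= Suc (stp d1) + 4 * length Y2"
     "card (tch d2) + 1 <= card (tch d1) + 2 * length Y2" using p2 by (auto simp: vpost_def)
    have rgi: "rng i (tx d2) (length (tx d)) (length (tx d1)) (length (tx d2))"
     using emits_rng[OF less.prems(1) Pair bi Y1(2) Y2(2), of "tx d"] Y1(1) Y2(1) by simp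
    have ne: "length (tx d2) ~= 0" using Y2 by auto
    have mono: "\<forall>j. se d j ~= 0 --> se ?d2 j = se d j & pp ?d2 j = pp d j & md ?d2 j = md d j"
    proof (intro allI impI)
     fix j assume j: "se d j ~= 0"
     then have ij: "j ~= i" using True by auto
     have "se d1 j = se d j & pp d1 j = pp d j & md d1 j = md d j" using p1 j ij by (auto simp: vpost_def)
     moreover have "se d2 j = se d1 j & pp d2 j = pp d1 j & md d2 j = md d1 j" using p2 j ij calculation by (auto simp: vpost_def)
     ultimately show "se ?d2 j = se d j & pp ?d2 j = pp d j & md ?d2 j = md d j" using ij by simp
    qed
    have tcs: "insert i (tch d) \<subseteq> tch d1" "tch d1 \<subseteq> tch d2" "reach G l \<subseteq> tch d1" "reach G r \<subseteq> tch d2"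
     using p1 p2 by (auto simp: vpost_def)
    have ses: "se d2 k ~= 0" if "se d1 k ~= 0" for k using p2 that by (auto simp: vpost_def)
    have rb: "se ?d2 k ~= 0" if "k \<in> reach G i" "big k" for k
    proof (cases "k = i")
     case True then show ?thesis using ne by simp
    next
     case False
     then have "k \<in> reach G l \<or> k \<in> reach G r" using that re by auto
     then have "se d2 k ~= 0"
     proof
      assume "k \<in> reach G l"
      from ses[OF vpost_se[OF p1 this that(2)]] show ?thesis .
     next
      assume "k \<in> reach G r"
      from vpost_se[OF p2 this that(2)] show ?thesis .
     qed
     then show ?thesis using False by simp
    qed
    have rt: "reach G i \<subseteq> tch ?d2" unfolding re using tcs by auto
    have dv: "dinv ?d2" unfolding dinv_def
    proof (intro conjI allI impI)
     show "finite (tch ?d2)" using i2 by (simp add: dinv_def)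
    next
     fix j assume j: "se ?d2 j ~= 0"
     show "dj ?d2 j"
     proof (cases "j = i")
      case True
      then show ?thesis unfolding dj_def using less.prems(1) bi rgi at2 rt rb by simp
     next
      case False
      then have "dj d2 j" using i2 j by (simp add: dinv_def)
      then show ?thesis by (rule dj_mono[where Y = "[]"]) (use False ne in auto)
     qed
    qed
    have dn: "fin_set ?d2 = insert i (fin_set d2)" "i \<notin> fin_set d2" using ne less.prems(1) at2 by (auto simp: fin_set_def)
    have sw: "sum wt (fin_set ?d2) = wt i + sum wt (fin_set d2)" unfolding dn(1) using dn(2) finfs by simp
    have d0: "fin_set ?d0 = fin_set d" "fin_set ?d1 = fin_set d1" by (auto simp: fin_set_def)
    have g1: "length (tx d1) + sum wt (fin_set d) <= length (tx d) + sum wt (fin_set d1) + (if big l then 2 * H else vl l)"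
     using p1 d0 by (simp add: vpost_def)
    have g2: "length (tx d2) + sum wt (fin_set d1) <= length (tx d1) + sum wt (fin_set d2) + (if big r then 2 * H else vl r)"
     using p2 d0 by (simp add: vpost_def)
    have "(if big l then 2 * H else vl l) + (if big r then 2 * H else vl r) <= wt i + 2 * H"
     using Pair bi by (auto simp: wt_def)
    then have "length (tx ?d2) + sum wt (fin_set d) <= length (tx d) + sum wt (fin_set ?d2) + 2 * H" using g1 g2 sw by simp
    moreover have "\<exists>Y. tx ?d2 = tx d @ Y & emits i Y & 0 < length Y &
     stp ?d2 + 3 <= stp d + 4 * length Y & card (tch ?d2) + 1 <= card (tch d) + 2 * length Y"
     by (rule exI[of _ "Y1 @ Y2"]) (use Y1 Y2 ci emits_Pair[OF less.prems(1) Pair Y1(2) Y2(2)] in auto)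
    moreover have "\<forall>j>i. se ?d2 j = se d j & pp ?d2 j = pp d j & md ?d2 j = md d j" using p1 p2 lr by (auto simp: vpost_def)
    moreover have "tch d \<subseteq> tch ?d2" using tcs by auto
    moreover have "\<forall>k\<in>reach G i. big k --> se ?d2 k ~= 0" using rb by blast
    ultimately have "vpost i d ?d2" unfolding vpost_def if_P[OF bi] using dv mono rt by blast
    then show ?thesis using Pair lr bi True by (subst vis.simps) (simp add: d1_def d2_def Let_def)
   qed
  qed
 qed
qed

definition d0 :: dst where "d0 = (|tx = [], pp = %_. 0, md = %_. 0, se = %_. 0, stp = 0, tch = {}|)"

definition root :: nat where "root = length G - 1"

definition D :: dst where "D = vis G cf H root d0"

text \<open>A bound on the text that depends only on the lengths of the nonterminals. The program
  can thus compute it before the traversal and size its arrays by it.\<close>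

definition Z :: nat where "Z = 2 * H + (\<Sum>j<length G. wt j)"

lemma root: "root < length G"
 using slp by (auto simp: root_def is_slp_def)

lemma D_post: "vpost root d0 D"
 unfolding D_def by (rule vis_vpost[OF root]) (simp add: dinv_def d0_def)

lemma D_text:
 shows D_dinv: "dinv D" and D_emits: "emits root (tx D)" and D_pos: "0 < length (tx D)"
  and D_stp: "stp D <= 4 * length (tx D)" and D_reach: "card (reach G root) <= 2 * length (tx D)"
  and D_len: "length (tx D) <= Z"
proof -
 obtain Y where Y: "tx D = Y" "emits root Y" "0 < length Y" "stp D + 3 <= 4 * length Y" "card (tch D) + 1 <= 2 * length Y"
  using D_post unfolding vpost_def by (auto simp: d0_def)
 have di: "dinv D" using D_post unfolding vpost_def by blast
 have "reach G root \<subseteq> tch D" "finite (tch D)" using D_post unfolding vpost_def dinv_def by blast+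
 then have "card (reach G root) <= card (tch D)" by (simp add: card_mono)
 moreover have "length (tx D) + sum wt (fin_set d0) <= length (tx d0) + sum wt (fin_set D) + (if big root then 2 * H else vl root)"
  using D_post unfolding vpost_def by blast
 moreover have "fin_set d0 = {}" "length (tx d0) = 0" by (auto simp: fin_set_def d0_def)
 moreover have "sum wt (fin_set D) <= (\<Sum>j<length G. wt j)" by (rule sum_mono2) (auto simp: fin_set_def)
 ultimately show "dinv D" "emits root (tx D)" "0 < length (tx D)" "stp D <= 4 * length (tx D)"
  "card (reach G root) <= 2 * length (tx D)" "length (tx D) <= Z"
  using Y di by (auto simp: Z_def split: if_splits)
qed

lemma D_rng: "j \<in> reach G root ==> big j ==> rng j (tx D) (pp D j) (md D j) (se D j) & j < length G"
proof -
 assume "j \<in> reach G root" "big j"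
 then have "se D j ~= 0" using D_post unfolding vpost_def by blast
 then show ?thesis using D_dinv unfolding dinv_def dj_def by blast
qed

end

section \<open>Covering the string by pieces of the text\<close>

lemma reach_trans: "k \<in> reach G i ==> reach G k \<subseteq> reach G i"
proof (induction i rule: less_induct)
 case (less i)
 show ?case
 proof (cases "k = i \<or> (\<nexists>l r. G ! i = Pair l r & l < i & r < i)")
  case True
  then show ?thesis using less.prems by (cases "G ! i") (auto simp: reach.simps[of G i] split: if_splits)
 next
  case False
  then obtain l r where P: "G ! i = Pair l r" "l < i" "r < i" by auto
  have "k \<in> reach G l \<or> k \<in> reach G r" using less.prems False reach_Pair[OF P] by auto
  then show ?thesis using less.IH[OF P(2)] less.IH[OF P(3)] reach_Pair[OF P] by auto
 qed
qed

lemma reach_less: "is_slp G ==> i < length G ==> k \<in> reach G i ==> k < length G"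
proof (induction i rule: less_induct)
 case (less i)
 show ?case
 proof (cases "G ! i")
  case (Terminal a)
  then show ?thesis using less.prems by (simp add: reach.simps)
 next
  case (Pair l r)
  then have lr: "l < i" "r < i" using less.prems by (auto simp: is_slp_def)
  then show ?thesis using less.IH[of l] less.IH[of r] less.prems reach_Pair[OF Pair lr] by auto
 qed
qed

text \<open>A tiling consumes all but the last h characters. This remainder is the overlap on which
  \<open>tile_append\<close> glues two tilings, and at the end of the whole string it receives a
  piece of its own.\<close>

fun tile :: "nat list => nat => nat list => (nat \<times> nat) list => bool" where
 "tile T h w [] \<longleftrightarrow> length w = h"
| "tile T h w (x # its) \<longleftrightarrow> snd x + h <= length w & sub T (fst x) (take (snd x + h) w) & tile T h (drop (snd x) w) its"

lemma tile_append:
 "tile T h u a ==> tile T h (drop (length u - h) u @ v) b ==> tile T h (u @ v) (a @ b)"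
proof (induction a arbitrary: u)
 case (Cons x a)
 have le: "snd x + h <= length u" using Cons.prems(1) by simp
 then have "drop (length (drop (snd x) u) - h) (drop (snd x) u) = drop (length u - h) u" by simp
 then have "tile T h (drop (snd x) u @ v) (a @ b)" using Cons by simp
 then show ?case using Cons.prems(1) le by simp
qed simp

lemma tile_good:
 "tile T h w its ==> start its (length its) + h = length w &
  (\<forall>j<length its. \<forall>y<snd (its ! j) + h. start its j + y < length w & zc T (fst (its ! j) + y) = w ! (start its j + y))"
proof (induction its arbitrary: w)
 case Nil
 then show ?case by (simp add: start_def)
next
 case (Cons x its)
 have IH: "start its (length its) + h = length (drop (snd x) w)"
  "\<And>j y. j < length its ==> y < snd (its ! j) + h ==> start its j + y < length (drop (snd x) w) &
   zc T (fst (its ! j) + y) = drop (snd x) w ! (start its j + y)"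
  using Cons.IH[of "drop (snd x) w"] Cons.prems by (metis tile.simps(2))+
 have le: "snd x + h <= length w" and sb: "sub T (fst x) (take (snd x + h) w)" using Cons.prems by auto
 have st: "start (x # its) (Suc j) = snd x + start its j" "start (x # its) 0 = 0" for j by (auto simp: start_def)
 show ?case
 proof (intro conjI allI impI)
  show "start (x # its) (length (x # its)) + h = length w" using IH(1) le by (simp add: st)
 next
  fix j y assume j: "j < length (x # its)" "y < snd ((x # its) ! j) + h"
  show "start (x # its) j + y < length w"
   using j IH(2)[of "j - 1" y] le by (cases j) (auto simp: st)
  show "zc T (fst ((x # its) ! j) + y) = w ! (start (x # its) j + y)"
   using j IH(2)[of "j - 1" y] le sub_nth[OF sb, of y] by (cases j) (auto simp: st zc_def add.assoc)
 qed
qed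

lemma good_items_snoc:
 assumes "tile T h w its" "sub T e (drop (length w - h) w)" "h <= length w"
 shows "good_items T w h (its @ [(e, h)])"
proof -
 note g = tile_good[OF assms(1)]
 have st: "start (its @ [(e, h)]) j = start its j" if "j <= length its" for j using that by (simp add: start_def)
 have st1: "start (its @ [(e, h)]) (Suc (length its)) = start its (length its) + h" by (simp add: start_def)
 have "zc T (fst ((its @ [(e, h)]) ! j) + y) = w ! (start (its @ [(e, h)]) j + y)"
  if j: "j < Suc (length its)" "y < snd ((its @ [(e, h)]) ! j) + h" "start (its @ [(e, h)]) j + y < length w" for j y
 proof (cases "j = length its")
  case True
  have y: "y < length (drop (length w - h) w)" using j(3) True g st[of j] assms(3) by simp
  have e: "length w - h + y = start its (length its) + y" using conjunct1[OF g] assms(3) by linarith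
  have "zc T (e + y) = w ! (start its (length its) + y)" using sub_nth[OF assms(2) y] assms(3) unfolding e[symmetric] by (simp add: zc_def)
  then show ?thesis using True st[of j] by simp
 next
  case False
  then show ?thesis using j g st[of j] by (simp add: nth_append)
 qed
 then show ?thesis unfolding good_items_def using g st1 by simp
qed

context slp_text
begin

lemma Hb: "3 * h <= H" "H <= 3 * h" "h ~= 0" "0 < h" "h < H"
 using H by auto

section \<open>Jumps along chains of rules with one long child\<close>

definition one :: "nat => bool" where
 "one i \<longleftrightarrow> (\<exists>l r. G ! i = Pair l r & big l ~= big r)"

text \<open>
 A chain of rules each with exactly one long child is traversed in jumps \<open>(a, b, c)\<close>, where
 \<open>val i\<close> is \<open>val c\<close> with \<open>a\<close> characters on the left and \<open>b\<close> on the right. Two successive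
 jumps absorb more than \<open>2 h\<close> characters, which bounds the number of pieces.
\<close>

fun jmp :: "nat => nat \<times> nat \<times> nat" where
 "jmp i = (case G ! i of Terminal a => (0, 0, i) | Pair l r =>
   if \<not> (l < i & r < i) \<or> big l = big r then (0, 0, i)
   else if big r then (case jmp r of (a, b, c) => if a + b + vl l <= 2 * h then (a + vl l, b, c) else (vl l, 0, r))
   else (case jmp l of (a, b, c) => if a + b + vl r <= 2 * h then (a, b + vl r, c) else (0, vl r, l)))"

declare jmp.simps [simp del]

abbreviation "nx i \<equiv> snd (snd (jmp i))"

text \<open>A jump that merges several rules absorbs at most 2 h characters and is read off the ends
  of i. A single step may absorb more, up to H - 1 characters of a short child; for these
  \<open>rng\<close> keeps the whole child with its junction.\<close>

definition jok :: "nat => nat => nat => nat => bool" where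
 "jok i a b c \<longleftrightarrow> c < length G & big c & c \<in> reach G i &
  (\<exists>u v. V i = u @ V c @ v & length u = a & length v = b) &
  (one i --> c < i & 0 < a + b) & (\<not> one i --> (a, b, c) = (0, 0, i)) &
  (a + b <= 2 * h \<or> (\<exists>l r. G ! i = Pair l r & (\<not> big l & big r & a = vl l & b = 0 \<or> big l & \<not> big r & a = 0 & b = vl r))) &
  (one c --> 2 * h + vl (nx c) < vl i)"

lemma jok_vl: "jok i a b c ==> vl i = a + vl c + b"
proof -
 assume "jok i a b c"
 then obtain u v where "V i = u @ V c @ v" "length u = a" "length v = b" unfolding jok_def by blast
 then have "length (V i) = a + vl c + b" by simp
 then show ?thesis by simp
qed

lemma jmp_ok: "i < length G ==> big i ==> jmp i = (a, b, c) ==> jok i a b c"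
proof (induction i arbitrary: a b c rule: less_induct)
 case (less i)
 obtain l r where P: "G ! i = Pair l r" using big_Pair[OF less.prems(1,2)] by auto
 have lr: "l < i" "r < i" "l < length G" "r < length G" using children[OF less.prems(1) P] by auto
 have Vi: "V i = V l @ V r" and li: "vl i = vl l + vl r" using V_Pair[OF less.prems(1) P] vl_Pair[OF less.prems(1) P] by auto
 have re: "reach G i = insert i (reach G l \<union> reach G r)" using reach_Pair[OF P lr(1,2)] .
 have vp: "0 < vl l" "0 < vl r" using vl_pos lr by auto
 have one: "one i \<longleftrightarrow> big l ~= big r" using P by (simp add: one_def)
 show ?case
 proof (cases "big l = big r")
  case True
  then have no: "\<not> one i" using one by simp
  then have "a = 0" "b = 0" "c = i" using True less.prems(3) P by (auto simp: jmp.simps[of i])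
  then show ?thesis unfolding jok_def using less.prems no reach_self[of i G] by (simp add: Hb)
 next
  case ne: False
  show ?thesis
  proof (cases "big r")
   case True
   then have bl: "\<not> big l" using ne by simp
   obtain a' b' c' where j: "jmp r = (a', b', c')" by (cases "jmp r") auto
   have ok: "jok r a' b' c'" by (rule less.IH[OF lr(2,4) True j])
   note vr = jok_vl[OF ok]
   have rs: "r \<in> reach G i" "reach G r \<subseteq> reach G i" using re reach_self[of r G] by auto
   show ?thesis
   proof (cases "a' + b' + vl l <= 2 * h")
    case m: True
    then have abc: "a = a' + vl l" "b = b'" "c = c'" using less.prems(3) P lr ne True j by (auto simp: jmp.simps[of i])
    obtain u v where uv: "V r = u @ V c' @ v" "length u = a'" "length v = b'" using ok unfolding jok_def by blast
    have e: "\<exists>u v. V i = u @ V c @ v & length u = a & length v = b"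
     by (rule exI[of _ "V l @ u"], rule exI[of _ v]) (use uv abc Vi in simp)
    have ci: "c < i" using ok lr abc unfolding jok_def by (metis order_less_trans prod.inject)
    have f: "c < length G" "big c" "c \<in> reach G i" using ok rs abc unfolding jok_def by auto
    have g: "2 * h + vl (nx c) < vl i" if "one c"
     using ok that abc li unfolding jok_def by auto
    show ?thesis unfolding jok_def using e ci f g m abc vp one ne by auto
   next
    case m: False
    then have abc: "a = vl l" "b = 0" "c = r" using less.prems(3) P lr ne True j by (auto simp: jmp.simps[of i])
    have e: "\<exists>u v. V i = u @ V c @ v & length u = a & length v = b"
     by (rule exI[of _ "V l"], rule exI[of _ "[]"]) (use abc Vi in simp)
    \<comment> \<open>The two jumps were kept apart because together they absorb more than 2 h
      characters; this is exactly the progress claimed.\<close>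
    have g: "2 * h + vl (nx c) < vl i" using abc j m vr li by simp
    show ?thesis unfolding jok_def using e g abc vp one ne lr rs True bl P by simp
   qed
  next
   case False
   then have bl: "big l" using ne by simp
   obtain a' b' c' where j: "jmp l = (a', b', c')" by (cases "jmp l") auto
   have ok: "jok l a' b' c'" by (rule less.IH[OF lr(1,3) bl j])
   note vr = jok_vl[OF ok]
   have rs: "l \<in> reach G i" "reach G l \<subseteq> reach G i" using re reach_self[of l G] by auto
   show ?thesis
   proof (cases "a' + b' + vl r <= 2 * h")
    case m: True
    then have abc: "a = a'" "b = b' + vl r" "c = c'" using less.prems(3) P lr ne False j by (auto simp: jmp.simps[of i])
    obtain u v where uv: "V l = u @ V c' @ v" "length u = a'" "length v = b'" using ok unfolding jok_def by blast
    have e: "\<exists>u v. V i = u @ V c @ v & length u = a & length v = b"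
     by (rule exI[of _ u], rule exI[of _ "v @ V r"]) (use uv abc Vi in simp)
    have ci: "c < i" using ok lr abc unfolding jok_def by (metis order_less_trans prod.inject)
    have f: "c < length G" "big c" "c \<in> reach G i" using ok rs abc unfolding jok_def by auto
    have g: "2 * h + vl (nx c) < vl i" if "one c"
     using ok that abc li unfolding jok_def by auto
    show ?thesis unfolding jok_def using e ci f g m abc vp one ne by auto
   next
    case m: False
    then have abc: "a = 0" "b = vl r" "c = l" using less.prems(3) P lr ne False j by (auto simp: jmp.simps[of i])
    have e: "\<exists>u v. V i = u @ V c @ v & length u = a & length v = b"
     by (rule exI[of _ "[]"], rule exI[of _ "V r"]) (use abc Vi in simp)
    have g: "2 * h + vl (nx c) < vl i" using abc j m vr li by simp
    show ?thesis unfolding jok_def using e g abc vp one ne lr rs bl False P by simp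
   qed
  qed
 qed
qed

text \<open>A task \<open>(o, k)\<close> stands for a piece if \<open>k \<noteq> 0\<close>, and for all pieces of nonterminal \<open>o\<close> if \<open>k = 0\<close>.\<close>

definition expand :: "nat => (nat \<times> nat) list" where
 "expand i = (case G ! i of Terminal a => [] | Pair l r =>
   if big l & big r then [(l, 0), (md D i - h, h), (r, 0)]
   else if \<not> big l & \<not> big r then [(pp D i, vl i - h)]
   else (case jmp i of (a, b, c) =>
    (if a = 0 then [] else [(pp D i, a)]) @ [(c, 0)] @ (if b = 0 then [] else [(se D i - b - h, b)])))"

function items :: "nat => (nat \<times> nat) list" where
 "items i = concat (map (%(p, k). if k ~= 0 then [(p, k)] else if p < i then items p else []) (expand i))"
 by pat_completeness auto
termination by (relation "measure id") auto

declare items.simps [simp del]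

definition tsem :: "nat \<times> nat => (nat \<times> nat) list" where
 "tsem t = (if snd t ~= 0 then [t] else items (fst t))"

lemma big_cases:
 assumes "i < length G" "big i"
 obtains (two) l r where "G ! i = Pair l r" "l < i" "r < i" "l < length G" "r < length G" "vl i = vl l + vl r" "V i = V l @ V r"
   "big l" "big r" "\<not> one i" "expand i = [(l, 0), (md D i - h, h), (r, 0)]"
 | (none) l r where "G ! i = Pair l r" "\<not> big l" "\<not> big r" "\<not> one i" "expand i = [(pp D i, vl i - h)]"
 | (single) a b c where "one i" "jmp i = (a, b, c)" "jok i a b c"
   "expand i = (if a = 0 then [] else [(pp D i, a)]) @ [(c, 0)] @ (if b = 0 then [] else [(se D i - b - h, b)])"
proof -
 obtain l r where P: "G ! i = Pair l r" using big_Pair[OF assms] by auto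
 have lr: "l < i" "r < i" "l < length G" "r < length G" using children[OF assms(1) P] by auto
 have Vi: "V i = V l @ V r" and li: "vl i = vl l + vl r" using V_Pair[OF assms(1) P] vl_Pair[OF assms(1) P] by auto
 have one: "one i \<longleftrightarrow> big l ~= big r" using P by (simp add: one_def)
 consider "big l" "big r" | "\<not> big l" "\<not> big r" | "big l ~= big r" by blast
 then show ?thesis
 proof cases
  case 1
  then show ?thesis using two[OF P lr li Vi 1] one P by (simp add: expand_def)
 next
  case 2
  then show ?thesis using none[OF P 2] one P by (simp add: expand_def)
 next
  case 3
  obtain a b c where j: "jmp i = (a, b, c)" by (cases "jmp i") auto
  show ?thesis by (rule single[OF _ j jmp_ok[OF assms j]]) (use one 3 P j in \<open>auto simp: expand_def\<close>)
 qed
qed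

lemma items_expand:
 assumes "i < length G" "big i"
 shows "items i = concat (map tsem (expand i))"
proof -
 have "p < i" if "(p, 0) \<in> set (expand i)" for p
 proof -
  have ne: "vl i - h ~= 0" using assms(2) Hb by linarith
  from assms show ?thesis
  proof (cases rule: big_cases)
   case (single a b c)
   have "p = c" using that unfolding single(4) by (simp split: if_splits)
   then show ?thesis using single(1,3) unfolding jok_def by blast
  next
   case (two l r)
   then show ?thesis using that Hb(3) by auto
  next
   case (none l r)
   then show ?thesis using that ne by auto
  qed
 qed
 then show ?thesis unfolding items.simps[of i]
  by (intro arg_cong[where f = concat] map_cong) (auto simp: tsem_def)
qed

text \<open>The slack carries the induction. Joining two tilings adds one piece, and 3 h + 3 h - h =
  5 h. A jump adds at most two pieces: the last jump of a chain pays 2 h for them out of the slack 5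
  h, and two successive jumps add at most four pieces, paid by the more than 2 h characters they
  absorb, counted twice.\<close>

lemma items_count:
 "i < length G ==> big i ==> 0 < length (items i) & h * length (items i) + 3 * h <= 2 * vl i &
   (\<not> one i --> h * length (items i) + 5 * h <= 2 * vl i)"
proof (induction i rule: less_induct)
 case (less i)
 have sing: "length (items k) <= 2 + length (items c)" if "one k" "jmp k = (a, b, c)" "k < length G" "big k" for k a b c
 proof -
  from that(3,4) show ?thesis
  proof (cases rule: big_cases)
   case (single a' b' c')
   then show ?thesis unfolding items_expand[OF that(3,4)] single(4) using that(2) by (simp add: tsem_def)
  next
   case (two l r)
   from two(10) that(1) show ?thesis by (rule notE)
  next
   case (none l r)
   from none(4) that(1) show ?thesis by (rule notE)
  qed
 qed
 from less.prems show ?case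
 proof (cases rule: big_cases)
  case (two l r)
  have "items i = items l @ [(md D i - h, h)] @ items r"
   using two Hb(3) by (simp add: items_expand[OF less.prems] tsem_def)
  then have "h * length (items i) = h * length (items l) + h * length (items r) + h" by (simp add: algebra_simps)
  then show ?thesis using less.IH[OF two(2,4,8)] less.IH[OF two(3,5,9)] two(6) \<open>items i = _\<close> by simp
 next
  case (none l r)
  have "items i = [(pp D i, vl i - h)]" using none less.prems(2) Hb by (simp add: items_expand[OF less.prems] tsem_def)
  then show ?thesis using less.prems(2) Hb by simp
 next
  case (single a b c)
  have c: "c < i" "c < length G" "big c" using single(1,3) unfolding jok_def by blast+
  have c4: "vl i = a + vl c + b" by (rule jok_vl[OF single(3)])
  note IH = less.IH[OF c(1-3)]
  have "items i = concat (map tsem (expand i))" by (rule items_expand[OF less.prems])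
  then have pos: "0 < length (items i)" using IH single(4) by (simp add: tsem_def)
  have le: "length (items i) <= 2 + length (items c)" using sing[OF single(1,2) less.prems] .
  show ?thesis
  proof (cases "one c")
   case False
   then have "h * length (items c) + 5 * h <= 2 * vl c" using IH by simp
   moreover have "h * length (items i) <= h * (2 + length (items c))" using le by (rule mult_le_mono2)
   ultimately have "h * length (items i) + 3 * h <= 2 * vl i" using c4 by simp
   then show ?thesis using pos single(1) by blast
  next
   case True
   obtain a' b' c' where j: "jmp c = (a', b', c')" by (cases "jmp c") auto
   have ok: "jok c a' b' c'" by (rule jmp_ok[OF c(2,3) j])
   then have c': "c' < c" "c' < length G" "big c'" using True unfolding jok_def by blast+
   have "2 * h + vl c' < vl i" using single(3) True j unfolding jok_def by (metis snd_conv)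
   moreover have "h * length (items c') + 3 * h <= 2 * vl c'" using less.IH[of c'] c' c(1) by simp
   moreover have "length (items i) <= 4 + length (items c')" using le sing[OF True j c(2,3)] by simp
   then have "h * length (items i) <= h * (4 + length (items c'))" by (rule mult_le_mono2)
   ultimately have "h * length (items i) + 3 * h <= 2 * vl i" unfolding distrib_left by linarith
   then show ?thesis using pos single(1) by blast
  qed
 qed
qed

lemma sub_last:
 assumes "sub T (e - H) (lastH w)" "H <= e" "H <= length w" "k <= H"
 shows "sub T (e - k) (drop (length w - k) w)"
 using sub_drop[OF assms(1), of "H - k"] assms(2-4) by simp

lemma items_tile: "i \<in> reach G root ==> big i ==> tile (tx D) h (V i) (items i)"
proof (induction i rule: less_induct)
 case (less i)
 let ?T = "tx D"
 have rg: "rng i ?T (pp D i) (md D i) (se D i)" and iG: "i < length G" using D_rng[OF less.prems] by auto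
 from iG less.prems(2) show ?case
 proof (cases rule: big_cases)
  case (two l r)
  have re: "l \<in> reach G root" "r \<in> reach G root"
   using reach_trans[OF less.prems(1)] reach_Pair[OF two(1-3)] reach_self[of l G] reach_self[of r G] by auto
  have it: "items i = items l @ [(md D i - h, h)] @ items r"
   using two Hb(3) by (simp add: items_expand[OF iG less.prems(2)] tsem_def)
  \<comment> \<open>The tiling of the left child omits its last h characters; the piece across the
    junction consumes these and looks h characters into the right child.\<close>
  let ?x = "drop (vl l - h) (V l)"
  have m: "H <= md D i" "sub ?T (md D i - H) (lastH (V l) @ take H (V r))" using rg two unfolding rng_def by auto
  have "sub ?T (md D i - H + 2 * h) (drop (2 * h) (lastH (V l) @ take H (V r)))"
   by (rule sub_drop[OF m(2)]) (use two(8) H in simp)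
  moreover have "drop (2 * h) (lastH (V l) @ take H (V r)) = ?x @ take H (V r)" using two(8) H by simp
  moreover have "md D i - H + 2 * h = md D i - h" using m(1) H by simp
  ultimately have "sub ?T (md D i - h) (?x @ take H (V r))" by simp
  from sub_take[OF this, of "h + h"] have sb: "sub ?T (md D i - h) (take (h + h) (?x @ V r))" using two(8,9) H by simp
  have "tile ?T h (?x @ V r) ([(md D i - h, h)] @ items r)"
   using sb less.IH[OF two(3) re(2) two(9)] two(8,9) Hb by simp
  then show ?thesis unfolding it two(7) using tile_append[OF less.IH[OF two(2) re(1) two(8)]] by simp
 next
  case (none l r)
  have it: "items i = [(pp D i, vl i - h)]" using none less.prems(2) Hb by (simp add: items_expand[OF iG less.prems(2)] tsem_def)
  have "sub ?T (pp D i) (V i)" using rg none unfolding rng_def by blast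
  then show ?thesis unfolding it using less.prems(2) Hb by simp
 next
  case (single a b c)
  obtain u v where uv: "V i = u @ V c @ v" "length u = a" "length v = b" using single(3) unfolding jok_def by blast
  have c: "c < i" "c < length G" "big c" "c \<in> reach G i" using single(1,3) unfolding jok_def by blast+
  have cr: "c \<in> reach G root" using reach_trans[OF less.prems(1)] c(4) by blast
  note vi = jok_vl[OF single(3)]
  let ?L = "if a = 0 then [] else [(pp D i, a)]" and ?R = "if b = 0 then [] else [(se D i - b - h, b)]"
  have it: "items i = ?L @ items c @ ?R"
   unfolding items_expand[OF iG less.prems(2)] single(4) by (simp add: tsem_def)
  have r1: "sub ?T (pp D i) (take H (V i))" "H <= se D i" "sub ?T (se D i - H) (lastH (V i))" using rg unfolding rng_def by auto
  have cas: "a + b <= 2 * h \<or> (\<exists>l r. G ! i = Pair l r & (\<not> big l & big r & a = vl l & b = 0 \<or> big l & \<not> big r & a = 0 & b = vl r))"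
   using single(3) unfolding jok_def by blast
  \<comment> \<open>A right part of at most 2 h characters, with the h characters before it, lies
    within the last H characters of i; a longer one is a whole short child and is read at its
    junction.\<close>
  have sR: "sub ?T (se D i - b - h) (drop (vl i - (b + h)) (V i))" if "b ~= 0"
  proof -
   consider "b <= 2 * h" | l r where "G ! i = Pair l r" "big l" "\<not> big r" "b = vl r" using cas that by auto
   then show ?thesis
   proof cases
    case 1
    have "sub ?T (se D i - (b + h)) (drop (length (V i) - (b + h)) (V i))"
     by (rule sub_last[OF r1(3,2)]) (use less.prems(2) H 1 in auto)
    then show ?thesis by (simp add: diff_diff_left)
   next
    case 2
    have s: "H + vl r <= se D i" "sub ?T (se D i - (H + vl r)) (lastH (V l) @ V r)" using rg 2 unfolding rng_def by auto
    have "sub ?T (se D i - (H + vl r) + 2 * h) (drop (2 * h) (lastH (V l) @ V r))" by (rule sub_drop[OF s(2)]) (use 2 H in simp)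
    moreover have "drop (2 * h) (lastH (V l) @ V r) = drop (vl l - h) (V l) @ V r" using 2 H by simp
    moreover have "se D i - (H + vl r) + 2 * h = se D i - b - h" using s(1) 2 H by simp
    moreover have "drop (vl i - (b + h)) (V i) = drop (vl l - h) (V l) @ V r"
     using V_Pair[OF iG 2(1)] vl_Pair[OF iG 2(1)] 2 H by simp
    ultimately show ?thesis by simp
   qed
  qed
  have sL: "sub ?T (pp D i) (take (a + h) (V i))" if "a ~= 0"
  proof -
   consider "a <= 2 * h" | l r where "G ! i = Pair l r" "big r" "\<not> big l" "a = vl l" using cas that by auto
   then show ?thesis
   proof cases
    case 1
    then show ?thesis using sub_take[OF r1(1), of "a + h"] H by simp
   next
    case 2
    then have "sub ?T (pp D i) (V l @ take H (V r))" using rg unfolding rng_def by auto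
    from sub_take[OF this, of "a + h"] show ?thesis using V_Pair[OF iG 2(1)] 2 H by simp
   qed
  qed
  have W: "tile ?T h (V c @ v) (items c @ ?R)"
  proof (rule tile_append[OF less.IH[OF c(1) cr c(3)]])
   have e: "drop (vl i - (b + h)) (V i) = drop (vl c - h) (V c) @ v"
    using uv vi c(3) H by simp
   show "tile ?T h (drop (length (V c) - h) (V c) @ v) ?R"
    proof (cases "b = 0")
    case True
    then show ?thesis using uv(3) c(3) Hb by simp
   next
    case False
    have "length (drop b (drop (vl c - h) (V c) @ v)) = h" using uv(3) c(3) Hb by (simp only: length_drop length_append length_map)
    then show ?thesis using False sR uv(3) c(3) Hb unfolding e by simp
   qed
  qed
  have "tile ?T h (V i) (?L @ (items c @ ?R))"
  proof (cases "a = 0")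
   case True
   then show ?thesis using W uv by simp
  next
   case False
   have "a + h <= length (V i)" "drop a (V i) = V c @ v" using vi c(3) H uv(1,2) by auto
   then show ?thesis using False W sL by simp
  qed
  then show ?thesis unfolding it .
 qed
qed

text \<open>The second task covers the h characters that a tiling of the whole string omits. A
  string shorter than H is written in full and forms a single piece.\<close>

definition tasks0 :: "(nat \<times> nat) list" where
 "tasks0 = (if big root then [(root, 0), (se D root - h, h)] else [(0, vl root)])"

definition all_items :: "(nat \<times> nat) list" where
 "all_items = concat (map tsem tasks0)"

lemma all_items:
 shows all_items_good: "good_items (tx D) (V root) h all_items"
  and all_items_count: "h * length all_items <= 2 * vl root + h"
proof -
 have "good_items (tx D) (V root) h all_items & h * length all_items <= 2 * vl root + h"
 proof (cases "big root")
  case True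
  have it: "all_items = items root @ [(se D root - h, h)]" using True Hb(3) by (simp add: all_items_def tasks0_def tsem_def)
  have rg: "rng root (tx D) (pp D root) (md D root) (se D root)" using D_rng[OF reach_self True] by auto
  have "sub (tx D) (se D root - h) (drop (length (V root) - h) (V root))"
   by (rule sub_last) (use rg True Hb in \<open>auto simp: rng_def\<close>)
  then have "good_items (tx D) (V root) h all_items" unfolding it
   using good_items_snoc[OF items_tile[OF reach_self True]] True Hb by simp
  moreover have "h * length all_items <= 2 * vl root + h" unfolding it using items_count[OF root True] by (simp add: algebra_simps)
  ultimately show ?thesis ..
 next
  case False
  have it: "all_items = [(0, vl root)]" using False vl_pos[OF root] by (simp add: all_items_def tasks0_def tsem_def)
  have "tx D = V root" using D_emits False by (simp add: emits_def)
  then show ?thesis unfolding it good_items_def by (simp add: start_def zc_def)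
 qed
 then show "good_items (tx D) (V root) h all_items" "h * length all_items <= 2 * vl root + h" by auto
qed

end

section \<open>The size of the text in terms of \<open>\<alpha>\<close>\<close>

text \<open>Comparing L with \<open>c_bound N\<close> thereby becomes comparing L (L + 1) with 2 N
  in the natural numbers.\<close>

lemma c_bound_eq: "c_bound N * (c_bound N + 1) = 2 * real N"
proof -
 have "(sqrt (2 * real N + 1 / 4))\<^sup>2 = 2 * real N + 1 / 4" by simp
 then show ?thesis unfolding c_bound_def by (simp add: power2_eq_square algebra_simps)
qed

lemma c_bound_ge: "L * (L + 1) <= 2 * N ==> real L <= c_bound N"
proof (rule ccontr)
 assume L: "L * (L + 1) <= 2 * N" and "\<not> real L <= c_bound N"
 then have lt: "c_bound N < real L" by simp
 have "0 <= c_bound N" unfolding c_bound_def using real_le_rsqrt[of "1/2" "2 * real N + 1/4"] by (simp add: power2_eq_square)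
 then have "c_bound N * (c_bound N + 1) < real L * (real L + 1)" using lt by (intro mult_strict_mono) auto
 moreover have "real (L * (L + 1)) <= real (2 * N)" using L by (rule of_nat_mono)
 ultimately show False using c_bound_eq[of N] by (simp add: algebra_simps)
qed

lemma c_bound_less: "2 * N < L * (L + 1) ==> c_bound N < real L"
proof (rule ccontr)
 assume L: "2 * N < L * (L + 1)" and "\<not> c_bound N < real L"
 then have "real L * (real L + 1) <= c_bound N * (c_bound N + 1)" by (intro mult_mono) auto
 moreover have "real (2 * N) < real (L * (L + 1))" using L by (simp only: of_nat_less_iff)
 ultimately show False using c_bound_eq[of N] by (simp add: algebra_simps)
qed

locale slp_alpha = slp_text +
 assumes used: "all_nonterminals_used G"
  and hh: "h * (h + 1) <= 2 * length (slp_string G)" "2 * length (slp_string G) < (h + 1) * (h + 2)"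
begin

definition N :: nat where "N = length (slp_string G)"

definition Q :: nat where "Q = h - 1"

lemma N_vl: "vl root = N"
 by (simp add: N_def slp_string_def root_def)

lemma c_range: "real h <= c_bound N" "c_bound N < real h + 1"
 using c_bound_ge[OF hh(1)] c_bound_less[of "length (slp_string G)" "h + 1"] hh(2) by (auto simp: N_def)

lemma Q_floor: "nat \<lfloor>c_bound N - 1\<rfloor> = Q"
proof -
 have "\<lfloor>c_bound N - 1\<rfloor> = int h - 1" using c_range by (intro floor_unique) auto
 then show ?thesis using Hb(4) by (simp add: Q_def)
qed

text \<open>The number of windows of length Q + 1 in \<open>t_string G j\<close>, all of which
  straddle the boundary between the two children because either side has at most Q characters.
  Truncated subtraction gives 0 if there is none.\<close>

definition om :: "nat => nat" where
 "om j = (case G ! j of Terminal a => 0 | Pair l r => min (vl l) Q + min (vl r) Q - Q)"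

lemma t_string_length:
 "length (t_string G j) = (case G ! j of Terminal a => 0 | Pair l r => min (vl l) Q + min (vl r) Q)"
 unfolding t_string_def Let_def N_def[symmetric] Q_floor by (auto simp: suf_def pre_def split: rule.split)

lemma tree_Pair: "G ! i = Pair l r ==> i < length G ==>
  nodes_labelled j (deriv_tree_at G i) = of_bool (j = i) + nodes_labelled j (deriv_tree_at G l) + nodes_labelled j (deriv_tree_at G r)"
 using children[of i l r] by (simp add: deriv_tree_at.simps[of G i])

text \<open>A window of length Q + 1 lies inside one child or straddles the boundary, so descending
  the tree assigns it to exactly one node. A terminal has no such window because Q > 0.\<close>

lemma windows: "0 < Q ==> i < length G ==>
  (\<Sum>j<length G. nodes_labelled j (deriv_tree_at G i) * om j) = vl i - Q"
proof (induction i rule: less_induct)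
 case (less i)
 show ?case
 proof (cases "G ! i")
  case (Terminal a)
  have "nodes_labelled j (deriv_tree_at G i) * om j = 0" for j
   using Terminal by (cases "j = i") (auto simp: deriv_tree_at.simps om_def)
  then show ?thesis using Terminal less.prems by (simp add: val_Terminal)
 next
  case (Pair l r)
  note lr = children[OF less.prems(2) Pair]
  have "nodes_labelled j (deriv_tree_at G i) * om j =
    (if j = i then om j else 0) + nodes_labelled j (deriv_tree_at G l) * om j + nodes_labelled j (deriv_tree_at G r) * om j" for j
   unfolding tree_Pair[OF Pair less.prems(2)] by (simp add: algebra_simps)
  then have "(\<Sum>j<length G. nodes_labelled j (deriv_tree_at G i) * om j) = om i + (vl l - Q) + (vl r - Q)"
   using less.IH[of l] less.IH[of r] lr less.prems by (simp add: sum.distrib)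
  moreover have "min x q + min y q - q + (x - q) + (y - q) = x + y - q" for x y q :: nat by (auto simp: min_def)
  ultimately show ?thesis using vl_Pair[OF less.prems(2) Pair] Pair by (simp add: om_def)
 qed
qed

lemma nodes_greater: "j < i ==> j < length G ==> nodes_labelled i (deriv_tree_at G j) = 0"
proof (induction j rule: less_induct)
 case (less j)
 show ?case
 proof (cases "G ! j")
  case (Terminal a)
  then show ?thesis using less.prems by (simp add: deriv_tree_at.simps)
 next
  case (Pair l r)
  then show ?thesis using less.IH[of l] less.IH[of r] less.prems children[OF less.prems(2) Pair] tree_Pair[OF Pair less.prems(2), of i] by simp
 qed
qed

text \<open>A nonterminal does not occur below itself, so its occurrences derive disjoint parts of
  the string.\<close>

lemma occ_vl: "j < length G ==> nodes_labelled i (deriv_tree_at G j) * vl i <= vl j"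
proof (induction j rule: less_induct)
 case (less j)
 show ?case
 proof (cases "G ! j")
  case (Terminal a)
  then show ?thesis by (cases "i = j") (simp_all add: deriv_tree_at.simps)
 next
  case (Pair l r)
  note lr = children[OF less.prems Pair]
  show ?thesis
  proof (cases "i = j")
   case True
   then show ?thesis using tree_Pair[OF Pair less.prems, of i] nodes_greater[of l i] nodes_greater[of r i] lr by simp
  next
   case False
   then have "nodes_labelled i (deriv_tree_at G j) * vl i = nodes_labelled i (deriv_tree_at G l) * vl i + nodes_labelled i (deriv_tree_at G r) * vl i"
    using tree_Pair[OF Pair less.prems, of i] by (simp add: algebra_simps)
   then show ?thesis using less.IH[of l] less.IH[of r] lr vl_Pair[OF less.prems Pair] by simp
  qed
 qed
qed

lemma vOcc_vl: "vOcc G i * vl i <= N"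
 using occ_vl[OF root, of i] unfolding vOcc_def deriv_tree_def root_def[symmetric] N_vl by simp

lemma vOcc_pos: "i < length G ==> 1 <= vOcc G i"
 using used by (simp add: all_nonterminals_used_def)

lemma vl_le_N: "i < length G ==> vl i <= N"
 using vOcc_vl[of i] vOcc_pos[of i] by (metis le_trans mult_le_mono1 nat_mult_1)

lemma N_pos: "0 < N"
 using vl_pos[OF root] N_vl by simp

lemma Q0: "Q = 0 ==> h = 1 & N <= 2"
proof -
 assume "Q = 0"
 then have "h = 1" using Hb(4) by (simp add: Q_def)
 then show ?thesis using hh(2) by (simp add: N_def)
qed

abbreviation "LI \<equiv> long_nonterminals G"

lemma LI: "i \<in> LI \<longleftrightarrow> i < length G & c_bound N <= real (vl i)"
 by (simp add: long_nonterminals_def N_def)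

definition trm :: "nat => real" where
 "trm i = (real (vOcc G i) - 1) * (real (length (t_string G i)) - (c_bound N - 1))"

lemma alpha_trm: "alpha G = (\<Sum>i\<in>LI. trm i)"
 by (simp add: alpha_def trm_def N_def)

text \<open>For Q > 0 and a pair, nonnegativity holds since \<open>t_string G i\<close> either has
  at least Q + 1 = h > c_N - 1 characters or is the whole value of i, of length at least c_N. The
  upper bound comes from c_N - 1 >= Q.\<close>

lemma trm_bounds:
 assumes "i \<in> LI"
 shows "0 <= trm i" "trm i <= (real (vOcc G i) - 1) * real (om i)"
proof -
 have i: "i < length G" "c_bound N <= real (vl i)" using assms LI by auto
 have o1: "0 <= real (vOcc G i) - 1" using vOcc_pos[OF i(1)] by simp
 have h1: "real Q + 1 = real h" using Hb(4) by (simp add: Q_def)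
 have *: "0 <= trm i & trm i <= (real (vOcc G i) - 1) * real (om i)"
 proof (cases "G ! i")
  case (Terminal a)
  have "1 <= real h" using Hb(4) by simp
  then have "c_bound N = 1" using i(2) c_range(1) Terminal by (simp add: val_Terminal)
  then show ?thesis using Terminal by (simp add: trm_def t_string_length om_def)
 next
  case (Pair l r)
  have v: "vl i = vl l + vl r" "0 < vl l" "0 < vl r" using vl_Pair[OF i(1) Pair] vl_pos children[OF i(1) Pair] by auto
  have t: "length (t_string G i) = min (vl l) Q + min (vl r) Q" using Pair by (simp add: t_string_length)
  have o: "om i = length (t_string G i) - Q" unfolding om_def t using Pair by simp
  have "length (t_string G i) <= om i + Q" unfolding o by simp
  then have "real (length (t_string G i)) <= real (om i) + real Q" by (metis of_nat_add of_nat_le_iff)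
  then have b: "real (length (t_string G i)) - (c_bound N - 1) <= real (om i)" using c_range h1 by linarith
  show ?thesis
  \<comment> \<open>For Q = 0 the string \<open>t_string G i\<close> is empty and its length minus
    (c_N - 1) may be negative. But then N <= 2, so a pair occurs only once and the factor
    \<open>vOcc G i - 1\<close> vanishes.\<close>
  proof (cases "Q = 0")
   case True
   then have "vOcc G i * vl i <= 2" using vOcc_vl[of i] Q0 by linarith
   moreover have "2 <= vl i" using v by linarith
   ultimately
   have "vOcc G i * 2 <= 2" by (metis le_trans mult_le_mono2)
   then have "vOcc G i = 1" using vOcc_pos[OF i(1)] by simp
   then show ?thesis by (simp add: trm_def)
  next
   case False
   then have "vl i <= length (t_string G i) \<or> Q + 1 <= length (t_string G i)" 
   proof -
    have "0 < x ==> 0 < y ==> 0 < q ==> x + y <= min x q + min y q \<or> q + 1 <= min x q + min y q" for x y q :: nat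
     by (auto simp: min_def)
    from this[OF v(2,3), of Q] show ?thesis unfolding t using v(1) False by linarith
   qed
   then have "real (vl i) <= real (length (t_string G i)) \<or> real Q + 1 <= real (length (t_string G i))"
    by (metis of_nat_le_iff of_nat_add of_nat_1)
   then have a: "0 <= real (length (t_string G i)) - (c_bound N - 1)" using i(2) c_range h1 by linarith
   show ?thesis unfolding trm_def using mult_nonneg_nonneg[OF o1 a] mult_left_mono[OF b o1] by simp
  qed
 qed
 then show "0 <= trm i" "trm i <= (real (vOcc G i) - 1) * real (om i)" by auto
qed

lemma alpha_nonneg: "0 <= alpha G"
 unfolding alpha_trm by (rule sum_nonneg) (rule trm_bounds)

text \<open>By \<open>windows\<close> the occurrences of all nonterminals account for N - Q windows,
  and \<alpha> is at most the share of all but one occurrence of each long nonterminal.\<close>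

lemma alpha_upper: "real Q + (\<Sum>i\<in>LI. real (om i)) <= real N - alpha G"
proof (cases "Q = 0")
 case True
 then have o: "om i = 0" for i by (auto simp: om_def split: rule.split)
 have "trm i <= 0" if "i \<in> LI" for i using trm_bounds(2)[OF that] o by simp
 then have "alpha G <= 0" unfolding alpha_trm by (rule sum_nonpos)
 then show ?thesis using True o by simp
next
 case False
 have "alpha G <= (\<Sum>i\<in>LI. (real (vOcc G i) - 1) * real (om i))"
  unfolding alpha_trm by (rule sum_mono) (rule trm_bounds)
 also have "\<dots> = (\<Sum>i\<in>LI. real (vOcc G i * om i)) - (\<Sum>i\<in>LI. real (om i))"
  by (simp add: sum_subtractf[symmetric] algebra_simps)
 also have "(\<Sum>i\<in>LI. real (vOcc G i * om i)) <= (\<Sum>i<length G. real (vOcc G i * om i))"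
  by (rule sum_mono2) (auto simp: LI)
 also have "\<dots> = real (\<Sum>i<length G. vOcc G i * om i)" by simp
 also have "(\<Sum>i<length G. vOcc G i * om i) = N - Q"
  using windows[OF _ root] False unfolding vOcc_def deriv_tree_def root_def[symmetric] N_vl by simp
 finally have "alpha G <= real (N - Q) - (\<Sum>i\<in>LI. real (om i))" by simp
 moreover have "h <= N"
 proof -
  have "h * (h + 1) <= 2 * N" using hh(1) by (simp add: N_def)
  moreover have "h * 2 <= h * (h + 1)" using Hb(4) by simp
  ultimately show ?thesis by linarith
 qed
 ultimately show ?thesis by (simp add: Q_def of_nat_diff)
qed

text \<open>For a long rule with a long child, \<open>wt\<close> is governed by the shorter child
  capped at about H, and \<open>om\<close> by the same length capped at Q. For Q >= 1 the caps
  compare by H = 3 (Q + 1) <= 6 Q; for Q = 0 the string is too short for any rule to have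
  weight.\<close>

lemma wt_om:
 assumes "j < length G" "wt j ~= 0"
 shows "j \<in> LI" "wt j <= 12 * om j" "wt j <= 2 * H"
proof -
 obtain l r where P: "G ! j = Pair l r" using assms(2) by (cases "G ! j") (auto simp: wt_def)
 have b: "big j" using assms(2) P by (auto simp: wt_def split: if_splits)
 have v: "vl j = vl l + vl r" using vl_Pair[OF assms(1) P] .
 have "h + 1 <= vl j" using b Hb by linarith
 then have "real h + 1 <= real (vl j)" by (metis of_nat_le_iff of_nat_add of_nat_1)
 then show "j \<in> LI" using LI assms(1) c_range by auto
 have Q1: "0 < Q"
 proof (rule ccontr)
  assume "\<not> 0 < Q"
  then have "H = 3" "N <= 2" using Q0 H by auto
  then show False using vl_le_N[OF assms(1)] b by simp
 qed
 then have hQ: "H <= 6 * Q" using H by (simp add: Q_def)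
 have hQ': "Q <= H" using H by (simp add: Q_def)
 show "wt j <= 12 * om j" "wt j <= 2 * H" using P b hQ hQ' assms(2) by (auto simp: wt_def om_def split: if_splits)
qed

lemma Z_alpha: "real Z <= 12 * (real N - alpha G)"
proof -
 have "(\<Sum>j<length G. wt j) = (\<Sum>j\<in>LI. wt j)"
  by (rule sum.mono_neutral_right) (use wt_om LI in auto)
 also have "\<dots> <= (\<Sum>j\<in>LI. 12 * om j)"
  by (rule sum_mono) (use wt_om LI in \<open>metis le0\<close>)
 finally have s: "(\<Sum>j<length G. wt j) <= 12 * (\<Sum>j\<in>LI. om j)" by (simp add: sum_distrib_left)
 show ?thesis
 proof (cases "Q = 0")
  case True
  have "om i = 0" for i using True by (auto simp: om_def split: rule.split)
  then have "(\<Sum>j<length G. wt j) = 0" using s by simp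
  then have "Z = 2 * H" unfolding Z_def by linarith
  then have "Z = 6" using Q0[OF True] H(1) by linarith
  moreover have "alpha G <= 0"
  proof -
   have "trm i <= 0" if "i \<in> LI" for i using trm_bounds(2)[OF that] \<open>om i = 0\<close> by simp
   then show ?thesis unfolding alpha_trm by (rule sum_nonpos)
  qed
  ultimately show ?thesis using N_pos by simp
 next
  case False
  then have "2 * H <= 12 * Q" using H by (simp add: Q_def)
  then have "Z <= 12 * (Q + (\<Sum>j\<in>LI. om j))" using s by (simp add: Z_def)
  then have "real Z <= real (12 * (Q + (\<Sum>j\<in>LI. om j)))" by (simp only: of_nat_le_iff)
  then show ?thesis using alpha_upper by simp
 qed
qed

text \<open>From h * h <= 2 N, with 3/2 as a rational bound for sqrt 2.\<close>

lemma h_sqrt: "real h <= 3 / 2 * sqrt (real N)"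
proof (rule power2_le_imp_le)
 have "h * h <= h * (h + 1)" by simp
 also have "\<dots> <= 2 * N" using hh(1) by (simp add: N_def)
 finally have "real (h * h) <= real (2 * N)" by (simp only: of_nat_le_iff)
 then show "(real h)\<^sup>2 <= (3 / 2 * sqrt (real N))\<^sup>2" by (simp add: power_mult_distrib power2_eq_square)
qed simp

lemma n_pos: "0 < length G"
 using root by linarith

lemma Z_sqrt: "real Z <= 18 * (real (length G) * sqrt (real N))"
proof -
 have "(\<Sum>j<length G. wt j) <= (\<Sum>j<length G. 2 * H)"
  by (rule sum_mono) (use wt_om in \<open>metis le0 lessThan_iff\<close>)
 then have "Z <= 2 * H * (1 + length G)" by (simp add: Z_def algebra_simps)
 also have "\<dots> <= 2 * H * (2 * length G)" using n_pos by (intro mult_le_mono2) linarith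
 finally have "Z <= 12 * h * length G" using H by simp
 then have "real Z <= real (12 * h * length G)" by (simp only: of_nat_le_iff)
 also have "\<dots> = 12 * real h * real (length G)" by simp
 also have "\<dots> <= 12 * (3 / 2 * sqrt (real N)) * real (length G)" using h_sqrt by (intro mult_mono) auto
 finally show ?thesis by (simp add: algebra_simps)
qed

text \<open>All nonterminals are reachable, and the traversal meets at most two new ones per
  character written. So the passes over the rules, linear in n, stay within the bound for the
  text.\<close>

lemma n_text: "length G <= 2 * length (tx D)"
proof -
 have "{..<length G} \<subseteq> reach G root"
 proof
  fix i assume "i \<in> {..<length G}"
  then have "1 <= vOcc G i" using vOcc_pos by blast
  then show "i \<in> reach G root" by (intro reach_nodes[OF slp root]) (simp add: vOcc_def deriv_tree_def root_def)
 qed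
 moreover have "reach G root \<subseteq> {..<length G}" using reach_less[OF slp root] by blast
 then have "finite (reach G root)" by (rule finite_subset) simp
 ultimately have "card {..<length G} <= card (reach G root)" by (metis card_mono)
 then show ?thesis using D_reach by simp
qed

end

section \<open>Writing the text with an explicit stack\<close>

abbreviation (input) "aLEN \<equiv> 1::nat"
abbreviation (input) "aPP \<equiv> 3::nat"
abbreviation (input) "aMD \<equiv> 4::nat"
abbreviation (input) "aSE \<equiv> 5::nat"
abbreviation (input) "aDS \<equiv> 6::nat"
abbreviation (input) "vH \<equiv> 80::nat"
abbreviation (input) "vSp \<equiv> 82::nat"
abbreviation (input) "vT1 \<equiv> 83::nat"
abbreviation (input) "vI1 \<equiv> 84::nat"
abbreviation (input) "vA1 \<equiv> 85::nat"
abbreviation (input) "vK1 \<equiv> 86::nat"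

definition stk :: "(nat => 'b) => 'b list => bool" where
 "stk f ts \<longleftrightarrow> (\<forall>k<length ts. f k = rev ts ! k)"

lemma stk_push: "stk f ts ==> length ts = n ==> stk (f(n := x)) (x # ts)"
 by (auto simp: stk_def nth_append less_Suc_eq)

lemma stk_pop: "stk f (t # ts) ==> stk f ts & f (length ts) = t"
 by (auto simp: stk_def nth_append)

lemma zc_snoc: "n = length T ==> (zc T)(n := x) = zc (T @ [x])"
 by (rule ext) (auto simp: zc_def nth_append)

definition psh :: "aexp => com" where
 "psh e = (Write aDS (Var vSp) e ;; vSp ::= Var vSp \<oplus> Lit (Suc 0))"

definition copy_text :: com where
 "copy_text = For vK1 vH (Write aTX (Var vLen) (Idx aTX (Var vA1)) ;; vLen ::= Var vLen \<oplus> Lit (Suc 0) ;; vA1 ::= Var vA1 \<oplus> Lit (Suc 0))"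

abbreviation (input) "lft \<equiv> Idx 0 (Var vI1 \<otimes> Lit 3 \<oplus> Lit 2)"
abbreviation (input) "rgt \<equiv> Idx 0 (Var vI1 \<otimes> Lit 3 \<oplus> Lit 3)"

definition emit_char :: com where
 "emit_char = (Write aTX (Var vLen) (lft \<oplus> Lit (Suc 0)) ;; vLen ::= Var vLen \<oplus> Lit (Suc 0))"

definition push_small :: com where
 "push_small = (psh (rgt \<otimes> Lit 3) ;; psh (lft \<otimes> Lit 3))"

definition push_new :: com where
 "push_new = (Write aPP (Var vI1) (Var vLen) ;; psh (Var vI1 \<otimes> Lit 3 \<oplus> Lit 2) ;; psh (rgt \<otimes> Lit 3) ;;
   psh (Var vI1 \<otimes> Lit 3 \<oplus> Lit (Suc 0)) ;; psh (lft \<otimes> Lit 3))"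

definition copy_seen :: com where
 "copy_seen = (vA1 ::= Idx aPP (Var vI1) ;; vK1 ::= Lit 0 ;; copy_text ;;
   vA1 ::= Idx aSE (Var vI1) \<ominus> Var vH ;; vK1 ::= Lit 0 ;; copy_text)"

definition pop_task :: com where
 "pop_task = (vSp ::= Var vSp \<ominus> Lit (Suc 0) ;; vT1 ::= Idx aDS (Var vSp) ;; vI1 ::= Var vT1 \<oslash> Lit 3 ;; vT1 ::= Var vT1 \<odot> Lit 3)"

text \<open>A task on the stack is 3 i plus a kind: 0 visits i, 1 records the middle of i, and 2
  records its end. The last two are pushed below the visits after which they are due.\<close>

definition dfs_body :: com where
 "dfs_body = (pop_task ;;
   Cond (Var vT1 \<doteq> Lit 0)
    (Cond (Idx 0 (Var vI1 \<otimes> Lit 3 \<oplus> Lit (Suc 0)) \<doteq> Lit 0) emit_char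
     (Cond (Idx aLEN (Var vI1) \<lhd> Var vH) push_small
      (Cond (Idx aSE (Var vI1) \<doteq> Lit 0) push_new copy_seen)))
    (Cond (Var vT1 \<doteq> Lit (Suc 0)) (Write aMD (Var vI1) (Var vLen)) (Write aSE (Var vI1) (Var vLen))))"

definition dfs_loop :: com where "dfs_loop = Loop (Lit 0 \<lhd> Var vSp) dfs_body"

lemma dfs_mods [simp]:
 "wv copy_text = {vLen, vA1, vK1}" "wa copy_text = {aTX}" "al copy_text = {}"
 "wv dfs_body = {vSp, vT1, vI1, vLen, vA1, vK1}" "wa dfs_body = {aTX, aPP, aMD, aSE, aDS}" "al dfs_body = {}"
 "wv dfs_loop = {vSp, vT1, vI1, vLen, vA1, vK1}" "wa dfs_loop = {aTX, aPP, aMD, aSE, aDS}" "al dfs_loop = {}"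
 by (auto simp: copy_text_def dfs_body_def dfs_loop_def pop_task_def emit_char_def push_small_def push_new_def copy_seen_def psh_def)

context machine
begin

lemma wp_copy_text:
 assumes "ar u aTX = zc T" "vr u vLen = length T" "vr u vA1 = p" "vr u vK1 = 0" "p + vr u vH <= length T"
  "length T + vr u vH <= sz u aTX" "length T + vr u vH + 1 < B"
 shows "wp copy_text (%v. ar v aTX = zc (T @ take (vr u vH) (drop p T)) & vr v vLen = length T + vr u vH &
   tm v <= tm u + 5 * vr u vH + 1) u"
 unfolding copy_text_def
proof (rule wp_For[where I = "%k v. ar v aTX = zc (T @ take k (drop p T)) & vr v vLen = length T + k & vr v vA1 = p + k" and D = 3], goal_cases)
 case (8 k v)
 have sz: "sz v = sz u" using frame_simps(3)[OF 8(4)] by simp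
 have k: "k < vr u vH" using 8 by simp
 have tk: "zc (T @ take k (drop p T)) (p + k) = T ! (p + k)" using k assms(5) by (simp add: zc_def nth_append)
 have "take (Suc k) (drop p T) = take k (drop p T) @ [T ! (p + k)]"
  using k assms(5) by (subst take_Suc_conv_app_nth) auto
 moreover have "length (T @ take k (drop p T)) = length T + k" using k assms(5) by simp
 ultimately have up: "(zc (T @ take k (drop p T)))(length T + k := T ! (p + k)) = zc (T @ take (Suc k) (drop p T))"
  using zc_snoc[of "length T + k" "T @ take k (drop p T)"] by simp
 show ?case using 8(5) k assms sz by (simp add: tk up)
qed (use assms in auto)

end

locale dfs_machine = machine B A + slp_text G cf h H
 for B A :: nat and G :: "'a slp" and cf :: "'a => nat" and h H :: nat
begin

definition tsk :: "nat => dst => dst" where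
 "tsk t d = (if t mod 3 = 0 then vis G cf H (t div 3) d
   else if t mod 3 = 1 then d(|md := (md d)(t div 3 := length (tx d)), stp := Suc (stp d)|)
   else d(|se := (se d)(t div 3 := length (tx d)), stp := Suc (stp d)|))"

text \<open>A visit may copy from recorded positions, so \<open>dinv\<close> must hold when it is
  reached; tasks that only record a position do not read any.\<close>

fun safe :: "dst => nat list => bool" where
 "safe d [] = True"
| "safe d (t # ts) = ((t mod 3 = 0 --> dinv d) & t div 3 < length G & safe (tsk t d) ts)"

lemma vis_grow: "i < length G ==> stp d < stp (vis G cf H i d) & length (tx d) <= length (tx (vis G cf H i d))"
proof (induction i arbitrary: d rule: less_induct)
 case (less i)
 show ?case
 proof (cases "G ! i")
  case (Terminal a)
  then show ?thesis by (simp add: vis.simps)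
 next
  case (Pair l r)
  note lr = children[OF less.prems Pair]
  have L: "stp d < stp (vis G cf H l d)" "length (tx d) <= length (tx (vis G cf H l d))"
   and R: "stp d < stp (vis G cf H r d)" "length (tx d) <= length (tx (vis G cf H r d))" for d
   using less.IH lr by auto
  show ?thesis
  proof (cases "big i & se d i ~= 0")
   case True
   then show ?thesis using Pair lr by (subst (1 2) vis.simps) simp
  next
   case nv: False
   show ?thesis
   proof (cases "big i")
    case False
    let ?d = "d(|stp := Suc (stp d), tch := insert i (tch d)|)"
    have "vis G cf H i d = vis G cf H r (vis G cf H l ?d)" using Pair lr False by (subst vis.simps) simp
    then show ?thesis using L[of ?d] R[of "vis G cf H l ?d"] by simp
   next
    case True
    let ?d = "d(|pp := (pp d)(i := length (tx d)), stp := Suc (stp d), tch := insert i (tch d)|)"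
    let ?e = "vis G cf H l ?d"
    let ?e' = "?e(|md := (md ?e)(i := length (tx ?e)), stp := Suc (stp ?e)|)"
    let ?f = "vis G cf H r ?e'"
    have "vis G cf H i d = ?f(|se := (se ?f)(i := length (tx ?f)), stp := Suc (stp ?f)|)"
     using Pair lr True nv by (subst vis.simps) (simp add: Let_def)
    then show ?thesis using L[of ?d] R[of ?e'] by simp
   qed
  qed
 qed
qed

lemma tsk_grow: "t div 3 < length G ==> stp d < stp (tsk t d) & length (tx d) <= length (tx (tsk t d))"
 using vis_grow by (simp add: tsk_def)

text \<open>Every pending task still takes a step, so the stack is never higher than the final step
  count, and the text is never longer than the final text. This justifies the sizes
  \<open>4 * Z\<close> and \<open>Z\<close>.\<close>

lemma safe_grow: "safe d ts ==> length ts + stp d <= stp (fold tsk ts d) & length (tx d) <= length (tx (fold tsk ts d))"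
proof (induction ts arbitrary: d)
 case (Cons t ts)
 then show ?case using tsk_grow[of t d] Cons.IH[of "tsk t d"] by fastforce
qed simp

definition dsim :: "dst => nat list => state => bool" where
 "dsim d ts u \<longleftrightarrow> ar u aTX = zc (tx d) & vr u vLen = length (tx d) & ar u aPP = pp d & ar u aMD = md d & ar u aSE = se d &
   stk (ar u aDS) ts & vr u vSp = length ts"

text \<open>The input holds codes while the text uses \<open>cf\<close>, larger by one, which keeps
  0 free for the padding.\<close>

definition renc :: "(nat => nat) => bool" where
 "renc f \<longleftrightarrow> (\<forall>i<length G. case G ! i of
   Terminal a => f (i * 3 + 1) = 0 & Suc (f (i * 3 + 2)) = cf a & cf a < B
  | Pair l r => f (i * 3 + 1) = 1 & f (i * 3 + 2) = l & f (i * 3 + 3) = r)"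

definition dctx :: "state => bool" where
 "dctx u \<longleftrightarrow> renc (ar u 0) & (\<forall>i<length G. ar u aLEN i = vl i) & vr u vH = H &
   3 * length G + 1 <= sz u 0 & length G <= sz u aLEN & length G <= sz u aPP & length G <= sz u aMD & length G <= sz u aSE &
   Z <= sz u aTX & 4 * Z <= sz u aDS & 3 * length G + 10 < B & 4 * Z + 10 < B"

text \<open>The clock is measured against \<open>stp\<close>. Copying two blocks of H characters
  advances \<open>stp\<close> by 2 H + 1, so a constant factor suffices in every case.\<close>

lemma wp_dfs_body:
 assumes sim: "dsim d (t # ts) u" and ctx: "dctx u" and sf: "safe d (t # ts)" and F: "fold tsk (t # ts) d = D"
 shows "wp dfs_body (%v. \<exists>d' ts'. dsim d' ts' v & safe d' ts' & fold tsk ts' d' = D & stp d < stp d' & tm v + 40 * stp d <= tm u + 40 * stp d') u"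
proof -
 define i where "i = t div 3"
 have i: "i < length G" using sf by (simp add: i_def)
 have sd: "dinv d" if "t mod 3 = 0" using sf that by simp
 have s2: "safe (tsk t d) ts" "fold tsk ts (tsk t d) = D" using sf F by auto
 have Dl: "length (tx D) <= Z" "stp D <= 4 * Z" using D_len D_stp by auto
 have lim: "length ts' <= 4 * Z & length (tx d') <= Z" if "safe d' ts'" "fold tsk ts' d' = D" for d' ts'
  using safe_grow[OF that(1)] that(2) Dl by simp
 have l0: "length ts < 4 * Z" "length (tx d) <= Z" using lim[OF sf F] by auto
 have sm: "ar u aTX = zc (tx d)" "vr u vLen = length (tx d)" "ar u aPP = pp d" "ar u aMD = md d" "ar u aSE = se d"
  "stk (ar u aDS) ts" "ar u aDS (length ts) = t" "vr u vSp = Suc (length ts)"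
  using sim stk_pop[of "ar u aDS" t ts] by (auto simp: dsim_def)
 have cx: "renc (ar u 0)" "\<And>j. j < length G ==> ar u aLEN j = vl j" "vr u vH = H" "3 * length G + 1 <= sz u 0" "length G <= sz u aLEN"
  "length G <= sz u aPP" "length G <= sz u aMD" "length G <= sz u aSE" "Z <= sz u aTX" "4 * Z <= sz u aDS" "3 * length G + 10 < B" "4 * Z + 10 < B"
  using ctx by (auto simp: dctx_def)
 define Qq where "Qq = (%v. \<exists>d' ts'. dsim d' ts' v & safe d' ts' & fold tsk ts' d' = D & stp d < stp d' & tm v + 40 * stp d <= tm u + 40 * stp d')"
 have QqI: "Qq v" if "dsim d' ts' v" "safe d' ts'" "fold tsk ts' d' = D" "stp d < stp d'" "tm v + 40 * stp d <= tm u + 40 * stp d'" for v d' ts'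
  using that unfolding Qq_def by blast
 define s1 where "s1 = u(|vr := (vr u)(vSp := length ts, vT1 := t mod 3, vI1 := i), tm := tm u + 4|)"
 have f1: "ar s1 = ar u" "sz s1 = sz u" "vr s1 vLen = length (tx d)" "vr s1 vSp = length ts" "vr s1 vI1 = i" "vr s1 vT1 = t mod 3"
  "vr s1 vH = H" "tm s1 = tm u + 4"
  using sm cx by (auto simp: s1_def)
 have pop: "wp pop_task Qx u" if "Qx s1" for Qx
  using that sm cx l0 unfolding pop_task_def
  by (simp add: s1_def i_def) (erule back_subst[of Qx], simp add: fun_upd_twist fun_upd_def fun_eq_iff)
 have i3: "i * 3 + 3 < sz u 0" "i * 3 + 3 < B" "i < sz u aLEN" "i < sz u aPP" "i < sz u aMD" "i < sz u aSE" using i cx by auto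
 have B3: "3 < B" using cx by simp
 show ?thesis unfolding dfs_body_def wp_Seq Qq_def[symmetric]
 proof (rule pop)
  show "wp (Cond (Var vT1 \<doteq> Lit 0)
    (Cond (Idx 0 (Var vI1 \<otimes> Lit 3 \<oplus> Lit (Suc 0)) \<doteq> Lit 0) emit_char
     (Cond (Idx aLEN (Var vI1) \<lhd> Var vH) push_small
      (Cond (Idx aSE (Var vI1) \<doteq> Lit 0) push_new copy_seen)))
    (Cond (Var vT1 \<doteq> Lit (Suc 0)) (Write aMD (Var vI1) (Var vLen)) (Write aSE (Var vI1) (Var vLen)))) Qq s1"
  proof (cases "t mod 3 = 0")
   case False
   have g: "Qq v" if "dsim (tsk t d) ts v" "tm v <= tm u + 10" for v
    by (rule QqI[OF that(1) s2]) (use that tsk_grow[of t d] i in \<open>auto simp: i_def\<close>)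
   show ?thesis
   proof (cases "t mod 3 = 1")
    case True
    then have tk: "tsk t d = d(|md := (md d)(i := length (tx d)), stp := Suc (stp d)|)" by (simp add: tsk_def i_def)
    show ?thesis using True B3 by (simp add: f1 i3) (rule g, use sm f1 in \<open>simp_all add: dsim_def tk\<close>)
   next
    case ne: False
    then have tk: "tsk t d = d(|se := (se d)(i := length (tx d)), stp := Suc (stp d)|)" using False by (simp add: tsk_def i_def)
    show ?thesis using ne False B3 by (simp add: f1 i3) (rule g, use sm f1 in \<open>simp_all add: dsim_def tk\<close>)
   qed
  next
   case t0: True
   have tk: "tsk t d = vis G cf H i d" using t0 by (simp add: tsk_def i_def)
   have t3: "tsk (i * 3) = vis G cf H i" for i by (rule ext) (simp add: tsk_def)
   show ?thesis
   proof (cases "G ! i")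
    case (Terminal a)
    let ?d = "d(|tx := tx d @ [cf a], stp := Suc (stp d), tch := insert i (tch d)|)"
    have vd: "tsk t d = ?d" unfolding tk using Terminal by (simp add: vis.simps)
    have r: "ar u 0 (i * 3 + 1) = 0" "Suc (ar u 0 (i * 3 + 2)) = cf a" "cf a < B" using cx(1) i Terminal by (auto simp: renc_def)
    have len: "length (tx d) < Z" using lim[OF s2] vd by simp
    show ?thesis unfolding emit_char_def using t0 B3 i3 r len cx sm
     by (simp add: f1) (rule QqI[of ?d ts], use s2 vd zc_snoc[of _ "tx d" "cf a"] in \<open>simp_all add: dsim_def f1\<close>)
   next
    case (Pair l r)
    note lr = children[OF i Pair]
    have rr: "ar u 0 (i * 3 + 1) = 1" "ar u 0 (i * 3 + 2) = l" "ar u 0 (i * 3 + 3) = r" using cx(1) i Pair by (auto simp: renc_def)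
    have fin: "finite (tch d)" using sd[OF t0] by (simp add: dinv_def)
    have lr3: "l * 3 < B" "r * 3 < B" using lr cx by auto
    show ?thesis
    proof (cases "big i")
     case False
     let ?d = "d(|stp := Suc (stp d), tch := insert i (tch d)|)" and ?ts = "l * 3 # r * 3 # ts"
     have i0: "dinv ?d" by (rule dinv_ext[OF sd[OF t0], where Y = "[]"]) (use fin in auto)
     have i1: "dinv (vis G cf H l ?d)" using vis_vpost[OF _ i0, of l] lr unfolding vpost_def by blast
     have vd: "tsk t d = vis G cf H r (vis G cf H l ?d)" unfolding tk using Pair lr False by (subst vis.simps) simp
     have sf': "safe ?d ?ts" using i0 i1 lr s2(1) by (simp add: t3 vd)
     have fo: "fold tsk ?ts ?d = D" using s2(2) by (simp add: t3 vd)
     have ll: "Suc (Suc (length ts)) <= 4 * Z" using lim[OF sf' fo] by simp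
     have st: "stk ((ar u aDS)(length ts := r * 3, Suc (length ts) := l * 3)) ?ts"
      by (intro stk_push sm(6)) auto
     show ?thesis unfolding push_small_def psh_def using t0 B3 i3 rr cx sm ll lr3 False i
      by (simp add: f1) (rule QqI[of ?d ?ts], use sf' fo st in \<open>simp_all add: dsim_def f1\<close>)
    next
     case bi: True
     show ?thesis
     proof (cases "se d i = 0")
      case True
      let ?d = "d(|pp := (pp d)(i := length (tx d)), stp := Suc (stp d), tch := insert i (tch d)|)"
       and ?ts = "l * 3 # (i * 3 + 1) # r * 3 # (i * 3 + 2) # ts"
      have i0: "dinv ?d" by (rule dinv_ext[OF sd[OF t0], where Y = "[]"]) (use fin True in auto)
      define d1 where "d1 = vis G cf H l ?d"
      have p1: "vpost l ?d d1" unfolding d1_def by (rule vis_vpost[OF _ i0]) (use lr in simp)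
      then have i1: "dinv d1" and at1: "se d1 i = 0" using lr True by (auto simp: vpost_def)
      let ?d1 = "d1(|md := (md d1)(i := length (tx d1)), stp := Suc (stp d1)|)"
      have i1': "dinv ?d1" by (rule dinv_ext[OF i1, where Y = "[]"]) (use i1 at1 in \<open>auto simp: dinv_def\<close>)
      define d2 where "d2 = vis G cf H r ?d1"
      have vd: "tsk t d = d2(|se := (se d2)(i := length (tx d2)), stp := Suc (stp d2)|)"
       unfolding tk d2_def d1_def using Pair lr bi True by (subst vis.simps) (simp add: Let_def)
      have md3: "(i * 3 + 1) div 3 = i" "(i * 3 + 1) mod 3 = 1" "(i * 3 + 2) div 3 = i" "(i * 3 + 2) mod 3 = 2" by presburger+
      have k1: "tsk (i * 3 + 1) d1 = ?d1" unfolding tsk_def md3 by simp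
      have k2: "tsk (i * 3 + 2) d2 = tsk t d" unfolding vd unfolding tsk_def md3 by simp
      have sf': "safe ?d ?ts" unfolding safe.simps t3 d1_def[symmetric] k1 d2_def[symmetric] k2 md3
       using i0 i1' lr s2(1) i by simp
      have fo: "fold tsk ?ts ?d = D" unfolding fold_simps t3 d1_def[symmetric] k1 d2_def[symmetric] k2 using s2(2) .
      have ll: "Suc (Suc (Suc (Suc (length ts)))) <= 4 * Z" using lim[OF sf' fo] by simp
      have st: "stk ((ar u aDS)(length ts := i * 3 + 2, Suc (length ts) := r * 3, Suc (Suc (length ts)) := i * 3 + 1, Suc (Suc (Suc (length ts))) := l * 3)) ?ts"
       by (intro stk_push sm(6)) auto
      show ?thesis unfolding push_new_def psh_def using t0 B3 i3 rr cx sm ll lr3 True bi i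
       by (simp add: f1) (rule QqI[of ?d ?ts], use sf' fo st in \<open>simp_all add: dsim_def f1\<close>)
     next
      case False
      let ?T = "tx d" and ?T1 = "tx d @ take H (drop (pp d i) (tx d))"
      let ?Y = "take H (drop (pp d i) (tx d)) @ take H (drop (se d i - H) (tx d))"
      let ?d = "d(|tx := tx d @ ?Y, stp := Suc (stp d + 2 * H), tch := insert i (tch d)|)"
      have vd: "tsk t d = ?d" unfolding tk using Pair lr bi False by (subst vis.simps) simp
      have "rng i (tx d) (pp d i) (md d i) (se d i)" using sd[OF t0] False unfolding dinv_def dj_def by blast
      then have "sub (tx d) (pp d i) (take H (V i))" "sub (tx d) (se d i - H) (lastH (V i))" "H <= se d i" by (auto simp: rng_def)
      moreover have "length (take H (V i)) = H" "length (lastH (V i)) = H" using bi by auto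
      ultimately have inn: "pp d i + H <= length ?T" "se d i - H + H <= length ?T" "H <= se d i" by (auto simp: sub_iff)
      have l1: "length ?T1 = length ?T + H" using inn by simp
      have "length (tx d) + 2 * H <= Z" using lim[OF s2] vd inn by simp
      then have zz: "length (tx d) + 2 * H <= sz u aTX" "length (tx d) + 2 * H + 1 < B" using cx by auto
      have T2: "?T1 @ take H (drop (se d i - H) ?T1) = tx d @ ?Y" using inn by simp
      define s2' where "s2' = s1(|tm := tm s1 + 6, vr := (vr s1)(vA1 := pp d i, vK1 := 0)|)"
      have P1: "wp (vA1 ::= Idx aPP (Var vI1) ;; vK1 ::= Lit 0) Qx (s1(|tm := tm s1 + 4|))" if "Qx s2'" for Qx
       using that i3 B3 sm by (simp add: f1) (erule back_subst[of Qx], simp add: s2'_def f1)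
      have W1: "wp copy_text (%v. ar v aTX = zc (?T @ take (vr s2' vH) (drop (pp d i) ?T)) & vr v vLen = length ?T + vr s2' vH &
        tm v <= tm s2' + 5 * vr s2' vH + 1) s2'"
       by (rule wp_copy_text) (use f1 sm inn zz in \<open>simp_all add: s2'_def\<close>)
      have W2: "wp (vA1 ::= Idx aSE (Var vI1) \<ominus> Var vH ;; vK1 ::= Lit 0 ;; copy_text) Qq v"
       if fr: "frame copy_text s2' v" and v: "ar v aTX = zc ?T1" "vr v vLen = length ?T + H" "tm v <= tm s2' + 5 * H + 1" for v
      proof -
       have fv: "vr v vI1 = i" "vr v vH = H" "ar v aSE = se d" "ar v aPP = pp d" "ar v aMD = md d" "ar v aDS = ar u aDS" "vr v vSp = length ts" "sz v = sz u"
        using sm f1 by (simp_all add: frame_simps[OF fr] s2'_def)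
       define s3 where "s3 = v(|tm := tm v + 2, vr := (vr v)(vA1 := se d i - H, vK1 := 0)|)"
       have P2: "wp (vA1 ::= Idx aSE (Var vI1) \<ominus> Var vH ;; vK1 ::= Lit 0) Qx v" if "Qx s3" for Qx
        using that i3 B3 inn zz by (simp add: fv) (erule back_subst[of Qx], simp add: s3_def)
       have W3: "wp copy_text (%v. ar v aTX = zc (?T1 @ take (vr s3 vH) (drop (se d i - H) ?T1)) & vr v vLen = length ?T1 + vr s3 vH &
         tm v <= tm s3 + 5 * vr s3 vH + 1) s3"
        by (rule wp_copy_text) (use fv v inn zz l1 in \<open>simp_all add: s3_def\<close>)
       have h3: "vr s3 vH = H" by (simp add: s3_def fv)
       have "wp copy_text Qq s3"
       proof (rule wp_conseq[OF W3], goal_cases)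
        case (1 v')
        have fv': "ar v' aSE = se d" "ar v' aPP = pp d" "ar v' aMD = md d" "ar v' aDS = ar u aDS" "vr v' vSp = length ts"
         using fv by (simp_all add: frame_simps[OF 1(1)] s3_def)
        have "dsim ?d ts v'" unfolding dsim_def using 1(2) fv' sm(6) h3 T2 l1 inn by simp
        moreover have "tm v' <= tm u + 40 + 10 * H" using 1(2) h3 v(3) f1 by (simp add: s3_def s2'_def)
        ultimately show ?case by - (rule QqI[of ?d ts], use s2 vd in simp_all)
       qed
       then have "wp (vA1 ::= Idx aSE (Var vI1) \<ominus> Var vH ;; vK1 ::= Lit 0) (wp copy_text Qq) v" by (rule P2)
       then show ?thesis by simp
      qed
      have "wp copy_text (wp (vA1 ::= Idx aSE (Var vI1) \<ominus> Var vH ;; vK1 ::= Lit 0 ;; copy_text) Qq) s2'"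
       by (rule wp_conseq[OF W1], rule W2) (simp_all add: s2'_def f1)
      then have "wp (vA1 ::= Idx aPP (Var vI1) ;; vK1 ::= Lit 0)
        (wp copy_text (wp (vA1 ::= Idx aSE (Var vI1) \<ominus> Var vH ;; vK1 ::= Lit 0 ;; copy_text) Qq)) (s1(|tm := tm s1 + 4|))"
       by (rule P1)
      then have W: "wp copy_seen Qq (s1(|tm := tm s1 + 4|))" unfolding copy_seen_def wp_Seq .
      have ts4: "s1(|tm := Suc (Suc (Suc (Suc (tm s1))))|) = s1(|tm := tm s1 + 4|)" by simp
      show ?thesis using t0 B3 i3 rr cx sm False bi i W by (simp add: f1 ts4)
     qed
    qed
   qed
  qed
 qed
qed

lemma wp_dfs_loop:
 assumes sim: "dsim d0 [root * 3] s" and ctx: "dctx s"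
 shows "wp dfs_loop (%v. ar v aTX = zc (tx D) & vr v vLen = length (tx D) & ar v aPP = pp D & ar v aMD = md D & ar v aSE = se D &
   tm v <= tm s + 200 * Z) s"
 unfolding dfs_loop_def
proof (rule wp_Loop[where I = "%u. \<exists>d ts. dsim d ts u & safe d ts & fold tsk ts d = D & tm u <= tm s + 42 * stp d" and T = "tm s + 42 * stp D"], goal_cases)
 case 1
 have "dinv d0" by (simp add: dinv_def d0_def)
 then show ?case using sim root by - (rule exI[of _ d0], rule exI[of _ "[root * 3]"], simp add: tsk_def D_def d0_def)
next
 case (2 u)
 then obtain d ts where I: "dsim d ts u" "safe d ts" "fold tsk ts d = D" "tm u <= tm s + 42 * stp d" by blast
 have cu: "dctx u" using ctx unfolding dctx_def by (simp add: frame_simps[OF 2(2)])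
 have sD: "stp d <= stp D" using safe_grow[OF I(2)] I(3) by simp
 have tmu: "tm u <= tm s + 42 * stp D" using I(4) sD by simp
 have spd: "vr u vSp = length ts" using I(1) by (simp add: dsim_def)
 have B0: "0 < B" using ctx by (simp add: dctx_def)
 show ?case
 proof (cases ts)
  case Nil
  then have "d = D" using I(3) by simp
  moreover have "stp D <= 4 * Z" "1 <= Z" using D_stp D_len D_pos by linarith+
  ultimately show ?thesis using tmu Nil spd B0 I(1) by (simp add: dsim_def)
 next
  case (Cons t ts')
  have simt: "dsim d (t # ts') (tick u)" and ct: "dctx (tick u)" using I(1) cu Cons by (auto simp: dsim_def dctx_def)
  have "wp dfs_body (%v. \<exists>d ts. dsim d ts v & safe d ts & fold tsk ts d = D & tm v <= tm s + 42 * stp d) (tick u)"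
  proof (rule wp_conseq[OF wp_dfs_body[OF simt ct I(2)[unfolded Cons] I(3)[unfolded Cons]]], goal_cases)
   case (1 v)
   then obtain d' ts' where *: "dsim d' ts' v" "safe d' ts'" "fold tsk ts' d' = D" "stp d < stp d'" "tm v + 40 * stp d <= tm (tick u) + 40 * stp d'" by blast
   have "tm v <= tm s + 42 * stp d'" using *(4,5) I(4) by simp
   then show ?case using * by blast
  qed
  then show ?thesis using tmu spd Cons B0 by simp
 qed
qed

end

section \<open>Computing the pieces\<close>

abbreviation (input) "aLL \<equiv> 7::nat"
abbreviation (input) "aLR \<equiv> 8::nat"
abbreviation (input) "aNX \<equiv> 9::nat"
abbreviation (input) "aISA \<equiv> 10::nat"
abbreviation (input) "aISB \<equiv> 11::nat"
abbreviation (input) "vHh \<equiv> 81::nat"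
abbreviation (input) "vn \<equiv> 87::nat"
abbreviation (input) "vX1 \<equiv> 89::nat"

definition jump_left :: com where
 "jump_left = Cond (Var vHh \<otimes> Lit 2 \<lhd> Idx aLL rgt \<oplus> Idx aLR rgt \<oplus> Idx aLEN lft)
   (Write aLL (Var vI1) (Idx aLEN lft) ;; Write aNX (Var vI1) rgt)
   (Write aLL (Var vI1) (Idx aLL rgt \<oplus> Idx aLEN lft) ;; Write aLR (Var vI1) (Idx aLR rgt) ;; Write aNX (Var vI1) (Idx aNX rgt))"

definition jump_right :: com where
 "jump_right = Cond (Var vHh \<otimes> Lit 2 \<lhd> Idx aLL lft \<oplus> Idx aLR lft \<oplus> Idx aLEN rgt)
   (Write aLR (Var vI1) (Idx aLEN rgt) ;; Write aNX (Var vI1) lft)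
   (Write aLR (Var vI1) (Idx aLR lft \<oplus> Idx aLEN rgt) ;; Write aLL (Var vI1) (Idx aLL lft) ;; Write aNX (Var vI1) (Idx aNX lft))"

text \<open>Children have smaller indices, so a single pass in increasing order finds the jumps of
  both children already tabulated.\<close>

definition jump_body :: com where
 "jump_body = (Write aLL (Var vI1) (Lit 0) ;; Write aLR (Var vI1) (Lit 0) ;; Write aNX (Var vI1) (Var vI1) ;;
   Cond (Idx 0 (Var vI1 \<otimes> Lit 3 \<oplus> Lit (Suc 0)))
    (Cond (Idx aLEN lft \<lhd> Var vH)
     (Cond (Idx aLEN rgt \<lhd> Var vH) Skip jump_left)
     (Cond (Idx aLEN rgt \<lhd> Var vH) jump_right Skip)) Skip)"

definition jump_loop :: com where "jump_loop = (vI1 ::= Lit 0 ;; For vI1 vn jump_body)"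

definition psh2 :: "aexp => aexp => com" where
 "psh2 a b = (Write aISA (Var vSp) a ;; Write aISB (Var vSp) b ;; vSp ::= Var vSp \<oplus> Lit (Suc 0))"

text \<open>Pushed from right to left, so that the leftmost task ends up on top of the
  stack.\<close>

definition push_single :: com where
 "push_single = (Cond (Idx aLR (Var vI1)) (psh2 (Idx aSE (Var vI1) \<ominus> Idx aLR (Var vI1) \<ominus> Var vHh) (Idx aLR (Var vI1))) Skip ;;
   psh2 (Idx aNX (Var vI1)) (Lit 0) ;;
   Cond (Idx aLL (Var vI1)) (psh2 (Idx aPP (Var vI1)) (Idx aLL (Var vI1))) Skip)"

definition put_item :: com where
 "put_item = (Write aITM (Var vX1 \<oplus> Var vX1) (Var vI1) ;; Write aITM (Var vX1 \<oplus> Var vX1 \<oplus> Lit (Suc 0)) (Var vK1) ;;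
   vX1 ::= Var vX1 \<oplus> Lit (Suc 0))"

definition pop2 :: com where
 "pop2 = (vSp ::= Var vSp \<ominus> Lit (Suc 0) ;; vI1 ::= Idx aISA (Var vSp) ;; vK1 ::= Idx aISB (Var vSp))"

definition item_body :: com where
 "item_body = (pop2 ;;
   Cond (Var vK1) put_item
    (Cond (Idx aLEN lft \<lhd> Var vH)
     (Cond (Idx aLEN rgt \<lhd> Var vH) (psh2 (Idx aPP (Var vI1)) (Idx aLEN (Var vI1) \<ominus> Var vHh)) push_single)
     (Cond (Idx aLEN rgt \<lhd> Var vH) push_single
      (psh2 rgt (Lit 0) ;; psh2 (Idx aMD (Var vI1) \<ominus> Var vHh) (Var vHh) ;; psh2 lft (Lit 0)))))"

definition item_loop :: com where "item_loop = Loop (Lit 0 \<lhd> Var vSp) item_body"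

lemma item_mods [simp]:
 "wv jump_body = {}" "wa jump_body = {aLL, aLR, aNX}" "al jump_body = {}"
 "wv jump_loop = {vI1}" "wa jump_loop = {aLL, aLR, aNX}" "al jump_loop = {}"
 "wv item_body = {vSp, vI1, vK1, vX1}" "wa item_body = {aISA, aISB, aITM}" "al item_body = {}"
 "wv item_loop = {vSp, vI1, vK1, vX1}" "wa item_loop = {aISA, aISB, aITM}" "al item_loop = {}"
 by (auto simp: jump_body_def jump_left_def jump_right_def jump_loop_def item_body_def item_loop_def pop2_def put_item_def push_single_def psh2_def)

locale lz_machine = dfs_machine B A G cf h H + slp_alpha G cf h H
 for B A :: nat and G :: "'a slp" and cf :: "'a => nat" and h H :: nat
begin

definition jarr :: "nat => (nat => nat) => (nat => nat) => (nat => nat) => bool" where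
 "jarr k f g e \<longleftrightarrow> (\<forall>j<k. jmp j = (f j, g j, e j))"

lemma jarr_Suc:
 assumes "jarr k f g e" "jmp k = (f' k, g' k, e' k)" "\<And>j. j ~= k ==> f' j = f j & g' j = g j & e' j = e j"
 shows "jarr (Suc k) f' g' e'"
 unfolding jarr_def
proof (intro allI impI)
 fix j assume "j < Suc k"
 then show "jmp j = (f' j, g' j, e' j)" using assms unfolding jarr_def by (cases "j = k") auto
qed

lemma wp_jump_body:
 assumes rn: "renc (ar u 0)" and ln: "\<And>j. j < length G ==> ar u aLEN j = vl j" and v: "vr u vH = H" "vr u vHh = h" "vr u vI1 = k" "k < length G"
  and sz: "3 * length G + 1 <= sz u 0" "length G <= sz u aLEN" "length G <= sz u aLL" "length G <= sz u aLR" "length G <= sz u aNX"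
  and B: "3 * length G + 10 < B" "N + 10 < B" "3 * h + 10 < B" and j: "jarr k (ar u aLL) (ar u aLR) (ar u aNX)"
 shows "wp jump_body (%v. tm v <= tm u + 20 & jarr (Suc k) (ar v aLL) (ar v aLR) (ar v aNX)) u"
proof -
 define Qq where "Qq = (%v::state. tm v <= tm u + 20 & jarr (Suc k) (ar v aLL) (ar v aLR) (ar v aNX))"
 have QqI: "Qq v" if "tm v <= tm u + 20" "jmp k = (ar v aLL k, ar v aLR k, ar v aNX k)"
  "\<And>j. j ~= k ==> ar v aLL j = ar u aLL j & ar v aLR j = ar u aLR j & ar v aNX j = ar u aNX j" for v
  unfolding Qq_def using that jarr_Suc[OF j that(2,3)] by blast
 have k3: "k * 3 + 3 < sz u 0" "k * 3 + 3 < B" "k < sz u aLEN" "k < sz u aLL" "k < sz u aLR" "k < sz u aNX" using v(4) sz B by auto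
 have B3: "3 < B" "h * 2 < B" using B by auto
 show ?thesis unfolding Qq_def[symmetric]
 proof (cases "G ! k")
  case (Terminal a)
  have r: "ar u 0 (k * 3 + 1) = 0" using rn v(4) Terminal by (auto simp: renc_def)
  have jk: "jmp k = (0, 0, k)" using Terminal by (simp add: jmp.simps)
  show "wp jump_body Qq u" unfolding jump_body_def using r k3 B3 v by simp (rule QqI, simp_all add: jk)
 next
  case (Pair l r)
  note lr = children[OF v(4) Pair]
  have rr: "ar u 0 (k * 3 + 1) = 1" "ar u 0 (k * 3 + 2) = l" "ar u 0 (k * 3 + 3) = r" using rn v(4) Pair by (auto simp: renc_def)
  have ll: "ar u aLEN l = vl l" "ar u aLEN r = vl r" using ln lr by auto
  have szl: "l < sz u aLEN" "l < sz u aLL" "l < sz u aLR" "l < sz u aNX" "r < sz u aLEN" "r < sz u aLL" "r < sz u aLR" "r < sz u aNX" using lr sz by auto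
  have jl: "jmp l = (ar u aLL l, ar u aLR l, ar u aNX l)" "jmp r = (ar u aLL r, ar u aLR r, ar u aNX r)" using j lr unfolding jarr_def by auto
  have ne: "l ~= k" "r ~= k" using lr by auto
  have vk: "vl l + vl r <= N" using vl_le_N[OF v(4)] vl_Pair[OF v(4) Pair] by simp
  show "wp jump_body Qq u"
  proof (cases "big l = big r")
   case True
   have jk: "jmp k = (0, 0, k)" using Pair True by (simp add: jmp.simps[of k])
   show ?thesis
   proof (cases "big r")
    case br: True
    show ?thesis unfolding jump_body_def using rr k3 B3 v True br ll szl ne by simp (rule QqI, simp_all add: jk)
   next
    case br: False
    show ?thesis unfolding jump_body_def using rr k3 B3 v True br ll szl ne by simp (rule QqI, simp_all add: jk)
   qed
  next
   case dif: False
   show ?thesis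
   proof (cases "big r")
    case True
    have "vl r = ar u aLL r + vl (ar u aNX r) + ar u aLR r" by (rule jok_vl[OF jmp_ok[OF _ True jl(2)]]) (use lr in simp)
    then have bb: "ar u aLL r + ar u aLR r + vl l < B" "ar u aLL r + ar u aLR r < B" "ar u aLL r + vl l < B" using vk B by auto
    have jk: "jmp k = (if ar u aLL r + ar u aLR r + vl l <= 2 * h then (ar u aLL r + vl l, ar u aLR r, ar u aNX r) else (vl l, 0, r))"
     using Pair True dif lr jl by (simp add: jmp.simps[of k])
    show ?thesis
    proof (cases "ar u aLL r + ar u aLR r + vl l <= 2 * h")
     case c: True
     show ?thesis unfolding jump_body_def jump_left_def using rr k3 B3 v True dif ll szl ne bb c
      by simp (rule QqI, simp_all add: jk)
    next
     case c: False
     show ?thesis unfolding jump_body_def jump_left_def using rr k3 B3 v True dif ll szl ne bb c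
      by simp (rule QqI, simp_all add: jk)
    qed
   next
    case False
    then have bl: "big l" using dif by simp
    have "vl l = ar u aLL l + vl (ar u aNX l) + ar u aLR l" by (rule jok_vl[OF jmp_ok[OF _ bl jl(1)]]) (use lr in simp)
    then have bb: "ar u aLL l + ar u aLR l + vl r < B" "ar u aLL l + ar u aLR l < B" "ar u aLR l + vl r < B" using vk B by auto
    have jk: "jmp k = (if ar u aLL l + ar u aLR l + vl r <= 2 * h then (ar u aLL l, ar u aLR l + vl r, ar u aNX l) else (0, vl r, l))"
     using Pair False dif lr jl by (simp add: jmp.simps[of k])
    show ?thesis
    proof (cases "ar u aLL l + ar u aLR l + vl r <= 2 * h")
     case c: True
     show ?thesis unfolding jump_body_def jump_right_def using rr k3 B3 v False bl ll szl ne bb c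
      by simp (rule QqI, simp_all add: jk)
    next
     case c: False
     show ?thesis unfolding jump_body_def jump_right_def using rr k3 B3 v False bl ll szl ne bb c
      by simp (rule QqI, simp_all add: jk)
    qed
   qed
  qed
 qed
qed

lemma wp_jump_loop:
 assumes rn: "renc (ar s 0)" and ln: "\<And>j. j < length G ==> ar s aLEN j = vl j" and v: "vr s vH = H" "vr s vHh = h" "vr s vn = length G"
  and sz: "3 * length G + 1 <= sz s 0" "length G <= sz s aLEN" "length G <= sz s aLL" "length G <= sz s aLR" "length G <= sz s aNX"
  and B: "3 * length G + 10 < B" "N + 10 < B" "3 * h + 10 < B"
 shows "wp jump_loop (%v. jarr (length G) (ar v aLL) (ar v aLR) (ar v aNX) & tm v <= tm s + 22 * length G + 2) s"
proof -
 define s1 where "s1 = s(|tm := Suc (tm s), vr := (vr s)(vI1 := 0)|)"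
 have W: "wp (For vI1 vn jump_body) (%v. jarr (length G) (ar v aLL) (ar v aLR) (ar v aNX) & tm v <= tm s + 22 * length G + 2) s1"
 proof (rule wp_For[where I = "%k u. jarr k (ar u aLL) (ar u aLR) (ar u aNX)" and D = 20], goal_cases)
  case (8 k u)
  have f: "ar u 0 = ar s 0" "ar u aLEN = ar s aLEN" "vr u vH = H" "vr u vHh = h" "sz u = sz s"
   using v by (simp_all add: frame_simps[OF 8(4)] s1_def)
  have "wp jump_body (%v. tm v <= tm u + 20 & jarr (Suc k) (ar v aLL) (ar v aLR) (ar v aNX)) u"
   by (rule wp_jump_body) (use 8 f rn ln v sz B in \<open>auto simp: s1_def\<close>)
  then show ?case by simp
 qed (use v B in \<open>auto simp: s1_def jarr_def\<close>)
 show ?thesis unfolding jump_loop_def using W B by (simp add: s1_def)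
qed

text \<open>A potential: one unit for a piece and two for each piece that a nonterminal will
  produce. Every expansion yields at least one piece directly and so spends a unit. As each pending
  task holds a unit, the potential also bounds the stack.\<close>

definition tc :: "nat \<times> nat => nat" where
 "tc t = (if snd t ~= 0 then 1 else 2 * length (items (fst t)))"

definition valid :: "nat \<times> nat => bool" where
 "valid t \<longleftrightarrow> (snd t = 0 --> fst t \<in> reach G root & big (fst t))"

lemma valid_less: "valid (i, 0) ==> i < length G & big i"
 using reach_less[OF slp root] by (auto simp: valid_def)

lemma tc_pos: "valid t ==> 1 <= tc t"
proof (cases t)
 case (Pair p k)
 assume "valid t"
 then show ?thesis using Pair items_count[of p] valid_less[of p] by (cases "k = 0") (auto simp: tc_def Suc_le_eq)
qed

lemma tc_sum: "(\<forall>t\<in>set ts. valid t) ==> length ts <= sum_list (map tc ts)"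
proof (induction ts)
 case (Cons t ts)
 then show ?case using tc_pos[of t] by fastforce
qed simp

lemma expand_ok:
 assumes "valid (i, 0)"
 shows "\<forall>t\<in>set (expand i). valid t" "1 + sum_list (map tc (expand i)) <= tc (i, 0)"
proof -
 have i: "i \<in> reach G root" "i < length G" "big i" using assms valid_less[OF assms] by (auto simp: valid_def)
 have rt: "reach G i \<subseteq> reach G root" by (rule reach_trans[OF i(1)])
 have vh: "vl i - h ~= 0" using i(3) Hb by linarith
 have tci: "tc (i, 0) = 2 * length (concat (map tsem (expand i)))" using items_expand[OF i(2,3)] by (simp add: tc_def)
 have *: "(\<forall>t\<in>set (expand i). valid t) & 1 + sum_list (map tc (expand i)) <= tc (i, 0)"
  using i(2,3)
 proof (cases rule: big_cases)
  case (two l r)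
  have "l \<in> reach G root" "r \<in> reach G root" using rt reach_Pair[OF two(1-3)] reach_self[of l G] reach_self[of r G] by auto
  then show ?thesis unfolding tci two(11) using two(8,9) Hb(3) by (simp add: valid_def tc_def tsem_def)
 next
  case (none l r)
  then show ?thesis unfolding tci none(5) using vh by (simp add: valid_def tc_def tsem_def)
 next
  case (single a b c)
  have c: "c \<in> reach G root" "big c" "0 < a + b" using single(1,3) rt unfolding jok_def by blast+
  then show ?thesis unfolding tci single(4) by (cases "a = 0"; cases "b = 0") (simp_all add: valid_def tc_def tsem_def)
 qed
 then show "\<forall>t\<in>set (expand i). valid t" "1 + sum_list (map tc (expand i)) <= tc (i, 0)" by auto
qed

definition iout :: "(nat \<times> nat) list => (nat => nat) => bool" where
 "iout out f \<longleftrightarrow> (\<forall>j<length out. f (2 * j) = fst (out ! j) & f (2 * j + 1) = snd (out ! j))"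

lemma iout_snoc: "iout out f ==> iout (out @ [t]) (f(2 * length out := fst t, 2 * length out + 1 := snd t))"
 unfolding iout_def
proof (intro allI impI)
 fix j assume a: "\<forall>j<length out. f (2 * j) = fst (out ! j) & f (2 * j + 1) = snd (out ! j)" and j: "j < length (out @ [t])"
 show "(f(2 * length out := fst t, 2 * length out + 1 := snd t)) (2 * j) = fst ((out @ [t]) ! j) &
  (f(2 * length out := fst t, 2 * length out + 1 := snd t)) (2 * j + 1) = snd ((out @ [t]) ! j)"
 proof (cases "j = length out")
  case False
  then have "j < length out" "2 * j + 1 ~= 2 * length out" "2 * j ~= 2 * length out + 1" using j by (simp, presburger, presburger)
  then show ?thesis using a by (simp add: nth_append)
 qed simp
qed

definition isim :: "(nat \<times> nat) list => (nat \<times> nat) list => state => bool" where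
 "isim out ts u \<longleftrightarrow> iout out (ar u aITM) & vr u vX1 = length out & stk (ar u aISA) (map fst ts) & stk (ar u aISB) (map snd ts) &
   vr u vSp = length ts & (\<forall>t\<in>set ts. valid t) & out @ concat (map tsem ts) = all_items & sum_list (map tc ts) <= 2 * length all_items"

definition ictx :: "state => bool" where
 "ictx u \<longleftrightarrow> renc (ar u 0) & (\<forall>i<length G. ar u aLEN i = vl i) & vr u vH = H & vr u vHh = h &
   jarr (length G) (ar u aLL) (ar u aLR) (ar u aNX) & ar u aPP = pp D & ar u aMD = md D & ar u aSE = se D &
   3 * length G + 1 <= sz u 0 & length G <= sz u aLEN & length G <= sz u aPP & length G <= sz u aMD & length G <= sz u aSE &
   length G <= sz u aLL & length G <= sz u aLR & length G <= sz u aNX &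
   2 * length all_items <= sz u aISA & 2 * length all_items <= sz u aISB & 2 * length all_items <= sz u aITM &
   3 * length G + 10 < B & Z + 10 < B & N + 10 < B & 2 * length all_items + 10 < B"

lemma wp_item_body:
 assumes sim: "isim out (t # ts) u" and ctx: "ictx u"
 shows "wp item_body (%v. \<exists>out' ts'. isim out' ts' v & tm v + 40 * sum_list (map tc ts') + 10 <= tm u + 40 * sum_list (map tc (t # ts))) u"
proof -
 define Qq where "Qq = (%v. \<exists>out' ts'. isim out' ts' v & tm v + 40 * sum_list (map tc ts') + 10 <= tm u + 40 * sum_list (map tc (t # ts)))"
 obtain p k where t: "t = (p, k)" by (cases t)
 have sm: "iout out (ar u aITM)" "vr u vX1 = length out" "stk (ar u aISA) (map fst ts)" "stk (ar u aISB) (map snd ts)"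
  "ar u aISA (length ts) = p" "ar u aISB (length ts) = k" "vr u vSp = Suc (length ts)" "valid t" "\<forall>t\<in>set ts. valid t"
  "out @ concat (map tsem (t # ts)) = all_items" "sum_list (map tc (t # ts)) <= 2 * length all_items"
  using sim stk_pop[of "ar u aISA" p "map fst ts"] stk_pop[of "ar u aISB" k "map snd ts"] by (auto simp: isim_def t)
 have cx: "renc (ar u 0)" "\<And>j. j < length G ==> ar u aLEN j = vl j" "vr u vH = H" "vr u vHh = h"
   "jarr (length G) (ar u aLL) (ar u aLR) (ar u aNX)" "ar u aPP = pp D" "ar u aMD = md D" "ar u aSE = se D"
   "3 * length G + 1 <= sz u 0" "length G <= sz u aLEN" "length G <= sz u aPP" "length G <= sz u aMD" "length G <= sz u aSE"
   "length G <= sz u aLL" "length G <= sz u aLR" "length G <= sz u aNX"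
   "2 * length all_items <= sz u aISA" "2 * length all_items <= sz u aISB" "2 * length all_items <= sz u aITM"
   "3 * length G + 10 < B" "Z + 10 < B" "N + 10 < B" "2 * length all_items + 10 < B"
  using ctx by (auto simp: ictx_def)
 have lt: "Suc (length ts) <= 2 * length all_items" using tc_sum[of "t # ts"] sm by simp
 define s1 where "s1 = u(|vr := (vr u)(vSp := length ts, vI1 := p, vK1 := k), tm := tm u + 3|)"
 have f1: "ar s1 = ar u" "sz s1 = sz u" "vr s1 vX1 = length out" "vr s1 vSp = length ts" "vr s1 vI1 = p" "vr s1 vK1 = k"
  "vr s1 vH = H" "vr s1 vHh = h" "tm s1 = tm u + 3"
  using sm cx by (auto simp: s1_def)
 have B3: "3 < B" using cx by simp
 have pop: "wp pop2 Qx u" if "Qx s1" for Qx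
  using that sm cx lt B3 unfolding pop2_def
  by (simp add: s1_def) (erule back_subst[of Qx], simp)
 show ?thesis unfolding item_body_def wp_Seq Qq_def[symmetric]
 proof (rule pop)
  show "wp (Cond (Var vK1) put_item
    (Cond (Idx aLEN lft \<lhd> Var vH)
     (Cond (Idx aLEN rgt \<lhd> Var vH) (psh2 (Idx aPP (Var vI1)) (Idx aLEN (Var vI1) \<ominus> Var vHh)) push_single)
     (Cond (Idx aLEN rgt \<lhd> Var vH) push_single
      (psh2 rgt (Lit 0) ;; psh2 (Idx aMD (Var vI1) \<ominus> Var vHh) (Var vHh) ;; psh2 lft (Lit 0))))) Qq s1"
  proof (cases "k = 0")
   case False
   have ts: "tsem t = [t]" "tc t = 1" using False by (auto simp: tsem_def tc_def t)
   have lo: "length out < length all_items" using arg_cong[OF sm(10), of length] ts by simp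
   have g: "Qq v" if "ar v aITM = (ar u aITM)(2 * length out := p, 2 * length out + 1 := k)" "vr v vX1 = Suc (length out)"
     "ar v aISA = ar u aISA" "ar v aISB = ar u aISB" "vr v vSp = length ts" "tm v <= tm u + 10" for v
   proof -
    have "isim (out @ [t]) ts v" unfolding isim_def using that sm ts iout_snoc[OF sm(1), of t] by (simp add: t)
    then show ?thesis unfolding Qq_def using that(6) ts by - (rule exI[of _ "out @ [t]"], rule exI[of _ ts], simp)
   qed
   have d: "length out + length out = 2 * length out" by simp
   show ?thesis unfolding put_item_def using False lo B3 cx(19,23) by (simp add: f1 d) (rule g, simp_all add: f1)
  next
   case True
   then have vp: "valid (p, 0)" using sm(8) t by simp
   have p: "p \<in> reach G root" "p < length G" "big p" using vp valid_less[OF vp] by (auto simp: valid_def)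
   have rg: "rng p (tx D) (pp D p) (md D p) (se D p)" using D_rng[OF p(1,3)] by simp
   obtain l r where P: "G ! p = Pair l r" using big_Pair[OF p(2,3)] by auto
   note lr = children[OF p(2) P]
   have rr: "ar u 0 (p * 3 + 2) = l" "ar u 0 (p * 3 + 3) = r" using cx(1) p(2) P by (auto simp: renc_def)
   have p3: "p * 3 + 3 < sz u 0" "p * 3 + 3 < B" "p < sz u aLEN" "p < sz u aPP" "p < sz u aMD" "p < sz u aSE" "p < sz u aLL" "p < sz u aLR" "p < sz u aNX"
    "l < sz u aLEN" "r < sz u aLEN" using p(2) cx lr by auto
   have ll: "ar u aLEN l = vl l" "ar u aLEN r = vl r" "ar u aLEN p = vl p" using cx(2) lr p(2) by auto
   let ?ts = "expand p @ ts"
   have tsv: "\<forall>t\<in>set ?ts. valid t" using expand_ok(1)[OF vp] sm(9) by auto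
   have tcs: "sum_list (map tc ?ts) + 1 <= sum_list (map tc (t # ts))" using expand_ok(2)[OF vp] t True by simp
   have cc: "out @ concat (map tsem ?ts) = all_items" using sm(10) items_expand[OF p(2,3)] t True by (simp add: tsem_def)
   have lim: "length (expand p) + length ts <= 2 * length all_items" using tc_sum[OF tsv] tcs sm(11) by simp
   have g: "Qq v" if "ar v aITM = ar u aITM" "vr v vX1 = length out" "stk (ar v aISA) (map fst ?ts)" "stk (ar v aISB) (map snd ?ts)"
    "vr v vSp = length ?ts" "tm v <= tm u + 30" for v
   proof -
    have "isim out ?ts v" unfolding isim_def using that sm(1) tsv tcs cc sm(11) by simp
    then show ?thesis unfolding Qq_def using that(6) tcs by - (rule exI[of _ out], rule exI[of _ ?ts], simp)
   qed
   have hv: "h <= vl p" "vl p < B" using p(3) Hb cx(22) vl_le_N[OF p(2)] by auto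
   have lZ: "length (tx D) + 10 < B" using D_len cx(21) by simp
   from p(2,3) show ?thesis
   proof (cases rule: big_cases)
    case (two l' r')
    then have e: "l' = l" "r' = r" using P by auto
    have m: "H <= md D p" "sub (tx D) (md D p - H) (lastH (V l) @ take H (V r))" using rg two(8,9) P unfolding rng_def e by auto
    have "md D p <= length (tx D)" using m two(8,9) unfolding sub_iff e by simp
    then have mb: "h <= md D p" "md D p < B" using m(1) Hb lZ by auto
    have ex: "expand p = [(l, 0), (md D p - h, h), (r, 0)]" using two(11) e by simp
    have st: "stk ((ar u aISA)(length ts := r, Suc (length ts) := md D p - h, Suc (Suc (length ts)) := l)) (map fst ?ts)"
     "stk ((ar u aISB)(length ts := 0, Suc (length ts) := h, Suc (Suc (length ts)) := 0)) (map snd ?ts)"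
     unfolding ex using sm(3,4) by (auto intro!: stk_push)
    show ?thesis unfolding psh2_def using True two(8,9) e rr p3 ll B3 mb lim ex cx(7,17,18,23)
     by (simp add: f1) (rule g, use st in \<open>simp_all add: f1 ex\<close>)
   next
    case (none l' r')
    then have e: "l' = l" "r' = r" using P by auto
    have st: "stk ((ar u aISA)(length ts := pp D p)) (map fst ?ts)" "stk ((ar u aISB)(length ts := vl p - h)) (map snd ?ts)"
     unfolding none(5) using sm(3,4) by (auto intro!: stk_push)
    show ?thesis unfolding psh2_def using True none(2,3) e rr p3 ll B3 hv lim none(5) cx(6,17,18,23)
     by (simp add: f1) (rule g, use st in \<open>simp_all add: f1 none(5)\<close>)
   next
    case (single a b c)
    have dif: "big l ~= big r" using single(1) P by (simp add: one_def)
    have jj: "ar u aLL p = a" "ar u aLR p = b" "ar u aNX p = c" using cx(5) p(2) single(2) unfolding jarr_def by auto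
    have "a + b <= 2 * h \<or> (\<exists>l r. G ! p = Pair l r & (\<not> big l & big r & a = vl l & b = 0 \<or> big l & \<not> big r & a = 0 & b = vl r))"
     using single(3) unfolding jok_def by blast
    then consider "b <= 2 * h" | "big l" "\<not> big r" "b = vl r" using P by auto
    \<comment> \<open>The right piece starts at \<open>se D p - b - h\<close>, and
      \<open>opok\<close> admits only subtractions that do not fall below zero.\<close>
    then have sb: "b + h <= se D p"
    proof cases
     case 1
     then show ?thesis using rg Hb unfolding rng_def by linarith
    next
     case 2
     then have "H + vl r <= se D p" using rg P unfolding rng_def by auto
     then show ?thesis using 2 Hb by linarith
    qed
    have "sub (tx D) (se D p - H) (lastH (V p))" "H <= se D p" using rg unfolding rng_def by auto
    then have "se D p <= length (tx D)" using p(3) unfolding sub_iff by simp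
    then have seb: "se D p < B" "b <= se D p" "h <= se D p - b" "se D p - b < B" using lZ sb by auto
    have PS: "wp push_single Qq (s1(|tm := tm u + m|))" if m: "m <= 8" for m
    proof -
     consider "a = 0" "b = 0" | "a = 0" "b ~= 0" | "a ~= 0" "b = 0" | "a ~= 0" "b ~= 0" by blast
     then show ?thesis
     proof cases
      case 1
      then show ?thesis using single(1,3) unfolding jok_def by auto
     next
      case 2
      then have ex: "expand p = [(c, 0), (se D p - b - h, b)]" using single(4) by simp
      have st: "stk ((ar u aISA)(length ts := se D p - b - h, Suc (length ts) := c)) (map fst ?ts)"
       "stk ((ar u aISB)(length ts := b, Suc (length ts) := 0)) (map snd ?ts)"
       unfolding ex using sm(3,4) by (auto intro!: stk_push)
      show ?thesis unfolding push_single_def psh2_def using 2 p3 jj seb B3 lim ex cx(6,8,17,18,23)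
       by (simp add: f1) (rule g, use st m in \<open>simp_all add: f1 ex\<close>)
     next
      case 3
      then have ex: "expand p = [(pp D p, a), (c, 0)]" using single(4) by simp
      have st: "stk ((ar u aISA)(length ts := c, Suc (length ts) := pp D p)) (map fst ?ts)"
       "stk ((ar u aISB)(length ts := 0, Suc (length ts) := a)) (map snd ?ts)"
       unfolding ex using sm(3,4) by (auto intro!: stk_push)
      show ?thesis unfolding push_single_def psh2_def using 3 p3 jj seb B3 lim ex cx(6,8,17,18,23)
       by (simp add: f1) (rule g, use st m in \<open>simp_all add: f1 ex\<close>)
     next
      case 4
      then have ex: "expand p = [(pp D p, a), (c, 0), (se D p - b - h, b)]" using single(4) by simp
      have st: "stk ((ar u aISA)(length ts := se D p - b - h, Suc (length ts) := c, Suc (Suc (length ts)) := pp D p)) (map fst ?ts)"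
       "stk ((ar u aISB)(length ts := b, Suc (length ts) := 0, Suc (Suc (length ts)) := a)) (map snd ?ts)"
       unfolding ex using sm(3,4) by (auto intro!: stk_push)
      show ?thesis unfolding push_single_def psh2_def using 4 p3 jj seb B3 lim ex cx(6,8,17,18,23)
       by (simp add: f1) (rule g, use st m in \<open>simp_all add: f1 ex\<close>)
     qed
    qed
    have s6: "s1(|tm := Suc (Suc (Suc (tm s1)))|) = s1(|tm := tm u + 6|)" by (simp add: f1)
    show ?thesis using True dif rr p3 ll B3 PS[of 6] s6 by (cases "big r") (simp_all add: f1 add.commute[of 6])
   qed
  qed
 qed
qed

lemma wp_item_loop:
 assumes sim: "isim [] tasks0 s" and ctx: "ictx s"
 shows "wp item_loop (%v. iout all_items (ar v aITM) & vr v vX1 = length all_items & tm v <= tm s + 80 * length all_items + 1) s"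
 unfolding item_loop_def
proof (rule wp_Loop[where I = "%u. \<exists>out ts. isim out ts u & tm u + 40 * sum_list (map tc ts) <= tm s + 80 * length all_items" and T = "tm s + 80 * length all_items"], goal_cases)
 case 1
 show ?case by (rule exI[of _ "[]"], rule exI[of _ tasks0]) (use sim in \<open>auto simp: isim_def\<close>)
next
 case (2 u)
 then obtain out ts where I: "isim out ts u" "tm u + 40 * sum_list (map tc ts) <= tm s + 80 * length all_items" by blast
 have cu: "ictx u" using ctx unfolding ictx_def by (simp add: frame_simps[OF 2(2)])
 have spd: "vr u vSp = length ts" using I(1) by (simp add: isim_def)
 have B0: "0 < B" using ctx by (simp add: ictx_def)
 show ?case
 proof (cases ts)
  case Nil
  then show ?thesis using I spd B0 by (auto simp: isim_def)
 next
  case (Cons t ts')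
  have st: "isim out (t # ts') (tick u)" and ct: "ictx (tick u)" using I(1) cu Cons by (auto simp: isim_def ictx_def)
  have "wp item_body (%u. \<exists>out ts. isim out ts u & tm u + 40 * sum_list (map tc ts) <= tm s + 80 * length all_items) (tick u)"
  proof (rule wp_conseq[OF wp_item_body[OF st ct]], goal_cases)
   case (1 v)
   then obtain out' ts'' where *: "isim out' ts'' v" "tm v + 40 * sum_list (map tc ts'') + 10 <= tm (tick u) + 40 * sum_list (map tc (t # ts'))" by blast
   then have "tm v + 40 * sum_list (map tc ts'') <= tm s + 80 * length all_items" using I(2) Cons by simp
   then show ?case using *(1) by blast
  qed
  then show ?thesis using I(2) spd Cons B0 by simp
 qed
qed

lemma tasks0_ok: "\<forall>t\<in>set tasks0. valid t" "sum_list (map tc tasks0) <= 2 * length all_items"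
 using vl_pos[OF root] Hb(3) reach_self[of root G] by (auto simp: tasks0_def all_items_def valid_def tc_def tsem_def)

end

section \<open>Lengths, thresholds and memory layout\<close>

abbreviation (input) "vN1 \<equiv> 90::nat"
abbreviation (input) "vZ \<equiv> 91::nat"
abbreviation (input) "vNb \<equiv> 92::nat"

definition len_body :: com where
 "len_body = Cond (Idx 0 (Var vI1 \<otimes> Lit 3 \<oplus> Lit (Suc 0))) (Write aLEN (Var vI1) (Idx aLEN lft \<oplus> Idx aLEN rgt)) (Write aLEN (Var vI1) (Lit (Suc 0)))"

definition z_body :: com where
 "z_body = Cond (Idx 0 (Var vI1 \<otimes> Lit 3 \<oplus> Lit (Suc 0)))
   (Cond (Idx aLEN (Var vI1) \<lhd> Var vH) Skip
    (Cond (Idx aLEN lft \<lhd> Var vH)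
     (Cond (Idx aLEN rgt \<lhd> Var vH) Skip (vZ ::= Var vZ \<oplus> Idx aLEN lft))
     (Cond (Idx aLEN rgt \<lhd> Var vH) (vZ ::= Var vZ \<oplus> Idx aLEN rgt) (vZ ::= Var vZ \<oplus> Var vH \<oplus> Var vH)))) Skip"

definition len_phase :: com where
 "len_phase = (vn ::= Idx 0 (Lit 0) ;; Alloc aLEN (Var vn) ;; vI1 ::= Lit 0 ;; For vI1 vn len_body)"

text \<open>Linear search for h is affordable, since its h iterations are paid by 6 h <= Z.\<close>

definition root_loop :: com where
 "root_loop = Loop ((Var vHh \<oplus> Lit (Suc 0)) \<otimes> (Var vHh \<oplus> Lit 2) \<lhd> Var vN1 \<oplus> Var vN1 \<oplus> Lit (Suc 0)) (vHh ::= Var vHh \<oplus> Lit (Suc 0))"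

definition root_init :: com where
 "root_init = (vN1 ::= Idx aLEN (Var vn \<ominus> Lit (Suc 0)) ;; vHh ::= Lit (Suc 0))"

definition z_init :: com where
 "z_init = (vH ::= Var vHh \<otimes> Lit 3 ;; vZ ::= Var vH \<oplus> Var vH ;; vI1 ::= Lit 0)"

definition z_loop :: com where "z_loop = For vI1 vn z_body"

lemma pha_mods [simp]:
 "wv len_body = {}" "wa len_body = {aLEN}" "al len_body = {}"
 "wv z_body = {vZ}" "wa z_body = {}" "al z_body = {}"
 "wv root_loop = {vHh}" "wa root_loop = {}" "al root_loop = {}"
 "wv root_init = {vN1, vHh}" "wa root_init = {}" "al root_init = {}"
 "wv z_init = {vH, vZ, vI1}" "wa z_init = {}" "al z_init = {}"
 "wv z_loop = {vZ, vI1}" "wa z_loop = {}" "al z_loop = {}"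
 "wv len_phase = {vn, vI1}" "wa len_phase = {aLEN}" "al len_phase = {aLEN}"
 by (auto simp: len_body_def z_body_def root_loop_def root_init_def z_init_def z_loop_def len_phase_def)

fun allocl :: "(nat \<times> nat \<times> nat \<times> nat) list => com" where
 "allocl [] = Skip"
| "allocl ((a, x, c, d) # xs) = (Alloc a (Var x \<otimes> Lit c \<oplus> Lit d) ;; allocl xs)"

context machine
begin

lemma wpE: "wp c Q s ==> \<exists>u. bs c s u & frame c s u & Q u"
 unfolding wp_def using bs_frame by blast

lemma wp_allocl:
 "distinct (map fst xs) ==> (\<forall>(a, x, c, d)\<in>set xs. c < B & d < B & vr s x * c + d < B) ==>
  brk s + (\<Sum>(a, x, c, d)\<leftarrow>xs. vr s x * c + d) < A ==>
  wp (allocl xs) (%u. vr u = vr s & (\<forall>(a, x, c, d)\<in>set xs. ar u a = (%_. 0) & sz u a = vr s x * c + d) &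
   (\<forall>a. a \<notin> fst ` set xs --> ar u a = ar s a & sz u a = sz s a) &
   brk u = brk s + (\<Sum>(a, x, c, d)\<leftarrow>xs. vr s x * c + d) & tm u = tm s + length xs) s"
proof (induction xs arbitrary: s)
 case (Cons y xs)
 obtain a x c d where y: "y = (a, x, c, d)" by (cases y)
 define s1 where "s1 = s(|tm := Suc (tm s), ar := (ar s)(a := (%_. 0)), sz := (sz s)(a := vr s x * c + d), brk := brk s + (vr s x * c + d)|)"
 have d1: "distinct (map fst xs)" "a \<notin> fst ` set xs" using Cons.prems(1) by (auto simp: y)
 have ok: "c < B" "d < B" "vr s x * c + d < B" "vr s x * c < B" using Cons.prems(2) by (auto simp: y)
 have W: "wp (allocl xs) (%u. vr u = vr s1 & (\<forall>(a, x, c, d)\<in>set xs. ar u a = (%_. 0) & sz u a = vr s1 x * c + d) &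
   (\<forall>a. a \<notin> fst ` set xs --> ar u a = ar s1 a & sz u a = sz s1 a) &
   brk u = brk s1 + (\<Sum>(a, x, c, d)\<leftarrow>xs. vr s1 x * c + d) & tm u = tm s1 + length xs) s1"
  by (rule Cons.IH) (use Cons.prems d1 in \<open>auto simp: y s1_def\<close>)
 have "wp (allocl xs) (%u. vr u = vr s & (\<forall>(a, x, c, d)\<in>set (y # xs). ar u a = (%_. 0) & sz u a = vr s x * c + d) &
   (\<forall>a. a \<notin> fst ` set (y # xs) --> ar u a = ar s a & sz u a = sz s a) &
   brk u = brk s + (\<Sum>(a, x, c, d)\<leftarrow>y # xs. vr s x * c + d) & tm u = tm s + length (y # xs)) s1"
  by (rule wp_conseq[OF W]) (use d1(2) in \<open>auto simp: y s1_def\<close>)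
 then show ?case unfolding y allocl.simps wp_Seq using ok Cons.prems(3) by (simp add: y s1_def)
qed simp

end

context lz_machine
begin

lemma hN: "h <= N"
proof -
 have "h * (h + 1) <= 2 * N" using hh(1) by (simp add: N_def)
 moreover have "h * 2 <= h * (h + 1)" using Hb(4) by simp
 ultimately show ?thesis by linarith
qed

lemma wp_len_phase:
 assumes rn: "renc (ar s 0)" "ar s 0 0 = length G" "3 * length G + 1 <= sz s 0" and B: "3 * length G + 10 < B" "N + 10 < B" and A: "brk s + length G < A"
 shows "wp len_phase (%u. vr u vn = length G & (\<forall>j<length G. ar u aLEN j = vl j) & sz u = (sz s)(aLEN := length G) &
   brk u = brk s + length G & tm u <= tm s + 10 * length G + 4) s"
proof -
 define s1 where "s1 = s(|ar := (ar s)(aLEN := (%_. 0)), sz := (sz s)(aLEN := length G), brk := brk s + length G, tm := Suc (Suc (Suc (tm s))), vr := (vr s)(vn := length G, vI1 := 0)|)"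
 have W: "wp (For vI1 vn len_body) (%u. vr u vn = length G & (\<forall>j<length G. ar u aLEN j = vl j) & sz u = (sz s)(aLEN := length G) &
   brk u = brk s + length G & tm u <= tm s + 10 * length G + 4) s1"
 proof (rule wp_For[where I = "%k u. \<forall>j<k. ar u aLEN j = vl j" and D = 3], goal_cases)
  case (8 k u)
  have k: "k < length G" using 8 by (simp add: s1_def)
  have f: "ar u 0 = ar s 0" "sz u = (sz s)(aLEN := length G)" by (simp_all add: frame_simps[OF 8(4)] s1_def)
  have k3: "k * 3 + 3 < sz s 0" "k * 3 + 3 < B" using k rn B by auto
  show ?case
  proof (cases "G ! k")
   case (Terminal a)
   have r: "ar s 0 (k * 3 + 1) = 0" using rn k Terminal by (auto simp: renc_def)
   show ?thesis unfolding len_body_def using 8(3,5) r k k3 Terminal by (simp add: f less_Suc_eq val_Terminal)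
  next
   case (Pair l r)
   note lr = children[OF k Pair]
   have rr: "ar s 0 (k * 3 + 1) = 1" "ar s 0 (k * 3 + 2) = l" "ar s 0 (k * 3 + 3) = r" using rn k Pair by (auto simp: renc_def)
   have ll: "ar u aLEN l = vl l" "ar u aLEN r = vl r" using 8(5) lr by auto
   have vk: "vl k = vl l + vl r" "vl k < B" using vl_le_N[OF k] vl_Pair[OF k Pair] B by auto
   show ?thesis unfolding len_body_def using 8(3,5) rr k k3 ll lr vk by (simp add: f less_Suc_eq)
  qed
 next
  case (9 u)
  then show ?case by (simp add: frame_simps[OF 9(3)] s1_def)
 qed (use B in \<open>auto simp: s1_def\<close>)
 show ?thesis unfolding len_phase_def using W rn A B by (simp add: s1_def)
qed

lemma wp_root_loop:
 assumes "vr s vN1 = N" "vr s vHh = 1" "4 * N + 20 < B"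
 shows "wp root_loop (%u. vr u vHh = h & tm u <= tm s + 2 * h + 1) s"
 unfolding root_loop_def
proof (rule wp_Loop[where I = "%u. vr u vHh <= h & tm u + 2 <= tm s + 2 * vr u vHh" and T = "tm s + 2 * h"], goal_cases)
 case 1
 then show ?case using assms Hb(4) by simp
next
 case (2 u)
 have n: "vr u vN1 = N" using assms by (simp add: frame_simps[OF 2(2)])
 let ?v = "vr u vHh"
 have v: "?v <= h" "tm u + 2 <= tm s + 2 * ?v" using 2 by auto
 have "(?v + 1) * (?v + 2) <= (h + 1) * (h + 2)" by (intro mult_le_mono) (use v in auto)
 also have "\<dots> = h * (h + 1) + 2 * h + 2" by simp
 also have "\<dots> <= 4 * N + 2" using hh(1) hN by (simp add: N_def)
 finally have bb: "(?v + 1) * (?v + 2) < B" using assms(3) by simp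
 have ex: "?v = h" if "\<not> (?v + 1) * (?v + 2) < N + N + 1"
 proof (rule ccontr)
  assume "?v ~= h"
  then have "?v + 1 <= h" using v by simp
  then have "(?v + 1) * (?v + 2) <= h * (h + 1)" by (intro mult_le_mono) auto
  then show False using that hh(1) by (simp add: N_def)
 qed
 have st: "?v + 1 <= h" if "(?v + 1) * (?v + 2) < N + N + 1"
 proof (rule ccontr)
  assume "\<not> ?v + 1 <= h"
  then have "?v = h" using v by simp
  then show False using that hh(2) by (simp add: N_def)
 qed
 have vB: "?v + 2 < B" using v hN assms(3) by simp
 show ?case
 proof (cases "(?v + 1) * (?v + 2) < N + N + 1")
  case True
  then show ?thesis using bb st vB v assms(3) n by (simp del: mult_Suc mult_Suc_right) simp
 next
  case False
  then show ?thesis using bb ex vB v assms(3) n by (simp del: mult_Suc mult_Suc_right)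
 qed
qed

lemma wp_z_loop:
 assumes rn: "renc (ar s 0)" "3 * length G + 1 <= sz s 0" "length G <= sz s aLEN" and ln: "\<And>j. j < length G ==> ar s aLEN j = vl j"
  and v: "vr s vH = H" "vr s vZ = 2 * H" "vr s vI1 = 0" "vr s vn = length G" and B: "3 * length G + 10 < B" "Z < B"
 shows "wp z_loop (%u. vr u vZ = Z & tm u <= tm s + 9 * length G + 1) s"
 unfolding z_loop_def
proof (rule wp_For[where I = "%k u. vr u vZ = 2 * H + (\<Sum>j<k. wt j)" and D = 7], goal_cases)
 case (8 k u)
 have k: "k < length G" using 8 v by simp
 have f: "ar u = ar s" "sz u = sz s" "vr u vH = H" using v by (auto simp: frame_simps[OF 8(4)] fun_eq_iff)
 have k3: "k * 3 + 3 < sz s 0" "k * 3 + 3 < B" "k < sz s aLEN" using k rn B by auto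
 have "(\<Sum>j<Suc k. wt j) <= (\<Sum>j<length G. wt j)" by (rule sum_mono2) (use k in auto)
 then have zB: "2 * H + (\<Sum>j<k. wt j) + wt k < B" using B(2) unfolding Z_def by simp
 show ?case
 proof (cases "G ! k")
  case (Terminal a)
  have r: "ar s 0 (k * 3 + 1) = 0" "wt k = 0" using rn k Terminal by (auto simp: renc_def wt_def)
  show ?thesis unfolding z_body_def using 8(3,5) r k3 by (simp add: f)
 next
  case (Pair l r)
  note lr = children[OF k Pair]
  have rr: "ar s 0 (k * 3 + 1) = 1" "ar s 0 (k * 3 + 2) = l" "ar s 0 (k * 3 + 3) = r" using rn k Pair by (auto simp: renc_def)
  have ll: "ar s aLEN l = vl l" "ar s aLEN r = vl r" "ar s aLEN k = vl k" using ln lr k by auto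
  have szl: "l < sz s aLEN" "r < sz s aLEN" using lr rn by auto
  show ?thesis unfolding z_body_def using 8(3,5) rr k3 ll szl zB Pair
   by (cases "big k"; cases "big l"; cases "big r") (simp_all add: f wt_def)
 qed
qed (use v B in \<open>auto simp: Z_def\<close>)

end

section \<open>The whole program\<close>

text \<open>All sizes are linear in \<open>vZ\<close>, \<open>vn\<close> and \<open>vNb\<close>,
  which are known before the text is written: 36 Z cells hold all levels of suffix sorting, 4 Z the
  traversal stack, 2 Z the segment tree. The array of nodes is missing because its size depends on
  m; it is allocated last, with all remaining memory.\<close>

definition layout :: "nat => (nat \<times> nat \<times> nat \<times> nat) list" where
 "layout M = [(aTX, vZ, 36, 50), (aPP, vn, 1, 0), (aMD, vn, 1, 0), (aSE, vn, 1, 0), (aDS, vZ, 4, 0),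
   (aLL, vn, 1, 0), (aLR, vn, 1, 0), (aNX, vn, 1, 0), (aISA, vNb, 2, 0), (aISB, vNb, 2, 0), (aITM, vNb, 2, 0),
   (aA1, vZ, 1, 3), (aA2, vZ, 1, 3), (aA3, vZ, 1, 3), (aA4, vZ, 1, 3), (aRK, vZ, 1, 3), (aCNT, vZ, 1, M + 1),
   (aLO, vZ, 1, 1), (aLN, vZ, 1, 1), (aSEG, vZ, 2, 0)]"

definition dfs_init :: com where
 "dfs_init = (Write aDS (Lit 0) ((Var vn \<ominus> Lit (Suc 0)) \<otimes> Lit 3) ;; vSp ::= Lit (Suc 0) ;; vLen ::= Lit 0)"

definition item_init :: com where
 "item_init = (Cond (Var vN1 \<lhd> Var vH)
   (Write aISA (Lit 0) (Lit 0) ;; Write aISB (Lit 0) (Var vN1) ;; vSp ::= Lit (Suc 0))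
   (Write aISA (Lit 0) (Idx aSE (Var vn \<ominus> Lit (Suc 0)) \<ominus> Var vHh) ;; Write aISB (Lit 0) (Var vHh) ;;
   Write aISA (Lit (Suc 0)) (Var vn \<ominus> Lit (Suc 0)) ;; Write aISB (Lit (Suc 0)) (Lit 0) ;; vSp ::= Lit 2) ;; vX1 ::= Lit 0)"

definition dc_init :: "nat => com" where
 "dc_init M = (vTl ::= Var vLen ;; vNI ::= Var vX1 ;; vM ::= Lit M)"

definition nb_com :: com where
 "nb_com = (vNb ::= (Var vN1 \<oplus> Var vN1) \<oslash> Var vHh \<oplus> Lit (Suc 0))"

definition prog :: "nat => com" where
 "prog M = (len_phase ;; root_init ;; root_loop ;; z_init ;; z_loop ;; nb_com ;; allocl (layout M) ;; dfs_init ;; dfs_loop ;; jump_loop ;;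
   item_init ;; item_loop ;; dc_init M ;; dc3 ;; AllocRest aREC ;; lz_phase)"

lemma prog_mods [simp]:
 "wv dfs_init = {vSp, vLen}" "wa dfs_init = {aDS}" "al dfs_init = {}"
 "wv item_init = {vSp, vX1}" "wa item_init = {aISA, aISB}" "al item_init = {}"
 "wv (dc_init M) = {vTl, vNI, vM}" "wa (dc_init M) = {}" "al (dc_init M) = {}"
 "wv nb_com = {vNb}" "wa nb_com = {}" "al nb_com = {}"
 by (auto simp: dfs_init_def item_init_def dc_init_def nb_com_def)

context lz_machine
begin

lemma vis_chars: "set (tx d) \<subseteq> range cf ==> i < length G ==> set (tx (vis G cf H i d)) \<subseteq> range cf"
proof (induction i arbitrary: d rule: less_induct)
 case (less i)
 show ?case
 proof (cases "G ! i")
  case (Terminal a)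
  then show ?thesis using less.prems by (simp add: vis.simps)
 next
  case (Pair l r)
  note lr = children[OF less.prems(2) Pair]
  have L: "set (tx d) \<subseteq> range cf ==> set (tx (vis G cf H l d)) \<subseteq> range cf"
   and R: "set (tx d) \<subseteq> range cf ==> set (tx (vis G cf H r d)) \<subseteq> range cf" for d
   using less.IH lr by auto
  show ?thesis
  proof (cases "big i & se d i ~= 0")
   case True
   have "set (take H (drop x (tx d))) \<subseteq> range cf" for x
    using less.prems(1) by (meson order_trans set_drop_subset set_take_subset)
   then show ?thesis using Pair lr True less.prems(1) by (subst vis.simps) simp
  next
   case nv: False
   show ?thesis
   proof (cases "big i")
    case False
    let ?d = "d(|stp := Suc (stp d), tch := insert i (tch d)|)"
    have "vis G cf H i d = vis G cf H r (vis G cf H l ?d)" using Pair lr False by (subst vis.simps) simp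
    then show ?thesis using L[of ?d] R[of "vis G cf H l ?d"] less.prems(1) by simp
   next
    case True
    let ?d = "d(|pp := (pp d)(i := length (tx d)), stp := Suc (stp d), tch := insert i (tch d)|)"
    let ?e = "vis G cf H l ?d"
    let ?e' = "?e(|md := (md ?e)(i := length (tx ?e)), stp := Suc (stp ?e)|)"
    let ?f = "vis G cf H r ?e'"
    have "vis G cf H i d = ?f(|se := (se ?f)(i := length (tx ?f)), stp := Suc (stp ?f)|)"
     using Pair lr True nv by (subst vis.simps) (simp add: Let_def)
    then show ?thesis using L[of ?d] R[of ?e'] less.prems(1) by simp
   qed
  qed
 qed
qed

definition nb :: nat where "nb = 2 * N div h + 1"

lemma nb_items: "length all_items <= nb"
proof -
 have "h * length all_items <= 2 * N + h" using all_items_count N_vl by simp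
 then have "h * length all_items div h <= (2 * N + h) div h" by (rule div_le_mono)
 then show ?thesis using Hb(4) by (simp add: nb_def)
qed

text \<open>The choice of h gives 2 N < (h + 1) (h + 2) <= h (h + 6). With h <= m this makes the
  number of pieces O(m).\<close>

lemma nb_h: "nb <= h + 6"
proof -
 have "(h + 1) * (h + 2) <= h * (h + 6)" using Hb(4) by (simp add: algebra_simps)
 then have "2 * N < h * (h + 6)" using hh(2) by (simp add: N_def)
 then have "2 * N div h < h + 6" using Hb(4) by (simp add: less_mult_imp_div_less mult.commute)
 then show ?thesis by (simp add: nb_def)
qed

lemma prog_run:
 fixes M lg :: nat and FS :: "nat list list"
 defines "m \<equiv> length FS"
 assumes cfM: "\<And>a. 0 < cf a & cf a <= M" and sen: "sentinel_terminated d (V root)" and FS: "lz78_factorization (V root) FS"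
  and s: "renc (ar s 0)" "ar s 0 0 = length G" "sz s 0 = 3 * length G + 1" "brk s = 3 * length G + 1"
  and A: "70 * Z + 6 * nb + M + 200 + 7 * m <= A" and B: "100 * Z + 100 * N + 10 * M + 10 * nb + 10 * m + 1000 < B"
  and lg: "2 * Z < 2 ^ lg"
 shows "\<exists>u. bs (prog M) s u & vr u vXq = 5 * m + 5 & 7 * m + 10 <= sz u aREC & ar u aREC (5 * m + 5) = m &
   (\<forall>k<m. ar u aREC (5 * m + 5 + (2 * k + 1)) <= k &
    ([] # FS) ! Suc k = ([] # FS) ! (ar u aREC (5 * m + 5 + (2 * k + 1))) @ [Suc (ar u aREC (5 * m + 5 + (2 * k + 2)))]) &
   tm u <= tm s + 6000 * (M + 2) * Z + (21 * lg + 200) * (m + nb)"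
proof -
 let ?n = "length G" and ?T = "tx D"
 have nZ: "?n <= 2 * Z" using n_text D_len by linarith
 have hZ: "6 * h <= Z" "6 <= Z" using Hb unfolding Z_def by linarith+
 have n1: "1 <= ?n" using root by linarith
 have tZ: "length ?T <= Z" "0 < length ?T" using D_len D_pos by auto
 have rn: "?n - Suc 0 = root" by (simp add: root_def)
 obtain u1 where b1: "bs len_phase s u1" and f1: "frame len_phase s u1" and r1: "vr u1 vn = ?n" "\<And>j. j < ?n ==> ar u1 aLEN j = vl j" "sz u1 = (sz s)(aLEN := ?n)"
  "brk u1 = brk s + ?n" "tm u1 <= tm s + 10 * ?n + 4"
  using wpE[OF wp_len_phase[OF s(1,2)]] s B A nZ by auto
 have g1: "ar u1 0 = ar s 0" by (simp add: frame_simps[OF f1])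
 have "wp root_init (%u. vr u vN1 = N & vr u vHh = 1 & tm u = tm u1 + 2) u1"
  unfolding root_init_def using r1 B n1 nZ root by (simp add: rn N_vl)
 from wpE[OF this] obtain u2 where b2: "bs root_init u1 u2" and f2: "frame root_init u1 u2" and r2: "vr u2 vN1 = N" "vr u2 vHh = 1" "tm u2 = tm u1 + 2" by auto
 have "wp root_loop (%u. vr u vHh = h & tm u <= tm u2 + 2 * h + 1) u2" by (rule wp_root_loop) (use r2 B in auto)
 from wpE[OF this] obtain u3 where b3: "bs root_loop u2 u3" and f3: "frame root_loop u2 u3" and r3: "vr u3 vHh = h" "tm u3 <= tm u2 + 2 * h + 1" by auto
 have "wp z_init (%u. vr u vH = H & vr u vZ = 2 * H & vr u vI1 = 0 & tm u = tm u3 + 3) u3"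
 proof -
  have e: "h * 3 = H" "H + H < B" "3 < B" using H(1) hN B by linarith+
  show ?thesis unfolding z_init_def using r3 e by simp
 qed
 from wpE[OF this] obtain u4 where b4: "bs z_init u3 u4" and f4: "frame z_init u3 u4" and r4: "vr u4 vH = H" "vr u4 vZ = 2 * H" "vr u4 vI1 = 0" "tm u4 = tm u3 + 3" by auto
 have g4: "ar u4 0 = ar s 0" "ar u4 aLEN = ar u1 aLEN" "vr u4 vn = ?n" "vr u4 vN1 = N" "vr u4 vHh = h" "sz u4 = (sz s)(aLEN := ?n)" "brk u4 = brk s + ?n"
  using r1 r2 r3 by (simp_all add: frame_simps[OF f1] frame_simps[OF f2] frame_simps[OF f3] frame_simps[OF f4])
 have "wp z_loop (%u. vr u vZ = Z & tm u <= tm u4 + 9 * ?n + 1) u4"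
  by (rule wp_z_loop) (use g4 r4 r1 s B nZ in auto)
 from wpE[OF this] obtain u5 where b5: "bs z_loop u4 u5" and f5: "frame z_loop u4 u5" and r5: "vr u5 vZ = Z" "tm u5 <= tm u4 + 9 * ?n + 1" by auto
 have g5: "ar u5 0 = ar s 0" "ar u5 aLEN = ar u1 aLEN" "vr u5 vn = ?n" "vr u5 vN1 = N" "vr u5 vHh = h" "vr u5 vH = H" "sz u5 = (sz s)(aLEN := ?n)" "brk u5 = brk s + ?n"
  using g4 r4 by (simp_all add: frame_simps[OF f5])
 have "wp nb_com (%u. vr u vNb = nb & tm u = tm u5 + 1) u5"
 proof -
  have e: "N + N < B" "Suc ((N + N) div h) < B" "(N + N) div h + 1 = nb" using B by (auto simp: nb_def mult_2)
  show ?thesis unfolding nb_com_def using g5 e B by simp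
 qed
 from wpE[OF this] obtain u6 where b6: "bs nb_com u5 u6" and f6: "frame nb_com u5 u6" and r6: "vr u6 vNb = nb" "tm u6 = tm u5 + 1" by auto
 have g6: "ar u6 0 = ar s 0" "ar u6 aLEN = ar u1 aLEN" "vr u6 vn = ?n" "vr u6 vN1 = N" "vr u6 vHh = h" "vr u6 vH = H" "vr u6 vZ = Z"
  "sz u6 = (sz s)(aLEN := ?n)" "brk u6 = brk s + ?n"
  using g5 r5 by (simp_all add: frame_simps[OF f6])
 have al_sum: "(\<Sum>(a, x, c, d)\<leftarrow>layout M. vr u6 x * c + d) = 50 * Z + 6 * ?n + 6 * nb + M + 68"
  by (simp add: layout_def g6 r6)
 have ly: "length (layout M) = 20" by (simp add: layout_def)
 have W7: "wp (allocl (layout M)) (%u. vr u = vr u6 & (\<forall>(a, x, c, d)\<in>set (layout M). ar u a = (%_. 0) & sz u a = vr u6 x * c + d) &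
   (\<forall>a. a \<notin> fst ` set (layout M) --> ar u a = ar u6 a & sz u a = sz u6 a) &
   brk u = brk u6 + (\<Sum>(a, x, c, d)\<leftarrow>layout M. vr u6 x * c + d) & tm u = tm u6 + length (layout M)) u6"
 proof (rule wp_allocl)
  show "distinct (map fst (layout M))" by (simp add: layout_def)
  show "\<forall>(a, x, c, d)\<in>set (layout M). c < B & d < B & vr u6 x * c + d < B"
   using B nZ by (simp add: layout_def g6 r6)
  show "brk u6 + (\<Sum>(a, x, c, d)\<leftarrow>layout M. vr u6 x * c + d) < A"
   unfolding al_sum using A nZ g6 s by simp
 qed
 from wpE[OF this] obtain u7 where b7: "bs (allocl (layout M)) u6 u7" and r7: "vr u7 = vr u6"
  "\<forall>(a, x, c, d)\<in>set (layout M). ar u7 a = (%_. 0) & sz u7 a = vr u6 x * c + d"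
  "\<forall>a. a \<notin> fst ` set (layout M) --> ar u7 a = ar u6 a & sz u7 a = sz u6 a"
  "brk u7 = brk u6 + (50 * Z + 6 * ?n + 6 * nb + M + 68)" "tm u7 = tm u6 + 20"
  unfolding al_sum ly by blast
 have z7: "ar u7 aTX = (%_. 0)" "ar u7 aPP = (%_. 0)" "ar u7 aMD = (%_. 0)" "ar u7 aSE = (%_. 0)" "ar u7 aSEG = (%_. 0)"
  "sz u7 aTX = 36 * Z + 50" "sz u7 aPP = ?n" "sz u7 aMD = ?n" "sz u7 aSE = ?n" "sz u7 aDS = 4 * Z" "sz u7 aLL = ?n" "sz u7 aLR = ?n" "sz u7 aNX = ?n"
  "sz u7 aISA = 2 * nb" "sz u7 aISB = 2 * nb" "sz u7 aITM = 2 * nb" "sz u7 aA1 = Z + 3" "sz u7 aA2 = Z + 3" "sz u7 aA3 = Z + 3" "sz u7 aA4 = Z + 3" "sz u7 aRK = Z + 3"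
  "sz u7 aCNT = Z + M + 1" "sz u7 aLO = Z + 1" "sz u7 aLN = Z + 1" "sz u7 aSEG = 2 * Z"
  using r7(2) by (simp_all add: layout_def g6 r6)
 have "ar u7 0 = ar u6 0 & sz u7 0 = sz u6 0" "ar u7 aLEN = ar u6 aLEN & sz u7 aLEN = sz u6 aLEN"
  by (rule r7(3)[rule_format], simp add: layout_def)+
 then have g7: "ar u7 0 = ar s 0" "ar u7 aLEN = ar u1 aLEN" "sz u7 0 = 3 * ?n + 1" "sz u7 aLEN = ?n" "vr u7 vn = ?n" "vr u7 vN1 = N" "vr u7 vHh = h" "vr u7 vH = H"
  using g6 s by (simp_all add: r7(1))
 have "wp dfs_init (%u. ar u aDS 0 = root * 3 & vr u vSp = 1 & vr u vLen = 0 & tm u = tm u7 + 3) u7"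
  unfolding dfs_init_def using g7 z7 B nZ n1 hZ by (simp add: rn) (simp add: root_def)
 from wpE[OF this] obtain u8 where b8: "bs dfs_init u7 u8" and f8: "frame dfs_init u7 u8" and r8: "ar u8 aDS 0 = root * 3" "vr u8 vSp = 1" "vr u8 vLen = 0" "tm u8 = tm u7 + 3" by auto
 have s8: "sz u8 = sz u7" by (simp add: frame_simps[OF f8])
 have g8: "ar u8 0 = ar s 0" "ar u8 aLEN = ar u1 aLEN" "vr u8 vH = H" using g7 by (simp_all add: frame_simps[OF f8])
 have z8: "ar u8 aTX = (%_. 0)" "ar u8 aPP = (%_. 0)" "ar u8 aMD = (%_. 0)" "ar u8 aSE = (%_. 0)" using z7 by (simp_all add: frame_simps[OF f8])
 have "zc [] = (%_. 0)" by (rule ext) (simp add: zc_def)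
 then have sim8: "dsim d0 [root * 3] u8" using z8 r8 by (simp add: dsim_def d0_def stk_def)
 have "dctx u8" unfolding dctx_def s8 using g8 r1(2) s(1) g7(3,4) z7 B nZ by simp
 from wpE[OF wp_dfs_loop[OF sim8 this]] obtain u9 where b9: "bs dfs_loop u8 u9" and f9: "frame dfs_loop u8 u9" and
  r9: "ar u9 aTX = zc ?T" "vr u9 vLen = length ?T" "ar u9 aPP = pp D" "ar u9 aMD = md D" "ar u9 aSE = se D" "tm u9 <= tm u8 + 200 * Z" by blast
 have g9: "ar u9 0 = ar s 0" "ar u9 aLEN = ar u1 aLEN" "vr u9 vH = H" "vr u9 vHh = h" "vr u9 vn = ?n" "vr u9 vN1 = N" "ar u9 aSEG = (%_. 0)" "sz u9 = sz u7" "brk u9 = brk u7"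
  using g8 g7 s8 z7 by (simp_all add: frame_simps[OF f9] frame_simps[OF f8])
 have "wp jump_loop (%v. jarr ?n (ar v aLL) (ar v aLR) (ar v aNX) & tm v <= tm u9 + 22 * ?n + 2) u9"
  by (rule wp_jump_loop) (use g9 r1(2) s(1) g7(3,4) z7 B nZ hN in auto)
 from wpE[OF this] obtain u10 where b10: "bs jump_loop u9 u10" and f10: "frame jump_loop u9 u10" and
  r10: "jarr ?n (ar u10 aLL) (ar u10 aLR) (ar u10 aNX)" "tm u10 <= tm u9 + 22 * ?n + 2" by blast
 have g10: "ar u10 0 = ar s 0" "ar u10 aLEN = ar u1 aLEN" "vr u10 vH = H" "vr u10 vHh = h" "vr u10 vn = ?n" "vr u10 vN1 = N" "ar u10 aSEG = (%_. 0)"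
  "sz u10 = sz u7" "brk u10 = brk u7" "ar u10 aTX = zc ?T" "vr u10 vLen = length ?T" "ar u10 aPP = pp D" "ar u10 aMD = md D" "ar u10 aSE = se D"
  using g9 r9 by (simp_all add: frame_simps[OF f10])
 have nb1: "1 <= nb" by (simp add: nb_def)
 have "wp item_init (%u. stk (ar u aISA) (map fst tasks0) & stk (ar u aISB) (map snd tasks0) & vr u vSp = length tasks0 & vr u vX1 = 0 & tm u <= tm u10 + 8) u10"
 proof (cases "big root")
  case True
  have rg: "rng root ?T (pp D root) (md D root) (se D root)" using D_rng[OF reach_self True] by simp
  have "sub ?T (se D root - H) (lastH (V root))" "H <= se D root" using rg unfolding rng_def by auto
  then have "se D root <= length ?T" using True unfolding sub_iff by simp
  then have se: "h <= se D root" "se D root < B" using \<open>H <= se D root\<close> Hb tZ B by auto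
  have ts: "tasks0 = [(root, 0), (se D root - h, h)]" using True by (simp add: tasks0_def)
  have st: "stk (f(0 := x, Suc 0 := y)) [y, x]" for f :: "nat => nat" and x y by (auto simp: stk_def less_Suc_eq)
  have rb: "root < sz u7 aSE" "?n < B" "3 < B" "Suc 0 <= ?n" "Suc 0 < sz u7 aISA" "Suc 0 < sz u7 aISB" using root z7 B nZ nb1 n1 by auto
  show ?thesis unfolding item_init_def ts using True se rb by (simp add: g10 rn N_vl[symmetric] st)
 next
  case False
  have ts: "tasks0 = [(0, N)]" using False by (simp add: tasks0_def N_vl)
  have st: "stk (f(0 := x)) [x]" for f :: "nat => nat" and x by (auto simp: stk_def)
  have rb: "3 < B" "0 < sz u7 aISA" "0 < sz u7 aISB" using z7 B nb1 by auto
  show ?thesis unfolding item_init_def ts using False[unfolded N_vl] rb by (simp add: g10 st)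
 qed
 from wpE[OF this] obtain u11 where b11: "bs item_init u10 u11" and f11: "frame item_init u10 u11" and
  r11: "stk (ar u11 aISA) (map fst tasks0)" "stk (ar u11 aISB) (map snd tasks0)" "vr u11 vSp = length tasks0" "vr u11 vX1 = 0" "tm u11 <= tm u10 + 8" by blast
 have g11: "ar u11 0 = ar s 0" "ar u11 aLEN = ar u1 aLEN" "vr u11 vH = H" "vr u11 vHh = h" "ar u11 aSEG = (%_. 0)"
  "sz u11 = sz u7" "brk u11 = brk u7" "ar u11 aTX = zc ?T" "vr u11 vLen = length ?T" "ar u11 aPP = pp D" "ar u11 aMD = md D" "ar u11 aSE = se D"
  "ar u11 aLL = ar u10 aLL" "ar u11 aLR = ar u10 aLR" "ar u11 aNX = ar u10 aNX"
  using g10 by (simp_all add: frame_simps[OF f11])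
 have sim11: "isim [] tasks0 u11" unfolding isim_def using r11 tasks0_ok by (simp add: iout_def all_items_def)
 have "ictx u11" unfolding ictx_def g11 using r10(1) r1(2) s(1) g7(3,4) z7 B nZ nb_items by simp
 from wpE[OF wp_item_loop[OF sim11 this]] obtain u12 where b12: "bs item_loop u11 u12" and f12: "frame item_loop u11 u12" and
  r12: "iout all_items (ar u12 aITM)" "vr u12 vX1 = length all_items" "tm u12 <= tm u11 + 80 * length all_items + 1" by blast
 have g12: "ar u12 aSEG = (%_. 0)" "sz u12 = sz u7" "brk u12 = brk u7" "ar u12 aTX = zc ?T" "vr u12 vLen = length ?T"
  using g11 by (simp_all add: frame_simps[OF f12])
 have "wp (dc_init M) (%u. vr u vTl = length ?T & vr u vNI = length all_items & vr u vM = M & tm u = tm u12 + 3) u12"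
  unfolding dc_init_def using g12 r12 B by simp
 from wpE[OF this] obtain u13 where b13: "bs (dc_init M) u12 u13" and f13: "frame (dc_init M) u12 u13" and
  r13: "vr u13 vTl = length ?T" "vr u13 vNI = length all_items" "vr u13 vM = M" "tm u13 = tm u12 + 3" by auto
 have g13: "ar u13 aSEG = (%_. 0)" "sz u13 = sz u7" "brk u13 = brk u7" "ar u13 aTX = zc ?T" "vr u13 vLen = length ?T" "ar u13 aITM = ar u12 aITM"
  using g12 by (simp_all add: frame_simps[OF f13])
 have sT: "set ?T \<subseteq> range cf" unfolding D_def by (rule vis_chars[OF _ root]) (simp add: d0_def)
 have chT: "0 < ?T ! x & ?T ! x <= M" if "x < length ?T" for x
 proof -
  have "?T ! x \<in> range cf" using sT nth_mem[OF that] by (rule subsetD)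
  then obtain a where "?T ! x = cf a" by (rule rangeE)
  then show ?thesis using cfM[of a] by simp
 qed
 have pT: "posl ?T" using chT by (simp add: posl_def)
 have h13: "holds u13 0 ?T" using g13 by (simp add: holds_def)
 have "wp dc3 (%u. isSA ?T (ar u aA3) & holds u 0 ?T & tm u <= tm u13 + 5000 * (vr u13 vM + 2) * length ?T) u13"
 proof (rule wp_dc3[OF h13 pT tZ(2) g13(5)])
  show "\<And>x. x < length ?T ==> ?T ! x <= vr u13 vM + length ?T" using chT r13 by (simp add: le_SucI trans_le_add1)
  show "\<And>x. length ?T + 3 <= x ==> ar u13 aTX x = 0" using g13 by (simp add: zc_def)
  show "dc_sizes (length ?T) (vr u13 vM) u13" unfolding dc_sizes_def g13(2) using z7 r13 tZ B by simp
 qed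
 from wpE[OF this] obtain u14 where b14: "bs dc3 u13 u14" and f14: "frame dc3 u13 u14" and
  r14: "isSA ?T (ar u14 aA3)" "holds u14 0 ?T" "tm u14 <= tm u13 + 5000 * (vr u13 vM + 2) * length ?T" by blast
 have g14: "ar u14 aSEG = (%_. 0)" "sz u14 = sz u7" "brk u14 = brk u7" "ar u14 aITM = ar u12 aITM" "vr u14 vTl = length ?T" "vr u14 vNI = length all_items"
  using g13 r13 by (simp_all add: frame_simps[OF f14])
 have bk: "brk u7 + 7 * m + 10 < A" using r7(4) g6 s A nZ by simp
 have "wp (AllocRest aREC) (%u. u = tick u14(|ar := (ar u14)(aREC := (%_. 0)), sz := (sz u14)(aREC := A - brk u14), brk := A|)) u14"
  using g14 bk by simp
 from wpE[OF this] obtain u15 where b15: "bs (AllocRest aREC) u14 u15" and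
  u15: "u15 = tick u14(|ar := (ar u14)(aREC := (%_. 0)), sz := (sz u14)(aREC := A - brk u14), brk := A|)" by blast
 have g15: "ar u15 aREC = (%_. 0)" "ar u15 aSEG = (%_. 0)" "ar u15 aA3 = ar u14 aA3" "ar u15 aITM = ar u12 aITM" "ar u15 aTX = ar u14 aTX"
  "vr u15 vTl = length ?T" "vr u15 vNI = length all_items" "sz u15 aREC = A - brk u7" "tm u15 = Suc (tm u14)"
  "sz u15 aA3 = Z + 3" "sz u15 aRK = Z + 3" "sz u15 aTX = 36 * Z + 50" "sz u15 aSEG = 2 * Z" "sz u15 aITM = 2 * nb"
  using g14 z7 by (simp_all add: u15)
 have h15: "holds u15 0 ?T" using r14(2) by (simp add: holds_def g15(5))
 have zcM: "zc ?T x <= M" for x using chT by (simp add: zc_def)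
 have chS: "0 < x & x <= M" if "x \<in> set (V root)" for x using that cfM by auto
 have pS: "posl (V root)" using chS by (simp add: posl_def)
 have lgT: "2 * length ?T < 2 ^ lg" using lg tZ(1) by linarith
 have its: "\<And>j. j < length all_items ==> ar u15 aITM (2 * j) = fst (all_items ! j) & ar u15 aITM (2 * j + 1) = snd (all_items ! j)"
  using r12(1) unfolding iout_def g15(4) by blast
 have hb: "\<And>L. L * (L + 1) <= 2 * length (V root) ==> L <= h"
 proof -
  fix L assume "L * (L + 1) <= 2 * length (V root)"
  then have l: "L * (L + 1) < (h + 1) * (h + 2)" using hh(2) by (simp add: N_vl N_def)
  show "L <= h"
  proof (rule ccontr)
   assume "\<not> L <= h"
   then have "(h + 1) * (h + 2) <= L * (L + 1)" by (intro mult_le_mono) auto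
   then show False using l by simp
  qed
 qed
 have zcB: "zc ?T x + 2 < B" for x using zcM[of x] B by linarith
 have chB: "\<And>x. x \<in> set (V root) ==> x < B"
 proof -
  fix x assume "x \<in> set (V root)"
  from chS[OF this] show "x < B" using B by linarith
 qed
 have LZ: "wp lz_phase (%u. vr u vXq = 5 * length FS + 5 & ar u aREC (5 * length FS + 5) = length FS &
   (\<forall>k<length FS. ar u aREC (5 * length FS + 5 + (2 * k + 1)) <= k &
    ([] # FS) ! Suc k = ([] # FS) ! (ar u aREC (5 * length FS + 5 + (2 * k + 1))) @ [Suc (ar u aREC (5 * length FS + 5 + (2 * k + 2)))]) &
   tm u <= tm u15 + 3 * length ?T + (21 * lg + 60) * (length FS + length all_items) + 30) u15"
  by (rule wp_lz_phase[OF h15 pT tZ(2) g15(6) _ pS sen FS all_items_good its hb g15(7) g15(1,2) zcB chB _ _ _ _ _ _ _ _ _ _ lgT])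
   (use r14(1) g15 B tZ bk nb_items m_def in \<open>auto simp: N_vl\<close>)
 from wpE[OF LZ] obtain u16 where b16: "bs lz_phase u15 u16" and f16: "frame lz_phase u15 u16" and r16: "vr u16 vXq = 5 * m + 5" "ar u16 aREC (5 * m + 5) = m"
   "\<forall>k<m. ar u16 aREC (5 * m + 5 + (2 * k + 1)) <= k &
    ([] # FS) ! Suc k = ([] # FS) ! (ar u16 aREC (5 * m + 5 + (2 * k + 1))) @ [Suc (ar u16 aREC (5 * m + 5 + (2 * k + 2)))]"
   "tm u16 <= tm u15 + 3 * length ?T + (21 * lg + 60) * (m + length all_items) + 30"
  unfolding m_def by blast
 have "al lz_phase = {}" by (simp add: lz_phase_def)
 then have "sz u16 = sz u15" by (rule frame_simps(3)[OF f16])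
 then have sz16: "7 * m + 10 <= sz u16 aREC" using g15(8) bk by simp
 have run: "bs (prog M) s u16" unfolding prog_def
  by (intro bsSeq[OF b1] bsSeq[OF b2] bsSeq[OF b3] bsSeq[OF b4] bsSeq[OF b5] bsSeq[OF b6] bsSeq[OF b7] bsSeq[OF b8] bsSeq[OF b9] bsSeq[OF b10]
   bsSeq[OF b11] bsSeq[OF b12] bsSeq[OF b13] bsSeq[OF b14] bsSeq[OF b15] b16)
 have "tm u16 <= tm s + 6000 * (M + 2) * Z + (21 * lg + 200) * (m + nb)"
 proof -
  define X where "X = (21 * lg + 60) * (m + length all_items)"
  define Y where "Y = 5000 * (M + 2) * length ?T"
  have "tm u16 <= tm s + 41 * ?n + 2 * h + 80 * length all_items + 203 * Z + 100 + X + Y"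
   using r1(5) r2(3) r3(2) r4(4) r5(2) r6(2) r7(5) r8(4) r9(6) r10(2) r11(5) r12(3) r13(4) r14(3)[unfolded r13(3)] g15(9) r16(4) tZ(1)
   unfolding X_def[symmetric] Y_def[symmetric] by linarith
  moreover have "X <= (21 * lg + 60) * (m + nb)" unfolding X_def using nb_items by (intro mult_le_mono2) simp
  moreover have "80 * length all_items <= 80 * (m + nb)" using nb_items by simp
  moreover have "Y <= 5000 * (M + 2) * Z" unfolding Y_def using tZ(1) by (intro mult_le_mono2)
  moreover have "41 * ?n + 2 * h + 203 * Z + 100 <= 1000 * (M + 2) * Z"
  proof -
   have "41 * ?n + 2 * h + 203 * Z + 100 <= 2000 * Z" using nZ hZ by linarith
   also have "\<dots> <= 1000 * (M + 2) * Z" by (intro mult_le_mono1) simp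
   finally show ?thesis .
  qed
  moreover have "(21 * lg + 200) * (m + nb) = (21 * lg + 60) * (m + nb) + 80 * (m + nb) + 60 * (m + nb)" by (simp add: algebra_simps)
  moreover have "6000 * (M + 2) * Z = 5000 * (M + 2) * Z + 1000 * (M + 2) * Z" by (simp add: algebra_simps)
  ultimately show ?thesis by linarith
 qed
 then show ?thesis using run r16 sz16 by blast
qed

end

section \<open>Resource bounds\<close>

text \<open>The run is analysed on the image of the string under \<open>cf\<close>, whose characters
  are positive; the factorization carries over because \<open>cf\<close> is injective.\<close>

lemma lz78_map:
 assumes f: "inj f" and L: "lz78_factorization S FS"
 shows "lz78_factorization (map f S) (map (map f) FS)"
proof -
 have c: "concat FS = S" using L by (simp add: lz78_factorization_def)
 have "map (map f) FS ! i \<in> lz78_candidates (take i (map (map f) FS)) &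
   (\<forall>g\<in>lz78_candidates (take i (map (map f) FS)). prefix g (concat (drop i (map (map f) FS))) --> length g <= length (map (map f) FS ! i))"
  if i: "i < length FS" for i
 proof (intro conjI ballI impI)
  have "FS ! i \<in> lz78_candidates (take i FS)" using L i by (simp add: lz78_factorization_def)
  then consider g a where "FS ! i = g @ [a]" "g \<in> set (take i FS)" | a where "FS ! i = [a]" by (auto simp: lz78_candidates_def)
  then show "map (map f) FS ! i \<in> lz78_candidates (take i (map (map f) FS))"
  proof cases
   case 1
   then have "map f g \<in> set (take i (map (map f) FS))" by (simp add: take_map)
   then show ?thesis unfolding lz78_candidates_def using 1 i by auto
  next
   case 2
   then show ?thesis unfolding lz78_candidates_def using i by auto
  qed
 next
  fix g assume g: "g \<in> lz78_candidates (take i (map (map f) FS))" and p: "prefix g (concat (drop i (map (map f) FS)))"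
  have "concat (drop i (map (map f) FS)) = map f (concat (drop i FS))" by (simp add: map_concat drop_map)
  then have "g = take (length g) (map f (concat (drop i FS)))" using p by (metis append_eq_conv_conj prefix_def)
  then obtain g0 where g0: "g = map f g0" "prefix g0 (concat (drop i FS))" by (metis take_is_prefix take_map)
  have "g0 \<in> lz78_candidates (take i FS)"
  proof -
   consider k a where "g = map f k @ [a]" "k \<in> set (take i FS)" | a where "g = [a]"
    using g by (auto simp: lz78_candidates_def take_map)
   then show ?thesis
   proof cases
    case 1
    then have ne: "g0 ~= []" using g0(1) by auto
    have "map f (butlast g0) = map f k" using g0(1) 1(1) by (metis butlast_snoc map_butlast)
    then have "butlast g0 = k" using f by (metis inj_map_eq_map)
    then have "g0 = k @ [last g0]" using ne by (metis append_butlast_last_id)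
    then show ?thesis unfolding lz78_candidates_def using 1(2) by blast
   next
    case 2
    then have "g0 = [hd g0]" using g0(1) by (cases g0) auto
    then show ?thesis unfolding lz78_candidates_def by blast
   qed
  qed
  then have "length g0 <= length (FS ! i)" using L i g0(2) by (simp add: lz78_factorization_def)
  then show "length g <= length (map (map f) FS ! i)" using g0(1) i by simp
 qed
 then show ?thesis unfolding lz78_factorization_def using c by (simp add: map_concat[symmetric])
qed

text \<open>A factor is a single character or extends an earlier factor by one, so the i-th, counted
  from 0, has length at most i + 1. Summing up gives N <= m (m + 1) / 2.\<close>

lemma lz78_length:
 assumes "lz78_factorization S FS"
 shows "2 * length S <= length FS * (length FS + 1)" "length FS <= length S"
proof -
 have ca: "FS ! i \<in> lz78_candidates (take i FS)" if "i < length FS" for i using assms that by (simp add: lz78_factorization_def)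
 have le: "i < length FS ==> 1 <= length (FS ! i) & length (FS ! i) <= i + 1" for i
 proof (induction i rule: less_induct)
  case (less i)
  consider g a where "FS ! i = g @ [a]" "g \<in> set (take i FS)" | a where "FS ! i = [a]" using ca[OF less.prems] by (auto simp: lz78_candidates_def)
  then show ?case
  proof cases
   case 1
   then obtain j where j: "j < i" "FS ! j = g" "j < length FS" by (auto simp: in_set_conv_nth)
   then show ?thesis using less.IH[OF j(1,3)] 1(1) by auto
  qed simp
 qed
 have "k <= length FS ==> 2 * length (concat (take k FS)) <= k * (k + 1) & k <= length (concat (take k FS))" for k
 proof (induction k)
  case (Suc k)
  then have "length (concat (take (Suc k) FS)) = length (concat (take k FS)) + length (FS ! k)" by (simp add: take_Suc_conv_app_nth)
  then show ?case using Suc le[of k] by simp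
 qed simp
 from this[of "length FS"] show "2 * length S <= length FS * (length FS + 1)" "length FS <= length S"
  using assms by (auto simp: lz78_factorization_def)
qed

lemma step_change: "P 0 ==> \<not> P n ==> \<exists>k. P k & \<not> P (Suc k)" for P :: "nat => bool"
 by (induction n) auto

lemma concat_pairs:
 "length (concat (map (%k. [f k, g k]) [0..<m])) = 2 * m"
 "i < 2 * m ==> concat (map (%k. [f k, g k]) [0..<m]) ! i = (if even i then f (i div 2) else g (i div 2))"
proof -
 show l: "length (concat (map (%k. [f k, g k]) [0..<m])) = 2 * m" for m by (induction m) auto
 show "i < 2 * m ==> concat (map (%k. [f k, g k]) [0..<m]) ! i = (if even i then f (i div 2) else g (i div 2))"
 proof (induction m)
  case (Suc m)
  have "i < 2 * m \<or> i = 2 * m \<or> i = 2 * m + 1" using Suc.prems by auto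
  then consider "i < 2 * m" | "i = 2 * m" | "i = 2 * m + 1" by blast
  then show ?case
  proof cases
   case 1
   then show ?thesis using Suc.IH l[of m] by (simp add: nth_append)
  qed (use l[of m] in \<open>simp_all add: nth_append\<close>)
 qed simp
qed

lemma concat_triples:
 assumes "\<And>x. length (f x) = 3"
 shows "length (concat (map f xs)) = 3 * length xs"
  "i < length xs ==> k < 3 ==> concat (map f xs) ! (i * 3 + k) = f (xs ! i) ! k"
proof -
 show "length (concat (map f xs)) = 3 * length xs" by (induction xs) (auto simp: assms)
 show "i < length xs ==> k < 3 ==> concat (map f xs) ! (i * 3 + k) = f (xs ! i) ! k"
 proof (induction xs arbitrary: i)
  case (Cons x xs)
  then show ?case by (cases i) (auto simp: nth_append assms)
 qed simp
qed

lemma encode_rule_length: "length (encode_rule code x) = 3"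
 by (cases x) auto

theorem theorem3:
  fixes code :: "'a::finite \<Rightarrow> nat" and dollar :: 'a
  assumes "inj code"
  shows "\<exists>(P :: program) (K :: real) (C :: real) (N_alpha :: 'a slp \<Rightarrow> real).
    \<forall>(G :: 'a slp) (n :: nat) (S :: 'a list) (N :: nat).
      is_slp G \<and> all_nonterminals_used G \<and> n = length G \<and>
      S = slp_string G \<and> N = length S \<and> sentinel_terminated dollar S \<longrightarrow>
        alpha G \<ge> 0 \<and>
        0 \<le> N_alpha G \<and>
        N_alpha G \<le> C * min (real N - alpha G) (real n * sqrt (real N)) \<and>
        (\<exists>fs m. lz78_factorization S fs \<and> m = length fs \<and>
          (\<forall>w :: nat. real w \<ge> log 2 (real N) + K \<longrightarrow>
            computes_lz78 code w P G fs \<and>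
            real (run_time w P (initial_config (encode_slp code G)))
              \<le> C * (N_alpha G + real m * log 2 (real N)) \<and>
            real (run_space w P (initial_config (encode_slp code G)))
              \<le> C * (N_alpha G + real m)))"
proof -
 \<comment> \<open>As the alphabet is finite, a bound on all characters can be a constant of the
   program.\<close>
 define M where "M = Suc (Max (range code))"
 define cf where "cf a = Suc (code a)" for a
 define P where "P = compiled (prog M) aREC vXq"
 \<comment> \<open>Chosen so that the value bound B and the memory bound A, both at most N (2500 +
   10 M), are at most \<open>2 ^ w\<close>.\<close>
 define K where "K = log 2 (2500 + 10 * real M)"
 \<comment> \<open>Machine steps per tick, at most the length of the program, times the constant in
   the bound \<open>tb\<close> on the number of ticks.\<close>
 define C where "C = (real (length P) + 1) * (120000 * (real M + 2))"
 \<comment> \<open>The minimum itself is taken for \<open>N_alpha\<close>; the substance lies in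
   bounding \<open>Z\<close> by 18 times this minimum.\<close>
 define Na where "Na = (%G :: 'a slp. min (real (length (slp_string G)) - alpha G) (real (length G) * sqrt (real (length (slp_string G)))))"
 have cfM: "0 < cf a & cf a <= M" for a by (simp add: cf_def M_def)
 have icf: "inj cf" using assms by (auto simp: cf_def inj_def)
 have C1: "1 <= C" unfolding C_def by (rule order_trans[of _ "1 * 1"]) (simp, rule mult_mono, auto)
 have main: "alpha G \<ge> 0 & 0 <= Na G & Na G <= C * min (real N - alpha G) (real n * sqrt (real N)) &
    (\<exists>fs m. lz78_factorization S fs & m = length fs &
     (\<forall>w :: nat. real w \<ge> log 2 (real N) + K -->
      computes_lz78 code w P G fs &
      real (run_time w P (initial_config (encode_slp code G))) <= C * (Na G + real m * log 2 (real N)) &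
      real (run_space w P (initial_config (encode_slp code G))) <= C * (Na G + real m)))"
  if as: "is_slp G" "all_nonterminals_used G" "n = length G" "S = slp_string G" "N = length S" "sentinel_terminated dollar S"
  for G :: "'a slp" and n S N
 proof -
  have N0: "0 < N" using as(5,6) by (simp add: sentinel_terminated_def)
  have big: "\<not> (2 * N) * (2 * N + 1) <= 2 * N" using N0 by simp
  from step_change[of "%k. k * (k + 1) <= 2 * N", OF _ big] obtain h where h: "h * (h + 1) <= 2 * N" "\<not> Suc h * (Suc h + 1) <= 2 * N" by auto
  have h0: "0 < h" using h(2) N0 by (cases h) auto
  interpret sa: slp_alpha G cf h "3 * h"
   by unfold_locales (use as h h0 in auto)
  have saN: "sa.N = N" using as by (simp add: sa.N_def)
  have Vr: "map cf (val G sa.root) = map cf S" using as by (simp add: slp_string_def sa.root_def)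
  obtain FS where FS: "lz78_factorization S FS" using lzp_extend[OF lzp_Nil as(6)] by auto
  define m where "m = length FS"
  have m1: "2 * N <= m * (m + 1)" "m <= N" using lz78_length[OF FS] as(5) by (auto simp: m_def)
  have hm: "h <= m"
  proof (rule ccontr)
   assume "\<not> h <= m"
   then have "(m + 1) * (m + 2) <= h * (h + 1)" by (intro mult_le_mono) auto
   then show False using m1(1) h(1) by simp
  qed
  have FSn: "lz78_factorization (map cf (val G sa.root)) (map (map cf) FS)" unfolding Vr by (rule lz78_map[OF icf FS])
  have sen: "sentinel_terminated (cf dollar) (map cf (val G sa.root))" unfolding Vr
   using as(6) icf by (auto simp: sentinel_terminated_def last_map map_butlast[symmetric] dest: injD)
  define nb where "nb = 2 * N div h + 1"
  define Z where "Z = sa.Z"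
  \<comment> \<open>A involves m, which the program does not know in advance. It is only the memory
    bound under which the run is analysed, and it fixes the extent of the array allocated
    last.\<close>
  define A where "A = 70 * Z + 6 * nb + M + 200 + 7 * m"
  define B where "B = 100 * Z + 100 * N + 10 * M + 10 * nb + 10 * m + 1001"
  interpret lm: lz_machine B A G cf h "3 * h" by unfold_locales
  have nbe: "lm.nb = nb" unfolding lm.nb_def nb_def saN ..
  have nb7: "nb <= 7 * m" using lm.nb_h hm h0 unfolding nbe by linarith
  have al0: "0 <= alpha G" by (rule sa.alpha_nonneg)
  have Na: "real Z <= 18 * Na G"
  proof -
   have "real Z <= 12 * (real N - alpha G)" "real Z <= 18 * (real n * sqrt (real N))"
    using sa.Z_alpha sa.Z_sqrt as(3) by (simp_all add: Z_def saN)
   moreover have "0 <= real N - alpha G" using calculation(1) by (smt (verit) of_nat_0_le_iff)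
   ultimately show ?thesis unfolding Na_def using as by (simp add: min_def)
  qed
  have Z6: "6 <= Z" unfolding Z_def sa.Z_def using h0 by simp
  then have Na1: "1 <= 3 * Na G" "0 <= Na G" using Na by linarith+
  have ZN: "Z <= 12 * N"
  proof -
   have "real Z <= 12 * real N" using sa.Z_alpha al0 by (simp add: Z_def saN)
   then show ?thesis by linarith
  qed
  have hN: "h <= N" using lm.hN by (simp add: saN)
  have nbN: "nb <= 7 * N" using nb7 m1(2) by simp
  have Nm: "Na G <= C * min (real N - alpha G) (real n * sqrt (real N))"
  proof -
   have "Na G = min (real N - alpha G) (real n * sqrt (real N))" using as by (simp add: Na_def)
   then show ?thesis using Na1(2) C1 mult_right_mono[of 1 C "Na G"] by simp
  qed
  define xs where "xs = encode_slp code G"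
  have len: "length xs = 3 * n + 1" using concat_triples(1)[of "encode_rule code" G, OF encode_rule_length] as(3) by (simp add: xs_def encode_slp_def)
  have x0: "xs ! 0 = n" "xs ~= []" "hd xs = n" using as(3) by (auto simp: xs_def encode_slp_def)
  have xr: "xs ! (i * 3 + Suc k) = encode_rule code (G ! i) ! k" if "i < n" "k < 3" for i k
   using concat_triples(2)[of "encode_rule code" i G k, OF encode_rule_length] that as(3) by (simp add: xs_def encode_slp_def)
  let ?s = "initial_state xs"
  have cfB: "cf a < B" for a using cfM[of a] by (simp add: B_def)
  have ren: "lm.renc (ar ?s 0)" unfolding lm.renc_def
  proof (intro allI impI)
   fix i assume "i < length G"
   then have i: "i < n" "i * 3 + 3 < length xs" using as(3) len by auto
   have a: "ar ?s 0 (i * 3 + Suc k) = encode_rule code (G ! i) ! k" if "k < 3" for k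
    using xr[OF i(1) that] i(2) that by (simp add: initial_state_def)
   show "case G ! i of Terminal a => ar ?s 0 (i * 3 + 1) = 0 & Suc (ar ?s 0 (i * 3 + 2)) = cf a & cf a < B
     | Pair l r => ar ?s 0 (i * 3 + 1) = 1 & ar ?s 0 (i * 3 + 2) = l & ar ?s 0 (i * 3 + 3) = r"
    using a[of 0] a[of 1] a[of 2] cfB by (cases "G ! i") (auto simp: cf_def numeral_2_eq_2 numeral_3_eq_3)
  qed
  have st: "ar ?s 0 0 = length G" "sz ?s 0 = 3 * length G + 1" "brk ?s = 3 * length G + 1" "tm ?s = 0"
   using x0 len as(3) by (auto simp: initial_state_def)
  \<comment> \<open>Z <= 12 N, so a power of two above 24 N exceeds 2 Z; as 24 <= 32, its exponent
    is at most log N + 6.\<close>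
  have nl: "\<not> 2 ^ (24 * N) <= 24 * N" by (metis less_exp not_le)
  from step_change[of "%k. 2 ^ k <= 24 * N", OF _ nl] obtain l where l: "2 ^ l <= 24 * N" "24 * N < 2 ^ Suc l" using N0 by auto
  have lgb: "real l <= log 2 (real N) + 5"
  proof -
   have "real l <= log 2 (real (24 * N))" using l(1) by (rule le_log2_of_power)
   also have "\<dots> <= log 2 (32 * real N)" using N0 by (subst log_le_cancel_iff) auto
   also have "\<dots> = log 2 32 + log 2 (real N)" using N0 by (simp add: log_mult)
   also have "log 2 32 = (5 :: real)" using log_pow_cancel[of 2 5] by simp
   finally show ?thesis by simp
  qed
  obtain u where u: "lm.bs (prog M) ?s u" "vr u vXq = 5 * m + 5" "7 * m + 10 <= sz u aREC" "ar u aREC (5 * m + 5) = m"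
   and pr: "\<And>k. k < m ==> ar u aREC (5 * m + 5 + (2 * k + 1)) <= k &
    ([] # map (map cf) FS) ! Suc k = ([] # map (map cf) FS) ! (ar u aREC (5 * m + 5 + (2 * k + 1))) @ [Suc (ar u aREC (5 * m + 5 + (2 * k + 2)))]"
   and tmu: "tm u <= 6000 * (M + 2) * Z + (21 * Suc l + 200) * (m + nb)"
  proof -
   have "\<exists>u. lm.bs (prog M) ?s u & vr u vXq = 5 * length (map (map cf) FS) + 5 & 7 * length (map (map cf) FS) + 10 <= sz u aREC &
     ar u aREC (5 * length (map (map cf) FS) + 5) = length (map (map cf) FS) &
     (\<forall>k<length (map (map cf) FS). ar u aREC (5 * length (map (map cf) FS) + 5 + (2 * k + 1)) <= k &
      ([] # map (map cf) FS) ! Suc k = ([] # map (map cf) FS) ! (ar u aREC (5 * length (map (map cf) FS) + 5 + (2 * k + 1))) @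
       [Suc (ar u aREC (5 * length (map (map cf) FS) + 5 + (2 * k + 2)))]) &
     tm u <= tm ?s + 6000 * (M + 2) * sa.Z + (21 * Suc l + 200) * (length (map (map cf) FS) + lm.nb)"
    by (rule lm.prog_run[OF cfM sen FSn ren st(1-3)])
     (use ZN l(2) in \<open>auto simp: A_def B_def Z_def nbe saN m_def\<close>)
   then show ?thesis using that unfolding length_map m_def[symmetric] nbe Z_def[symmetric] st(4) by auto
  qed
  define j where "j k = ar u aREC (5 * m + 5 + (2 * k + 1))" for k
  define c where "c k = ar u aREC (5 * m + 5 + (2 * k + 2))" for k
  \<comment> \<open>The run yields numbers; injectivity of \<open>cf\<close> turns equations between
    mapped factors back into equations between factors, with an actual character as the last
    one.\<close>
  have "\<exists>b. code b = c k & ([] # FS) ! Suc k = ([] # FS) ! j k @ [b]" if k: "k < m" for k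
  proof -
   have jk: "j k <= k" using pr[OF k] by (simp add: j_def)
   have nm: "([] # map (map cf) FS) ! i = map cf (([] # FS) ! i)" if "i <= m" for i
    using that by (cases i) (auto simp: m_def)
   have e: "map cf (([] # FS) ! Suc k) = map cf (([] # FS) ! j k) @ [Suc (c k)]"
   proof -
    have "j k <= m" "Suc k <= m" using jk k by simp_all
    from conjunct2[OF pr[OF k], folded j_def c_def, unfolded nm[OF this(1)] nm[OF this(2)]] show ?thesis .
   qed
   then have ne: "([] # FS) ! Suc k ~= []" by auto
   define b where "b = last (([] # FS) ! Suc k)"
   have "map cf (butlast (([] # FS) ! Suc k)) = map cf (([] # FS) ! j k)" using e by (metis butlast_snoc map_butlast)
   then have bl: "butlast (([] # FS) ! Suc k) = ([] # FS) ! j k" using icf by (metis inj_map_eq_map)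
   have "cf b = Suc (c k)" unfolding b_def using e ne by (metis last_map last_snoc)
   then show ?thesis using bl ne unfolding b_def cf_def by (metis append_butlast_last_id nat.inject)
  qed
  then obtain bf where bf: "\<And>k. k < m ==> code (bf k) = c k & ([] # FS) ! Suc k = ([] # FS) ! j k @ [bf k]" by metis
  define ps where "ps = map (%k. (j k, bf k)) [0..<m]"
  have out: "lz78_output FS ps" unfolding lz78_output_def
   using bf pr by (auto simp: ps_def m_def j_def)
  define ys where "ys = encode_output code ps"
  have mp: "map (%(j, c). [j, code c]) ps = map (%k. [j k, c k]) [0..<m]" unfolding ps_def using bf by simp
  have "length ps = m" by (simp add: ps_def)
  then have ysd: "ys = m # concat (map (%k. [j k, c k]) [0..<m])" unfolding ys_def encode_output_def mp by simp
  have yl: "length ys = 2 * m + 1" unfolding ysd using concat_pairs(1)[of j c m] by simp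
  have res: "vr u vXq + k < sz u aREC & ar u aREC (vr u vXq + k) = ys ! k" if "k < length ys" for k
  proof (cases k)
   case 0
   then show ?thesis using u by (simp add: ysd)
  next
   case (Suc i)
   then have i: "i < 2 * m" using that yl by simp
   have "ys ! k = (if even i then j (i div 2) else c (i div 2))" unfolding Suc ysd nth_Cons_Suc by (rule concat_pairs(2)[OF i])
   also have "\<dots> = ar u aREC (5 * m + 5 + k)"
   proof (cases "even i")
    case True
    then have "2 * (i div 2) + 1 = k" using Suc by simp
    then show ?thesis using True by (simp add: j_def)
   next
    case False
    then have "2 * (i div 2) + 2 = k" using Suc by presburger
    then show ?thesis using False by (simp add: c_def)
   qed
   finally show ?thesis using u i Suc by simp
  qed
  have ysne: "ys ~= []" by (simp add: ysd)
  have lnx: "length xs = 3 * hd xs + 1" "length xs < A" "3 < B"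
  proof -
   show "length xs = 3 * hd xs + 1" using len x0 by simp
   have "n <= 2 * Z" using sa.n_text sa.D_len as(3) unfolding Z_def by linarith
   then show "length xs < A" using len by (simp add: A_def)
   show "3 < B" by (simp add: B_def)
  qed
  \<comment> \<open>For N = 1 the logarithm vanishes, and the term m <= 1 must be paid by
    \<open>Na G\<close>, which is at least 1/3.\<close>
  have mlog: "real m <= real m * log 2 (real N) + 3 * Na G" and lg0: "0 <= log 2 (real N)"
  proof -
   show lg0: "0 <= log 2 (real N)" using N0 by (subst zero_le_log_cancel_iff) auto
   show "real m <= real m * log 2 (real N) + 3 * Na G"
   proof (cases "N = 1")
    case True
    then show ?thesis using m1(2) Na1 by simp
   next
    case False
    then have "1 <= log 2 (real N)" using N0 by (subst one_le_log_cancel_iff) auto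
    then have "real m * 1 <= real m * log 2 (real N)" by (rule mult_left_mono) simp
    then show ?thesis using Na1 by linarith
   qed
  qed
  define X where "X = real m * log 2 (real N)"
  have X0: "0 <= X" unfolding X_def using lg0 by simp
  have tb: "real (tm u + 1) <= 120000 * (real M + 2) * (Na G + X)"
  proof -
   have "real (tm u) <= real (6000 * (M + 2) * Z + (21 * Suc l + 200) * (m + nb))" using tmu by (simp only: of_nat_le_iff)
   also have "\<dots> = 6000 * (real M + 2) * real Z + (21 * real l + 221) * (real m + real nb)" by (simp add: algebra_simps)
   also have "(21 * real l + 221) * (real m + real nb) <= (21 * (log 2 (real N) + 5) + 221) * (8 * real m)"
    using lgb nb7 lg0 by (intro mult_mono) auto
   also have "\<dots> = 168 * X + 2608 * real m" unfolding X_def by (simp add: algebra_simps)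
   also have "6000 * (real M + 2) * real Z <= 6000 * (real M + 2) * (18 * Na G)" using Na by (intro mult_left_mono) auto
   finally have "real (tm u) <= 108000 * ((real M + 2) * Na G) + 168 * X + 2608 * real m" by (simp add: algebra_simps)
   moreover have "2608 * real m <= 2608 * X + 7824 * Na G" using mlog unfolding X_def by linarith
   moreover have "2 * Na G <= (real M + 2) * Na G" using Na1(2) by (intro mult_right_mono) auto
   moreover have "2 * X <= (real M + 2) * X" using X0 by (intro mult_right_mono) auto
   moreover have "120000 * (real M + 2) * (Na G + X) = 120000 * ((real M + 2) * Na G) + 120000 * ((real M + 2) * X)" by (simp add: algebra_simps)
   moreover have "real (tm u + 1) = real (tm u) + 1" by simp
   ultimately show ?thesis using Na1 X0 by linarith
  qed
  have sb: "real A <= C * (Na G + real m)"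
  proof -
   have Ar: "real A <= 1260 * Na G + 42 * real m + real M + 200 + 7 * real m"
   proof -
    have "real A = 70 * real Z + 6 * real nb + real M + 200 + 7 * real m" by (simp add: A_def)
    moreover have "real nb <= 7 * real m" using nb7 by linarith
    ultimately show ?thesis using Na by linarith
   qed
   have "real M * 1 <= real M * (3 * Na G)" using Na1 by (intro mult_left_mono) auto
   then have "real A <= 2000 * Na G + 3 * (real M * Na G) + 49 * real m" using Ar Na1 by linarith
   also have "\<dots> <= 120000 * (real M + 2) * (Na G + real m)"
   proof -
    have "0 <= real M * Na G" "0 <= real M * real m" using Na1 by auto
    then show ?thesis using Na1 by (simp add: algebra_simps)
   qed
   also have "\<dots> <= C * (Na G + real m)" unfolding C_def
    using Na1 by (intro mult_right_mono) (auto simp: distrib_right)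
   finally show ?thesis .
  qed
  have "computes_lz78 code w P G FS &
      real (run_time w P (initial_config (encode_slp code G))) <= C * (Na G + real m * log 2 (real N)) &
      real (run_space w P (initial_config (encode_slp code G))) <= C * (Na G + real m)" if w: "real w \<ge> log 2 (real N) + K" for w
  proof -
   have "real N * (2500 + 10 * real M) = 2 powr (log 2 (real N) + K)" unfolding K_def powr_add using N0 by (simp add: powr_log_cancel)
   also have "\<dots> <= 2 powr real w" using w by simp
   also have "\<dots> = real (2 ^ w)" by (simp add: powr_realpow)
   finally have "real (N * (2500 + 10 * M)) <= real (2 ^ w)" by simp
   then have W: "N * (2500 + 10 * M) <= 2 ^ w" by (simp only: of_nat_le_iff)
   have MN: "M <= M * N" "1 <= N" using N0 by auto
   have "B <= N * (2500 + 10 * M)" "A <= N * (2500 + 10 * M)"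
   proof -
    have e: "N * (2500 + 10 * M) = 2500 * N + 10 * (M * N)" by (simp add: algebra_simps)
    show "B <= N * (2500 + 10 * M)" "A <= N * (2500 + 10 * M)"
     unfolding e B_def A_def using ZN nbN m1(2) MN by linarith+
   qed
   then have BA: "B <= 2 ^ w" "A <= 2 ^ w" using W by linarith+
   note cor = compiled_correct[OF u(1) BA lnx(2,3) x0(2) lnx(1) res ysne, folded P_def]
   have "computes_lz78 code w P G FS" unfolding computes_lz78_def using cor(1,2) out unfolding xs_def ys_def by blast
   moreover have "real (run_time w P (initial_config xs)) <= C * (Na G + X)"
   proof -
    have "real (run_time w P (initial_config xs)) <= real (length P * (tm u + 1))" using cor(3) by (simp only: of_nat_le_iff)
    also have "\<dots> = real (length P) * real (tm u + 1)" by (rule of_nat_mult)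
    also have "\<dots> <= (real (length P) + 1) * (120000 * (real M + 2) * (Na G + X))" using tb by (intro mult_mono) auto
    finally show ?thesis unfolding C_def by (simp add: mult.assoc)
   qed
   moreover have "real (run_space w P (initial_config xs)) <= C * (Na G + real m)" using cor(4) sb by linarith
   ultimately show ?thesis unfolding xs_def X_def by blast
  qed
  then show ?thesis using al0 Na1(2) Nm FS m_def by blast
 qed
 show ?thesis
 proof (rule exI[of _ P], rule exI[of _ K], rule exI[of _ C], rule exI[of _ Na], intro allI impI, elim conjE)
  fix G :: "'a slp" and n :: nat and S :: "'a list" and N :: nat
  assume a: "is_slp G" "all_nonterminals_used G" "n = length G" "S = slp_string G" "N = length S" "sentinel_terminated dollar S"
  show "alpha G \<ge> 0 & 0 <= Na G & Na G <= C * min (real N - alpha G) (real n * sqrt (real N)) &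
    (\<exists>fs m. lz78_factorization S fs & m = length fs &
     (\<forall>w :: nat. real w \<ge> log 2 (real N) + K -->
      computes_lz78 code w P G fs &
      real (run_time w P (initial_config (encode_slp code G))) <= C * (Na G + real m * log 2 (real N)) &
      real (run_space w P (initial_config (encode_slp code G))) <= C * (Na G + real m)))"
   by (rule main[OF a])
 qed
qed

end
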